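(* Let $s>2$ and $-1\le\alpha\le 1$. Let $Z$ be any of the spaces $X^{s}$, $\widehat X^{s}$, $\widehat X_\alpha^{s}$, $Y^{s}$ and $\widehat Y^{s}$. If $\psi\in Z$ and $u\in C([0,T],H^{s}(\mathbb{R}^2))$ is the solution to $$u_t=u_{xxx}-\mathscr{H}D_x^{\alpha}u_{yy}+uu_x$$ with $u(0)=\psi$, then $u\in C([0,T],Z)$. Moreover, the map $\psi\mapsto u$ is continuous from $Z$ to $C([0,T],Z)$.
   Context: Functions are of $(x,y)\in\mathbb{R}^2$ with dual Fourier variables $(\xi,\eta)$; $u$ is real valued. $\mathscr{H}$ is the Hilbert transform in $x$ (Fourier symbol $-i\,\mathrm{sgn}(\xi)$), $D_x^\alpha$ has Fourier symbol $|\xi|^\alpha$, $\partial_x^{-1}$ is the Fourier multiplier $(i\xi)^{-1}$. $H^s=H^s(\mathbb{R}^2)$ is the usual Sobolev space. The following spaces carry the indicated Hilbert norms: $X^{s}=\{f\in H^s:\partial_x^{-1}f\in H^s\}$, $\|f\|^2_{X^s}=\|f\|_{H^s}^2+\|\partial_x^{-1}f\|_{H^s}^2$; $\widehat X^{s}=\{f\in H^s:\partial_x^{-1}f\in L^2\}$, $\|f\|^2=\|f\|_{H^s}^2+\|\partial_x^{-1}f\|_{L^2}^2$; $\widehat X^{s}_\alpha=\{f\in H^s: D_x^{\frac{\alpha-1}{2}}f\in L^2\}$, $\|f\|^2=\|f\|_{H^s}^2+\|D_x^{\frac{\alpha-1}{2}}f\|_{L^2}^2$; $Y^{s}=\{f\in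 H^s:\partial_x^{-1}\partial_yf\in H^s\}$, $\|f\|^2=\|f\|_{H^s}^2+\|\partial_x^{-1}\partial_yf\|_{H^s}^2$; $\widehat Y^{s}=\{f\in H^s:\partial_x^{-1}\partial_yf\in L^2\}$, $\|f\|^2=\|f\|_{H^s}^2+\|\partial_x^{-1}\partial_yf\|_{L^2}^2$. The Cauchy problem is locally well-posed in $H^s$: for $\psi\in H^s$ there are $T>0$ depending only on $\|\psi\|_{H^s}$ and a unique solution $u\in C([0,T],H^s)$, depending continuously on $\psi$; $T$ in the claim is this existence time. The equation is understood in $(X^{3})^*$, the dual of $X^3$, into which $\partial_x^3-\mathscr{H}D_x^\alpha\partial_y^2$ extends as a bounded operator from $L^2(\mathbb{R}^2)$. *)

theory Defs
  imports "HOL-Analysis.Analysis"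
begin

text \<open>Functions of \<open>(x, y)\<close> and of the dual variables \<open>(\<xi>, \<eta>)\<close> are total functions; identities between
  them are meant almost everywhere, and the norms below are seminorms on such functions.\<close>

type_synonym plane = "real \<times> real"
type_synonym func = "plane \<Rightarrow> complex"

datatype fspace = FSpace (pts: "func set") (nrm: "func \<Rightarrow> real")


subsection \<open>Fourier transform on \<open>L\<^sup>2\<close> and Fourier multipliers\<close>

definition l2_sq :: "func \<Rightarrow> ennreal" where
  "l2_sq f = (\<integral>\<^sup>+ z. ennreal ((cmod (f z))\<^sup>2) \<partial>lborel)"

definition L2 :: fspace where
  "L2 = FSpace {f \<in> borel_measurable lborel. l2_sq f < \<infinity>} (\<lambda>f. sqrt (enn2real (l2_sq f)))"

definition fourier_trunc :: "real \<Rightarrow> func \<Rightarrow> func" where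
  "fourier_trunc R f \<zeta> =
     complex_of_real (1 / (2 * pi)) * (LINT z:cball 0 R|lborel. exp (- \<i> * complex_of_real (z \<bullet> \<zeta>)) * f z)"

text \<open>The Plancherel transform: the \<open>L\<^sup>2\<close> limit of the transforms of the truncations of \<open>f\<close> to balls.
  The factor \<open>1 / (2 * pi)\<close> makes it unitary on \<open>L\<^sup>2\<close> of the plane. The choice operator only
  selects a representative of the almost everywhere class of the limit.\<close>

definition fourier :: "func \<Rightarrow> func" where
  "fourier f = (SOME g. g \<in> pts L2 \<and> ((\<lambda>R. l2_sq (\<lambda>\<zeta>. fourier_trunc R f \<zeta> - g \<zeta>)) \<longlongrightarrow> 0) at_top)"

definition mult_dom :: "func \<Rightarrow> func set" where
  "mult_dom m = {f \<in> pts L2. (\<lambda>\<zeta>. m \<zeta> * fourier f \<zeta>) \<in> pts L2}"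

definition fmult :: "func \<Rightarrow> func \<Rightarrow> func" where
  "fmult m f = (SOME g. g \<in> pts L2 \<and> (AE \<zeta> in lborel. fourier g \<zeta> = m \<zeta> * fourier f \<zeta>))"

text \<open>Symbols. Their values on the null set \<open>\<xi> = 0\<close> are irrelevant.\<close>

definition dx :: func where "dx = (\<lambda>(\<xi>, \<eta>). \<i> * complex_of_real \<xi>)"
definition dy :: func where "dy = (\<lambda>(\<xi>, \<eta>). \<i> * complex_of_real \<eta>)"
definition dx_inv :: func where "dx_inv = (\<lambda>(\<xi>, \<eta>). inverse (\<i> * complex_of_real \<xi>))"
definition hilbert :: func where "hilbert = (\<lambda>(\<xi>, \<eta>). - \<i> * complex_of_real (sgn \<xi>))"
definition Dx :: "real \<Rightarrow> func" where "Dx a = (\<lambda>(\<xi>, \<eta>). complex_of_real (\<bar>\<xi>\<bar> powr a))"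


subsection \<open>Function spaces\<close>

definition sobolev_sq :: "real \<Rightarrow> func \<Rightarrow> ennreal" where
  "sobolev_sq s f = (\<integral>\<^sup>+ \<zeta>. ennreal ((1 + (norm \<zeta>)\<^sup>2) powr s * (cmod (fourier f \<zeta>))\<^sup>2) \<partial>lborel)"

text \<open>This is \<open>H\<^sup>s\<close> for \<open>s \<ge> 0\<close> only, where it is contained in \<open>L\<^sup>2\<close>.\<close>

definition H :: "real \<Rightarrow> fspace" where
  "H s = FSpace {f \<in> pts L2. sobolev_sq s f < \<infinity>} (\<lambda>f. sqrt (enn2real (sobolev_sq s f)))"

definition graph_space :: "fspace \<Rightarrow> func \<Rightarrow> fspace \<Rightarrow> fspace" where
  "graph_space E m F =
     FSpace {f \<in> pts E. f \<in> mult_dom m \<and> fmult m f \<in> pts F}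
            (\<lambda>f. sqrt ((nrm E f)\<^sup>2 + (nrm F (fmult m f))\<^sup>2))"

definition X :: "real \<Rightarrow> fspace" where
  "X s = graph_space (H s) dx_inv (H s)"

definition X_hat :: "real \<Rightarrow> fspace" where
  "X_hat s = graph_space (H s) dx_inv L2"

definition X_hat_alpha :: "real \<Rightarrow> real \<Rightarrow> fspace" where
  "X_hat_alpha \<alpha> s = graph_space (H s) (Dx ((\<alpha> - 1) / 2)) L2"

definition Y :: "real \<Rightarrow> fspace" where
  "Y s = graph_space (H s) (\<lambda>\<zeta>. dx_inv \<zeta> * dy \<zeta>) (H s)"

definition Y_hat :: "real \<Rightarrow> fspace" where
  "Y_hat s = graph_space (H s) (\<lambda>\<zeta>. dx_inv \<zeta> * dy \<zeta>) L2"

text \<open>\<open>u \<in> C([0,T], Z)\<close>\<close>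

definition cont_into :: "real \<Rightarrow> fspace \<Rightarrow> (real \<Rightarrow> func) \<Rightarrow> bool" where
  "cont_into T Z u \<longleftrightarrow>
     (\<forall>t\<in>{0..T}. u t \<in> pts Z \<and> ((\<lambda>r. nrm Z (\<lambda>z. u r z - u t z)) \<longlongrightarrow> 0) (at t within {0..T}))"

definition real_valued :: "func \<Rightarrow> bool" where
  "real_valued f \<longleftrightarrow> (AE z in lborel. f z \<in> \<real>)"


subsection \<open>The equation in the dual of \<open>X\<^sup>3\<close>\<close>

text \<open>Functionals on \<open>X\<^sup>3\<close> are taken conjugate-linear, so that the duality extends the inner product of
  \<open>L\<^sup>2\<close>. The dual norm is extended valued: it is infinite for unbounded functionals.\<close>

type_synonym functional = "func \<Rightarrow> complex"

definition dual_norm :: "functional \<Rightarrow> ennreal" where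
  "dual_norm \<Lambda> = (SUP \<phi>\<in>{\<phi> \<in> pts (X 3). nrm (X 3) \<phi> \<le> 1}. ennreal (cmod (\<Lambda> \<phi>)))"

definition embed :: "func \<Rightarrow> functional" where
  "embed f \<phi> = (LINT z|lborel. f z * cnj (\<phi> z))"

text \<open>The extension of \<open>\<partial>\<^sub>x\<^sup>3 - \<H> D\<^sub>x\<^sup>\<alpha> \<partial>\<^sub>y\<^sup>2\<close> to \<open>L\<^sup>2\<close>, as a functional on \<open>X\<^sup>3\<close>; by Parseval it equals
  \<open>embed\<close> of the multiplier applied to \<open>f\<close> whenever the latter lies in \<open>L\<^sup>2\<close>.\<close>

definition lin_symbol :: "real \<Rightarrow> func" where
  "lin_symbol \<alpha> \<zeta> = dx \<zeta> ^ 3 - hilbert \<zeta> * Dx \<alpha> \<zeta> * dy \<zeta> ^ 2"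

definition lin_op :: "real \<Rightarrow> func \<Rightarrow> functional" where
  "lin_op \<alpha> f \<phi> = (LINT \<zeta>|lborel. lin_symbol \<alpha> \<zeta> * fourier f \<zeta> * cnj (fourier \<phi> \<zeta>))"

definition solves_at :: "real \<Rightarrow> real \<Rightarrow> (real \<Rightarrow> func) \<Rightarrow> real \<Rightarrow> bool" where
  "solves_at \<alpha> T u t \<longleftrightarrow>
     ((\<lambda>r. dual_norm (\<lambda>\<phi>. (embed (u r) \<phi> - embed (u t) \<phi>) / complex_of_real (r - t)
                          - (lin_op \<alpha> (u t) \<phi> + embed (\<lambda>z. u t z * fmult dx (u t) z) \<phi>)))
        \<longlongrightarrow> 0) (at t within {0..T})"

definition is_solution :: "real \<Rightarrow> real \<Rightarrow> real \<Rightarrow> func \<Rightarrow> (real \<Rightarrow> func) \<Rightarrow> bool" where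
  "is_solution \<alpha> s T \<psi> u \<longleftrightarrow>
     cont_into T (H s) u \<and> (\<forall>t\<in>{0..T}. real_valued (u t)) \<and>
     (AE z in lborel. u 0 z = \<psi> z) \<and> (\<forall>t\<in>{0..T}. solves_at \<alpha> T u t)"


subsection \<open>Well-posedness\<close>

definition data :: "real \<Rightarrow> real \<Rightarrow> func set" where
  "data s R = {\<psi> \<in> pts (H s). real_valued \<psi> \<and> nrm (H s) \<psi> \<le> R}"

text \<open>Continuity of \<open>\<psi> \<mapsto> u\<close> from \<open>B\<close>, with the topology of \<open>Z\<close>, to \<open>C([0,T], Z)\<close>. The solution enters
  through its defining property, which determines it up to null sets by uniqueness.\<close>

definition flow_continuous :: "real \<Rightarrow> real \<Rightarrow> real \<Rightarrow> fspace \<Rightarrow> func set \<Rightarrow> bool" where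
  "flow_continuous \<alpha> s T Z B \<longleftrightarrow>
     (\<forall>\<psi>\<in>B. \<forall>\<epsilon>>0. \<exists>\<delta>>0. \<forall>\<psi>'\<in>B. nrm Z (\<lambda>z. \<psi>' z - \<psi> z) < \<delta> \<longrightarrow>
        (\<forall>u u'. is_solution \<alpha> s T \<psi> u \<longrightarrow> is_solution \<alpha> s T \<psi>' u' \<longrightarrow>
           (\<forall>t\<in>{0..T}. nrm Z (\<lambda>z. u' t z - u t z) < \<epsilon>)))"

text \<open>Local well-posedness in \<open>H\<^sup>s\<close> with existence time \<open>T R\<close> for data of norm at most \<open>R\<close>. All these
  data share the time interval, which gives continuous dependence a fixed target space.\<close>

definition locally_well_posed :: "real \<Rightarrow> real \<Rightarrow> (real \<Rightarrow> real) \<Rightarrow> bool" where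
  "locally_well_posed \<alpha> s T \<longleftrightarrow>
     (\<forall>R\<ge>0. T R > 0 \<and>
        (\<forall>\<psi>\<in>data s R. (\<exists>u. is_solution \<alpha> s (T R) \<psi> u) \<and>
           (\<forall>u v. is_solution \<alpha> s (T R) \<psi> u \<longrightarrow> is_solution \<alpha> s (T R) \<psi> v \<longrightarrow>
              (\<forall>t\<in>{0..T R}. AE z in lborel. u t z = v t z))) \<and>
        flow_continuous \<alpha> s (T R) (H s) (data s R))"

end

theory Submission
  imports Defs "HOL-Probability.Probability"
begin

text \<open>
  The estimates take place on the Fourier side, for the transform \<open>U(t)\<close> of the solution. Testing the equation
  with functions of \<open>X\<^sup>3\<close> whose transforms live where \<open>\<bar>\<xi>\<bar>\<close> and \<open>1 / \<bar>\<xi>\<bar>\<close> are bounded shows that there \<open>U\<close> is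
  differentiable in \<open>L\<^sup>2\<close>. As the symbol is imaginary, the derivative of \<open>\<parallel>w U\<parallel>\<^sup>2\<close> only sees the nonlinearity
  \<open>\<i> \<xi> (U * U) / (4 * pi)\<close>.

  For \<open>X\<close>, \<open>X_hat\<close>, \<open>X_hat_alpha\<close> and \<open>Y_hat\<close> the weight \<open>\<mu>\<close> of the space satisfies \<open>\<mu> \<bar>\<xi>\<bar> \<le> \<langle>\<zeta>\<rangle>\<^sup>s\<close>. The derivative in the
  nonlinearity absorbs the singularity, and as \<open>H\<^sup>s\<close> is an algebra, Gronwall's inequality bounds the parts of \<open>\<mu> U\<close> at
  small \<open>\<bar>\<xi>\<bar>\<close> or large \<open>\<bar>\<zeta>\<bar>\<close> uniformly in time and in nearby data. On the remaining set \<open>\<mu>\<close> is bounded, so continuity in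
  \<open>H\<^sup>s\<close> suffices.

  For \<open>Y\<close> the weight \<open>\<langle>\<zeta>\<rangle>\<^sup>s \<bar>\<eta> / \<xi>\<bar>\<close> costs one derivative more. But \<open>v = \<partial>\<^sub>x\<inverse> u\<^sub>y\<close> solves the linear transport equation with
  nonlinearity \<open>u v\<^sub>x\<close>, and a commutator estimate gives the same uniform tail bound for \<open>\<parallel>v\<parallel>\<close> in \<open>H\<^sup>s\<close> at high
  frequencies. The low frequencies are controlled by the result for \<open>Y_hat\<close>.
\<close>

subsection \<open>Square integrable functions\<close>

text \<open>The difference of two solutions has no closed estimate at the top level of regularity:
  in its equation a derivative falls on one of the solutions themselves. Differences are therefore
  measured only with a weight whose continuity is already known, and the remaining tails are bounded
  for each solution separately; this is why no rate of convergence appears. The energy identity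
  holds only for weights supported on a window, as \<open>lin_symbol\<close> is unbounded and for
  negative \<alpha> also singular at \<xi> = 0. For \<open>Y\<close> it would spoil the commutator
  estimate, so the window is removed first, at fixed \<epsilon> and with an error controlled by the
  \<open>Y_hat\<close> tails; then \<epsilon> tends to 0 by Fatou, and the bounds left over are
  small for large \<open>N\<close>. The assumption s > 2 acts mainly through integrability of
  \<open>jb \<zeta> * cmod (U \<zeta>)\<close>, the Fourier form of a bounded gradient. The range of
  \<alpha> bounds |\<xi>|^\<alpha> on windows and fixes the size of the weight of
  \<open>X_hat_alpha\<close>.\<close>

abbreviation n2 :: "func \<Rightarrow> real" where "n2 \<equiv> nrm L2"

lemma borel_measurable_cnj [measurable]:
  "f \<in> borel_measurable M \<Longrightarrow> (\<lambda>x. cnj (f x)) \<in> borel_measurable M"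
  using borel_measurable_continuous_onI[of cnj] continuous_on_cnj[OF continuous_on_id]
  by (auto intro: measurable_compose)

definition ip :: "func \<Rightarrow> func \<Rightarrow> complex" where
  "ip f g = (LINT z|lborel. f z * cnj (g z))"

lemma L2_iff: "f \<in> pts L2 \<longleftrightarrow> f \<in> borel_measurable borel \<and> l2_sq f < \<infinity>"
  by (simp add: L2_def)

lemma L2_measurable [measurable_dest]: "f \<in> pts L2 \<Longrightarrow> f \<in> borel_measurable borel"
  by (simp add: L2_iff)

lemma n2_eq: "n2 f = sqrt (enn2real (l2_sq f))"
  by (simp add: L2_def)

lemma n2_nonneg [simp]: "0 \<le> n2 f"
  by (simp add: n2_eq)

lemma l2_sq_n2: "f \<in> pts L2 \<Longrightarrow> l2_sq f = ennreal ((n2 f)\<^sup>2)"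
  by (simp add: L2_iff n2_eq)

text \<open>\<open>enn2real\<close> sends infinity to 0, so \<open>n2\<close> is 0 whenever
  \<open>l2_sq\<close> is infinite, and a bound on it alone says nothing. Here and below membership
  is therefore proved along with the bound.\<close>

lemma L2_I:
  assumes "f \<in> borel_measurable borel" "l2_sq f \<le> ennreal (c\<^sup>2)" "0 \<le> c"
  shows "f \<in> pts L2" "n2 f \<le> c"
proof -
  show 1: "f \<in> pts L2"
    using assms by (auto simp: L2_iff intro: le_less_trans)
  have "ennreal ((n2 f)\<^sup>2) \<le> ennreal (c\<^sup>2)"
    using assms l2_sq_n2[OF 1] by simp
  then have "(n2 f)\<^sup>2 \<le> c\<^sup>2" by (simp add: ennreal_le_iff)
  then show "n2 f \<le> c" using assms(3) power2_le_imp_le by blast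
qed

lemma l2_sq_cong: "AE z in lborel. f z = g z \<Longrightarrow> l2_sq f = l2_sq g"
  unfolding l2_sq_def by (rule nn_integral_cong_AE) auto

lemma n2_cong: "AE z in lborel. f z = g z \<Longrightarrow> n2 f = n2 g"
  by (simp add: n2_eq l2_sq_cong)

lemma l2_sq_cmult: 
  assumes "f \<in> borel_measurable borel"
  shows "l2_sq (\<lambda>z. c * f z) = ennreal ((cmod c)\<^sup>2) * l2_sq f"
  unfolding l2_sq_def using assms
  by (subst nn_integral_cmult[symmetric]) (auto simp: norm_mult power_mult_distrib ennreal_mult')

lemma L2_dom:
  assumes [measurable]: "f \<in> borel_measurable borel" and g: "g \<in> pts L2" and "0 \<le> c"
    and le: "AE z in lborel. cmod (f z) \<le> c * cmod (g z)"
  shows "f \<in> pts L2" "n2 f \<le> c * n2 g"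
proof -
  note [measurable] = L2_measurable[OF g]
  have "l2_sq f \<le> l2_sq (\<lambda>z. of_real c * g z)"
    unfolding l2_sq_def
  proof (rule nn_integral_mono_AE, use le in eventually_elim)
    case (elim z)
    have "cmod (f z) \<le> cmod (of_real c * g z)" using elim \<open>0 \<le> c\<close> by (simp add: norm_mult)
    then show ?case by (intro ennreal_leI power_mono) auto
  qed
  also have "\<dots> = ennreal ((c * n2 g)\<^sup>2)"
    using \<open>0 \<le> c\<close> by (simp add: l2_sq_cmult l2_sq_n2[OF g] power_mult_distrib ennreal_mult')
  finally have *: "l2_sq f \<le> ennreal ((c * n2 g)\<^sup>2)" .
  have "0 \<le> c * n2 g" using \<open>0 \<le> c\<close> by simp
  then show "f \<in> pts L2" "n2 f \<le> c * n2 g" by (rule L2_I[OF assms(1) *])+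
qed

lemma L2_cmult:
  assumes "f \<in> pts L2"
  shows "(\<lambda>z. c * f z) \<in> pts L2" "n2 (\<lambda>z. c * f z) = cmod c * n2 f"
proof -
  note [measurable] = L2_measurable[OF assms]
  have "l2_sq (\<lambda>z. c * f z) = ennreal ((cmod c * n2 f)\<^sup>2)"
    by (simp add: l2_sq_cmult l2_sq_n2[OF assms] power_mult_distrib ennreal_mult')
  then show "(\<lambda>z. c * f z) \<in> pts L2" "n2 (\<lambda>z. c * f z) = cmod c * n2 f"
    by (auto simp: L2_iff n2_eq)
qed

lemma ennreal_sq_le_imp_le:
  fixes x :: ennreal
  assumes "x\<^sup>2 \<le> (ennreal c)\<^sup>2" "0 \<le> c"
  shows "x \<le> ennreal c"
proof (cases x)
  case (real r)
  with assms have "r\<^sup>2 \<le> c\<^sup>2" by (simp add: ennreal_power ennreal_le_iff)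
  with real assms show ?thesis by (auto intro!: ennreal_leI power2_le_imp_le)
next
  case top
  with assms show ?thesis by (simp add: ennreal_power top_unique)
qed

lemma L2_CS_nn:
  assumes f: "f \<in> pts L2" and g: "g \<in> pts L2"
  shows "(\<integral>\<^sup>+ z. ennreal (cmod (f z) * cmod (g z)) \<partial>lborel) \<le> ennreal (n2 f * n2 g)"
proof -
  note [measurable] = L2_measurable[OF f] L2_measurable[OF g]
  let ?I = "\<integral>\<^sup>+ z. ennreal (cmod (f z) * cmod (g z)) \<partial>lborel"
  have "?I\<^sup>2 = (\<integral>\<^sup>+ z. ennreal (cmod (f z)) * ennreal (cmod (g z)) \<partial>lborel)\<^sup>2"
    by (simp add: ennreal_mult')
  also have "\<dots> \<le> (\<integral>\<^sup>+ z. ennreal (cmod (f z)) ^ 2 \<partial>lborel) * (\<integral>\<^sup>+ z. ennreal (cmod (g z)) ^ 2 \<partial>lborel)"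
    by (rule Cauchy_Schwarz_nn_integral) auto
  also have "\<dots> = l2_sq f * l2_sq g"
    by (simp add: l2_sq_def ennreal_power)
  also have "\<dots> = ennreal (n2 f * n2 g) ^ 2"
    by (simp add: l2_sq_n2 f g ennreal_power power_mult_distrib ennreal_mult')
  finally show ?thesis by (rule ennreal_sq_le_imp_le) simp
qed

lemma L2_integrable:
  assumes f: "f \<in> pts L2" and g: "g \<in> pts L2"
  shows "integrable lborel (\<lambda>z. f z * g z)" "integrable lborel (\<lambda>z. f z * cnj (g z))"
    "integrable lborel (\<lambda>z. cmod (f z) * cmod (g z))"
    "(LINT z|lborel. cmod (f z) * cmod (g z)) \<le> n2 f * n2 g"
    "cmod (LINT z|lborel. f z * g z) \<le> n2 f * n2 g"
    "cmod (ip f g) \<le> n2 f * n2 g"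
proof -
  note [measurable] = L2_measurable[OF f] L2_measurable[OF g]
  note CS = L2_CS_nn[OF f g]
  show 1: "integrable lborel (\<lambda>z. f z * g z)" "integrable lborel (\<lambda>z. f z * cnj (g z))"
    and 2: "integrable lborel (\<lambda>z. cmod (f z) * cmod (g z))"
    using CS by (auto simp: integrable_iff_bounded norm_mult intro: le_less_trans)
  show 3: "(LINT z|lborel. cmod (f z) * cmod (g z)) \<le> n2 f * n2 g"
    using CS by (subst (asm) nn_integral_eq_integral[OF 2]) (auto simp: ennreal_le_iff)
  have "cmod (LINT z|lborel. f z * g z) \<le> (LINT z|lborel. norm (f z * g z))"
    by (rule integral_norm_bound)
  with 3 show "cmod (LINT z|lborel. f z * g z) \<le> n2 f * n2 g" by (simp add: norm_mult)
  have "cmod (ip f g) \<le> (LINT z|lborel. norm (f z * cnj (g z)))"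
    unfolding ip_def by (rule integral_norm_bound)
  with 3 show "cmod (ip f g) \<le> n2 f * n2 g" by (simp add: norm_mult)
qed

lemma ip_self: 
  assumes "f \<in> pts L2" 
  shows "ip f f = of_real ((n2 f)\<^sup>2)"
    "integrable lborel (\<lambda>z. (cmod (f z))\<^sup>2)" "(LINT z|lborel. (cmod (f z))\<^sup>2) = (n2 f)\<^sup>2"
proof -
  show 1: "integrable lborel (\<lambda>z. (cmod (f z))\<^sup>2)"
    using L2_integrable(3)[OF assms assms] by (simp add: power2_eq_square)
  have "ennreal (LINT z|lborel. (cmod (f z))\<^sup>2) = ennreal ((n2 f)\<^sup>2)"
    using l2_sq_n2[OF assms] nn_integral_eq_integral[OF 1] by (simp add: l2_sq_def)
  then show 2: "(LINT z|lborel. (cmod (f z))\<^sup>2) = (n2 f)\<^sup>2"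
    by (subst (asm) ennreal_inj) auto
  show "ip f f = of_real ((n2 f)\<^sup>2)"
    unfolding ip_def 2[symmetric] by (simp add: complex_norm_square[symmetric] del: of_real_power)
qed

lemma ip_commute: "ip g f = cnj (ip f g)"
proof -
  have "cnj (ip f g) = (LINT z|lborel. cnj (f z * cnj (g z)))"
    unfolding ip_def by (rule Bochner_Integration.integral_cnj[symmetric])
  then show ?thesis by (simp add: ip_def mult.commute)
qed

lemma ip_cong: "AE z in lborel. f z = f' z \<Longrightarrow> AE z in lborel. g z = g' z \<Longrightarrow>
    f \<in> borel_measurable borel \<Longrightarrow> f' \<in> borel_measurable borel \<Longrightarrow>
    g \<in> borel_measurable borel \<Longrightarrow> g' \<in> borel_measurable borel \<Longrightarrow> ip f g = ip f' g'"
  unfolding ip_def by (intro integral_cong_AE) auto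

lemma ip_add_left: "f \<in> pts L2 \<Longrightarrow> g \<in> pts L2 \<Longrightarrow> h \<in> pts L2 \<Longrightarrow>
    ip (\<lambda>z. f z + g z) h = ip f h + ip g h"
  unfolding ip_def by (simp add: distrib_right L2_integrable)

lemma ip_diff_left: "f \<in> pts L2 \<Longrightarrow> g \<in> pts L2 \<Longrightarrow> h \<in> pts L2 \<Longrightarrow>
    ip (\<lambda>z. f z - g z) h = ip f h - ip g h"
  unfolding ip_def by (simp add: left_diff_distrib L2_integrable)

lemma ip_add_right: "f \<in> pts L2 \<Longrightarrow> g \<in> pts L2 \<Longrightarrow> h \<in> pts L2 \<Longrightarrow>
    ip h (\<lambda>z. f z + g z) = ip h f + ip h g"
  unfolding ip_def by (simp add: distrib_left L2_integrable)

lemma ip_diff_right: "f \<in> pts L2 \<Longrightarrow> g \<in> pts L2 \<Longrightarrow> h \<in> pts L2 \<Longrightarrow>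
    ip h (\<lambda>z. f z - g z) = ip h f - ip h g"
  unfolding ip_def by (simp add: right_diff_distrib L2_integrable)

lemma ip_cmult_left: "ip (\<lambda>z. c * f z) g = c * ip f g"
  unfolding ip_def by (simp add: mult.assoc)

lemma ip_cmult_right: "ip f (\<lambda>z. c * g z) = cnj c * ip f g"
  by (subst ip_commute, simp add: ip_cmult_left, subst ip_commute, simp)

text \<open>The exact expansion of the square serves later for polarisation, for the derivative of
  the energy and for orthogonal splittings; the triangle inequality is read off from it by
  Cauchy-Schwarz.\<close>

lemma L2_add:
  assumes f: "f \<in> pts L2" and g: "g \<in> pts L2"
  shows "(\<lambda>z. f z + g z) \<in> pts L2" "n2 (\<lambda>z. f z + g z) \<le> n2 f + n2 g"
    "(n2 (\<lambda>z. f z + g z))\<^sup>2 = (n2 f)\<^sup>2 + (n2 g)\<^sup>2 + 2 * Re (ip f g)"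
proof -
  note [measurable] = L2_measurable[OF f] L2_measurable[OF g]
  have "l2_sq (\<lambda>z. f z + g z) \<le> (\<integral>\<^sup>+ z. ennreal (2 * (cmod (f z))\<^sup>2) + ennreal (2 * (cmod (g z))\<^sup>2) \<partial>lborel)"
    unfolding l2_sq_def
  proof (rule nn_integral_mono)
    fix z
    have "(cmod (f z + g z))\<^sup>2 \<le> (cmod (f z) + cmod (g z))\<^sup>2"
      by (intro power_mono norm_triangle_ineq) auto
    also have "\<dots> \<le> 2 * (cmod (f z))\<^sup>2 + 2 * (cmod (g z))\<^sup>2"
      using sum_squares_bound[of "cmod (f z)" "cmod (g z)"] by (simp add: power2_sum)
    finally show "ennreal ((cmod (f z + g z))\<^sup>2) \<le> ennreal (2 * (cmod (f z))\<^sup>2) + ennreal (2 * (cmod (g z))\<^sup>2)"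
      by (simp flip: ennreal_plus)
  qed
  also have "\<dots> = 2 * l2_sq f + 2 * l2_sq g"
    unfolding l2_sq_def by (subst nn_integral_add) (auto simp: ennreal_mult' nn_integral_cmult)
  also have "\<dots> < \<infinity>" using f g by (simp add: L2_iff ennreal_mult_less_top)
  finally show 1: "(\<lambda>z. f z + g z) \<in> pts L2" by (simp add: L2_iff)
  have "of_real ((n2 (\<lambda>z. f z + g z))\<^sup>2) = ip (\<lambda>z. f z + g z) (\<lambda>z. f z + g z)"
    by (simp only: ip_self(1)[OF 1])
  also have "\<dots> = of_real ((n2 f)\<^sup>2) + of_real ((n2 g)\<^sup>2) + (ip f g + cnj (ip f g))"
    unfolding ip_commute[of g f, symmetric]
    by (simp only: ip_add_left[OF f g 1] ip_add_right[OF f g f] ip_add_right[OF f g g] ip_self(1) f g ac_simps)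
  also have "\<dots> = of_real ((n2 f)\<^sup>2 + (n2 g)\<^sup>2 + 2 * Re (ip f g))"
    by (simp only: complex_add_cnj of_real_add)
  finally show 2: "(n2 (\<lambda>z. f z + g z))\<^sup>2 = (n2 f)\<^sup>2 + (n2 g)\<^sup>2 + 2 * Re (ip f g)"
    by (simp only: of_real_eq_iff)
  have "(n2 (\<lambda>z. f z + g z))\<^sup>2 \<le> (n2 f + n2 g)\<^sup>2"
    using L2_integrable(6)[OF f g] complex_Re_le_cmod[of "ip f g"] unfolding 2 power2_sum by simp
  then show "n2 (\<lambda>z. f z + g z) \<le> n2 f + n2 g"
    by (rule power2_le_imp_le) simp
qed

lemma L2_diff:
  assumes f: "f \<in> pts L2" and g: "g \<in> pts L2"
  shows "(\<lambda>z. f z - g z) \<in> pts L2" "n2 (\<lambda>z. f z - g z) \<le> n2 f + n2 g"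
    "(n2 (\<lambda>z. f z - g z))\<^sup>2 = (n2 f)\<^sup>2 + (n2 g)\<^sup>2 - 2 * Re (ip f g)"
  using L2_add[OF f L2_cmult(1)[OF g, of "-1"]] L2_cmult(2)[OF g, of "-1"] ip_cmult_right[of f "-1" g]
  by auto

lemma L2_zero: "(\<lambda>_. 0) \<in> pts L2" "n2 (\<lambda>_. 0) = 0"
  by (auto simp: L2_iff n2_eq l2_sq_def)

lemma n2_minus_commute: "n2 (\<lambda>z. f z - g z) = n2 (\<lambda>z. g z - f z)"
  by (simp add: n2_eq l2_sq_def norm_minus_commute)

lemma n2_triangle:
  assumes "f \<in> pts L2" "g \<in> pts L2" "h \<in> pts L2"
  shows "n2 (\<lambda>z. f z - h z) \<le> n2 (\<lambda>z. f z - g z) + n2 (\<lambda>z. g z - h z)"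
  using L2_add(2)[OF L2_diff(1)[OF assms(1,2)] L2_diff(1)[OF assms(2,3)]] by simp

lemma n2_le_diff:
  assumes "f \<in> pts L2" "g \<in> pts L2"
  shows "n2 f \<le> n2 g + n2 (\<lambda>z. f z - g z)"
  using L2_add(2)[OF assms(2) L2_diff(1)[OF assms]] by simp

lemma n2_abs_diff:
  assumes "f \<in> pts L2" "g \<in> pts L2"
  shows "\<bar>n2 f - n2 g\<bar> \<le> n2 (\<lambda>z. f z - g z)"
  using n2_le_diff[OF assms] n2_le_diff[OF assms(2,1)] n2_minus_commute[of f g] by simp

lemma n2_eq_0_iff:
  assumes "f \<in> pts L2"
  shows "n2 f = 0 \<longleftrightarrow> (AE z in lborel. f z = 0)"
proof -
  note [measurable] = L2_measurable[OF assms]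
  have "n2 f = 0 \<longleftrightarrow> l2_sq f = 0" by (simp add: l2_sq_n2[OF assms])
  also have "\<dots> \<longleftrightarrow> (AE z in lborel. f z = 0)"
    unfolding l2_sq_def by (subst nn_integral_0_iff_AE) auto
  finally show ?thesis .
qed

lemma L2_Fatou:
  assumes F: "\<And>n. F n \<in> pts L2" "\<And>n. n2 (F n) \<le> c"
    and lim: "AE z in lborel. (\<lambda>n. F n z) \<longlonglongrightarrow> f z" and [measurable]: "f \<in> borel_measurable borel"
  shows "f \<in> pts L2" "n2 f \<le> c"
proof -
  note [measurable] = L2_measurable[OF F(1)]
  have c: "0 \<le> c" using F(2)[of 0] n2_nonneg[of "F 0"] by linarith
  have "l2_sq f = (\<integral>\<^sup>+ z. liminf (\<lambda>n. ennreal ((cmod (F n z))\<^sup>2)) \<partial>lborel)"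
    unfolding l2_sq_def
  proof (rule nn_integral_cong_AE, use lim in eventually_elim)
    case (elim z)
    then have "(\<lambda>n. ennreal ((cmod (F n z))\<^sup>2)) \<longlonglongrightarrow> ennreal ((cmod (f z))\<^sup>2)"
      by (intro tendsto_intros)
    then show ?case by (simp only: lim_imp_Liminf sequentially_bot not_False_eq_True)
  qed
  also have "\<dots> \<le> liminf (\<lambda>n. l2_sq (F n))"
    unfolding l2_sq_def by (rule nn_integral_liminf) auto
  also have "\<dots> \<le> ennreal (c\<^sup>2)"
  proof (intro Liminf_le always_eventually allI)
    fix n show "l2_sq (F n) \<le> ennreal (c\<^sup>2)"
      unfolding l2_sq_n2[OF F(1)] by (intro ennreal_leI power_mono F) simp
  qed simp
  finally have *: "l2_sq f \<le> ennreal (c\<^sup>2)" .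
  show "f \<in> pts L2" "n2 f \<le> c" by (rule L2_I[OF assms(4) * c])+
qed

text \<open>Riesz-Fischer: a subsequence with geometrically small increments converges almost
  everywhere, and Fatou carries the Cauchy bound over to the limit.\<close>

lemma L2_complete:
  assumes F: "\<And>n. F n \<in> pts L2"
    and Cauchy: "\<And>e. e > 0 \<Longrightarrow> \<exists>N. \<forall>m\<ge>N. \<forall>n\<ge>N. n2 (\<lambda>z. F m z - F n z) < e"
  shows "\<exists>g\<in>pts L2. (\<lambda>n. n2 (\<lambda>z. F n z - g z)) \<longlonglongrightarrow> 0"
proof -
  note [measurable] = L2_measurable[OF F]
  have "\<exists>N. \<forall>k. (\<forall>m\<ge>N k. \<forall>n\<ge>N k. n2 (\<lambda>z. F m z - F n z) < (1/2)^k) \<and> N k < N (Suc k)"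
  proof (rule dependent_nat_choice)
    show "\<exists>N. \<forall>m\<ge>N. \<forall>n\<ge>N. n2 (\<lambda>z. F m z - F n z) < (1/2)^0" using Cauchy[of 1] by simp
    fix N k
    obtain N' where "\<forall>m\<ge>N'. \<forall>n\<ge>N'. n2 (\<lambda>z. F m z - F n z) < (1/2)^(Suc k)"
      using Cauchy[of "(1/2)^(Suc k)"] by auto
    then show "\<exists>N'. (\<forall>m\<ge>N'. \<forall>n\<ge>N'. n2 (\<lambda>z. F m z - F n z) < (1/2)^(Suc k)) \<and> N < N'"
      by (intro exI[of _ "max N' (Suc N)"]) auto
  qed
  then obtain r where r: "\<And>k m n. m \<ge> r k \<Longrightarrow> n \<ge> r k \<Longrightarrow> n2 (\<lambda>z. F m z - F n z) < (1/2)^k"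
    and r_mono: "\<And>k. r k < r (Suc k)" by blast
  have smono: "strict_mono r" using r_mono by (simp add: strict_mono_Suc_iff)
  \<comment> \<open>This yields a strictly positive \<open>p\<close> in L2. Pairing the increments
    with it by Cauchy-Schwarz makes the integral of the sum of |d k| |p| finite, and as
    \<open>p\<close> vanishes nowhere this forces absolute convergence at almost every
    point.\<close>
  obtain h where h [measurable]: "h \<in> borel_measurable (lborel :: plane measure)"
    and hfin: "integral\<^sup>N lborel h \<noteq> \<infinity>" and hpos: "\<And>x. 0 < h x \<and> h x < \<infinity>"
    using sigma_finite_measure.Ex_finite_integrable_function[OF sigma_finite_lborel] by auto
  define p where "p z = complex_of_real (sqrt (enn2real (h z)))" for z
  have [measurable]: "p \<in> borel_measurable borel" unfolding p_def using h by simp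
  have "l2_sq p = integral\<^sup>N lborel h"
    unfolding l2_sq_def p_def
  proof (rule nn_integral_cong)
    fix z show "ennreal ((cmod (complex_of_real (sqrt (enn2real (h z)))))\<^sup>2) = h z"
      using hpos[of z] by (simp add: norm_of_real)
  qed
  then have pL: "p \<in> pts L2" using hfin by (simp add: L2_iff less_top)
  have ppos: "cmod (p z) > 0" for z
    using hpos[of z] by (simp add: p_def enn2real_positive_iff)
  define d where "d k z = F (r (Suc k)) z - F (r k) z" for k z
  have dL: "d k \<in> pts L2" for k unfolding d_def by (intro L2_diff F)
  note [measurable] = L2_measurable[OF dL]
  have nd: "n2 (d k) \<le> (1/2)^k" for k
    unfolding d_def using r[of k "r (Suc k)" "r k"] r_mono[of k] by auto
  have "(\<integral>\<^sup>+ z. (\<Sum>k. ennreal (cmod (d k z) * cmod (p z))) \<partial>lborel) =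
      (\<Sum>k. \<integral>\<^sup>+ z. ennreal (cmod (d k z) * cmod (p z)) \<partial>lborel)"
    by (rule nn_integral_suminf) auto
  also have "\<dots> \<le> (\<Sum>k. ennreal ((1/2)^k * n2 p))"
    by (intro suminf_le order_trans[OF L2_CS_nn[OF dL pL]] ennreal_leI mult_right_mono nd) auto
  also have "\<dots> < \<infinity>"
    by (subst suminf_ennreal2) (auto intro!: summable_mult2 summable_geometric)
  finally have "(\<integral>\<^sup>+ z. (\<Sum>k. ennreal (cmod (d k z) * cmod (p z))) \<partial>lborel) \<noteq> \<infinity>" by simp
  then have "AE z in lborel. (\<Sum>k. ennreal (cmod (d k z) * cmod (p z))) \<noteq> \<infinity>"
    by (intro nn_integral_PInf_AE) auto
  then have AEc: "AE z in lborel. convergent (\<lambda>k. F (r k) z)"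
  proof eventually_elim
    case (elim z)
    then have "summable (\<lambda>k. cmod (d k z) * cmod (p z))"
      by (intro summable_suminf_not_top) auto
    then have "summable (\<lambda>k. cmod (d k z) * cmod (p z) * (1 / cmod (p z)))" by (rule summable_mult2)
    also have "(\<lambda>k. cmod (d k z) * cmod (p z) * (1 / cmod (p z))) = (\<lambda>k. norm (d k z))"
      using ppos[of z] by (intro ext) (simp add: field_simps)
    finally have "summable (\<lambda>k. d k z)" by (rule summable_norm_cancel)
    then have "convergent (\<lambda>n. \<Sum>k<n. d k z)" by (simp add: summable_iff_convergent)
    moreover have "(\<Sum>k<n. d k z) = F (r n) z - F (r 0) z" for n
      unfolding d_def by (rule sum_lessThan_telescope)
    ultimately have "convergent (\<lambda>n. F (r n) z - F (r 0) z)" by simp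
    from convergent_add[OF this convergent_const[of "F (r 0) z"]] show ?case by simp
  qed
  define g where "g z = lim (\<lambda>k. F (r k) z)" for z
  have [measurable]: "g \<in> borel_measurable borel" unfolding g_def by (rule borel_measurable_lim_metric) auto
  have lim: "AE z in lborel. (\<lambda>k. F (r k) z) \<longlonglongrightarrow> g z"
    using AEc by eventually_elim (simp add: g_def convergent_LIMSEQ_iff)
  have key: "(\<lambda>z. F m z - g z) \<in> pts L2 \<and> n2 (\<lambda>z. F m z - g z) \<le> (1/2)^k" if "m \<ge> r k" for m k
  proof -
    have 1: "(\<lambda>z. F m z - F (r (j + k)) z) \<in> pts L2" for j by (intro L2_diff F)
    have 2: "n2 (\<lambda>z. F m z - F (r (j + k)) z) \<le> (1/2)^k" for j
      using r[of k m "r (j + k)"] that smono by (simp add: less_imp_le strict_mono_less_eq)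
    have 3: "AE z in lborel. (\<lambda>j. F m z - F (r (j + k)) z) \<longlonglongrightarrow> F m z - g z"
      using lim by eventually_elim (intro tendsto_intros LIMSEQ_ignore_initial_segment)
    show ?thesis using L2_Fatou[OF 1 2 3] by auto
  qed
  have "g \<in> pts L2"
    using L2_diff(1)[OF F[of "r 0"], of "\<lambda>z. F (r 0) z - g z"] key[of 0 "r 0"] by simp
  moreover have "(\<lambda>n. n2 (\<lambda>z. F n z - g z)) \<longlonglongrightarrow> 0"
  proof (rule LIMSEQ_I)
    fix e :: real assume "e > 0"
    then obtain k where k: "(1/2)^k < e" using real_arch_pow_inv[of e "1/2"] by auto
    show "\<exists>N. \<forall>n\<ge>N. norm (n2 (\<lambda>z. F n z - g z) - 0) < e"
      using key k by (intro exI[of _ "r k"]) (auto intro: le_less_trans)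
  qed
  ultimately show ?thesis by blast
qed

subsection \<open>Reflections and translations\<close>

lemma lborel_distr_reflect: "distr lborel borel (\<lambda>z. a - z) = (lborel :: 'a::euclidean_space measure)"
  using lborel_affine[of "-1" a] by (simp add: density_1)

lemma nn_integral_reflect:
  fixes f :: "'a::euclidean_space \<Rightarrow> ennreal"
  assumes [measurable]: "f \<in> borel_measurable borel"
  shows "(\<integral>\<^sup>+ z. f (a - z) \<partial>lborel) = (\<integral>\<^sup>+ z. f z \<partial>lborel)"
  by (subst lborel_distr_reflect[of a, symmetric]) (simp add: nn_integral_distr)

lemma nn_integral_translate:
  fixes f :: "'a::euclidean_space \<Rightarrow> ennreal"
  assumes [measurable]: "f \<in> borel_measurable borel"
  shows "(\<integral>\<^sup>+ z. f (z - a) \<partial>lborel) = (\<integral>\<^sup>+ z. f z \<partial>lborel)"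
  by (subst lborel_distr_plus[of "- a", symmetric]) (simp add: nn_integral_distr)

lemma integral_reflect:
  fixes f :: "'a::euclidean_space \<Rightarrow> complex"
  assumes [measurable]: "f \<in> borel_measurable borel"
  shows "(LINT z|lborel. f (a - z)) = (LINT z|lborel. f z)"
  by (subst lborel_distr_reflect[of a, symmetric]) (simp add: integral_distr)

lemma AE_reflect:
  fixes P :: "'a::euclidean_space \<Rightarrow> bool"
  assumes "AE z in lborel. P z"
  shows "AE z in lborel. P (a - z)"
proof -
  from AE_E3[OF assms] obtain N where N: "\<And>x. x \<in> space lborel - N \<Longrightarrow> P x" "N \<in> null_sets lborel" by auto
  have "AE z in distr lborel borel (\<lambda>z. a - z). z \<notin> N"
    unfolding lborel_distr_reflect using N(2) by (rule AE_not_in)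
  then have "AE z in lborel. a - z \<notin> N"
    using N(2) by (subst (asm) AE_distr_iff) auto
  then show ?thesis by eventually_elim (use N in auto)
qed

lemma L2_translate:
  assumes "f \<in> pts L2"
  shows "(\<lambda>z. f (z - a)) \<in> pts L2" "n2 (\<lambda>z. f (z - a)) = n2 f"
proof -
  note [measurable] = L2_measurable[OF assms]
  have *: "l2_sq (\<lambda>z. f (z - a)) = l2_sq f"
    unfolding l2_sq_def by (rule nn_integral_translate) simp
  show "(\<lambda>z. f (z - a)) \<in> pts L2" using assms * by (simp add: L2_iff)
  show "n2 (\<lambda>z. f (z - a)) = n2 f" by (simp only: n2_eq *)
qed

lemma L2_reflect:
  assumes "f \<in> pts L2"
  shows "(\<lambda>z. f (a - z)) \<in> pts L2" "n2 (\<lambda>z. f (a - z)) = n2 f"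
proof -
  note [measurable] = L2_measurable[OF assms]
  have *: "l2_sq (\<lambda>z. f (a - z)) = l2_sq f"
    unfolding l2_sq_def by (rule nn_integral_reflect) simp
  show "(\<lambda>z. f (a - z)) \<in> pts L2" using assms * by (simp add: L2_iff)
  show "n2 (\<lambda>z. f (a - z)) = n2 f" by (simp only: n2_eq *)
qed

lemma L2_cnj:
  assumes "f \<in> pts L2"
  shows "(\<lambda>z. cnj (f z)) \<in> pts L2" "n2 (\<lambda>z. cnj (f z)) = n2 f"
  using assms by (auto simp: L2_iff n2_eq l2_sq_def)

lemma L2_dominated:
  assumes F: "\<And>n. F n \<in> borel_measurable borel" and f: "f \<in> borel_measurable borel" and g: "g \<in> pts L2"
    and dom: "\<And>n. AE z in lborel. cmod (F n z) \<le> c * cmod (g z)"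
    and lim: "AE z in lborel. (\<lambda>n. F n z) \<longlonglongrightarrow> f z"
  shows "(\<lambda>n. n2 (\<lambda>z. F n z - f z)) \<longlonglongrightarrow> 0"
proof -
  note [measurable] = F f L2_measurable[OF g]
  have all: "AE z in lborel. \<forall>n. cmod (F n z) \<le> c * cmod (g z)" using dom by (simp add: AE_all_countable)
  have bd: "AE z in lborel. (\<forall>n. cmod (F n z) \<le> c * cmod (g z)) \<and> cmod (f z) \<le> c * cmod (g z)"
    using all lim
  proof eventually_elim
    case (elim z)
    then have "cmod (f z) \<le> c * cmod (g z)"
      by (intro LIMSEQ_le_const2[OF tendsto_norm[OF elim(2)]]) auto
    with elim show ?case by simp
  qed
  have "(\<lambda>n. LINT z|lborel. (cmod (F n z - f z))\<^sup>2) \<longlonglongrightarrow> (LINT z|lborel. (0::real) * (cmod (g z)))"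
  proof (rule integral_dominated_convergence)
    show "integrable lborel (\<lambda>z. (2 * c)\<^sup>2 * (cmod (g z))\<^sup>2)" using ip_self(2)[OF g] by simp
    show "AE z in lborel. (\<lambda>n. (cmod (F n z - f z))\<^sup>2) \<longlonglongrightarrow> 0 * cmod (g z)"
      using lim
    proof eventually_elim
      case (elim z)
      from tendsto_diff[OF elim tendsto_const[of "f z"]] have "(\<lambda>n. F n z - f z) \<longlonglongrightarrow> 0" by simp
      from tendsto_power[OF tendsto_norm[OF this], of 2] show ?case by simp
    qed
    show "AE z in lborel. norm ((cmod (F n z - f z))\<^sup>2) \<le> (2 * c)\<^sup>2 * (cmod (g z))\<^sup>2" for n
      using bd
    proof eventually_elim
      case (elim z)
      have "cmod (F n z - f z) \<le> cmod (F n z) + cmod (f z)" by (rule norm_triangle_ineq4)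
      also have "\<dots> \<le> 2 * c * cmod (g z)" using conjunct1[OF elim, THEN spec, of n] conjunct2[OF elim] by linarith
      finally have "(cmod (F n z - f z))\<^sup>2 \<le> (2 * c * cmod (g z))\<^sup>2" by (rule power_mono) simp
      then show ?case by (simp add: power_mult_distrib)
    qed
  qed auto
  then have "(\<lambda>n. sqrt (LINT z|lborel. (cmod (F n z - f z))\<^sup>2)) \<longlonglongrightarrow> sqrt 0"
    by (intro tendsto_real_sqrt) simp
  moreover have "sqrt (LINT z|lborel. (cmod (F n z - f z))\<^sup>2) = n2 (\<lambda>z. F n z - f z)" for n
    by (simp add: n2_eq l2_sq_def integral_eq_nn_integral)
  ultimately show ?thesis by simp
qed

section \<open>Continuity of translations in L2, by density of simple functions\<close>

definition trans_cont :: "func \<Rightarrow> bool" where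
  "trans_cont f \<longleftrightarrow> (\<forall>h. h \<longlonglongrightarrow> 0 \<longrightarrow> (\<lambda>n. n2 (\<lambda>z. f (z - h n) - f z)) \<longlonglongrightarrow> 0)"

lemma trans_cont_add:
  assumes f: "f \<in> pts L2" "trans_cont f" and g: "g \<in> pts L2" "trans_cont g"
  shows "trans_cont (\<lambda>z. f z + g z)"
  unfolding trans_cont_def
proof (intro allI impI)
  fix h :: "nat \<Rightarrow> plane" assume h: "h \<longlonglongrightarrow> 0"
  have lim: "(\<lambda>n. n2 (\<lambda>z. f (z - h n) - f z) + n2 (\<lambda>z. g (z - h n) - g z)) \<longlonglongrightarrow> 0"
    using f g h by (intro tendsto_add_zero) (auto simp: trans_cont_def)
  have le: "n2 (\<lambda>z. (f (z - h n) + g (z - h n)) - (f z + g z)) \<le>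
      n2 (\<lambda>z. f (z - h n) - f z) + n2 (\<lambda>z. g (z - h n) - g z)" for n
    using L2_add(2)[OF L2_diff(1)[OF L2_translate(1)[OF f(1)] f(1)] L2_diff(1)[OF L2_translate(1)[OF g(1)] g(1)], of "h n" "h n"]
    by (simp add: algebra_simps)
  show "(\<lambda>n. n2 (\<lambda>z. (f (z - h n) + g (z - h n)) - (f z + g z))) \<longlonglongrightarrow> 0"
    by (rule tendsto_sandwich[OF _ _ tendsto_const lim]) (auto simp: le)
qed

lemma trans_cont_cmult:
  assumes f: "f \<in> pts L2" "trans_cont f"
  shows "trans_cont (\<lambda>z. c * f z)"
  unfolding trans_cont_def
proof (intro allI impI)
  fix h :: "nat \<Rightarrow> plane" assume h: "h \<longlonglongrightarrow> 0"
  have "n2 (\<lambda>z. c * f (z - h n) - c * f z) = cmod c * n2 (\<lambda>z. f (z - h n) - f z)" for n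
    using L2_cmult(2)[OF L2_diff(1)[OF L2_translate(1)[OF f(1)] f(1)], of c "h n"]
    by (simp add: right_diff_distrib)
  moreover have "(\<lambda>n. cmod c * n2 (\<lambda>z. f (z - h n) - f z)) \<longlonglongrightarrow> 0"
    using f h by (intro tendsto_mult_right_zero) (auto simp: trans_cont_def)
  ultimately show "(\<lambda>n. n2 (\<lambda>z. c * f (z - h n) - c * f z)) \<longlonglongrightarrow> 0" by simp
qed

lemma trans_cont_closed:
  assumes f: "f \<in> pts L2" and ap: "\<And>e. e > 0 \<Longrightarrow> \<exists>g\<in>pts L2. trans_cont g \<and> n2 (\<lambda>z. f z - g z) < e"
  shows "trans_cont f"
  unfolding trans_cont_def
proof (intro allI impI LIMSEQ_I)
  fix h :: "nat \<Rightarrow> plane" and e :: real assume h: "h \<longlonglongrightarrow> 0" and e: "0 < e"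
  obtain g where g: "g \<in> pts L2" "trans_cont g" "n2 (\<lambda>z. f z - g z) < e / 3"
    using ap[of "e / 3"] e by auto
  from LIMSEQ_D[OF g(2)[unfolded trans_cont_def, rule_format, OF h], of "e / 3"] e
  obtain N where N: "\<And>n. n \<ge> N \<Longrightarrow> n2 (\<lambda>z. g (z - h n) - g z) < e / 3" by auto
  have "n2 (\<lambda>z. f (z - h n) - f z) < e" if "n \<ge> N" for n
  proof -
    let ?f = "\<lambda>z. f (z - h n)" and ?g = "\<lambda>z. g (z - h n)"
    have m: "?f \<in> pts L2" "?g \<in> pts L2" using L2_translate f g by auto
    have "n2 (\<lambda>z. ?f z - f z) \<le> n2 (\<lambda>z. ?f z - ?g z) + n2 (\<lambda>z. ?g z - f z)"
      by (rule n2_triangle[OF m f])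
    also have "n2 (\<lambda>z. ?g z - f z) \<le> n2 (\<lambda>z. ?g z - g z) + n2 (\<lambda>z. g z - f z)"
      by (rule n2_triangle[OF m(2) g(1) f])
    also have "n2 (\<lambda>z. ?f z - ?g z) = n2 (\<lambda>z. f z - g z)"
      using L2_translate(2)[OF L2_diff(1)[OF f g(1)], of "h n"] by simp
    finally show ?thesis using N[OF that] g(3) n2_minus_commute[of f g] by linarith
  qed
  then show "\<exists>N. \<forall>n\<ge>N. norm (n2 (\<lambda>z. f (z - h n) - f z) - 0) < e" by auto
qed

lemma l2_sq_indicator: "A \<in> sets borel \<Longrightarrow> l2_sq (indicator A) = emeasure lborel A"
proof -
  assume A: "A \<in> sets borel"
  have "l2_sq (indicator A) = (\<integral>\<^sup>+ z. indicator A z \<partial>lborel)"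
    unfolding l2_sq_def by (intro nn_integral_cong) (simp split: split_indicator)
  also have "\<dots> = emeasure lborel A" using A by simp
  finally show ?thesis .
qed

text \<open>Expanding the square leaves only the inner product of the translate with the indicator,
  an integral over \<open>U\<close>. At a point of the open set \<open>U\<close> the translate is
  eventually 1, so the boundary of \<open>U\<close> never matters.\<close>

lemma trans_cont_open:
  assumes U: "open U" "emeasure lborel U < \<infinity>"
  shows "trans_cont (indicator U)"
  unfolding trans_cont_def
proof (intro allI impI)
  fix h :: "nat \<Rightarrow> plane" assume h: "h \<longlonglongrightarrow> 0"
  let ?f = "indicator U :: func"
  have f: "?f \<in> pts L2" using U by (simp add: L2_iff l2_sq_indicator)
  note [measurable] = L2_measurable[OF f] L2_measurable[OF L2_translate(1)[OF f]]
  have ev: "(n2 (\<lambda>z. ?f (z - h n) - ?f z))\<^sup>2 = 2 * (n2 ?f)\<^sup>2 - 2 * Re (ip (\<lambda>z. ?f (z - h n)) ?f)" for n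
    using L2_diff(3)[OF L2_translate(1)[OF f] f, of "h n"] L2_translate(2)[OF f, of "h n"] by simp
  have "(\<lambda>n. ip (\<lambda>z. ?f (z - h n)) ?f) \<longlonglongrightarrow> ip ?f ?f"
    unfolding ip_def
  proof (rule integral_dominated_convergence)
    show "integrable lborel (\<lambda>z. (cmod (?f z))\<^sup>2)" by (rule ip_self(2)[OF f])
    show "AE z in lborel. (\<lambda>n. ?f (z - h n) * cnj (?f z)) \<longlonglongrightarrow> ?f z * cnj (?f z)"
    proof (rule AE_I2)
      fix z show "(\<lambda>n. ?f (z - h n) * cnj (?f z)) \<longlonglongrightarrow> ?f z * cnj (?f z)"
      proof (cases "z \<in> U")
        case True
        have "(\<lambda>n. z - h n) \<longlonglongrightarrow> z" using tendsto_diff[OF tendsto_const h, of z] by simp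
        from topological_tendstoD[OF this U(1) True] have "\<forall>\<^sub>F n in sequentially. z - h n \<in> U" .
        then have "\<forall>\<^sub>F n in sequentially. ?f (z - h n) * cnj (?f z) = ?f z * cnj (?f z)"
          by eventually_elim (simp add: True)
        then show ?thesis by (rule tendsto_eventually)
      qed simp
    qed
    show "AE z in lborel. norm (?f (z - h n) * cnj (?f z)) \<le> (cmod (?f z))\<^sup>2" for n
      by (auto simp: indicator_def)
  qed auto
  then have "(\<lambda>n. 2 * (n2 ?f)\<^sup>2 - 2 * Re (ip (\<lambda>z. ?f (z - h n)) ?f)) \<longlonglongrightarrow> 2 * (n2 ?f)\<^sup>2 - 2 * Re (ip ?f ?f)"
    by (intro tendsto_intros)
  then have "(\<lambda>n. (n2 (\<lambda>z. ?f (z - h n) - ?f z))\<^sup>2) \<longlonglongrightarrow> 0"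
    unfolding ev by (simp add: ip_self(1)[OF f])
  then show "(\<lambda>n. n2 (\<lambda>z. ?f (z - h n) - ?f z)) \<longlonglongrightarrow> 0"
    using tendsto_real_sqrt by fastforce
qed

text \<open>By outer regularity \<open>A\<close> differs from an open superset by a set of measure
  below \<open>e\<^sup>2\<close>, hence by less than \<open>e\<close> in L2.\<close>

lemma trans_cont_indicator:
  assumes A: "A \<in> sets borel" "emeasure lborel A < \<infinity>"
  shows "trans_cont (indicator A)"
proof (rule trans_cont_closed)
  show f: "indicator A \<in> pts L2" using A by (simp add: L2_iff l2_sq_indicator)
  fix e :: real assume e: "e > 0"
  obtain U where U: "open U" "A \<subseteq> U" "emeasure lborel (U - A) < ennreal (e\<^sup>2)"
    using outer_regular_lborel[OF A(1), of "e\<^sup>2"] e by auto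
  have [measurable]: "U \<in> sets borel" using U by auto
  have "emeasure lborel U \<le> emeasure lborel A + emeasure lborel (U - A)"
    using A U emeasure_subadditive[of A lborel "U - A"] by (simp add: Un_absorb1)
  also have "\<dots> < \<infinity>" using A U(3) by (auto simp: less_top[symmetric])
  finally have Uf: "emeasure lborel U < \<infinity>" .
  have g: "indicator U \<in> pts L2" using Uf by (simp add: L2_iff l2_sq_indicator)
  have "l2_sq (\<lambda>z. indicator A z - indicator U z) = l2_sq (indicator (U - A))"
    unfolding l2_sq_def using U by (intro nn_integral_cong) (auto simp: indicator_def)
  also have "\<dots> < ennreal (e\<^sup>2)" using U A by (simp add: l2_sq_indicator)
  finally have "ennreal ((n2 (\<lambda>z. indicator A z - indicator U z))\<^sup>2) < ennreal (e\<^sup>2)"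
    by (simp only: l2_sq_n2[OF L2_diff(1)[OF f g]])
  then have "n2 (\<lambda>z. indicator A z - indicator U z) < e"
    using e by (simp add: ennreal_less_iff power2_less_imp_less)
  with g trans_cont_open[OF U(1) Uf]
  show "\<exists>g\<in>pts L2. trans_cont g \<and> n2 (\<lambda>z. indicator A z - g z) < e" by blast
qed

lemma L2_sum: "finite I \<Longrightarrow> (\<And>i. i \<in> I \<Longrightarrow> f i \<in> pts L2) \<Longrightarrow> (\<lambda>z. \<Sum>i\<in>I. f i z) \<in> pts L2"
  by (induction rule: finite_induct) (auto intro: L2_add L2_zero)

lemma trans_cont_sum:
  assumes "finite I" "\<And>i. i \<in> I \<Longrightarrow> f i \<in> pts L2" "\<And>i. i \<in> I \<Longrightarrow> trans_cont (f i)"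
  shows "trans_cont (\<lambda>z. \<Sum>i\<in>I. f i z)"
  using assms
proof (induction rule: finite_induct)
  case empty show ?case by (simp add: trans_cont_def L2_zero)
next
  case (insert i I)
  then show ?case by (simp add: trans_cont_add L2_sum)
qed

lemma trans_cont_simple:
  assumes s: "simple_function lborel f" and f: "f \<in> pts L2"
  shows "trans_cont f"
proof -
  note [measurable] = L2_measurable[OF f]
  have fin: "finite (range f)" using s by (simp add: simple_function_def)
  define A where "A y = f -` {y}" for y
  have A [measurable]: "A y \<in> sets borel" for y
    unfolding A_def using measurable_sets[OF L2_measurable[OF f], of "{y}"] by simp
  \<comment> \<open>Chebyshev: a nonzero value is taken on a set of finite measure. The value 0 is
    left out of the sum below.\<close>
  have Af: "emeasure lborel (A y) < \<infinity>" if "y \<noteq> 0" for y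
  proof -
    have "ennreal ((cmod y)\<^sup>2) * emeasure lborel (A y) = (\<integral>\<^sup>+ z. ennreal ((cmod y)\<^sup>2) * indicator (A y) z \<partial>lborel)"
      by (simp add: nn_integral_cmult_indicator)
    also have "\<dots> \<le> l2_sq f" unfolding l2_sq_def
      by (intro nn_integral_mono) (auto simp: indicator_def A_def)
    also have "\<dots> < \<infinity>" using f by (simp add: L2_iff)
    finally show ?thesis using that by (auto simp: ennreal_mult_less_top)
  qed
  have eq: "f = (\<lambda>z. \<Sum>y\<in>range f - {0}. y * indicator (A y) z)"
  proof
    fix z
    have "(\<Sum>y\<in>range f - {0}. y * indicator (A y) z) = (\<Sum>y\<in>range f - {0}. if y = f z then y else 0)"
      by (intro sum.cong) (auto simp: A_def indicator_def)
    also have "\<dots> = f z" using fin by (subst sum.delta) auto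
    finally show "f z = (\<Sum>y\<in>range f - {0}. y * indicator (A y) z)" by simp
  qed
  have "indicator (A y) \<in> pts L2" if "y \<noteq> 0" for y
    using Af[OF that] by (simp add: L2_iff l2_sq_indicator)
  then have "trans_cont (\<lambda>z. \<Sum>y\<in>range f - {0}. y * indicator (A y) z)"
    using fin Af by (intro trans_cont_sum trans_cont_cmult trans_cont_indicator L2_cmult) auto
  then show ?thesis by (simp add: eq[symmetric])
qed

lemma L2_translation_continuous:
  assumes f: "f \<in> pts L2" and h: "h \<longlonglongrightarrow> 0"
  shows "(\<lambda>n. n2 (\<lambda>z. f (z - h n) - f z)) \<longlonglongrightarrow> 0"
proof -
  have "f \<in> borel_measurable lborel" using L2_measurable[OF f] by simp
  from borel_measurable_implies_sequence_metric[OF this, of 0]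
  obtain F where F: "\<And>i. simple_function lborel (F i)" "\<And>z. (\<lambda>i. F i z) \<longlonglongrightarrow> f z"
    "\<And>i z. dist (F i z) 0 \<le> 2 * dist (f z) 0" by auto
  have Fm: "F i \<in> borel_measurable borel" for i
    using borel_measurable_simple_function[OF F(1)[of i]] by simp
  have bd: "AE z in lborel. cmod (F i z) \<le> 2 * cmod (f z)" for i using F(3)[of i] by simp
  have FL: "F i \<in> pts L2" for i by (rule L2_dom(1)[OF Fm f _ bd]) simp
  have lim: "(\<lambda>i. n2 (\<lambda>z. F i z - f z)) \<longlonglongrightarrow> 0"
    by (rule L2_dominated[OF Fm L2_measurable[OF f] f bd]) (simp add: F(2))
  have "trans_cont f"
  proof (rule trans_cont_closed[OF f])
    fix e :: real assume "e > 0"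
    from LIMSEQ_D[OF lim this] obtain i where "n2 (\<lambda>z. F i z - f z) < e" by auto
    then show "\<exists>g\<in>pts L2. trans_cont g \<and> n2 (\<lambda>z. f z - g z) < e"
      using FL trans_cont_simple[OF F(1) FL] n2_minus_commute[of f] by metis
  qed
  then show ?thesis using h by (simp add: trans_cont_def)
qed

subsection \<open>Plancherel's theorem for integrable functions\<close>

definition chi :: "plane \<Rightarrow> plane \<Rightarrow> complex" where
  "chi z \<zeta> = exp (- \<i> * complex_of_real (z \<bullet> \<zeta>))"

lemma chi_measurable [measurable]:
  assumes [measurable]: "f \<in> borel_measurable M" "g \<in> borel_measurable M"
  shows "(\<lambda>x. chi (f x) (g x)) \<in> borel_measurable M"
  unfolding chi_def by measurable

lemma norm_chi [simp]: "cmod (chi z \<zeta>) = 1"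
  unfolding chi_def by simp

lemma chi_add: "chi (y + z) \<zeta> = chi y \<zeta> * chi z \<zeta>" "chi z (\<zeta> + \<zeta>') = chi z \<zeta> * chi z \<zeta>'"
  unfolding chi_def by (simp_all add: inner_add exp_add[symmetric] algebra_simps)

lemma chi_minus: "chi (- z) \<zeta> = cnj (chi z \<zeta>)" "chi z (- \<zeta>) = cnj (chi z \<zeta>)"
  unfolding chi_def by (simp_all add: exp_cnj)

lemma chi_commute: "chi z \<zeta> = chi \<zeta> z"
  unfolding chi_def by (simp add: inner_commute)

definition ft1 :: "func \<Rightarrow> func" where
  "ft1 f \<zeta> = complex_of_real (1 / (2 * pi)) * (LINT z|lborel. chi z \<zeta> * f z)"

lemma integrable_chi_mult:
  assumes "integrable lborel f"
  shows "integrable lborel (\<lambda>z. chi z \<zeta> * f z)" "integrable lborel (\<lambda>z. chi \<zeta> z * f z)"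
proof -
  have [measurable]: "f \<in> borel_measurable borel" using borel_measurable_integrable[OF assms] by simp
  show "integrable lborel (\<lambda>z. chi z \<zeta> * f z)" "integrable lborel (\<lambda>z. chi \<zeta> z * f z)"
    by (rule Bochner_Integration.integrable_bound[OF assms]; simp add: norm_mult)+
qed

lemma ft1_measurable [measurable]:
  assumes [measurable]: "f \<in> borel_measurable borel"
  shows "ft1 f \<in> borel_measurable borel"
  unfolding ft1_def by measurable

lemma ft1_bound: "cmod (ft1 f \<zeta>) \<le> (LINT z|lborel. cmod (f z))"
proof -
  have "cmod (ft1 f \<zeta>) = 1 / (2 * pi) * cmod (LINT z|lborel. chi z \<zeta> * f z)"
    by (simp add: ft1_def norm_mult norm_divide)
  also have "\<dots> \<le> 1 * (LINT z|lborel. cmod (chi z \<zeta> * f z))"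
    using pi_gt3 by (intro mult_mono integral_norm_bound) auto
  finally show ?thesis by (simp add: norm_mult)
qed

lemma ft1_diff: "integrable lborel f \<Longrightarrow> integrable lborel g \<Longrightarrow>
    ft1 (\<lambda>z. f z - g z) \<zeta> = ft1 f \<zeta> - ft1 g \<zeta>"
  unfolding ft1_def by (simp add: right_diff_distrib integrable_chi_mult)

lemma Fubini_swap:
  fixes F :: "plane \<Rightarrow> plane \<Rightarrow> complex"
  assumes m [measurable]: "(\<lambda>(x, y). F x y) \<in> borel_measurable (borel \<Otimes>\<^sub>M borel)"
    and fin: "(\<integral>\<^sup>+ x. \<integral>\<^sup>+ y. ennreal (cmod (F x y)) \<partial>lborel \<partial>lborel) < \<infinity>"
  shows "(LINT x|lborel. LINT y|lborel. F x y) = (LINT y|lborel. LINT x|lborel. F x y)"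
proof -
  have m': "(\<lambda>(x, y). F x y) \<in> borel_measurable (lborel \<Otimes>\<^sub>M lborel)"
    using m by (simp cong: measurable_cong_sets sets_pair_measure_cong)
  have "(\<integral>\<^sup>+ z. ennreal (norm (case z of (x, y) \<Rightarrow> F x y)) \<partial>(lborel \<Otimes>\<^sub>M lborel)) =
      (\<integral>\<^sup>+ x. \<integral>\<^sup>+ y. ennreal (cmod (F x y)) \<partial>lborel \<partial>lborel)"
    by (subst lborel.nn_integral_fst[symmetric]) (use m' in auto)
  then have int: "integrable (lborel \<Otimes>\<^sub>M lborel) (\<lambda>(x, y). F x y)"
    using m' fin by (simp add: integrable_iff_bounded)
  show "(LINT x|lborel. LINT y|lborel. F x y) = (LINT y|lborel. LINT x|lborel. F x y)"
    using lborel_pair.Fubini_integral[OF int] by simp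
qed

lemma tensor_finite:
  fixes f g :: func
  assumes f: "integrable lborel f" and g: "integrable lborel g"
    and le: "\<And>x y. cmod (F x y) \<le> cmod (f x) * cmod (g y)"
  shows "(\<integral>\<^sup>+ x. \<integral>\<^sup>+ y. ennreal (cmod (F x y)) \<partial>lborel \<partial>lborel) < \<infinity>"
proof -
  have [measurable]: "f \<in> borel_measurable borel" "g \<in> borel_measurable borel"
    using borel_measurable_integrable[OF f] borel_measurable_integrable[OF g] by simp_all
  have "(\<integral>\<^sup>+ x. \<integral>\<^sup>+ y. ennreal (cmod (F x y)) \<partial>lborel \<partial>lborel) \<le>
      (\<integral>\<^sup>+ x. \<integral>\<^sup>+ y. ennreal (cmod (f x)) * ennreal (cmod (g y)) \<partial>lborel \<partial>lborel)"
    by (intro nn_integral_mono) (simp add: le ennreal_mult'[symmetric] ennreal_leI)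
  also have "\<dots> = (\<integral>\<^sup>+ x. ennreal (cmod (f x)) \<partial>lborel) * (\<integral>\<^sup>+ y. ennreal (cmod (g y)) \<partial>lborel)"
    by (simp add: nn_integral_cmult nn_integral_multc)
  also have "\<dots> < \<infinity>" using f g by (simp add: integrable_iff_bounded ennreal_mult_less_top)
  finally show ?thesis .
qed

text \<open>Fubini and the symmetry of \<open>chi\<close>. Plancherel's theorem, inversion and the
  product formula all start from here.\<close>

lemma ft1_multiplication:
  assumes f: "integrable lborel f" and g: "integrable lborel g"
  shows "(LINT z|lborel. ft1 f z * g z) = (LINT z|lborel. f z * ft1 g z)"
proof -
  have [measurable]: "f \<in> borel_measurable borel" "g \<in> borel_measurable borel"
    using borel_measurable_integrable[OF f] borel_measurable_integrable[OF g] by simp_all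
  let ?c = "complex_of_real (1 / (2 * pi))"
  have "(LINT z|lborel. ft1 f z * g z) = (LINT z|lborel. LINT y|lborel. ?c * (chi y z * f y * g z))"
  proof (rule Bochner_Integration.integral_cong[OF refl])
    fix z
    have "(LINT y|lborel. ?c * (chi y z * f y * g z)) = (LINT y|lborel. (chi y z * f y) * (?c * g z))"
      by (simp only: ac_simps)
    also have "\<dots> = (LINT y|lborel. chi y z * f y) * (?c * g z)" by (rule integral_mult_left_zero)
    finally show "ft1 f z * g z = (LINT y|lborel. ?c * (chi y z * f y * g z))"
      by (simp only: ft1_def ac_simps)
  qed
  also have "\<dots> = (LINT y|lborel. LINT z|lborel. ?c * (chi y z * f y * g z))"
  proof (intro Fubini_swap tensor_finite[OF g f])
    fix z y
    have "cmod ?c \<le> 1" using pi_gt3 by (simp add: norm_divide norm_mult)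
    from mult_right_mono[OF this, of "cmod (g z) * cmod (f y)",
      OF mult_nonneg_nonneg[OF norm_ge_zero norm_ge_zero]]
    show "cmod (?c * (chi y z * f y * g z)) \<le> cmod (g z) * cmod (f y)"
      by (simp only: norm_mult norm_chi mult_1 ac_simps)
  qed simp
  also have "\<dots> = (LINT y|lborel. f y * ft1 g y)"
  proof (rule Bochner_Integration.integral_cong[OF refl])
    fix y
    have "(LINT z|lborel. ?c * (chi y z * f y * g z)) = (LINT z|lborel. (?c * f y) * (chi z y * g z))"
      by (simp add: mult_ac chi_commute)
    also have "\<dots> = ?c * f y * (LINT z|lborel. chi z y * g z)" by (rule integral_mult_right_zero)
    finally show "(LINT z|lborel. ?c * (chi y z * f y * g z)) = f y * ft1 g y"
      by (simp add: ft1_def)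
  qed
  finally show ?thesis .
qed

section \<open>Scaling, and the transform of a Gaussian\<close>

lemma integral_scale:
  fixes f :: "plane \<Rightarrow> complex"
  assumes [measurable]: "f \<in> borel_measurable borel" and a: "a > 0"
  shows "(LINT z|lborel. f z) = of_real (a\<^sup>2) * (LINT z|lborel. f (t + a *\<^sub>R z))"
proof -
  have "(LINT z|lborel. f z) = (LINT z|density (distr lborel borel (\<lambda>z. t + a *\<^sub>R z)) (\<lambda>_. ennreal (\<bar>a\<bar>^DIM(plane))). f z)"
    by (subst lborel_affine[of a t]) (use a in auto)
  also have "\<dots> = (LINT z|distr lborel borel (\<lambda>z. t + a *\<^sub>R z). (\<bar>a\<bar>^DIM(plane)) *\<^sub>R f z)"
    by (rule integral_density) auto
  also have "\<dots> = (LINT z|lborel. (\<bar>a\<bar>^DIM(plane)) *\<^sub>R f (t + a *\<^sub>R z))"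
    by (rule integral_distr) auto
  also have "\<dots> = of_real (a\<^sup>2) * (LINT z|lborel. f (t + a *\<^sub>R z))"
    by (simp add: scaleR_conv_of_real power2_eq_square)
  finally show ?thesis .
qed

lemma borel_measurable_fst_snd [measurable]:
  fixes f :: "'a \<Rightarrow> plane"
  assumes "f \<in> borel_measurable M"
  shows "(\<lambda>x. fst (f x)) \<in> borel_measurable M" "(\<lambda>x. snd (f x)) \<in> borel_measurable M"
  by (rule measurable_compose[OF assms], rule borel_measurable_continuous_onI, intro continuous_intros)+

text \<open>The product form lets the transform factor into two copies of the characteristic
  function of the standard normal distribution.\<close>

definition gauss :: "plane \<Rightarrow> real" where
  "gauss z = std_normal_density (fst z) * std_normal_density (snd z)"

lemma gauss_measurable [measurable]: "gauss \<in> borel_measurable borel"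
  unfolding gauss_def[abs_def] by measurable

lemma gauss_nonneg [simp]: "0 \<le> gauss z"
  unfolding gauss_def by simp

lemma gauss_eq: "gauss z = exp (- (norm z)\<^sup>2 / 2) / (2 * pi)"
proof -
  have "gauss z = exp (- (fst z)\<^sup>2 / 2) * exp (- (snd z)\<^sup>2 / 2) / (sqrt (2 * pi) * sqrt (2 * pi))"
    by (simp add: gauss_def std_normal_density_def)
  also have "exp (- (fst z)\<^sup>2 / 2) * exp (- (snd z)\<^sup>2 / 2) = exp (- (norm z)\<^sup>2 / 2)"
    by (simp add: exp_add[symmetric] norm_prod_def add_divide_distrib)
  finally show ?thesis by simp
qed

lemma nn_integral_gauss: "(\<integral>\<^sup>+ z. ennreal (gauss z) \<partial>lborel) = 1"
proof -
  interpret N: prob_space "density lborel std_normal_density" by (rule prob_space_normal_density) simp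
  have 1: "(\<integral>\<^sup>+ x. ennreal (std_normal_density x) \<partial>lborel) = 1"
    using N.emeasure_space_1 by (simp add: emeasure_density)
  have "(\<integral>\<^sup>+ z. ennreal (gauss z) \<partial>lborel) =
      (\<integral>\<^sup>+ z. ennreal (gauss z) \<partial>(lborel \<Otimes>\<^sub>M lborel))" by (simp only: lborel_prod)
  also have "\<dots> = (\<integral>\<^sup>+ x. \<integral>\<^sup>+ y. ennreal (gauss (x, y)) \<partial>lborel \<partial>lborel)"
    by (rule lborel.nn_integral_fst[symmetric]) (simp add: lborel_prod)
  also have "\<dots> = 1"
    by (simp add: gauss_def ennreal_mult' nn_integral_cmult 1)
  finally show ?thesis .
qed

lemma integrable_gauss: "integrable lborel gauss"
  using nn_integral_gauss by (simp add: integrable_iff_bounded)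

lemma integral_gauss: "(LINT z|lborel. gauss z) = 1"
  using nn_integral_gauss by (simp add: integral_eq_nn_integral)

lemma gauss_chi: "(LINT \<zeta>|lborel. chi w \<zeta> * gauss \<zeta>) = exp (- (norm w)\<^sup>2 / 2)"
proof -
  have one: "(LINT x|lborel. exp (- \<i> * complex_of_real (t * x)) * std_normal_density x) = exp (- t\<^sup>2 / 2)" for t
  proof -
    have "char std_normal_distribution (- t) =
        (LINT x|lborel. std_normal_density x *\<^sub>R exp (\<i> * complex_of_real (- t * x)))"
      unfolding char_def by (rule integral_density) auto
    then show ?thesis
      by (simp add: char_std_normal_distribution scaleR_conv_of_real mult.commute)
  qed
  let ?F = "\<lambda>\<zeta>. chi w \<zeta> * complex_of_real (gauss \<zeta>)"
  have int: "integrable lborel ?F"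
    using integrable_gauss by (intro integrable_chi_mult) simp
  then have "integrable (lborel \<Otimes>\<^sub>M lborel) ?F" by (simp only: lborel_prod)
  from lborel_pair.integral_fst'[OF this]
  have "(LINT \<zeta>|lborel. ?F \<zeta>) = (LINT x|lborel. LINT y|lborel. ?F (x, y))"
    by (simp only: lborel_prod)
  also have "\<dots> = (LINT x|lborel. LINT y|lborel.
      (exp (- \<i> * complex_of_real (fst w * x)) * std_normal_density x) *
      (exp (- \<i> * complex_of_real (snd w * y)) * std_normal_density y))"
    by (simp add: chi_def gauss_def inner_prod_def exp_add[symmetric] algebra_simps
        exp_diff exp_minus divide_inverse)
  also have "\<dots> = complex_of_real (exp (- (fst w)\<^sup>2 / 2)) * complex_of_real (exp (- (snd w)\<^sup>2 / 2))"
    by (simp only: integral_mult_right_zero integral_mult_left_zero one)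
  also have "\<dots> = exp (- (norm w)\<^sup>2 / 2)"
    by (simp add: of_real_mult[symmetric] exp_add[symmetric] norm_prod_def add_divide_distrib del: of_real_mult)
  finally show ?thesis .
qed

lemma nn_integral_scale:
  fixes f :: "plane \<Rightarrow> ennreal"
  assumes [measurable]: "f \<in> borel_measurable borel" and a: "a > 0"
  shows "(\<integral>\<^sup>+ z. f z \<partial>lborel) = ennreal (a\<^sup>2) * (\<integral>\<^sup>+ z. f (t + a *\<^sub>R z) \<partial>lborel)"
  by (subst lborel_affine[of a t])
     (use a in \<open>auto simp: nn_integral_density nn_integral_distr nn_integral_cmult ennreal_power power2_eq_square ennreal_mult'\<close>)

text \<open>Left unnormalised: as \<open>a\<close> tends to 0 it tends to 1 pointwise, while its
  transform is a multiple of the Gaussian of width \<open>a\<close> and concentrates at the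
  origin.\<close>

definition gk :: "real \<Rightarrow> plane \<Rightarrow> real" where
  "gk a \<zeta> = exp (- (a * norm \<zeta>)\<^sup>2 / 2)"

lemma gk_gauss: "gk a \<zeta> = 2 * pi * gauss (a *\<^sub>R \<zeta>)"
  by (simp add: gk_def gauss_eq power_mult_distrib)

lemma gk_measurable [measurable]: "gk a \<in> borel_measurable borel"
  unfolding gk_def[abs_def] by measurable

lemma nn_integral_gk: "a > 0 \<Longrightarrow> (\<integral>\<^sup>+ z. ennreal (gk a z) \<partial>lborel) < \<infinity>"
proof -
  assume a: "a > 0"
  have "1 = ennreal (a\<^sup>2) * (\<integral>\<^sup>+ z. ennreal (gauss (a *\<^sub>R z)) \<partial>lborel)"
    using nn_integral_scale[of "\<lambda>z. ennreal (gauss z)" a 0] a nn_integral_gauss by simp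
  then have "(\<integral>\<^sup>+ z. ennreal (gauss (a *\<^sub>R z)) \<partial>lborel) \<noteq> \<infinity>"
    using a by (auto simp: ennreal_mult_eq_top_iff)
  moreover have "(\<integral>\<^sup>+ z. ennreal (gk a z) \<partial>lborel) = ennreal (2 * pi) * (\<integral>\<^sup>+ z. ennreal (gauss (a *\<^sub>R z)) \<partial>lborel)"
    by (simp add: gk_gauss ennreal_mult' nn_integral_cmult)
  ultimately show ?thesis by (simp add: ennreal_mult_less_top less_top)
qed

lemma integrable_gk: "a > 0 \<Longrightarrow> integrable lborel (\<lambda>z. complex_of_real (gk a z))"
  using nn_integral_gk[of a] by (simp add: integrable_iff_bounded gk_def)

lemma ft1_gk:
  assumes a: "a > 0"
  shows "ft1 (\<lambda>z. of_real (gk a z)) w = of_real (2 * pi / a\<^sup>2 * gauss ((1 / a) *\<^sub>R w))"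
proof -
  have "(LINT \<zeta>|lborel. chi \<zeta> w * of_real (gk a \<zeta>)) =
      of_real ((1 / a)\<^sup>2) * (LINT \<zeta>|lborel. chi ((1 / a) *\<^sub>R \<zeta>) w * of_real (gk a ((1 / a) *\<^sub>R \<zeta>)))"
    using integral_scale[of "\<lambda>\<zeta>. chi \<zeta> w * of_real (gk a \<zeta>)" "1 / a" 0] a by simp
  also have "(LINT \<zeta>|lborel. chi ((1 / a) *\<^sub>R \<zeta>) w * of_real (gk a ((1 / a) *\<^sub>R \<zeta>))) =
      (LINT \<zeta>|lborel. of_real (2 * pi) * (chi ((1 / a) *\<^sub>R w) \<zeta> * of_real (gauss \<zeta>)))"
    using a by (simp add: gk_gauss chi_def inner_commute mult_ac)
  also have "\<dots> = of_real (2 * pi) * of_real (exp (- (norm ((1 / a) *\<^sub>R w))\<^sup>2 / 2))"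
    by (simp only: integral_mult_right_zero gauss_chi)
  finally show ?thesis
    using a by (simp add: ft1_def gauss_eq power_divide)
qed

lemma ft1_cnj_reflect:
  assumes f: "integrable lborel f"
  shows "ft1 (\<lambda>y. cnj (f (- y))) \<zeta> = cnj (ft1 f \<zeta>)"
proof -
  have [measurable]: "f \<in> borel_measurable borel" using borel_measurable_integrable[OF f] by simp
  have "(LINT y|lborel. chi y \<zeta> * cnj (f (- y))) = (LINT y|lborel. chi (- y) \<zeta> * cnj (f y))"
    using integral_reflect[of "\<lambda>y. chi (- y) \<zeta> * cnj (f y)" 0] by simp
  also have "\<dots> = (LINT y|lborel. cnj (chi y \<zeta> * f y))" by (simp add: chi_minus)
  also have "\<dots> = cnj (LINT y|lborel. chi y \<zeta> * f y)" by (rule Bochner_Integration.integral_cnj)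
  finally show ?thesis by (simp add: ft1_def)
qed

lemma integrable_reflect:
  fixes f :: func
  assumes "integrable lborel f"
  shows "integrable lborel (\<lambda>z. f (- z))"
proof -
  have [measurable]: "f \<in> borel_measurable borel" using borel_measurable_integrable[OF assms] by simp
  show ?thesis using assms nn_integral_reflect[of "\<lambda>z. ennreal (cmod (f z))" 0]
    by (simp add: integrable_iff_bounded)
qed

text \<open>Against a Gaussian the energy of the transform becomes a Gaussian average of autocorrelations of
  \<open>f\<close>; as the Gaussian widens, translation continuity turns the average into the energy of \<open>f\<close>.\<close>

lemma plancherel_gauss:
  assumes f: "f \<in> pts L2" "integrable lborel f" and a: "a > 0"
  shows "(LINT \<zeta>|lborel. of_real (gk a \<zeta>) * (ft1 f \<zeta> * cnj (ft1 f \<zeta>))) =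
    (LINT z|lborel. of_real (gauss z) * ip (\<lambda>y. f (y + a *\<^sub>R z)) f)"
proof -
  note [measurable] = L2_measurable[OF f(1)]
  let ?k = "\<lambda>\<zeta>. complex_of_real (gk a \<zeta>)"
  \<comment> \<open>Its transform is the conjugate of \<open>ft1 f\<close>, so the squared modulus
    of \<open>ft1 f\<close> becomes a product of two transforms, and the multiplication formula can
    be applied to each in turn.\<close>
  let ?fb = "\<lambda>y. cnj (f (- y))"
  note ik = integrable_gk[OF a]
  have ifb: "integrable lborel ?fb" using integrable_reflect[OF f(2)] by simp
  have ikf: "integrable lborel (\<lambda>\<zeta>. ?k \<zeta> * ft1 f \<zeta>)"
    by (rule Bochner_Integration.integrable_bound[OF integrable_mult_left[OF ik, of "complex_of_real (LINT z|lborel. cmod (f z))"]])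
       (auto simp: norm_mult gk_def intro!: mult_left_mono ft1_bound order_trans[OF _ abs_ge_self])
  have inner: "ft1 (\<lambda>\<zeta>. ?k \<zeta> * ft1 f \<zeta>) y = (LINT z|lborel. f (- y + a *\<^sub>R z) * of_real (gauss z))" for y
  proof -
    \<comment> \<open>Multiplication by \<open>chi y\<close> translates the transform, which becomes
      a Gaussian of width \<open>a\<close> centred at \<open>- y\<close>.\<close>
    have sh: "ft1 (\<lambda>\<zeta>. chi y \<zeta> * ?k \<zeta>) z = of_real (2 * pi / a\<^sup>2 * gauss ((1 / a) *\<^sub>R (y + z)))" for z
    proof -
      have "ft1 (\<lambda>\<zeta>. chi y \<zeta> * ?k \<zeta>) z = ft1 ?k (y + z)"
        by (simp add: ft1_def chi_commute[of y] chi_add mult_ac)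
      then show ?thesis by (simp only: ft1_gk[OF a])
    qed
    have "(LINT \<zeta>|lborel. chi \<zeta> y * (?k \<zeta> * ft1 f \<zeta>)) = (LINT \<zeta>|lborel. ft1 f \<zeta> * (chi y \<zeta> * ?k \<zeta>))"
      by (simp add: chi_commute[of y] mult_ac)
    also have "\<dots> = (LINT z|lborel. f z * ft1 (\<lambda>\<zeta>. chi y \<zeta> * ?k \<zeta>) z)"
      by (rule ft1_multiplication[OF f(2) integrable_chi_mult(2)[OF ik]])
    also have "\<dots> = (LINT z|lborel. of_real (2 * pi / a\<^sup>2) * (f z * of_real (gauss ((1 / a) *\<^sub>R (y + z)))))"
      by (simp only: sh of_real_mult ac_simps)
    also have "\<dots> = of_real (2 * pi / a\<^sup>2) * (LINT z|lborel. f z * of_real (gauss ((1 / a) *\<^sub>R (y + z))))"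
      by (rule integral_mult_right_zero)
    also have "(LINT z|lborel. f z * of_real (gauss ((1 / a) *\<^sub>R (y + z)))) =
        of_real (a\<^sup>2) * (LINT z|lborel. f (- y + a *\<^sub>R z) * of_real (gauss z))"
      using integral_scale[of "\<lambda>z. f z * of_real (gauss ((1 / a) *\<^sub>R (y + z)))" a "- y"] a by simp
    finally show ?thesis using a by (simp add: ft1_def)
  qed
  have "(LINT \<zeta>|lborel. ?k \<zeta> * (ft1 f \<zeta> * cnj (ft1 f \<zeta>))) = (LINT \<zeta>|lborel. ft1 ?fb \<zeta> * (?k \<zeta> * ft1 f \<zeta>))"
    by (simp add: ft1_cnj_reflect[OF f(2)] mult_ac)
  also have "\<dots> = (LINT y|lborel. ?fb y * ft1 (\<lambda>\<zeta>. ?k \<zeta> * ft1 f \<zeta>) y)"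
    by (rule ft1_multiplication[OF ifb ikf])
  also have "\<dots> = (LINT y|lborel. cnj (f (- y)) * (LINT z|lborel. f (- y + a *\<^sub>R z) * of_real (gauss z)))"
    by (simp only: inner)
  also have "\<dots> = (LINT y|lborel. cnj (f y) * (LINT z|lborel. f (y + a *\<^sub>R z) * of_real (gauss z)))"
    using integral_reflect[of "\<lambda>y. cnj (f y) * (LINT z|lborel. f (y + a *\<^sub>R z) * of_real (gauss z))" 0] by simp
  also have "\<dots> = (LINT y|lborel. LINT z|lborel. of_real (gauss z) * (f (y + a *\<^sub>R z) * cnj (f y)))"
    by (subst integral_mult_right_zero[symmetric]) (simp only: ac_simps)
  also have "\<dots> = (LINT z|lborel. LINT y|lborel. of_real (gauss z) * (f (y + a *\<^sub>R z) * cnj (f y)))"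
  proof (rule Fubini_swap[symmetric])
    have "(\<integral>\<^sup>+ z. \<integral>\<^sup>+ y. ennreal (cmod (of_real (gauss z) * (f (y + a *\<^sub>R z) * cnj (f y)))) \<partial>lborel \<partial>lborel) =
        (\<integral>\<^sup>+ z. ennreal (gauss z) * (\<integral>\<^sup>+ y. ennreal (cmod (f (y + a *\<^sub>R z)) * cmod (f y)) \<partial>lborel) \<partial>lborel)"
      by (subst nn_integral_cmult[symmetric]) (auto simp: norm_mult ennreal_mult')
    also have "\<dots> \<le> (\<integral>\<^sup>+ z. ennreal (gauss z) * ennreal (n2 f * n2 f) \<partial>lborel)"
    proof (intro nn_integral_mono mult_left_mono)
      fix z
      show "(\<integral>\<^sup>+ y. ennreal (cmod (f (y + a *\<^sub>R z)) * cmod (f y)) \<partial>lborel) \<le> ennreal (n2 f * n2 f)"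
        using L2_CS_nn[OF L2_translate(1)[OF f(1), of "- a *\<^sub>R z"] f(1)] L2_translate(2)[OF f(1), of "- a *\<^sub>R z"]
        by simp
    qed simp
    also have "\<dots> = ennreal (n2 f * n2 f)" by (simp add: nn_integral_multc nn_integral_gauss)
    finally show "(\<integral>\<^sup>+ z. \<integral>\<^sup>+ y. ennreal (cmod (of_real (gauss z) * (f (y + a *\<^sub>R z) * cnj (f y)))) \<partial>lborel \<partial>lborel) < \<infinity>"
      by (rule le_less_trans) simp
  qed measurable
  also have "\<dots> = (LINT z|lborel. of_real (gauss z) * ip (\<lambda>y. f (y + a *\<^sub>R z)) f)"
    unfolding ip_def by (simp only: integral_mult_right_zero)
  finally show ?thesis .
qed

lemma plancherel_L1_L2:
  assumes f: "f \<in> pts L2" "integrable lborel f"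
  shows "ft1 f \<in> pts L2" "n2 (ft1 f) = n2 f"
proof -
  note [measurable] = L2_measurable[OF f(1)]
  define a where "a n = 1 / real (Suc n)" for n
  have a: "a n > 0" for n by (simp add: a_def)
  have a0: "a \<longlonglongrightarrow> 0" unfolding a_def[abs_def] by (rule LIMSEQ_Suc[OF lim_1_over_n])
  \<comment> \<open>The factor is the square root of \<open>gk (a n)\<close>, whence the 4; the
    squared norm of \<open>F n\<close> is then the Gaussian energy of
    \<open>plancherel_gauss\<close>.\<close>
  define F where "F n \<zeta> = complex_of_real (exp (- (a n * norm \<zeta>)\<^sup>2 / 4)) * ft1 f \<zeta>" for n \<zeta>
  have [measurable]: "F n \<in> borel_measurable borel" for n unfolding F_def[abs_def] by measurable
  have sq: "(exp (- (a n * norm \<zeta>)\<^sup>2 / 4))\<^sup>2 = gk (a n) \<zeta>" for n \<zeta>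
    by (simp add: gk_def power2_eq_square exp_add[symmetric])
  let ?M = "LINT z|lborel. cmod (f z)"
  have FL: "F n \<in> pts L2" for n
  proof -
    have "l2_sq (F n) \<le> (\<integral>\<^sup>+ \<zeta>. ennreal (?M\<^sup>2) * ennreal (gk (a n) \<zeta>) \<partial>lborel)"
      unfolding l2_sq_def
    proof (rule nn_integral_mono)
      fix \<zeta>
      have "(cmod (F n \<zeta>))\<^sup>2 = gk (a n) \<zeta> * (cmod (ft1 f \<zeta>))\<^sup>2"
        unfolding sq[symmetric] F_def norm_mult by (simp only: power_mult_distrib norm_of_real power2_abs)
      also have "\<dots> \<le> gk (a n) \<zeta> * ?M\<^sup>2"
        by (intro mult_left_mono power_mono ft1_bound) (auto simp: gk_def)
      finally show "ennreal ((cmod (F n \<zeta>))\<^sup>2) \<le> ennreal (?M\<^sup>2) * ennreal (gk (a n) \<zeta>)"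
        by (subst ennreal_mult'[symmetric]) (auto intro!: ennreal_leI simp: mult.commute)
    qed
    also have "\<dots> < \<infinity>" using nn_integral_gk[OF a] by (simp add: nn_integral_cmult ennreal_mult_less_top)
    finally show ?thesis by (simp add: L2_iff)
  qed
  let ?P = "\<lambda>n z. ip (\<lambda>y. f (y + a n *\<^sub>R z)) f"
  have tr: "(\<lambda>y. f (y + a n *\<^sub>R z)) \<in> pts L2" "n2 (\<lambda>y. f (y + a n *\<^sub>R z)) = n2 f" for n z
    using L2_translate[OF f(1), of "- (a n *\<^sub>R z)"] by simp_all
  have J: "of_real ((n2 (F n))\<^sup>2) = (LINT z|lborel. of_real (gauss z) * ?P n z)" for n
  proof -
    have "of_real ((n2 (F n))\<^sup>2) = ip (F n) (F n)" by (simp only: ip_self(1)[OF FL])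
    also have "\<dots> = (LINT \<zeta>|lborel. of_real (gk (a n) \<zeta>) * (ft1 f \<zeta> * cnj (ft1 f \<zeta>)))"
      unfolding ip_def
    proof (rule Bochner_Integration.integral_cong[OF refl])
      fix \<zeta> show "F n \<zeta> * cnj (F n \<zeta>) = of_real (gk (a n) \<zeta>) * (ft1 f \<zeta> * cnj (ft1 f \<zeta>))"
        unfolding sq[symmetric] F_def by (simp add: power2_eq_square mult_ac)
    qed
    finally show ?thesis by (simp only: plancherel_gauss[OF f a])
  qed
  have Pbd: "cmod (?P n z) \<le> (n2 f)\<^sup>2" for n z
    using L2_integrable(6)[OF tr(1)[of n z] f(1)] by (simp add: tr power2_eq_square)
  have lim: "(\<lambda>n. LINT z|lborel. of_real (gauss z) * ?P n z) \<longlonglongrightarrow> (LINT z|lborel. of_real (gauss z) * of_real ((n2 f)\<^sup>2))"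
  proof (rule integral_dominated_convergence)
    show "(\<lambda>z. complex_of_real (gauss z) * ?P n z) \<in> borel_measurable lborel" for n
      unfolding ip_def by measurable
    show "integrable lborel (\<lambda>z. gauss z * (n2 f)\<^sup>2)" using integrable_gauss by simp
    show "AE z in lborel. norm (complex_of_real (gauss z) * ?P n z) \<le> gauss z * (n2 f)\<^sup>2" for n
      by (rule AE_I2) (auto simp: norm_mult intro!: mult_left_mono Pbd)
    show "AE z in lborel. (\<lambda>n. complex_of_real (gauss z) * ?P n z) \<longlonglongrightarrow> of_real (gauss z) * of_real ((n2 f)\<^sup>2)"
    proof (rule AE_I2)
      fix z :: plane
      have h: "(\<lambda>n. - (a n *\<^sub>R z)) \<longlonglongrightarrow> 0" using tendsto_minus[OF tendsto_scaleR[OF a0 tendsto_const[of z]]] by simp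
      have lim0: "(\<lambda>n. n2 (\<lambda>y. f (y + a n *\<^sub>R z) - f y) * n2 f) \<longlonglongrightarrow> 0"
        using tendsto_mult_left_zero[OF L2_translation_continuous[OF f(1) h]] by simp
      have bd0: "norm (?P n z - of_real ((n2 f)\<^sup>2)) \<le> n2 (\<lambda>y. f (y + a n *\<^sub>R z) - f y) * n2 f" for n
        using L2_integrable(6)[OF L2_diff(1)[OF tr(1)[of n z] f(1)] f(1)]
        by (simp only: ip_diff_left[OF tr(1) f(1) f(1)] ip_self(1)[OF f(1)])
      have "(\<lambda>n. ?P n z - of_real ((n2 f)\<^sup>2)) \<longlonglongrightarrow> 0"
        by (rule Lim_null_comparison[OF always_eventually[OF allI[OF bd0]] lim0])
      then have "(\<lambda>n. ?P n z) \<longlonglongrightarrow> of_real ((n2 f)\<^sup>2)" by (simp only: Lim_null[symmetric])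
      then show "(\<lambda>n. complex_of_real (gauss z) * ?P n z) \<longlonglongrightarrow> of_real (gauss z) * of_real ((n2 f)\<^sup>2)"
        by (intro tendsto_intros)
    qed
  qed measurable
  have "(LINT z|lborel. complex_of_real (gauss z) * of_real ((n2 f)\<^sup>2)) = of_real ((n2 f)\<^sup>2)"
    by (simp add: integral_gauss)
  with lim have "(\<lambda>n. complex_of_real ((n2 (F n))\<^sup>2)) \<longlonglongrightarrow> of_real ((n2 f)\<^sup>2)" by (simp only: J)
  then have nF: "(\<lambda>n. (n2 (F n))\<^sup>2) \<longlonglongrightarrow> (n2 f)\<^sup>2" by (simp only: tendsto_of_real_iff)
  have F_le: "n2 (F n) \<le> n2 f" for n
  proof (rule power2_le_imp_le)
    have "(n2 (F n))\<^sup>2 = cmod (of_real ((n2 (F n))\<^sup>2))" by (simp only: norm_of_real abs_power2)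
    also have "\<dots> \<le> (LINT z|lborel. norm (complex_of_real (gauss z) * ?P n z))"
      unfolding J by (rule integral_norm_bound)
    also have "\<dots> \<le> (LINT z|lborel. gauss z * (n2 f)\<^sup>2)"
      using integrable_gauss Pbd by (intro integral_mono') (auto simp: norm_mult intro!: mult_left_mono)
    finally show "(n2 (F n))\<^sup>2 \<le> (n2 f)\<^sup>2" by (simp add: integral_gauss)
  qed simp
  have Flim: "(\<lambda>n. F n \<zeta>) \<longlonglongrightarrow> ft1 f \<zeta>" for \<zeta>
  proof -
    have "(\<lambda>n. complex_of_real (exp (- (a n * norm \<zeta>)\<^sup>2 / 4)) * ft1 f \<zeta>) \<longlonglongrightarrow>
        complex_of_real (exp (- (0 * norm \<zeta>)\<^sup>2 / 4)) * ft1 f \<zeta>"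
      by (intro tendsto_intros a0) simp
    then show ?thesis by (simp add: F_def)
  qed
  \<comment> \<open>Membership has to come first, by Fatou; only then can \<open>ft1 f\<close>
    itself dominate the \<open>F n\<close>, so that their norms converge to its norm.\<close>
  show L: "ft1 f \<in> pts L2" by (rule L2_Fatou(1)[OF FL F_le AE_I2[OF Flim]]) measurable
  have dlim: "(\<lambda>n. n2 (\<lambda>z. F n z - ft1 f z)) \<longlonglongrightarrow> 0"
  proof (rule L2_dominated[where c=1, OF _ _ L])
    show "AE z in lborel. cmod (F n z) \<le> 1 * cmod (ft1 f z)" for n
      by (rule AE_I2) (auto simp: F_def norm_mult intro!: mult_left_le_one_le)
  qed (auto simp: Flim)
  have "norm (n2 (F n) - n2 (ft1 f)) \<le> n2 (\<lambda>z. F n z - ft1 f z)" for n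
    using n2_abs_diff[OF FL L] by simp
  from Lim_null_comparison[OF always_eventually[OF allI[OF this]] dlim]
  have "(\<lambda>n. n2 (F n)) \<longlonglongrightarrow> n2 (ft1 f)" by (simp only: Lim_null[symmetric])
  from tendsto_power[OF this, of 2] nF have "(n2 (ft1 f))\<^sup>2 = (n2 f)\<^sup>2" by (rule LIMSEQ_unique)
  then show "n2 (ft1 f) = n2 f" by simp
qed

subsection \<open>The Fourier transform of square integrable functions\<close>

lemma n2_squeeze:
  assumes "\<And>n. n2 (F n) \<le> b n" "b \<longlonglongrightarrow> 0"
  shows "(\<lambda>n. n2 (F n)) \<longlonglongrightarrow> 0"
  by (rule tendsto_sandwich[OF _ _ tendsto_const assms(2)]) (simp_all add: assms(1))

lemma cball_borel [measurable]: "cball (a::plane) r \<in> sets borel"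
  by simp

definition trunc :: "real \<Rightarrow> func \<Rightarrow> func" where
  "trunc R f z = indicator (cball 0 R) z * f z"

lemma fourier_trunc_eq: "fourier_trunc R f = ft1 (trunc R f)"
  unfolding fourier_trunc_def ft1_def trunc_def chi_def set_lebesgue_integral_def
  by (auto intro!: ext Bochner_Integration.integral_cong simp: indicator_def)

lemma trunc_L2:
  assumes f: "f \<in> pts L2"
  shows "trunc R f \<in> pts L2" "integrable lborel (trunc R f)"
proof -
  note [measurable] = L2_measurable[OF f]
  show "trunc R f \<in> pts L2"
    by (rule L2_dom(1)[of _ f 1, OF _ f]) (auto simp: trunc_def[abs_def] norm_mult indicator_def)
  have "emeasure lborel (cball (0::plane) R) < \<infinity>"
    using emeasure_bounded_finite[OF bounded_cball] by (simp add: less_top)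
  then have "indicator (cball 0 R) \<in> pts L2" by (auto simp: L2_iff l2_sq_indicator intro!: borel_measurable_indicator)
  from L2_integrable(1)[OF this f] show "integrable lborel (trunc R f)"
    by (simp add: trunc_def[abs_def])
qed

lemma trunc_tendsto:
  assumes f: "f \<in> pts L2" and rs: "filterlim rs at_top sequentially"
  shows "(\<lambda>n. n2 (\<lambda>z. trunc (rs n) f z - f z)) \<longlonglongrightarrow> 0"
proof (rule L2_dominated[where c=1, OF L2_measurable[OF trunc_L2(1)[OF f]] L2_measurable[OF f] f])
  show "AE z in lborel. cmod (trunc (rs n) f z) \<le> 1 * cmod (f z)" for n
    by (rule AE_I2) (simp add: trunc_def norm_mult indicator_def)
  show "AE z in lborel. (\<lambda>n. trunc (rs n) f z) \<longlonglongrightarrow> f z"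
  proof (rule AE_I2)
    fix z :: plane
    from rs have "eventually (\<lambda>n. norm z \<le> rs n) sequentially"
      by (simp add: filterlim_at_top)
    then have "eventually (\<lambda>n. trunc (rs n) f z = f z) sequentially"
      by eventually_elim (simp add: trunc_def)
    then show "(\<lambda>n. trunc (rs n) f z) \<longlonglongrightarrow> f z" by (rule tendsto_eventually)
  qed
qed

lemma ft1_isometry_diff:
  assumes "f \<in> pts L2" "integrable lborel f" "g \<in> pts L2" "integrable lborel g"
  shows "n2 (\<lambda>z. ft1 f z - ft1 g z) = n2 (\<lambda>z. f z - g z)"
proof -
  have "(\<lambda>z. ft1 f z - ft1 g z) = ft1 (\<lambda>z. f z - g z)" using assms by (auto simp: ft1_diff)
  then show ?thesis
    using plancherel_L1_L2(2)[OF L2_diff(1)[OF assms(1,3)]] assms by simp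
qed

text \<open>This makes the choice in \<open>fourier\<close> sound. The truncations are integrable,
  so by the isometry on integrable functions their transforms form a Cauchy sequence; the limit
  along the reals is reduced to sequences.\<close>

lemma fourier_exists:
  assumes f: "f \<in> pts L2"
  shows "\<exists>g. g \<in> pts L2 \<and> ((\<lambda>R. l2_sq (\<lambda>\<zeta>. fourier_trunc R f \<zeta> - g \<zeta>)) \<longlongrightarrow> 0) at_top"
proof -
  note t = trunc_L2[OF f]
  have F: "ft1 (trunc R f) \<in> pts L2" for R by (rule plancherel_L1_L2(1)[OF t])
  have le: "n2 (\<lambda>z. ft1 (trunc R f) z - ft1 (trunc R' f) z) \<le>
      n2 (\<lambda>z. trunc R f z - f z) + n2 (\<lambda>z. trunc R' f z - f z)" for R R'
    using n2_triangle[OF t(1) f t(1), of R R'] n2_minus_commute[of f]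
    by (simp add: ft1_isometry_diff t)
  have lim: "(\<lambda>n. n2 (\<lambda>z. trunc (real n) f z - f z)) \<longlonglongrightarrow> 0"
    by (rule trunc_tendsto[OF f filterlim_real_sequentially])
  have "\<exists>g\<in>pts L2. (\<lambda>n. n2 (\<lambda>z. ft1 (trunc (real n) f) z - g z)) \<longlonglongrightarrow> 0"
  proof (rule L2_complete[OF F])
    fix e :: real assume "e > 0"
    then obtain N where N: "\<And>n. n \<ge> N \<Longrightarrow> n2 (\<lambda>z. trunc (real n) f z - f z) < e / 2"
      using LIMSEQ_D[OF lim, of "e / 2"] by auto
    have "n2 (\<lambda>z. ft1 (trunc (real m) f) z - ft1 (trunc (real n) f) z) < e" if "m \<ge> N" "n \<ge> N" for m n
      using le[of "real m" "real n"] N[OF that(1)] N[OF that(2)] by linarith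
    then show "\<exists>N. \<forall>m\<ge>N. \<forall>n\<ge>N. n2 (\<lambda>z. ft1 (trunc (real m) f) z - ft1 (trunc (real n) f) z) < e"
      by blast
  qed
  then obtain g where g: "g \<in> pts L2" "(\<lambda>n. n2 (\<lambda>z. ft1 (trunc (real n) f) z - g z)) \<longlonglongrightarrow> 0" by blast
  have "((\<lambda>R. l2_sq (\<lambda>\<zeta>. fourier_trunc R f \<zeta> - g \<zeta>)) \<longlongrightarrow> 0) at_top"
  proof (rule tendsto_at_topI_sequentially)
    fix rs :: "nat \<Rightarrow> real" assume rs: "filterlim rs at_top sequentially"
    let ?b = "\<lambda>n. n2 (\<lambda>z. trunc (rs n) f z - f z) + n2 (\<lambda>z. trunc (real n) f z - f z) +
      n2 (\<lambda>z. ft1 (trunc (real n) f) z - g z)"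
    have b: "?b \<longlonglongrightarrow> 0" using tendsto_add[OF tendsto_add[OF trunc_tendsto[OF f rs] lim] g(2)] by simp
    have "n2 (\<lambda>z. ft1 (trunc (rs n) f) z - g z) \<le> ?b n" for n
      using n2_triangle[OF F F g(1), of "rs n" "real n"] le[of "rs n" "real n"] by linarith
    then have "(\<lambda>n. n2 (\<lambda>z. ft1 (trunc (rs n) f) z - g z)) \<longlonglongrightarrow> 0"
      by (rule n2_squeeze) (rule b)
    then have "(\<lambda>n. ennreal ((n2 (\<lambda>z. ft1 (trunc (rs n) f) z - g z))\<^sup>2)) \<longlonglongrightarrow> ennreal (0\<^sup>2)"
      by (intro tendsto_intros)
    then show "(\<lambda>n. l2_sq (\<lambda>\<zeta>. fourier_trunc (rs n) f \<zeta> - g \<zeta>)) \<longlonglongrightarrow> 0"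
      by (simp add: fourier_trunc_eq l2_sq_n2[OF L2_diff(1)[OF F g(1)]])
  qed
  with g(1) show ?thesis by blast
qed

lemma fourier_L2:
  assumes f: "f \<in> pts L2"
  shows "fourier f \<in> pts L2" 
    "filterlim rs at_top sequentially \<Longrightarrow> (\<lambda>n. n2 (\<lambda>z. ft1 (trunc (rs n) f) z - fourier f z)) \<longlonglongrightarrow> 0"
proof -
  note s = someI_ex[OF fourier_exists[OF f], folded fourier_def]
  show F: "fourier f \<in> pts L2" using s by blast
  assume rs: "filterlim rs at_top sequentially"
  have "(\<lambda>n. l2_sq (\<lambda>\<zeta>. fourier_trunc (rs n) f \<zeta> - fourier f \<zeta>)) \<longlonglongrightarrow> 0"
    using filterlim_compose[OF conjunct2[OF s] rs] by simp
  then have "(\<lambda>n. enn2real (l2_sq (\<lambda>\<zeta>. fourier_trunc (rs n) f \<zeta> - fourier f \<zeta>))) \<longlonglongrightarrow> enn2real 0"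
    by (intro tendsto_enn2real) auto
  then have "(\<lambda>n. sqrt (enn2real (l2_sq (\<lambda>\<zeta>. fourier_trunc (rs n) f \<zeta> - fourier f \<zeta>)))) \<longlonglongrightarrow> sqrt 0"
    by (intro tendsto_real_sqrt) simp
  then show "(\<lambda>n. n2 (\<lambda>z. ft1 (trunc (rs n) f) z - fourier f z)) \<longlonglongrightarrow> 0"
    by (simp add: n2_eq fourier_trunc_eq)
qed

lemma fourier_measurable: "f \<in> pts L2 \<Longrightarrow> fourier f \<in> borel_measurable borel"
  by (rule L2_measurable[OF fourier_L2(1)])

lemma n2_tendsto:
  assumes "\<And>n. f n \<in> pts L2" "g \<in> pts L2" "(\<lambda>n. n2 (\<lambda>z. f n z - g z)) \<longlonglongrightarrow> 0"
  shows "(\<lambda>n. n2 (f n)) \<longlonglongrightarrow> n2 g"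
proof -
  have "norm (n2 (f n) - n2 g) \<le> n2 (\<lambda>z. f n z - g z)" for n
    using n2_abs_diff[OF assms(1,2)] by simp
  from Lim_null_comparison[OF always_eventually[OF allI[OF this]] assms(3)]
  show ?thesis by (simp only: Lim_null[symmetric])
qed

lemma n2_fourier: 
  assumes f: "f \<in> pts L2"
  shows "n2 (fourier f) = n2 f"
proof -
  note t = trunc_L2[OF f]
  have "(\<lambda>n. n2 (ft1 (trunc (real n) f))) \<longlonglongrightarrow> n2 (fourier f)"
    by (rule n2_tendsto[OF plancherel_L1_L2(1)[OF t] fourier_L2(1)[OF f] fourier_L2(2)[OF f filterlim_real_sequentially]])
  moreover have "(\<lambda>n. n2 (trunc (real n) f)) \<longlonglongrightarrow> n2 f"
    by (rule n2_tendsto[OF t(1) f trunc_tendsto[OF f filterlim_real_sequentially]])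
  ultimately show ?thesis
    by (simp add: plancherel_L1_L2(2)[OF t] LIMSEQ_unique)
qed

lemma n2_diff_0_AE:
  assumes "f \<in> pts L2" "g \<in> pts L2" "n2 (\<lambda>z. f z - g z) \<le> 0"
  shows "AE z in lborel. f z = g z"
proof -
  have "n2 (\<lambda>z. f z - g z) = 0" using assms(3) n2_nonneg[of "\<lambda>z. f z - g z"] by linarith
  then have "AE z in lborel. f z - g z = 0" using n2_eq_0_iff[OF L2_diff(1)[OF assms(1,2)]] by simp
  then show ?thesis by eventually_elim simp
qed

text \<open>The truncations of the definition may be replaced by any approximating sequence of
  integrable functions. The transform of each operation below is found with a sequence adapted to
  that operation.\<close>

lemma fourier_unique:
  assumes f: "f \<in> pts L2" and F: "\<And>n. F n \<in> pts L2" "\<And>n. integrable lborel (F n)"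
    and lim: "(\<lambda>n. n2 (\<lambda>z. F n z - f z)) \<longlonglongrightarrow> 0"
    and g: "g \<in> pts L2" "(\<lambda>n. n2 (\<lambda>z. ft1 (F n) z - g z)) \<longlonglongrightarrow> 0"
  shows "AE z in lborel. fourier f z = g z"
proof (rule n2_diff_0_AE[OF fourier_L2(1)[OF f] g(1)])
  note t = trunc_L2[OF f]
  note rs = filterlim_real_sequentially
  let ?T = "\<lambda>n. trunc (real n) f"
  let ?b = "\<lambda>n. n2 (\<lambda>z. ft1 (?T n) z - fourier f z) + (n2 (\<lambda>z. ?T n z - f z) + n2 (\<lambda>z. F n z - f z)) +
    n2 (\<lambda>z. ft1 (F n) z - g z)"
  have b: "?b \<longlonglongrightarrow> 0"
    using tendsto_add[OF tendsto_add[OF fourier_L2(2)[OF f rs] tendsto_add[OF trunc_tendsto[OF f rs] lim]] g(2)] by simp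
  have "n2 (\<lambda>z. fourier f z - g z) \<le> ?b n" for n
  proof -
    note L = plancherel_L1_L2(1)[OF t, of "real n"] plancherel_L1_L2(1)[OF F, of n]
    have "n2 (\<lambda>z. fourier f z - g z) \<le> n2 (\<lambda>z. fourier f z - ft1 (?T n) z) + n2 (\<lambda>z. ft1 (?T n) z - g z)"
      by (rule n2_triangle[OF fourier_L2(1)[OF f] L(1) g(1)])
    moreover have "n2 (\<lambda>z. ft1 (?T n) z - g z) \<le> n2 (\<lambda>z. ft1 (?T n) z - ft1 (F n) z) + n2 (\<lambda>z. ft1 (F n) z - g z)"
      by (rule n2_triangle[OF L g(1)])
    moreover have "n2 (\<lambda>z. ft1 (?T n) z - ft1 (F n) z) \<le> n2 (\<lambda>z. ?T n z - f z) + n2 (\<lambda>z. F n z - f z)"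
      using n2_triangle[OF t(1) f F(1), of "real n" n] n2_minus_commute[of f "F n"]
      by (simp add: ft1_isometry_diff t F)
    ultimately show ?thesis using n2_minus_commute[of "fourier f" "ft1 (?T n)"] by linarith
  qed
  then show "n2 (\<lambda>z. fourier f z - g z) \<le> 0"
    by (intro LIMSEQ_le_const[OF b]) auto
qed

text \<open>Equality of functions and not only almost everywhere: the truncated integrals agree
  exactly, so both choices are made from the same predicate. Later this permits passing to another
  representative of a solution.\<close>

lemma fourier_cong:
  assumes [measurable]: "f \<in> borel_measurable borel" "g \<in> borel_measurable borel" and "AE z in lborel. f z = g z"
  shows "fourier f = fourier g"
proof -
  have "fourier_trunc R f = fourier_trunc R g" for R
    unfolding fourier_trunc_eq ft1_def trunc_def
    by (intro ext arg_cong2[of _ _ _ _ "(*)"] refl integral_cong_AE) (use assms(3) in auto)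
  then show ?thesis by (simp add: fourier_def)
qed

lemma fourier_diff:
  assumes f: "f \<in> pts L2" and g: "g \<in> pts L2"
  shows "AE z in lborel. fourier (\<lambda>z. f z - g z) z = fourier f z - fourier g z"
proof (rule fourier_unique[where F="\<lambda>n z. trunc (real n) f z - trunc (real n) g z"])
  note rs = filterlim_real_sequentially
  note t = trunc_L2[OF f] trunc_L2[OF g]
  show "(\<lambda>z. f z - g z) \<in> pts L2" "(\<lambda>z. fourier f z - fourier g z) \<in> pts L2"
    "(\<lambda>z. trunc (real n) f z - trunc (real n) g z) \<in> pts L2"
    "integrable lborel (\<lambda>z. trunc (real n) f z - trunc (real n) g z)" for n
    using t by (auto intro!: L2_diff(1) fourier_L2 f g)
  have *: "(\<lambda>n. n2 (\<lambda>z. (a n z - b n z) - (a' z - b' z))) \<longlonglongrightarrow> 0"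
    if "\<And>n. a n \<in> pts L2" "\<And>n. b n \<in> pts L2" "a' \<in> pts L2" "b' \<in> pts L2"
      "(\<lambda>n. n2 (\<lambda>z. a n z - a' z)) \<longlonglongrightarrow> 0" "(\<lambda>n. n2 (\<lambda>z. b n z - b' z)) \<longlonglongrightarrow> 0" for a b a' b'
  proof -
    have "n2 (\<lambda>z. (a n z - b n z) - (a' z - b' z)) \<le> n2 (\<lambda>z. a n z - a' z) + n2 (\<lambda>z. b n z - b' z)" for n
      using L2_diff(2)[OF L2_diff(1)[OF that(1,3)] L2_diff(1)[OF that(2,4)], of n n]
      by (simp add: algebra_simps)
    then show ?thesis
      by (rule n2_squeeze) (use tendsto_add[OF that(5,6)] in simp)
  qed
  show "(\<lambda>n. n2 (\<lambda>z. (trunc (real n) f z - trunc (real n) g z) - (f z - g z))) \<longlonglongrightarrow> 0"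
    by (intro * t f g trunc_tendsto rs)
  show "(\<lambda>n. n2 (\<lambda>z. ft1 (\<lambda>z. trunc (real n) f z - trunc (real n) g z) z - (fourier f z - fourier g z))) \<longlonglongrightarrow> 0"
    unfolding ft1_diff[OF t(2) t(4)]
    by (intro * t f g plancherel_L1_L2 fourier_L2 rs)
qed

lemma ft1_cmult: "ft1 (\<lambda>z. c * f z) \<zeta> = c * ft1 f \<zeta>"
proof -
  have "(LINT z|lborel. chi z \<zeta> * (c * f z)) = (LINT z|lborel. c * (chi z \<zeta> * f z))"
    by (simp only: ac_simps)
  also have "\<dots> = c * (LINT z|lborel. chi z \<zeta> * f z)" by (rule integral_mult_right_zero)
  finally show ?thesis by (simp add: ft1_def)
qed

lemma fourier_cmult:
  assumes f: "f \<in> pts L2"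
  shows "AE z in lborel. fourier (\<lambda>z. c * f z) z = c * fourier f z"
proof (rule fourier_unique[where F="\<lambda>n z. c * trunc (real n) f z"])
  note rs = filterlim_real_sequentially
  note t = trunc_L2[OF f]
  have *: "(\<lambda>n. n2 (\<lambda>z. c * a n z - c * a' z)) \<longlonglongrightarrow> 0"
    if "\<And>n. a n \<in> pts L2" "a' \<in> pts L2" "(\<lambda>n. n2 (\<lambda>z. a n z - a' z)) \<longlonglongrightarrow> 0" for a a'
    using tendsto_mult_right_zero[OF that(3), of "cmod c"] L2_cmult(2)[OF L2_diff(1)[OF that(1,2)], of c]
    by (simp add: right_diff_distrib)
  show "(\<lambda>z. c * f z) \<in> pts L2" "(\<lambda>z. c * fourier f z) \<in> pts L2"
    "(\<lambda>z. c * trunc (real n) f z) \<in> pts L2" "integrable lborel (\<lambda>z. c * trunc (real n) f z)" for n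
    using t by (auto intro!: L2_cmult fourier_L2 f)
  show "(\<lambda>n. n2 (\<lambda>z. c * trunc (real n) f z - c * f z)) \<longlonglongrightarrow> 0"
    by (intro * t f trunc_tendsto rs)
  show "(\<lambda>n. n2 (\<lambda>z. ft1 (\<lambda>z. c * trunc (real n) f z) z - c * fourier f z)) \<longlonglongrightarrow> 0"
    unfolding ft1_cmult by (intro * t f plancherel_L1_L2 fourier_L2 rs)
qed

lemma ft1_cnj: "ft1 (\<lambda>z. cnj (f z)) \<zeta> = cnj (ft1 f (- \<zeta>))"
proof -
  have "(LINT z|lborel. chi z \<zeta> * cnj (f z)) = (LINT z|lborel. cnj (chi z (- \<zeta>) * f z))"
    by (simp add: chi_minus)
  also have "\<dots> = cnj (LINT z|lborel. chi z (- \<zeta>) * f z)" by (rule Bochner_Integration.integral_cnj)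
  finally show ?thesis by (simp add: ft1_def)
qed

lemma fourier_cnj:
  assumes f: "f \<in> pts L2"
  shows "AE z in lborel. fourier (\<lambda>z. cnj (f z)) z = cnj (fourier f (- z))"
proof (rule fourier_unique[where F="\<lambda>n z. cnj (trunc (real n) f z)"])
  note rs = filterlim_real_sequentially
  note t = trunc_L2[OF f]
  have r: "(\<lambda>z. cnj (g (- z))) \<in> pts L2" "n2 (\<lambda>z. cnj (g (- z))) = n2 g" if "g \<in> pts L2" for g
    using L2_cnj[OF L2_reflect(1)[OF that, of 0]] L2_reflect(2)[OF that, of 0] by simp_all
  show "(\<lambda>z. cnj (f z)) \<in> pts L2" "(\<lambda>z. cnj (fourier f (- z))) \<in> pts L2"
    "(\<lambda>z. cnj (trunc (real n) f z)) \<in> pts L2" "integrable lborel (\<lambda>z. cnj (trunc (real n) f z))" for n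
    using t by (auto intro!: L2_cnj r fourier_L2 f)
  show "(\<lambda>n. n2 (\<lambda>z. cnj (trunc (real n) f z) - cnj (f z))) \<longlonglongrightarrow> 0"
    using trunc_tendsto[OF f rs] L2_cnj(2)[OF L2_diff(1)[OF t(1) f]] by simp
  show "(\<lambda>n. n2 (\<lambda>z. ft1 (\<lambda>z. cnj (trunc (real n) f z)) z - cnj (fourier f (- z)))) \<longlonglongrightarrow> 0"
    using fourier_L2(2)[OF f rs] r(2)[OF L2_diff(1)[OF plancherel_L1_L2(1)[OF t] fourier_L2(1)[OF f]]]
    by (simp add: ft1_cnj)
qed

lemma fourier_L1:
  assumes f: "f \<in> pts L2" "integrable lborel f"
  shows "AE z in lborel. fourier f z = ft1 f z"
  by (rule fourier_unique[where F="\<lambda>_. f"]) (auto intro!: f plancherel_L1_L2 simp: L2_zero)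

lemma ip_tendsto:
  assumes f: "\<And>n. f n \<in> pts L2" "f' \<in> pts L2" "(\<lambda>n. n2 (\<lambda>z. f n z - f' z)) \<longlonglongrightarrow> 0"
    and g: "\<And>n. g n \<in> pts L2" "g' \<in> pts L2" "(\<lambda>n. n2 (\<lambda>z. g n z - g' z)) \<longlonglongrightarrow> 0"
  shows "(\<lambda>n. ip (f n) (g n)) \<longlonglongrightarrow> ip f' g'"
proof -
  let ?b = "\<lambda>n. n2 (\<lambda>z. f n z - f' z) * n2 (g n) + n2 f' * n2 (\<lambda>z. g n z - g' z)"
  have b: "?b \<longlonglongrightarrow> 0"
    using tendsto_add[OF tendsto_mult[OF f(3) n2_tendsto[OF g]] tendsto_mult_right_zero[OF g(3), of "n2 f'"]] by simp
  have "norm (ip (f n) (g n) - ip f' g') \<le> ?b n" for n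
  proof -
    have "ip (f n) (g n) - ip f' g' = ip (\<lambda>z. f n z - f' z) (g n) + ip f' (\<lambda>z. g n z - g' z)"
      by (simp add: ip_diff_left ip_diff_right f g)
    also have "norm \<dots> \<le> norm (ip (\<lambda>z. f n z - f' z) (g n)) + norm (ip f' (\<lambda>z. g n z - g' z))"
      by (rule norm_triangle_ineq)
    also have "\<dots> \<le> ?b n"
      by (intro add_mono L2_integrable(6) L2_diff(1) f g)
    finally show ?thesis .
  qed
  from Lim_null_comparison[OF always_eventually[OF allI[OF this]] b]
  show ?thesis by (simp only: Lim_null[symmetric])
qed

text \<open>Polarisation of the isometry: expanding the norm of a difference gives the real part,
  and testing with \<open>\<i> * g\<close> the imaginary part.\<close>

lemma parseval:
  assumes f: "f \<in> pts L2" and g: "g \<in> pts L2"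
  shows "ip (fourier f) (fourier g) = ip f g"
proof (rule complex_eqI)
  have re: "Re (ip (fourier f) (fourier h)) = Re (ip f h)" if h: "h \<in> pts L2" for h
  proof -
    have "n2 (\<lambda>z. fourier f z - fourier h z) = n2 (\<lambda>z. f z - h z)"
      using n2_cong[OF fourier_diff[OF f h]] n2_fourier[OF L2_diff(1)[OF f h]] by simp
    then show ?thesis
      using L2_diff(3)[OF f h] L2_diff(3)[OF fourier_L2(1)[OF f] fourier_L2(1)[OF h]]
      by (simp add: n2_fourier f h)
  qed
  show "Re (ip (fourier f) (fourier g)) = Re (ip f g)" by (rule re[OF g])
  have "ip (fourier f) (fourier (\<lambda>z. \<i> * g z)) = ip (fourier f) (\<lambda>z. \<i> * fourier g z)"
    by (rule ip_cong) (auto intro!: fourier_cmult fourier_measurable L2_cmult f g borel_measurable_times)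
  with re[OF L2_cmult(1)[OF g, of \<i>]]
  show "Im (ip (fourier f) (fourier g)) = Im (ip f g)" by (simp add: ip_cmult_right)
qed

text \<open>The conjugates only undo the one inside \<open>ip\<close>, so both sides are bilinear
  pairings and the formula for integrable functions passes to the limit.\<close>

lemma fourier_multiplication:
  assumes f: "f \<in> pts L2" and g: "g \<in> pts L2"
  shows "ip (fourier f) (\<lambda>z. cnj (g z)) = ip f (\<lambda>z. cnj (fourier g z))"
proof -
  note r = filterlim_real_sequentially
  note tf = trunc_L2[OF f, of "real n" for n] 
  note tg = trunc_L2[OF g, of "real n" for n]
  have c: "(\<lambda>n. n2 (\<lambda>z. cnj (a n z) - cnj (b z))) \<longlonglongrightarrow> 0"
    if "\<And>n. a n \<in> pts L2" "b \<in> pts L2" "(\<lambda>n. n2 (\<lambda>z. a n z - b z)) \<longlonglongrightarrow> 0" for a b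
    using that(3) L2_cnj(2)[OF L2_diff(1)[OF that(1,2)]] by simp
  note Fg = plancherel_L1_L2(1)[OF tg] fourier_L2(1)[OF g] fourier_L2(2)[OF g r]
  note Ff = plancherel_L1_L2(1)[OF tf] fourier_L2(1)[OF f] fourier_L2(2)[OF f r]
  have "(\<lambda>n. ip (ft1 (trunc (real n) f)) (\<lambda>z. cnj (trunc (real n) g z))) \<longlonglongrightarrow> ip (fourier f) (\<lambda>z. cnj (g z))"
    by (intro ip_tendsto Ff L2_cnj(1) c tg(1) g trunc_tendsto r)
  moreover have "(\<lambda>n. ip (trunc (real n) f) (\<lambda>z. cnj (ft1 (trunc (real n) g) z))) \<longlonglongrightarrow> ip f (\<lambda>z. cnj (fourier g z))"
    by (intro ip_tendsto Fg L2_cnj(1) c tf(1) f trunc_tendsto r)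
  moreover have "ip (ft1 (trunc (real n) f)) (\<lambda>z. cnj (trunc (real n) g z)) =
      ip (trunc (real n) f) (\<lambda>z. cnj (ft1 (trunc (real n) g) z))" for n
    unfolding ip_def complex_cnj_cnj by (rule ft1_multiplication[OF tf(2) tg(2)])
  ultimately show ?thesis by (simp add: LIMSEQ_unique)
qed

text \<open>The equality case of Cauchy-Schwarz: \<open>fourier h\<close> and \<open>g\<close> have
  the same norm, and by the multiplication formula the real part of their inner product is
  \<open>(n2 g)\<^sup>2\<close>, so their distance vanishes. This surjectivity provides the values
  of \<open>fmult\<close> and the test functions for the equation.\<close>

lemma fourier_inverse:
  assumes g: "g \<in> pts L2"
  defines "h \<equiv> \<lambda>z. cnj (fourier (\<lambda>z. cnj (g z)) z)"
  shows "h \<in> pts L2" "AE z in lborel. fourier h z = g z"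
proof -
  note cg = L2_cnj(1)[OF g]
  show h: "h \<in> pts L2" unfolding h_def by (intro L2_cnj fourier_L2 g)
  have nh: "n2 h = n2 g" unfolding h_def by (simp add: L2_cnj fourier_L2 n2_fourier g cg)
  have "ip (fourier h) g = ip h (\<lambda>z. cnj (fourier (\<lambda>z. cnj (g z)) z))"
    using fourier_multiplication[OF h cg] by simp
  also have "\<dots> = ip h h" by (simp add: h_def)
  finally have "Re (ip (fourier h) g) = (n2 g)\<^sup>2" using ip_self(1)[OF h] nh by simp
  then have "(n2 (\<lambda>z. fourier h z - g z))\<^sup>2 = 0"
    using L2_diff(3)[OF fourier_L2(1)[OF h] g] by (simp add: n2_fourier h nh)
  then show "AE z in lborel. fourier h z = g z"
    by (intro n2_diff_0_AE fourier_L2 h g) simp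
qed

text \<open>On \<open>mult_dom\<close> the choice in \<open>fmult\<close> has a witness because the
  transform is onto.\<close>

lemma fmult_L2:
  assumes "f \<in> mult_dom m"
  shows "fmult m f \<in> pts L2" "AE \<zeta> in lborel. fourier (fmult m f) \<zeta> = m \<zeta> * fourier f \<zeta>"
proof -
  have "(\<lambda>\<zeta>. m \<zeta> * fourier f \<zeta>) \<in> pts L2" using assms by (simp add: mult_dom_def)
  from fourier_inverse[OF this] have "\<exists>g. g \<in> pts L2 \<and> (AE \<zeta> in lborel. fourier g \<zeta> = m \<zeta> * fourier f \<zeta>)"
    by blast
  from someI_ex[OF this, folded fmult_def]
  show "fmult m f \<in> pts L2" "AE \<zeta> in lborel. fourier (fmult m f) \<zeta> = m \<zeta> * fourier f \<zeta>" by blast+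
qed

text \<open>Two transforms in a row amount to a reflection, and the outer one is an absolutely
  convergent integral since \<open>fourier u\<close> is integrable.\<close>

lemma fourier_inversion_L1:
  assumes u: "u \<in> pts L2" and Fu: "integrable lborel (fourier u)"
  shows "AE z in lborel. u z = ft1 (fourier u) (- z)"
proof -
  note F = fourier_L2(1)[OF u]
  let ?h = "\<lambda>z. cnj (fourier (\<lambda>z. cnj (fourier u z)) z)"
  note h = fourier_inverse[OF F]
  have "n2 (\<lambda>z. ?h z - u z) = n2 (\<lambda>z. fourier ?h z - fourier u z)"
    using n2_cong[OF fourier_diff[OF h(1) u]] n2_fourier[OF L2_diff(1)[OF h(1) u]] by simp
  also have "\<dots> = n2 (\<lambda>_. 0)" by (rule n2_cong) (use h(2) in eventually_elim, simp)
  finally have 1: "AE z in lborel. ?h z = u z" by (intro n2_diff_0_AE h(1) u) (simp add: L2_zero)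
  have 2: "AE z in lborel. fourier (\<lambda>z. cnj (fourier u z)) z = cnj (fourier (fourier u) (- z))"
    by (rule fourier_cnj[OF F])
  have 3: "AE z in lborel. fourier (fourier u) (0 - z) = ft1 (fourier u) (0 - z)"
    by (rule AE_reflect) (rule fourier_L1[OF F Fu])
  from 1 2 3 show ?thesis by eventually_elim simp
qed

section \<open>Convolution and the transform of a product\<close>

definition conv :: "func \<Rightarrow> func \<Rightarrow> func" where
  "conv U V \<zeta> = (LINT \<zeta>'|lborel. U (\<zeta> - \<zeta>') * V \<zeta>')"

lemma conv_measurable [measurable]:
  assumes [measurable]: "U \<in> borel_measurable borel" "V \<in> borel_measurable borel"
  shows "conv U V \<in> borel_measurable borel"
  unfolding conv_def[abs_def] by measurable

lemma conv_integrable: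
  assumes "U \<in> pts L2" "V \<in> pts L2"
  shows "integrable lborel (\<lambda>\<zeta>'. U (\<zeta> - \<zeta>') * V \<zeta>')"
  by (rule L2_integrable(1)[OF L2_reflect(1)[OF assms(1)] assms(2)])

lemma conv_diff_left: "U \<in> pts L2 \<Longrightarrow> U' \<in> pts L2 \<Longrightarrow> V \<in> pts L2 \<Longrightarrow>
    conv (\<lambda>z. U z - U' z) V \<zeta> = conv U V \<zeta> - conv U' V \<zeta>"
  unfolding conv_def by (simp add: left_diff_distrib conv_integrable)

lemma conv_diff_right: "U \<in> pts L2 \<Longrightarrow> V \<in> pts L2 \<Longrightarrow> V' \<in> pts L2 \<Longrightarrow>
    conv U (\<lambda>z. V z - V' z) \<zeta> = conv U V \<zeta> - conv U V' \<zeta>"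
  unfolding conv_def by (simp add: right_diff_distrib conv_integrable)

lemma conv_commute:
  assumes [measurable]: "U \<in> borel_measurable borel" "V \<in> borel_measurable borel"
  shows "conv U V = conv V U"
proof
  fix \<zeta>
  show "conv U V \<zeta> = conv V U \<zeta>"
    unfolding conv_def using integral_reflect[of "\<lambda>z. U z * V (\<zeta> - z)" \<zeta>] by (simp add: mult.commute)
qed

lemma conv_cong_right:
  assumes [measurable]: "U \<in> borel_measurable borel" "V \<in> borel_measurable borel" "V' \<in> borel_measurable borel"
    and "AE z in lborel. V z = V' z"
  shows "conv U V = conv U V'"
  unfolding conv_def by (intro ext integral_cong_AE) (use assms(4) in auto)

text \<open>Cauchy-Schwarz with |U| split into two square roots bounds |U * V|^2 pointwise by the L1
  norm of \<open>U\<close> times the convolution of |U| with |V|^2, which Tonelli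
  integrates.\<close>

lemma young:
  assumes U: "integrable lborel U" and V: "V \<in> pts L2"
  shows "conv U V \<in> pts L2" "n2 (conv U V) \<le> (LINT z|lborel. cmod (U z)) * n2 V"
proof -
  have [measurable]: "U \<in> borel_measurable borel" using borel_measurable_integrable[OF U] by simp
  note [measurable] = L2_measurable[OF V]
  let ?A = "LINT z|lborel. cmod (U z)"
  have A: "(\<integral>\<^sup>+ z. ennreal (cmod (U z)) \<partial>lborel) = ennreal ?A"
    using U by (intro nn_integral_eq_integral) auto
  have A0: "0 \<le> ?A" by (rule integral_nonneg_AE) auto
  have pw: "ennreal ((cmod (conv U V \<zeta>))\<^sup>2) \<le>
      ennreal ?A * (\<integral>\<^sup>+ \<zeta>'. ennreal (cmod (U (\<zeta> - \<zeta>'))) * ennreal ((cmod (V \<zeta>'))\<^sup>2) \<partial>lborel)" for \<zeta>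
  proof -
    \<comment> \<open>If the product is not integrable, \<open>conv\<close> takes the default value
      0 and the bound is trivial.\<close>
    have "ennreal (cmod (conv U V \<zeta>)) \<le> (\<integral>\<^sup>+ \<zeta>'. ennreal (cmod (U (\<zeta> - \<zeta>') * V \<zeta>')) \<partial>lborel)"
    proof (cases "integrable lborel (\<lambda>\<zeta>'. U (\<zeta> - \<zeta>') * V \<zeta>')")
      case True then show ?thesis unfolding conv_def by (rule integral_norm_bound_ennreal)
    qed (simp add: conv_def not_integrable_integral_eq)
    also have "\<dots> = (\<integral>\<^sup>+ \<zeta>'. ennreal (sqrt (cmod (U (\<zeta> - \<zeta>')))) * ennreal (sqrt (cmod (U (\<zeta> - \<zeta>'))) * cmod (V \<zeta>')) \<partial>lborel)"
      by (intro nn_integral_cong) (simp add: norm_mult ennreal_mult'[symmetric] mult.assoc[symmetric])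
    finally have "ennreal (cmod (conv U V \<zeta>)) ^ 2 \<le> \<dots> ^ 2" by (rule power_mono) simp
    also have "\<dots> \<le> (\<integral>\<^sup>+ \<zeta>'. ennreal (sqrt (cmod (U (\<zeta> - \<zeta>')))) ^ 2 \<partial>lborel) *
        (\<integral>\<^sup>+ \<zeta>'. ennreal (sqrt (cmod (U (\<zeta> - \<zeta>'))) * cmod (V \<zeta>')) ^ 2 \<partial>lborel)"
      by (rule Cauchy_Schwarz_nn_integral) auto
    also have "(\<integral>\<^sup>+ \<zeta>'. ennreal (sqrt (cmod (U (\<zeta> - \<zeta>')))) ^ 2 \<partial>lborel) = ennreal ?A"
      using nn_integral_reflect[of "\<lambda>z. ennreal (cmod (U z))" \<zeta>] by (simp add: ennreal_power A)
    also have "(\<integral>\<^sup>+ \<zeta>'. ennreal (sqrt (cmod (U (\<zeta> - \<zeta>'))) * cmod (V \<zeta>')) ^ 2 \<partial>lborel) =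
        (\<integral>\<^sup>+ \<zeta>'. ennreal (cmod (U (\<zeta> - \<zeta>'))) * ennreal ((cmod (V \<zeta>'))\<^sup>2) \<partial>lborel)"
      by (intro nn_integral_cong) (simp add: ennreal_power power_mult_distrib ennreal_mult')
    finally show ?thesis by (simp add: ennreal_power)
  qed
  have "l2_sq (conv U V) \<le> (\<integral>\<^sup>+ \<zeta>. ennreal ?A * (\<integral>\<^sup>+ \<zeta>'. ennreal (cmod (U (\<zeta> - \<zeta>'))) * ennreal ((cmod (V \<zeta>'))\<^sup>2) \<partial>lborel) \<partial>lborel)"
    unfolding l2_sq_def by (intro nn_integral_mono pw)
  also have "\<dots> = ennreal ?A * (\<integral>\<^sup>+ \<zeta>. \<integral>\<^sup>+ \<zeta>'. ennreal (cmod (U (\<zeta> - \<zeta>'))) * ennreal ((cmod (V \<zeta>'))\<^sup>2) \<partial>lborel \<partial>lborel)"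
    by (rule nn_integral_cmult) measurable
  also have "(\<integral>\<^sup>+ \<zeta>. \<integral>\<^sup>+ \<zeta>'. ennreal (cmod (U (\<zeta> - \<zeta>'))) * ennreal ((cmod (V \<zeta>'))\<^sup>2) \<partial>lborel \<partial>lborel) =
      (\<integral>\<^sup>+ \<zeta>'. \<integral>\<^sup>+ \<zeta>. ennreal (cmod (U (\<zeta> - \<zeta>'))) * ennreal ((cmod (V \<zeta>'))\<^sup>2) \<partial>lborel \<partial>lborel)"
    by (rule lborel_pair.Fubini') measurable
  also have "\<dots> = (\<integral>\<^sup>+ \<zeta>'. ennreal ?A * ennreal ((cmod (V \<zeta>'))\<^sup>2) \<partial>lborel)"
    using nn_integral_translate[of "\<lambda>z. ennreal (cmod (U z))"] by (simp add: nn_integral_multc A)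
  also have "\<dots> = ennreal ?A * l2_sq V" unfolding l2_sq_def by (rule nn_integral_cmult) measurable
  also have "ennreal ?A * (ennreal ?A * l2_sq V) = ennreal ((?A * n2 V)\<^sup>2)"
    using A0 by (simp add: l2_sq_n2[OF V] ennreal_mult'[symmetric] power2_eq_square mult_ac)
  finally have *: "l2_sq (conv U V) \<le> ennreal ((?A * n2 V)\<^sup>2)" .
  have "conv U V \<in> borel_measurable borel" by measurable
  note L = L2_I[OF this * mult_nonneg_nonneg[OF A0 n2_nonneg]]
  show "conv U V \<in> pts L2" "n2 (conv U V) \<le> ?A * n2 V" by (rule L)+
qed

text \<open>\<open>u\<close> agrees almost everywhere with the bounded function \<open>w\<close>,
  the inversion integral of \<open>fourier u\<close>, so only \<open>v\<close> has to be truncated.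
  For the truncations the multiplication formula produces the convolution, and Young's inequality
  passes to the limit.\<close>

lemma fourier_product:
  assumes u: "u \<in> pts L2" and Fu: "integrable lborel (fourier u)" and v: "v \<in> pts L2"
  shows "(\<lambda>z. u z * v z) \<in> pts L2"
    "AE \<zeta> in lborel. fourier (\<lambda>z. u z * v z) \<zeta> = of_real (1 / (2 * pi)) * conv (fourier u) (fourier v) \<zeta>"
proof -
  note [measurable] = L2_measurable[OF u] L2_measurable[OF v] fourier_measurable[OF u] fourier_measurable[OF v]
  note F = fourier_L2(1)[OF u]
  define w where "w z = ft1 (fourier u) (- z)" for z
  let ?M = "LINT z|lborel. cmod (fourier u z)"
  have [measurable]: "w \<in> borel_measurable borel" unfolding w_def[abs_def] by measurable
  have wM: "cmod (w z) \<le> ?M" for z unfolding w_def by (rule ft1_bound)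
  have M0: "0 \<le> ?M" by (rule order_trans[OF norm_ge_zero wM])
  have uw: "AE z in lborel. u z = w z" unfolding w_def by (rule fourier_inversion_L1[OF u Fu])
  have wL: "(\<lambda>z. w z * f z) \<in> pts L2" "n2 (\<lambda>z. w z * f z) \<le> ?M * n2 f" if f: "f \<in> pts L2" for f
  proof -
    have m: "(\<lambda>z. w z * f z) \<in> borel_measurable borel" using L2_measurable[OF f] by measurable
    have "AE z in lborel. cmod (w z * f z) \<le> ?M * cmod (f z)"
      by (rule AE_I2) (simp add: norm_mult mult_right_mono[OF wM])
    from L2_dom[OF m f M0 this] show "(\<lambda>z. w z * f z) \<in> pts L2" "n2 (\<lambda>z. w z * f z) \<le> ?M * n2 f" .
  qed
  have uwv: "AE z in lborel. u z * v z = w z * v z" using uw by eventually_elim simp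
  show "(\<lambda>z. u z * v z) \<in> pts L2" using wL(1)[OF v] l2_sq_cong[OF uwv] by (simp add: L2_iff)
  have tF: "ft1 (\<lambda>z. w z * f z) \<zeta> = of_real (1 / (2 * pi)) * conv (fourier u) (ft1 f) \<zeta>"
    if f: "f \<in> pts L2" "integrable lborel f" for f \<zeta>
  proof -
    note [measurable] = L2_measurable[OF f(1)]
    have w_eq: "w z = ft1 (\<lambda>\<zeta>. fourier u (- \<zeta>)) z" for z
    proof -
      have "(LINT y|lborel. chi y z * fourier u (- y)) = (LINT y|lborel. chi (- y) z * fourier u y)"
        using integral_reflect[of "\<lambda>y. chi (- y) z * fourier u y" 0] by simp
      then show ?thesis by (simp add: w_def ft1_def chi_minus)
    qed
    have "(LINT z|lborel. chi z \<zeta> * (w z * f z)) = (LINT z|lborel. ft1 (\<lambda>\<zeta>. fourier u (- \<zeta>)) z * (chi z \<zeta> * f z))"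
      by (simp only: w_eq ac_simps)
    also have "\<dots> = (LINT z|lborel. fourier u (- z) * ft1 (\<lambda>z. chi z \<zeta> * f z) z)"
      by (rule ft1_multiplication[OF integrable_reflect[OF Fu] integrable_chi_mult(1)[OF f(2)]])
    also have "\<dots> = (LINT z|lborel. fourier u (- z) * ft1 f (\<zeta> + z))"
      by (simp add: ft1_def chi_add mult_ac)
    also have "\<dots> = (LINT z|lborel. fourier u z * ft1 f (\<zeta> - z))"
      using integral_reflect[of "\<lambda>z. fourier u z * ft1 f (\<zeta> - z)" 0] by simp
    also have "\<dots> = conv (fourier u) (ft1 f) \<zeta>"
      using integral_reflect[of "\<lambda>z. fourier u z * ft1 f (\<zeta> - z)" \<zeta>] by (simp add: conv_def)
    finally show ?thesis by (simp add: ft1_def)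
  qed
  have eq: "fourier (\<lambda>z. u z * v z) = fourier (\<lambda>z. w z * v z)"
    by (rule fourier_cong[OF _ _ uwv]) measurable
  note r = filterlim_real_sequentially
  note tv = trunc_L2[OF v, of "real n" for n]
  note YL = young[OF Fu]
  let ?c = "complex_of_real (1 / (2 * pi))"
  show "AE \<zeta> in lborel. fourier (\<lambda>z. u z * v z) \<zeta> = ?c * conv (fourier u) (fourier v) \<zeta>"
    unfolding eq
  proof (rule fourier_unique[where F="\<lambda>n z. w z * trunc (real n) v z"])
    show "(\<lambda>z. w z * v z) \<in> pts L2" "(\<lambda>z. w z * trunc (real n) v z) \<in> pts L2" for n
      by (intro wL(1) v tv(1))+
    show "integrable lborel (\<lambda>z. w z * trunc (real n) v z)" for n
    proof (rule Bochner_Integration.integrable_bound[OF integrable_mult_right[OF tv(2)[of n], of "complex_of_real ?M"]])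
      show "(\<lambda>z. w z * trunc (real n) v z) \<in> borel_measurable lborel"
        using L2_measurable[OF tv(1)[of n]] by simp
      show "AE z in lborel. norm (w z * trunc (real n) v z) \<le> norm (complex_of_real ?M * trunc (real n) v z)"
        using wM M0 by (intro AE_I2) (simp add: norm_mult mult_right_mono)
    qed
    show "(\<lambda>z. ?c * conv (fourier u) (fourier v) z) \<in> pts L2"
      by (intro L2_cmult(1) YL(1) fourier_L2(1) v)
    show "(\<lambda>n. n2 (\<lambda>z. w z * trunc (real n) v z - w z * v z)) \<longlonglongrightarrow> 0"
    proof (rule n2_squeeze)
      show "n2 (\<lambda>z. w z * trunc (real n) v z - w z * v z) \<le> ?M * n2 (\<lambda>z. trunc (real n) v z - v z)" for n
        using wL(2)[OF L2_diff(1)[OF tv(1)[of n] v]] by (simp add: right_diff_distrib)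
      show "(\<lambda>n. ?M * n2 (\<lambda>z. trunc (real n) v z - v z)) \<longlonglongrightarrow> 0"
        by (intro tendsto_mult_right_zero trunc_tendsto v r)
    qed
    show "(\<lambda>n. n2 (\<lambda>z. ft1 (\<lambda>z. w z * trunc (real n) v z) z - ?c * conv (fourier u) (fourier v) z)) \<longlonglongrightarrow> 0"
      unfolding tF[OF tv]
    proof (rule n2_squeeze)
      fix n
      note T = plancherel_L1_L2(1)[OF tv, of n]
      note Fv = fourier_L2(1)[OF v]
      have "(\<lambda>z. ?c * conv (fourier u) (ft1 (trunc (real n) v)) z - ?c * conv (fourier u) (fourier v) z) =
          (\<lambda>z. ?c * conv (fourier u) (\<lambda>z. ft1 (trunc (real n) v) z - fourier v z) z)"
        by (simp add: conv_diff_right F T Fv right_diff_distrib del: of_real_divide)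
      then have "n2 (\<lambda>z. ?c * conv (fourier u) (ft1 (trunc (real n) v)) z - ?c * conv (fourier u) (fourier v) z) =
          cmod ?c * n2 (conv (fourier u) (\<lambda>z. ft1 (trunc (real n) v) z - fourier v z))"
        by (simp only: L2_cmult(2)[OF YL(1)[OF L2_diff(1)[OF T Fv]]])
      also have "\<dots> \<le> cmod ?c * (?M * n2 (\<lambda>z. ft1 (trunc (real n) v) z - fourier v z))"
        by (intro mult_left_mono YL(2) L2_diff(1) T Fv) simp
      finally show "n2 (\<lambda>z. ?c * conv (fourier u) (ft1 (trunc (real n) v)) z - ?c * conv (fourier u) (fourier v) z)
          \<le> cmod ?c * (?M * n2 (\<lambda>z. ft1 (trunc (real n) v) z - fourier v z))" .
    next
      show "(\<lambda>n. cmod ?c * (?M * n2 (\<lambda>z. ft1 (trunc (real n) v) z - fourier v z))) \<longlonglongrightarrow> 0"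
        by (intro tendsto_mult_right_zero fourier_L2(2) v r)
    qed
  qed
qed

subsection \<open>Weights and the function spaces\<close>

abbreviation wt :: "(plane \<Rightarrow> real) \<Rightarrow> func \<Rightarrow> func" where
  "wt \<mu> U \<equiv> (\<lambda>\<zeta>. complex_of_real (\<mu> \<zeta>) * U \<zeta>)"

definition jb :: "plane \<Rightarrow> real" where "jb \<zeta> = sqrt (1 + (norm \<zeta>)\<^sup>2)"

lemma jb_ge_1: "1 \<le> jb \<zeta>" by (simp add: jb_def)

lemma jb_pos [simp]: "0 < jb \<zeta>" using jb_ge_1[of \<zeta>] by linarith

lemma abs_jb [simp]: "\<bar>jb \<zeta>\<bar> = jb \<zeta>" by (simp add: less_imp_le)

lemma norm_le_jb: "norm \<zeta> \<le> jb \<zeta>"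
  unfolding jb_def by (rule real_le_rsqrt) simp

lemma fst_snd_le_norm: "\<bar>fst \<zeta>\<bar> \<le> norm \<zeta>" "\<bar>snd \<zeta>\<bar> \<le> norm (\<zeta> :: plane)"
  using norm_fst_le[of "fst \<zeta>" "snd \<zeta>"] norm_snd_le[of "snd \<zeta>" "fst \<zeta>"] by simp_all

lemma jb_measurable [measurable]: "jb \<in> borel_measurable borel"
  unfolding jb_def[abs_def] by measurable

text \<open>The bracket of \<open>z\<close> is the Euclidean norm of \<open>(1, z)\<close>, so this
  is the reverse triangle inequality.\<close>

lemma jb_triangle: "\<bar>jb x - jb y\<bar> \<le> norm (x - y)"
proof -
  have 1: "jb z = norm (1 :: real, z)" for z by (simp add: jb_def norm_prod_def)
  have "\<bar>jb x - jb y\<bar> \<le> norm ((1 :: real, x) - (1, y))" unfolding 1 by (rule norm_triangle_ineq3)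
  also have "\<dots> = norm (x - y)" by (simp add: norm_prod_def)
  finally show ?thesis .
qed

lemma jb_powr_ge_1: "0 \<le> s \<Longrightarrow> 1 \<le> jb \<zeta> powr s"
  by (rule ge_one_powr_ge_zero[OF jb_ge_1])

lemma sobolev_sq_eq: "sobolev_sq s f = l2_sq (wt (\<lambda>\<zeta>. jb \<zeta> powr s) (fourier f))"
  unfolding sobolev_sq_def l2_sq_def
proof (intro nn_integral_cong)
  fix \<zeta>
  have "(jb \<zeta> powr s)\<^sup>2 = (1 + (norm \<zeta>)\<^sup>2) powr s"
    by (simp add: jb_def powr_half_sqrt[symmetric] powr_powr power2_eq_square powr_add[symmetric])
  then show "ennreal ((1 + (norm \<zeta>)\<^sup>2) powr s * (cmod (fourier f \<zeta>))\<^sup>2) =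
      ennreal ((cmod (complex_of_real (jb \<zeta> powr s) * fourier f \<zeta>))\<^sup>2)"
    by (simp add: norm_mult power_mult_distrib)
qed

lemma H_iff: "f \<in> pts (H s) \<longleftrightarrow> f \<in> pts L2 \<and> wt (\<lambda>\<zeta>. jb \<zeta> powr s) (fourier f) \<in> pts L2"
proof -
  have "wt (\<lambda>\<zeta>. jb \<zeta> powr s) (fourier f) \<in> borel_measurable borel" if "f \<in> pts L2"
    using fourier_measurable[OF that] by measurable
  then show ?thesis by (auto simp: H_def sobolev_sq_eq L2_iff)
qed

lemma nrm_H: "nrm (H s) f = n2 (wt (\<lambda>\<zeta>. jb \<zeta> powr s) (fourier f))"
  by (simp add: H_def sobolev_sq_eq n2_eq)

lemma wt_cong_AE: "AE \<zeta> in lborel. U \<zeta> = V \<zeta> \<Longrightarrow> AE \<zeta> in lborel. wt \<mu> U \<zeta> = wt \<mu> V \<zeta>"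
  by auto

lemma L2_cong_AE:
  assumes "AE z in lborel. f z = g z" "f \<in> borel_measurable borel" "g \<in> borel_measurable borel"
  shows "f \<in> pts L2 \<longleftrightarrow> g \<in> pts L2"
  using l2_sq_cong[OF assms(1)] assms(2,3) by (simp add: L2_iff)

lemma l2_sq_norm_cong: "(\<And>z. cmod (f z) = cmod (g z)) \<Longrightarrow> l2_sq f = l2_sq g"
  by (simp add: l2_sq_def)

lemma L2_norm_cong:
  assumes "\<And>z. cmod (f z) = cmod (g z)" "f \<in> borel_measurable borel" "g \<in> borel_measurable borel"
  shows "f \<in> pts L2 \<longleftrightarrow> g \<in> pts L2" "n2 f = n2 g"
  using l2_sq_norm_cong[OF assms(1)] assms(2,3) by (simp_all add: L2_iff n2_eq)

lemma mult_dom_iff: "f \<in> mult_dom m \<longleftrightarrow> f \<in> pts L2 \<and> (\<lambda>\<zeta>. m \<zeta> * fourier f \<zeta>) \<in> pts L2"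
  by (simp add: mult_dom_def)

text \<open>By Plancherel only the modulus of the symbol matters: a graph space is
  \<open>H s\<close> with one more weighted L2 norm on the Fourier side.\<close>

lemma graph_L2:
  assumes [measurable]: "m \<in> borel_measurable borel"
  defines "\<mu> \<equiv> \<lambda>\<zeta>. cmod (m \<zeta>)"
  shows "f \<in> pts (graph_space (H s) m L2) \<longleftrightarrow> f \<in> pts (H s) \<and> wt \<mu> (fourier f) \<in> pts L2"
    "f \<in> pts (graph_space (H s) m L2) \<Longrightarrow>
      nrm (graph_space (H s) m L2) f = sqrt ((nrm (H s) f)\<^sup>2 + (n2 (wt \<mu> (fourier f)))\<^sup>2)"
proof -
  have eq: "(\<lambda>\<zeta>. m \<zeta> * fourier f \<zeta>) \<in> pts L2 \<longleftrightarrow> wt \<mu> (fourier f) \<in> pts L2"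
    "n2 (\<lambda>\<zeta>. m \<zeta> * fourier f \<zeta>) = n2 (wt \<mu> (fourier f))" if "f \<in> pts L2"
  proof -
    note [measurable] = fourier_measurable[OF that]
    show "(\<lambda>\<zeta>. m \<zeta> * fourier f \<zeta>) \<in> pts L2 \<longleftrightarrow> wt \<mu> (fourier f) \<in> pts L2"
      "n2 (\<lambda>\<zeta>. m \<zeta> * fourier f \<zeta>) = n2 (wt \<mu> (fourier f))"
      unfolding \<mu>_def by (intro L2_norm_cong; simp add: norm_mult)+
  qed
  show *: "f \<in> pts (graph_space (H s) m L2) \<longleftrightarrow> f \<in> pts (H s) \<and> wt \<mu> (fourier f) \<in> pts L2"
    using eq(1) fmult_L2(1)[of f m] by (auto simp: graph_space_def mult_dom_iff H_iff)
  assume "f \<in> pts (graph_space (H s) m L2)"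
  then have f: "f \<in> pts L2" "f \<in> mult_dom m" by (auto simp: graph_space_def mult_dom_iff)
  have "n2 (fmult m f) = n2 (\<lambda>\<zeta>. m \<zeta> * fourier f \<zeta>)"
    using n2_fourier[OF fmult_L2(1)[OF f(2)]] n2_cong[OF fmult_L2(2)[OF f(2)]] by simp
  then show "nrm (graph_space (H s) m L2) f = sqrt ((nrm (H s) f)\<^sup>2 + (n2 (wt \<mu> (fourier f)))\<^sup>2)"
    by (simp add: graph_space_def eq(2)[OF f(1)])
qed

lemma graph_H:
  assumes [measurable]: "m \<in> borel_measurable borel" and s: "0 \<le> s"
  defines "\<mu> \<equiv> \<lambda>\<zeta>. jb \<zeta> powr s * cmod (m \<zeta>)"
  shows "f \<in> pts (graph_space (H s) m (H s)) \<longleftrightarrow> f \<in> pts (H s) \<and> wt \<mu> (fourier f) \<in> pts L2"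
    "f \<in> pts (graph_space (H s) m (H s)) \<Longrightarrow>
      nrm (graph_space (H s) m (H s)) f = sqrt ((nrm (H s) f)\<^sup>2 + (n2 (wt \<mu> (fourier f)))\<^sup>2)"
proof -
  let ?j = "\<lambda>\<zeta>. jb \<zeta> powr s"
  have eq: "wt ?j (fourier (fmult m f)) \<in> pts L2 \<longleftrightarrow> wt \<mu> (fourier f) \<in> pts L2"
    "n2 (wt ?j (fourier (fmult m f))) = n2 (wt \<mu> (fourier f))" if f: "f \<in> pts L2" "f \<in> mult_dom m"
  proof -
    note [measurable] = fourier_measurable[OF f(1)] fourier_measurable[OF fmult_L2(1)[OF f(2)]]
    have ae: "AE \<zeta> in lborel. wt ?j (fourier (fmult m f)) \<zeta> = wt ?j (\<lambda>\<zeta>. m \<zeta> * fourier f \<zeta>) \<zeta>"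
      by (rule wt_cong_AE[OF fmult_L2(2)[OF f(2)]])
    have "wt ?j (fourier (fmult m f)) \<in> pts L2 \<longleftrightarrow> wt ?j (\<lambda>\<zeta>. m \<zeta> * fourier f \<zeta>) \<in> pts L2"
      by (rule L2_cong_AE[OF ae]) measurable
    also have "\<dots> \<longleftrightarrow> wt \<mu> (fourier f) \<in> pts L2"
      unfolding \<mu>_def by (rule L2_norm_cong(1)) (simp_all add: norm_mult)
    finally show "wt ?j (fourier (fmult m f)) \<in> pts L2 \<longleftrightarrow> wt \<mu> (fourier f) \<in> pts L2" .
    have "n2 (wt ?j (fourier (fmult m f))) = n2 (wt ?j (\<lambda>\<zeta>. m \<zeta> * fourier f \<zeta>))"
      by (rule n2_cong[OF ae])
    also have "\<dots> = n2 (wt \<mu> (fourier f))"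
      unfolding \<mu>_def by (rule L2_norm_cong(2)) (simp_all add: norm_mult)
    finally show "n2 (wt ?j (fourier (fmult m f))) = n2 (wt \<mu> (fourier f))" .
  qed
  \<comment> \<open>The Sobolev weight is at least 1, so membership in the domain of the multiplier
    already follows from the weighted bound.\<close>
  have dom: "f \<in> mult_dom m" if f: "f \<in> pts L2" "wt \<mu> (fourier f) \<in> pts L2"
  proof -
    note [measurable] = fourier_measurable[OF f(1)]
    have "(\<lambda>\<zeta>. m \<zeta> * fourier f \<zeta>) \<in> pts L2"
    proof (rule L2_dom(1)[where c=1, OF _ f(2)])
      show "AE \<zeta> in lborel. cmod (m \<zeta> * fourier f \<zeta>) \<le> 1 * cmod (wt \<mu> (fourier f) \<zeta>)"
      proof (rule AE_I2)
        fix \<zeta>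
        have "1 * (cmod (m \<zeta>) * cmod (fourier f \<zeta>)) \<le> jb \<zeta> powr s * (cmod (m \<zeta>) * cmod (fourier f \<zeta>))"
          by (intro mult_right_mono jb_powr_ge_1 s) simp
        then show "cmod (m \<zeta> * fourier f \<zeta>) \<le> 1 * cmod (wt \<mu> (fourier f) \<zeta>)"
          by (simp add: norm_mult \<mu>_def mult.assoc)
      qed
    qed simp_all
    with f(1) show ?thesis by (simp add: mult_dom_iff)
  qed
  show *: "f \<in> pts (graph_space (H s) m (H s)) \<longleftrightarrow> f \<in> pts (H s) \<and> wt \<mu> (fourier f) \<in> pts L2"
    using eq(1) dom fmult_L2(1)[of f m] by (auto simp: graph_space_def H_iff)
  assume "f \<in> pts (graph_space (H s) m (H s))"
  then have f: "f \<in> pts L2" "f \<in> mult_dom m" by (auto simp: graph_space_def mult_dom_iff)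
  then show "nrm (graph_space (H s) m (H s)) f = sqrt ((nrm (H s) f)\<^sup>2 + (n2 (wt \<mu> (fourier f)))\<^sup>2)"
    using eq(2)[OF f] by (simp add: graph_space_def nrm_H)
qed

lemma symbols_measurable [measurable]:
  "dx \<in> borel_measurable borel" "dy \<in> borel_measurable borel" "dx_inv \<in> borel_measurable borel"
  "hilbert \<in> borel_measurable borel" "Dx a \<in> borel_measurable borel" "lin_symbol a \<in> borel_measurable borel"
proof -
  show [measurable]: "dx \<in> borel_measurable borel" "dy \<in> borel_measurable borel" "dx_inv \<in> borel_measurable borel"
    "hilbert \<in> borel_measurable borel" "Dx a \<in> borel_measurable borel"
    unfolding dx_def dy_def dx_inv_def hilbert_def Dx_def case_prod_beta by measurable
  show "lin_symbol a \<in> borel_measurable borel" unfolding lin_symbol_def[abs_def] by measurable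
qed

section \<open>The phase of the linear equation and the frequency windows\<close>

definition psym :: "real \<Rightarrow> plane \<Rightarrow> real" where
  "psym \<alpha> \<zeta> = - (fst \<zeta> ^ 3 + sgn (fst \<zeta>) * \<bar>fst \<zeta>\<bar> powr \<alpha> * (snd \<zeta>)\<^sup>2)"

lemma psym_measurable [measurable]: "psym \<alpha> \<in> borel_measurable borel"
  unfolding psym_def[abs_def] by measurable

lemma lin_symbol_eq: "lin_symbol \<alpha> \<zeta> = \<i> * of_real (psym \<alpha> \<zeta>)"
  by (cases \<zeta>) (simp add: lin_symbol_def psym_def dx_def hilbert_def Dx_def dy_def power_mult_distrib algebra_simps power3_eq_cube)

text \<open>On a window the symbol and the inverse of \<open>\<xi>\<close> are bounded, so that there the equation in the dual of
  \<open>X\<^sup>3\<close> becomes an equation in \<open>L\<^sup>2\<close>. The windows exhaust the plane up to the null set \<open>\<xi> = 0\<close>.\<close>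

definition window :: "nat \<Rightarrow> plane set" where
  "window n = {\<zeta>. 1 / real (Suc n) \<le> \<bar>fst \<zeta>\<bar> \<and> norm \<zeta> \<le> real (Suc n)}"

lemma window_measurable [measurable]: "window n \<in> sets borel"
proof -
  have "{\<zeta>\<in>space borel. 1 / real (Suc n) \<le> \<bar>fst \<zeta>\<bar> \<and> norm (\<zeta> :: plane) \<le> real (Suc n)} \<in> sets borel"
    by measurable
  then show ?thesis by (simp add: window_def)
qed

lemma window_bounds:
  assumes "\<zeta> \<in> window n"
  shows "fst \<zeta> \<noteq> 0" "inverse \<bar>fst \<zeta>\<bar> \<le> real (Suc n)" "\<bar>fst \<zeta>\<bar> \<le> real (Suc n)" "\<bar>snd \<zeta>\<bar> \<le> real (Suc n)"
    "jb \<zeta> \<le> real (Suc (Suc n))"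
proof -
  have w: "1 / real (Suc n) \<le> \<bar>fst \<zeta>\<bar>" "norm \<zeta> \<le> real (Suc n)" using assms by (auto simp: window_def)
  have "0 < 1 / real (Suc n)" by simp
  with w(1) have p: "0 < \<bar>fst \<zeta>\<bar>" by linarith
  then show "fst \<zeta> \<noteq> 0" by simp
  show "inverse \<bar>fst \<zeta>\<bar> \<le> real (Suc n)"
    using w(1) p by (simp add: field_simps)
  show "\<bar>fst \<zeta>\<bar> \<le> real (Suc n)" "\<bar>snd \<zeta>\<bar> \<le> real (Suc n)"
    using fst_snd_le_norm[of \<zeta>] w(2) by linarith+
  have "jb \<zeta> \<le> jb 0 + norm (\<zeta> - 0)" using jb_triangle[of \<zeta> 0] by linarith
  then show "jb \<zeta> \<le> real (Suc (Suc n))" using w(2) by (simp add: jb_def)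
qed

lemma psym_window_bound:
  assumes "\<zeta> \<in> window n" "-1 \<le> \<alpha>" "\<alpha> \<le> 1"
  shows "\<bar>psym \<alpha> \<zeta>\<bar> \<le> 2 * real (Suc n) ^ 3"
proof -
  note b = window_bounds[OF assms(1)]
  let ?x = "\<bar>fst \<zeta>\<bar>" and ?N = "real (Suc n)"
  have x: "0 < ?x" using b(1) by simp
  \<comment> \<open>For exponents between -1 and 1 the power is at most the larger of |\<xi>| and 1
    / |\<xi>|, and the window bounds both.\<close>
  have pw: "?x powr \<alpha> \<le> ?N"
  proof (cases "1 \<le> ?x")
    case True
    have "?x powr \<alpha> \<le> ?x powr 1" using True assms by (intro powr_mono) auto
    then show ?thesis using b(3) x by simp
  next
    case False
    have "?x powr \<alpha> \<le> ?x powr (-1)" using False assms x by (intro powr_mono') auto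
    also have "\<dots> = inverse ?x" using x by (simp add: powr_minus)
    finally show ?thesis using b(2) by simp
  qed
  have "\<bar>psym \<alpha> \<zeta>\<bar> \<le> \<bar>fst \<zeta> ^ 3\<bar> + \<bar>sgn (fst \<zeta>) * ?x powr \<alpha> * (snd \<zeta>)\<^sup>2\<bar>"
    unfolding psym_def abs_minus_cancel by (rule abs_triangle_ineq)
  also have "\<bar>fst \<zeta> ^ 3\<bar> \<le> ?N ^ 3" unfolding power_abs by (intro power_mono b) simp
  also have "\<bar>sgn (fst \<zeta>) * ?x powr \<alpha> * (snd \<zeta>)\<^sup>2\<bar> = ?x powr \<alpha> * \<bar>snd \<zeta>\<bar>\<^sup>2"
    using b(1) by (simp add: abs_mult abs_sgn_eq)
  also have "\<dots> \<le> ?N * ?N\<^sup>2" by (intro mult_mono power_mono pw b) auto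
  also have "?N ^ 3 + ?N * ?N\<^sup>2 = 2 * ?N ^ 3" by (simp add: power2_eq_square power3_eq_cube)
  finally show ?thesis by simp
qed

section \<open>Integrability of powers of the bracket\<close>

lemma powr_one_plus_finite:
  fixes \<beta> :: real
  assumes "\<beta> > 1"
  shows "(\<integral>\<^sup>+ x. ennreal ((1 + x\<^sup>2) powr (- \<beta> / 2)) \<partial>lborel) < \<infinity>"
proof -
  let ?f = "\<lambda>x. (1 + x) powr (- \<beta>)"
  have half: "(\<integral>\<^sup>+ x. ennreal (?f x) * indicator {0..} x \<partial>lborel) < \<infinity>"
  proof -
    have "(\<integral>\<^sup>+ x. ennreal (?f x) * indicator {0..} x \<partial>lborel) = ennreal (0 - (- ((1 + 0) powr (1 - \<beta>) / (\<beta> - 1))))"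
    proof (rule nn_integral_FTC_atLeast)
      show "((\<lambda>x. - ((1 + x) powr (1 - \<beta>) / (\<beta> - 1))) has_real_derivative ?f x) (at x)" if "0 \<le> x" for x
      proof -
        have "((\<lambda>x. - ((1 + x) powr (1 - \<beta>) / (\<beta> - 1))) has_real_derivative
            - ((1 - \<beta>) * (1 + x) powr (- \<beta>) / (\<beta> - 1))) (at x)"
          using that assms by (auto intro!: derivative_eq_intros)
        also have "- ((1 - \<beta>) * (1 + x) powr (- \<beta>) / (\<beta> - 1)) = ?f x"
          using assms by (simp add: divide_simps algebra_simps)
        finally show ?thesis .
      qed
      have "((\<lambda>x. (1 + x) powr (1 - \<beta>)) \<longlongrightarrow> 0) at_top"
        using assms by (intro tendsto_neg_powr filterlim_tendsto_add_at_top[OF tendsto_const] filterlim_ident) auto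
      from tendsto_minus[OF tendsto_divide[OF this tendsto_const[of "\<beta> - 1"]]] assms
      show "((\<lambda>x. - ((1 + x) powr (1 - \<beta>) / (\<beta> - 1))) \<longlongrightarrow> 0) at_top" by simp
    qed auto
    then show ?thesis by simp
  qed
  \<comment> \<open>The factor comes from (1 + |x|)^2 \<le> 2 (1 + x^2); \<open>?g x\<close> and
    \<open>?g (0 - x)\<close> cover the two half-lines.\<close>
  let ?g = "\<lambda>x. ennreal (2 powr (\<beta> / 2)) * (ennreal (?f x) * indicator {0..} x)"
  have g [measurable]: "?g \<in> borel_measurable borel" by measurable
  have "(\<integral>\<^sup>+ x. ennreal ((1 + x\<^sup>2) powr (- \<beta> / 2)) \<partial>lborel) \<le> (\<integral>\<^sup>+ x. ?g x + ?g (0 - x) \<partial>lborel)"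
  proof (rule nn_integral_mono)
    fix x :: real
    have "(1 + \<bar>x\<bar>)\<^sup>2 \<le> 2 * (1 + x\<^sup>2)"
      using sum_squares_bound[of 1 "\<bar>x\<bar>"] by (simp add: power2_sum)
    then have "(2 * (1 + x\<^sup>2)) powr (- \<beta> / 2) \<le> ((1 + \<bar>x\<bar>)\<^sup>2) powr (- \<beta> / 2)"
      using assms by (intro powr_mono2') auto
    also have "((1 + \<bar>x\<bar>)\<^sup>2) powr (- \<beta> / 2) = ?f \<bar>x\<bar>"
      by (simp add: powr_powr flip: powr_numeral)
    finally have le2: "2 powr (\<beta> / 2) * (2 * (1 + x\<^sup>2)) powr (- \<beta> / 2) \<le> 2 powr (\<beta> / 2) * ?f \<bar>x\<bar>"
      by (intro mult_left_mono) auto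
    have "(1 + x\<^sup>2) powr (- \<beta> / 2) \<le> 2 powr (\<beta> / 2) * ?f \<bar>x\<bar>"
    proof -
      have "2 powr (\<beta> / 2) * (2 * (1 + x\<^sup>2)) powr (- \<beta> / 2) =
          2 powr (\<beta> / 2 + - \<beta> / 2) * (1 + x\<^sup>2) powr (- \<beta> / 2)"
        unfolding powr_mult powr_add by (simp only: mult.assoc)
      then show ?thesis using le2 by simp
    qed
    then have "ennreal ((1 + x\<^sup>2) powr (- \<beta> / 2)) \<le> ennreal (2 powr (\<beta> / 2)) * ennreal (?f \<bar>x\<bar>)"
      by (simp add: ennreal_mult'[symmetric] ennreal_leI)
    also have "\<dots> \<le> ?g x + ?g (0 - x)"
      by (cases "x \<ge> 0") (auto simp: indicator_def)
    finally show "ennreal ((1 + x\<^sup>2) powr (- \<beta> / 2)) \<le> ?g x + ?g (0 - x)" .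
  qed
  also have "\<dots> = (\<integral>\<^sup>+ x. ?g x \<partial>lborel) + (\<integral>\<^sup>+ x. ?g (0 - x) \<partial>lborel)"
    by (rule nn_integral_add) measurable
  also have "(\<integral>\<^sup>+ x. ?g (0 - x) \<partial>lborel) = (\<integral>\<^sup>+ x. ?g x \<partial>lborel)"
    by (rule nn_integral_reflect[OF g])
  also have "(\<integral>\<^sup>+ x. ?g x \<partial>lborel) + (\<integral>\<^sup>+ x. ?g x \<partial>lborel) < \<infinity>"
    using half by (simp add: nn_integral_cmult ennreal_mult_less_top)
  finally show ?thesis .
qed

text \<open>(1 + |\<zeta>|^2)^2 dominates (1 + \<xi>^2) (1 + \<eta>^2), which separates the
  variables; each one-dimensional integral converges because s - 1 > 1.\<close>

lemma jb_powr_L2: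
  assumes s: "s > 2"
  shows "(\<lambda>\<zeta>. complex_of_real (jb \<zeta> powr (1 - s))) \<in> pts L2"
proof -
  let ?f = "\<lambda>x :: real. ennreal ((1 + x\<^sup>2) powr (- (s - 1) / 2))"
  have "l2_sq (\<lambda>\<zeta>. complex_of_real (jb \<zeta> powr (1 - s))) \<le> (\<integral>\<^sup>+ \<zeta>. ?f (fst \<zeta>) * ?f (snd \<zeta>) \<partial>lborel)"
    unfolding l2_sq_def
  proof (rule nn_integral_mono)
    fix \<zeta> :: plane
    have "(cmod (complex_of_real (jb \<zeta> powr (1 - s))))\<^sup>2 = (1 + (norm \<zeta>)\<^sup>2) powr (- (s - 1))"
      by (simp add: jb_def powr_half_sqrt[symmetric] powr_powr power2_eq_square powr_add[symmetric])
    also have "(1 + (norm \<zeta>)\<^sup>2) powr (- (s - 1)) = ((1 + (norm \<zeta>)\<^sup>2)\<^sup>2) powr (- (s - 1) / 2)"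
    proof -
      have "2 * (- (s - 1) / 2) = - (s - 1)" by simp
      with powr_powr[of "1 + (norm \<zeta>)\<^sup>2" 2 "- (s - 1) / 2"] show ?thesis
        by (simp only: powr_numeral[OF add_nonneg_nonneg[OF zero_le_one zero_le_power2]])
    qed
    also have "\<dots> \<le> ((1 + (fst \<zeta>)\<^sup>2) * (1 + (snd \<zeta>)\<^sup>2)) powr (- (s - 1) / 2)"
    proof (rule powr_mono2')
      have "(norm \<zeta>)\<^sup>2 = (fst \<zeta>)\<^sup>2 + (snd \<zeta>)\<^sup>2" by (simp add: norm_prod_def)
      then show "(1 + (fst \<zeta>)\<^sup>2) * (1 + (snd \<zeta>)\<^sup>2) \<le> (1 + (norm \<zeta>)\<^sup>2)\<^sup>2"
        unfolding power2_eq_square[of "1 + (norm \<zeta>)\<^sup>2"] by (intro mult_mono) auto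
    qed (use s in \<open>auto intro!: mult_pos_pos add_pos_nonneg\<close>)
    also have "\<dots> = (1 + (fst \<zeta>)\<^sup>2) powr (- (s - 1) / 2) * (1 + (snd \<zeta>)\<^sup>2) powr (- (s - 1) / 2)"
      by (rule powr_mult)
    finally show "ennreal ((cmod (complex_of_real (jb \<zeta> powr (1 - s))))\<^sup>2) \<le> ?f (fst \<zeta>) * ?f (snd \<zeta>)"
      by (simp add: ennreal_mult'[symmetric] ennreal_leI)
  qed
  also have "\<dots> = (\<integral>\<^sup>+ \<zeta>. ?f (fst \<zeta>) * ?f (snd \<zeta>) \<partial>(lborel \<Otimes>\<^sub>M lborel))" by (simp only: lborel_prod)
  also have "\<dots> = (\<integral>\<^sup>+ x. \<integral>\<^sup>+ y. ?f x * ?f y \<partial>lborel \<partial>lborel)"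
    by (subst lborel.nn_integral_fst[symmetric]) (simp_all add: lborel_prod)
  also have "\<dots> = (\<integral>\<^sup>+ x. ?f x \<partial>lborel) * (\<integral>\<^sup>+ x. ?f x \<partial>lborel)"
    by (simp add: nn_integral_cmult nn_integral_multc)
  also have "\<dots> < \<infinity>"
    using powr_one_plus_finite[of "s - 1"] s by (simp add: ennreal_mult_less_top)
  finally show ?thesis by (simp add: L2_iff)
qed

definition emb_const :: "real \<Rightarrow> real" where
  "emb_const s = n2 (\<lambda>\<zeta>. complex_of_real (jb \<zeta> powr (1 - s)))"

text \<open>Cauchy-Schwarz after writing \<open>jb\<close> as its power 1 - s times its power s. The
  factor \<open>jb\<close> beyond mere integrability of the transform is the bound on the gradient
  of \<open>u\<close> that the transport and commutator estimates consume.\<close>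

lemma weighted_L1:
  assumes s: "s > 2" and [measurable]: "V \<in> borel_measurable borel"
    and V: "wt (\<lambda>\<zeta>. jb \<zeta> powr s) V \<in> pts L2"
  shows "integrable lborel (wt jb V)"
    "(LINT \<zeta>|lborel. jb \<zeta> * cmod (V \<zeta>)) \<le> emb_const s * n2 (wt (\<lambda>\<zeta>. jb \<zeta> powr s) V)"
proof -
  note I = L2_integrable[OF jb_powr_L2[OF s] V]
  have "jb \<zeta> powr (1 - s) * jb \<zeta> powr s = jb \<zeta>" for \<zeta>
    by (simp add: powr_add[symmetric])
  then have e: "jb \<zeta> powr (1 - s) * (jb \<zeta> powr s * x) = jb \<zeta> * x" for \<zeta> x
    by (simp add: mult.assoc[symmetric])
  have e': "complex_of_real (jb \<zeta> powr (1 - s)) * (complex_of_real (jb \<zeta> powr s) * x) = of_real (jb \<zeta>) * x" for \<zeta> and x :: complex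
    using e[of \<zeta> 1] by (simp add: mult.assoc[symmetric] of_real_mult[symmetric] del: of_real_mult)
  show "integrable lborel (wt jb V)" using I(1) by (simp only: e')
  show "(LINT \<zeta>|lborel. jb \<zeta> * cmod (V \<zeta>)) \<le> emb_const s * n2 (wt (\<lambda>\<zeta>. jb \<zeta> powr s) V)"
    using I(4) by (simp add: norm_mult e emb_const_def)
qed

subsection \<open>Solutions on the Fourier side\<close>

lemma wt_measurable [measurable]:
  assumes [measurable]: "\<mu> \<in> borel_measurable borel" "U \<in> borel_measurable borel"
  shows "wt \<mu> U \<in> borel_measurable borel"
  by measurable

lemma wt_L2_dom:
  assumes U: "wt \<nu> U \<in> pts L2" and m: "\<mu> \<in> borel_measurable borel" "U \<in> borel_measurable borel"
    and c: "0 \<le> c" and le: "\<And>\<zeta>. \<bar>\<mu> \<zeta>\<bar> \<le> c * \<bar>\<nu> \<zeta>\<bar>"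
  shows "wt \<mu> U \<in> pts L2" "n2 (wt \<mu> U) \<le> c * n2 (wt \<nu> U)"
proof -
  have "AE \<zeta> in lborel. cmod (wt \<mu> U \<zeta>) \<le> c * cmod (wt \<nu> U \<zeta>)"
    by (rule AE_I2) (simp add: norm_mult mult.assoc[symmetric] mult_right_mono[OF le])
  from L2_dom[OF wt_measurable[OF m] U c this]
  show "wt \<mu> U \<in> pts L2" "n2 (wt \<mu> U) \<le> c * n2 (wt \<nu> U)" .
qed

text \<open>An additive weight acts as a derivative on the Fourier side, and this is its product
  rule; \<open>l\<close> will be \<open>fst\<close> or \<open>snd\<close>.\<close>

lemma conv_leibniz:
  assumes "U \<in> pts L2" "V \<in> pts L2" "wt l U \<in> pts L2" "wt l V \<in> pts L2"
    and l: "\<And>x y. l x = l (x - y) + l y"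
  shows "of_real (l \<zeta>) * conv U V \<zeta> = conv (wt l U) V \<zeta> + conv U (wt l V) \<zeta>"
proof -
  have "of_real (l \<zeta>) * conv U V \<zeta> = (LINT \<zeta>'|lborel. of_real (l \<zeta>) * (U (\<zeta> - \<zeta>') * V \<zeta>'))"
    unfolding conv_def by (rule integral_mult_right_zero[symmetric])
  also have "\<dots> = (LINT \<zeta>'|lborel. wt l U (\<zeta> - \<zeta>') * V \<zeta>' + U (\<zeta> - \<zeta>') * wt l V \<zeta>')"
  proof (rule Bochner_Integration.integral_cong[OF refl])
    fix \<zeta>'
    show "of_real (l \<zeta>) * (U (\<zeta> - \<zeta>') * V \<zeta>') = wt l U (\<zeta> - \<zeta>') * V \<zeta>' + U (\<zeta> - \<zeta>') * wt l V \<zeta>'"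
      by (subst l[of \<zeta> \<zeta>']) (simp add: algebra_simps)
  qed
  also have "\<dots> = conv (wt l U) V \<zeta> + conv U (wt l V) \<zeta>"
    unfolding conv_def by (rule Bochner_Integration.integral_add) (intro conv_integrable assms)+
  finally show ?thesis .
qed

lemma conv_self_leibniz:
  assumes "U \<in> pts L2" "wt l U \<in> pts L2" and l: "\<And>x y. l x = l (x - y) + l y"
  shows "of_real (l \<zeta>) * conv U U \<zeta> = 2 * conv U (wt l U) \<zeta>"
  using conv_leibniz[OF assms(1,1,2,2) l, of \<zeta>] conv_commute[OF L2_measurable L2_measurable, OF assms(2,1)]
  by simp

lemma conv_cmult: "conv U (\<lambda>z. c * V z) \<zeta> = c * conv U V \<zeta>"
proof -
  have "conv U (\<lambda>z. c * V z) \<zeta> = (LINT \<zeta>'|lborel. c * (U (\<zeta> - \<zeta>') * V \<zeta>'))"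
    unfolding conv_def by (simp only: ac_simps)
  also have "\<dots> = c * conv U V \<zeta>" unfolding conv_def by (rule integral_mult_right_zero)
  finally show ?thesis .
qed

text \<open>The transform of \<open>u u\<^sub>x = \<partial>\<^sub>x (u\<^sup>2) / 2\<close>; the constant combines the factors \<open>1 / 2\<close> and \<open>1 / (2 * pi)\<close>.\<close>

definition nonlin :: "func \<Rightarrow> func" where
  "nonlin U \<zeta> = \<i> * of_real (fst \<zeta> / (4 * pi)) * conv U U \<zeta>"

lemma nonlin_measurable [measurable]: "U \<in> borel_measurable borel \<Longrightarrow> nonlin U \<in> borel_measurable borel"
  unfolding nonlin_def[abs_def] by measurable

abbreviation wdist :: "(plane \<Rightarrow> real) \<Rightarrow> func \<Rightarrow> func \<Rightarrow> real" where
  "wdist \<mu> U V \<equiv> n2 (wt \<mu> (\<lambda>\<zeta>. U \<zeta> - V \<zeta>))"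

text \<open>What the estimates use of a solution, with the equation kept only in L2 of each window.
  The symmetry under reflection is the reality of \<open>u\<close>; it makes the transport term
  symmetric later on.\<close>

definition fsol :: "real \<Rightarrow> real \<Rightarrow> real \<Rightarrow> (real \<Rightarrow> func) \<Rightarrow> bool" where
  "fsol \<alpha> s T U \<longleftrightarrow>
    (\<forall>t\<in>{0..T}. U t \<in> borel_measurable borel \<and> wt (\<lambda>\<zeta>. jb \<zeta> powr s) (U t) \<in> pts L2 \<and>
       (AE \<zeta> in lborel. U t (- \<zeta>) = cnj (U t \<zeta>)) \<and>
       ((\<lambda>r. n2 (wt (\<lambda>\<zeta>. jb \<zeta> powr s) (\<lambda>\<zeta>. U r \<zeta> - U t \<zeta>))) \<longlongrightarrow> 0) (at t within {0..T}) \<and>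
       (\<forall>n. ((\<lambda>r. n2 (\<lambda>\<zeta>. indicator (window n) \<zeta> * ((U r \<zeta> - U t \<zeta>) / of_real (r - t) -
          (\<i> * of_real (psym \<alpha> \<zeta>) * U t \<zeta> + nonlin (U t) \<zeta>)))) \<longlongrightarrow> 0) (at t within {0..T})))"

lemma jb_weight_L2:
  assumes "0 \<le> s" and U: "U \<in> borel_measurable borel" "wt (\<lambda>\<zeta>. jb \<zeta> powr s) U \<in> pts L2"
  shows "U \<in> pts L2" "n2 U \<le> n2 (wt (\<lambda>\<zeta>. jb \<zeta> powr s) U)"
  using wt_L2_dom[OF U(2) _ U(1), of "\<lambda>_. 1" 1] jb_powr_ge_1[OF assms(1)] by auto

lemma jb_le_powr: "1 \<le> s \<Longrightarrow> jb \<zeta> \<le> jb \<zeta> powr s"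
  using powr_mono[of 1 s "jb \<zeta>"] jb_ge_1[of \<zeta>] by simp

lemma L1_of_jb:
  assumes [measurable]: "V \<in> borel_measurable borel" and V: "integrable lborel (wt jb V)"
  shows "integrable lborel V" "(LINT z|lborel. cmod (V z)) \<le> (LINT z|lborel. jb z * cmod (V z))"
proof -
  have le: "cmod (V z) \<le> jb z * cmod (V z)" for z
    using mult_right_mono[OF jb_ge_1[of z] norm_ge_zero[of "V z"]] by simp
  show i: "integrable lborel V"
    by (rule Bochner_Integration.integrable_bound[OF V]) (auto simp: norm_mult le)
  have "integrable lborel (\<lambda>z. jb z * cmod (V z))" using integrable_norm[OF V] by (simp add: norm_mult)
  then show "(LINT z|lborel. cmod (V z)) \<le> (LINT z|lborel. jb z * cmod (V z))"
    using i le by (intro integral_mono) auto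
qed

text \<open>A function living on a window is the transform of an admissible test function once it is
  scaled down. On the window \<open>jb\<close> is at most n + 2 and 1 / |\<xi>| at most n + 1, so
  both weights in the norm of \<open>X 3\<close> are at most (n + 2)^4; the 2 adds the two parts of
  the norm.\<close>

lemma test_function:
  assumes y: "y \<in> pts L2" "\<And>\<zeta>. \<zeta> \<notin> window n \<Longrightarrow> y \<zeta> = 0" and small: "2 * real (n + 2) ^ 4 * n2 y \<le> 1"
  shows "\<exists>\<phi>\<in>pts (X 3). nrm (X 3) \<phi> \<le> 1 \<and> (AE \<zeta> in lborel. fourier \<phi> \<zeta> = y \<zeta>)"
proof -
  let ?N = "real (n + 2)"
  note [measurable] = L2_measurable[OF y(1)]
  obtain \<phi> where \<phi>: "\<phi> \<in> pts L2" "AE \<zeta> in lborel. fourier \<phi> \<zeta> = y \<zeta>" using fourier_inverse[OF y(1)] by blast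
  note [measurable] = fourier_measurable[OF \<phi>(1)]
  have wb: "wt \<mu> (fourier \<phi>) \<in> pts L2 \<and> n2 (wt \<mu> (fourier \<phi>)) \<le> ?N ^ 4 * n2 y"
    if [measurable]: "\<mu> \<in> borel_measurable borel" and b: "\<And>\<zeta>. \<zeta> \<in> window n \<Longrightarrow> \<bar>\<mu> \<zeta>\<bar> \<le> ?N ^ 4" for \<mu>
  proof -
    have ae: "AE \<zeta> in lborel. wt \<mu> (fourier \<phi>) \<zeta> = wt \<mu> y \<zeta>" by (rule wt_cong_AE[OF \<phi>(2)])
    have "AE \<zeta> in lborel. cmod (wt \<mu> y \<zeta>) \<le> ?N ^ 4 * cmod (y \<zeta>)"
    proof (rule AE_I2)
      fix \<zeta> show "cmod (wt \<mu> y \<zeta>) \<le> ?N ^ 4 * cmod (y \<zeta>)"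
        using b[of \<zeta>] y(2)[of \<zeta>] by (cases "\<zeta> \<in> window n") (auto simp: norm_mult intro!: mult_right_mono)
    qed
    from L2_dom[OF _ y(1) _ this] have "wt \<mu> y \<in> pts L2" "n2 (wt \<mu> y) \<le> ?N ^ 4 * n2 y" by auto
    with n2_cong[OF ae] L2_cong_AE[OF ae] show ?thesis by simp
  qed
  have N1: "1 \<le> ?N" by simp
  have j3: "jb \<zeta> powr 3 \<le> ?N ^ 3" if "\<zeta> \<in> window n" for \<zeta>
  proof -
    have "jb \<zeta> powr 3 = jb \<zeta> ^ 3" by (rule powr_numeral[OF less_imp_le[OF jb_pos]])
    also have "\<dots> \<le> ?N ^ 3" using window_bounds(5)[OF that] by (intro power_mono) (auto simp: less_imp_le)
    finally show ?thesis .
  qed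
  have w1: "wt (\<lambda>\<zeta>. jb \<zeta> powr 3) (fourier \<phi>) \<in> pts L2 \<and> n2 (wt (\<lambda>\<zeta>. jb \<zeta> powr 3) (fourier \<phi>)) \<le> ?N ^ 4 * n2 y"
  proof (rule wb)
    fix \<zeta> assume "\<zeta> \<in> window n"
    have "?N ^ 3 \<le> ?N ^ 4" by (rule power_increasing[OF _ N1]) simp
    from order_trans[OF j3[OF \<open>\<zeta> \<in> window n\<close>] this] show "\<bar>jb \<zeta> powr 3\<bar> \<le> ?N ^ 4"
      by (simp only: abs_of_nonneg powr_ge_zero)
  qed measurable
  have w2: "wt (\<lambda>\<zeta>. jb \<zeta> powr 3 * cmod (dx_inv \<zeta>)) (fourier \<phi>) \<in> pts L2 \<and>
      n2 (wt (\<lambda>\<zeta>. jb \<zeta> powr 3 * cmod (dx_inv \<zeta>)) (fourier \<phi>)) \<le> ?N ^ 4 * n2 y"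
  proof (rule wb)
    fix \<zeta> assume w: "\<zeta> \<in> window n"
    have "cmod (dx_inv \<zeta>) = inverse \<bar>fst \<zeta>\<bar>" by (simp add: dx_inv_def case_prod_beta norm_inverse norm_mult)
    then have "cmod (dx_inv \<zeta>) \<le> ?N" using window_bounds(2)[OF w] by simp
    with j3[OF w] have "jb \<zeta> powr 3 * cmod (dx_inv \<zeta>) \<le> ?N ^ 3 * ?N" by (intro mult_mono) auto
    then show "\<bar>jb \<zeta> powr 3 * cmod (dx_inv \<zeta>)\<bar> \<le> ?N ^ 4" by (simp add: power_Suc2[symmetric] numeral_eq_Suc)
  qed measurable
  have XH: "\<phi> \<in> pts (X 3)" unfolding X_def
    by (subst graph_H(1)) (use w1 w2 \<phi> in \<open>auto simp: H_iff\<close>)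
  have "nrm (X 3) \<phi> = sqrt ((nrm (H 3) \<phi>)\<^sup>2 + (n2 (wt (\<lambda>\<zeta>. jb \<zeta> powr 3 * cmod (dx_inv \<zeta>)) (fourier \<phi>)))\<^sup>2)"
    using XH unfolding X_def by (intro graph_H(2)) auto
  also have "\<dots> \<le> nrm (H 3) \<phi> + n2 (wt (\<lambda>\<zeta>. jb \<zeta> powr 3 * cmod (dx_inv \<zeta>)) (fourier \<phi>))"
    by (intro sqrt_sum_squares_le_sum) (simp_all add: nrm_H)
  also have "\<dots> \<le> 2 * ?N ^ 4 * n2 y" using w1 w2 by (simp add: nrm_H)
  also have "\<dots> \<le> 1" by (rule small)
  finally show ?thesis using XH \<phi>(2) by blast
qed

text \<open>The normalised multiple of \<open>y\<close> is the transform of a test function in the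
  unit ball, on which \<open>\<Lambda>\<close> acts as the pairing with \<open>y\<close>. This
  recovers the norm of \<open>y\<close> up to the loss in \<open>test_function\<close>.\<close>

lemma dual_norm_window_bound:
  assumes y: "y \<in> pts L2" "\<And>\<zeta>. \<zeta> \<notin> window n \<Longrightarrow> y \<zeta> = 0"
    and \<Lambda>: "\<And>\<phi> c. \<phi> \<in> pts (X 3) \<Longrightarrow> (AE \<zeta> in lborel. fourier \<phi> \<zeta> = of_real c * y \<zeta>) \<Longrightarrow>
      \<Lambda> \<phi> = of_real (c * (n2 y)\<^sup>2)"
  shows "ennreal (n2 y) \<le> ennreal (2 * real (n + 2) ^ 4) * dual_norm \<Lambda>"
proof (cases "n2 y = 0")
  case False
  let ?K = "2 * real (n + 2) ^ 4"
  have K: "0 < ?K" by simp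
  have p: "0 < n2 y" using False n2_nonneg[of y] by linarith
  define c where "c = 1 / (?K * n2 y)"
  have c: "0 < c" using K p by (simp add: c_def)
  have "?K * n2 (\<lambda>\<zeta>. of_real c * y \<zeta>) \<le> 1"
  proof -
    have nz: "?K * n2 y \<noteq> 0" using mult_pos_pos[OF K p] by (rule less_imp_neq[symmetric])
    have "?K * n2 (\<lambda>\<zeta>. of_real c * y \<zeta>) = ?K * (c * n2 y)"
      using c unfolding L2_cmult(2)[OF y(1)] norm_of_real by (simp only: abs_of_pos)
    also have "\<dots> = (?K * n2 y) * (1 / (?K * n2 y))" by (simp only: c_def ac_simps)
    also have "\<dots> = 1" by (simp only: times_divide_eq_right mult_1_right divide_self[OF nz])
    finally show ?thesis by simp
  qed
  from test_function[OF L2_cmult(1)[OF y(1)] _ this] y(2)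
  obtain \<phi> where \<phi>: "\<phi> \<in> pts (X 3)" "nrm (X 3) \<phi> \<le> 1" "AE \<zeta> in lborel. fourier \<phi> \<zeta> = of_real c * y \<zeta>" by auto
  have e: "c * (n2 y)\<^sup>2 = n2 y / ?K" using p by (simp add: c_def power2_eq_square)
  have "ennreal (cmod (\<Lambda> \<phi>)) \<le> dual_norm \<Lambda>"
    unfolding dual_norm_def by (rule SUP_upper) (use \<phi> in simp)
  then have "ennreal (n2 y / ?K) \<le> dual_norm \<Lambda>"
    using \<Lambda>[OF \<phi>(1,3)] p K unfolding e by (simp only: norm_of_real) simp
  then have "ennreal ?K * ennreal (n2 y / ?K) \<le> ennreal ?K * dual_norm \<Lambda>" by (rule mult_left_mono) simp
  also have "ennreal ?K * ennreal (n2 y / ?K) = ennreal (n2 y)"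
    by (subst ennreal_mult'[symmetric]) auto
  finally show ?thesis .
qed simp

lemma embed_window:
  assumes f: "f \<in> pts L2" and \<phi>: "\<phi> \<in> pts L2" and [measurable]: "y \<in> borel_measurable borel"
    and y: "\<And>\<zeta>. \<zeta> \<notin> A \<Longrightarrow> y \<zeta> = 0" "AE \<zeta> in lborel. fourier \<phi> \<zeta> = y \<zeta>"
  shows "embed f \<phi> = ip (\<lambda>\<zeta>. indicator A \<zeta> * fourier f \<zeta>) y"
proof -
  have "embed f \<phi> = ip (fourier f) (fourier \<phi>)" by (simp add: embed_def parseval f \<phi> ip_def[symmetric])
  also have "\<dots> = ip (fourier f) y"
    by (rule ip_cong) (auto intro!: y fourier_measurable f \<phi>)
  also have "\<dots> = ip (\<lambda>\<zeta>. indicator A \<zeta> * fourier f \<zeta>) y"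
    unfolding ip_def
  proof (rule Bochner_Integration.integral_cong[OF refl])
    fix \<zeta> show "fourier f \<zeta> * cnj (y \<zeta>) = indicator A \<zeta> * fourier f \<zeta> * cnj (y \<zeta>)"
      using y(1)[of \<zeta>] by (cases "\<zeta> \<in> A") auto
  qed
  finally show ?thesis .
qed

text \<open>The product formula gives the convolution of U with \<i> \<xi> U; the Leibniz rule for a
  self-convolution then brings \<xi> to the front. The weights of size 1 / |\<xi>| depend on this
  form.\<close>

lemma fourier_nonlin:
  assumes s: "s > 2" and u: "u \<in> pts (H s)"
  shows "(\<lambda>z. u z * fmult dx u z) \<in> pts L2"
    "AE \<zeta> in lborel. fourier (\<lambda>z. u z * fmult dx u z) \<zeta> = nonlin (fourier u) \<zeta>"
proof -
  have uL: "u \<in> pts L2" and w: "wt (\<lambda>\<zeta>. jb \<zeta> powr s) (fourier u) \<in> pts L2" using u by (auto simp: H_iff)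
  note m [measurable] = fourier_measurable[OF uL]
  note FL = fourier_L2(1)[OF uL]
  have wf: "wt fst (fourier u) \<in> pts L2"
  proof (rule wt_L2_dom(1)[OF w _ m, of _ 1])
    fix \<zeta> :: plane
    have "\<bar>fst \<zeta>\<bar> \<le> jb \<zeta> powr s"
      using fst_snd_le_norm(1)[of \<zeta>] norm_le_jb[of \<zeta>] jb_le_powr[of s \<zeta>] s by linarith
    then show "\<bar>fst \<zeta>\<bar> \<le> 1 * \<bar>jb \<zeta> powr s\<bar>" by simp
  qed auto
  have dxe: "(\<lambda>\<zeta>. dx \<zeta> * fourier u \<zeta>) = (\<lambda>\<zeta>. \<i> * wt fst (fourier u) \<zeta>)"
    by (auto simp: dx_def case_prod_beta)
  have dom: "u \<in> mult_dom dx" using uL L2_cmult(1)[OF wf, of \<i>] by (simp add: mult_dom_iff dxe)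
  note v = fmult_L2[OF dom]
  have int: "integrable lborel (fourier u)"
    by (rule L1_of_jb(1)[OF m weighted_L1(1)[OF s m w]])
  note P = fourier_product[OF uL int v(1)]
  show "(\<lambda>z. u z * fmult dx u z) \<in> pts L2" by (rule P(1))
  have vdx: "AE \<zeta> in lborel. fourier (fmult dx u) \<zeta> = \<i> * wt fst (fourier u) \<zeta>"
    using v(2) by (simp add: dxe[THEN fun_cong])
  have "conv (fourier u) (fourier (fmult dx u)) \<zeta> = \<i> * conv (fourier u) (wt fst (fourier u)) \<zeta>" for \<zeta>
    using conv_cong_right[OF m fourier_measurable[OF v(1)] _ vdx] conv_cmult[of "fourier u" \<i>] by simp
  moreover have "of_real (fst \<zeta>) * conv (fourier u) (fourier u) \<zeta> = 2 * conv (fourier u) (wt fst (fourier u)) \<zeta>" for \<zeta>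
    by (rule conv_self_leibniz[OF FL wf]) simp
  ultimately have "of_real (1 / (2 * pi)) * conv (fourier u) (fourier (fmult dx u)) \<zeta> = nonlin (fourier u) \<zeta>" for \<zeta>
    by (simp add: nonlin_def field_simps)
  with P(2) show "AE \<zeta> in lborel. fourier (\<lambda>z. u z * fmult dx u z) \<zeta> = nonlin (fourier u) \<zeta>" by simp
qed

text \<open>\<open>y\<close> is the transform of the error of the difference quotient, cut to a
  window. By Parseval the functional acts on test functions of the window as the pairing with
  \<open>y\<close>, so convergence in the dual of \<open>X 3\<close> forces convergence in L2
  there.\<close>

lemma solution_window_bound:
  fixes h :: real and n :: nat
  assumes s: "s > 2" and \<alpha>: "-1 \<le> \<alpha>" "\<alpha> \<le> 1" and ur: "ur \<in> pts (H s)" and ut: "ut \<in> pts (H s)"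
  defines "y \<equiv> \<lambda>\<zeta>. indicator (window n) \<zeta> * ((fourier ur \<zeta> - fourier ut \<zeta>) / of_real h -
          (\<i> * of_real (psym \<alpha> \<zeta>) * fourier ut \<zeta> + nonlin (fourier ut) \<zeta>))"
  shows "ennreal (n2 y) \<le> ennreal (2 * real (n + 2) ^ 4) *
    dual_norm (\<lambda>\<phi>. (embed ur \<phi> - embed ut \<phi>) / complex_of_real h
                          - (lin_op \<alpha> ut \<phi> + embed (\<lambda>z. ut z * fmult dx ut z) \<phi>))"
proof -
  have uL: "ur \<in> pts L2" "ut \<in> pts L2" using ur ut by (auto simp: H_iff)
  let ?g = "\<lambda>z. ut z * fmult dx ut z"
  note g = fourier_nonlin[OF s ut]
  note [measurable] = fourier_measurable[OF uL(1)] fourier_measurable[OF uL(2)] fourier_measurable[OF g(1)]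
  define I where "I f = (\<lambda>\<zeta>. indicator (window n) \<zeta> * f \<zeta> :: complex)" for f
  define l where "l = (\<lambda>\<zeta>. lin_symbol \<alpha> \<zeta> * fourier ut \<zeta>)"
  have [measurable]: "l \<in> borel_measurable borel" unfolding l_def by measurable
  have IL: "I f \<in> pts L2" if "f \<in> pts L2" for f
    by (rule L2_dom(1)[where c=1, OF _ that]) (use L2_measurable[OF that] in \<open>auto simp: I_def norm_mult indicator_def\<close>)
  have Il: "I l \<in> pts L2"
  proof (rule L2_dom(1)[where c="2 * real (Suc n) ^ 3", OF _ fourier_L2(1)[OF uL(2)]])
    show "I l \<in> borel_measurable borel" unfolding I_def by measurable
    show "AE \<zeta> in lborel. cmod (I l \<zeta>) \<le> 2 * real (Suc n) ^ 3 * cmod (fourier ut \<zeta>)"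
    proof (rule AE_I2)
      fix \<zeta> show "cmod (I l \<zeta>) \<le> 2 * real (Suc n) ^ 3 * cmod (fourier ut \<zeta>)"
        using psym_window_bound[OF _ \<alpha>, of \<zeta> n] mult_right_mono[OF psym_window_bound[OF _ \<alpha>, of \<zeta> n], of "cmod (fourier ut \<zeta>)"]
        by (cases "\<zeta> \<in> window n") (auto simp: I_def l_def lin_symbol_eq norm_mult)
    qed
  qed simp
  note L = IL[OF fourier_L2(1)[OF uL(1)]] IL[OF fourier_L2(1)[OF uL(2)]] Il IL[OF fourier_L2(1)[OF g(1)]]
  define y' where "y' = (\<lambda>\<zeta>. (of_real (1 / h) * (I (fourier ur) \<zeta> - I (fourier ut) \<zeta>)) - (I l \<zeta> + I (fourier ?g) \<zeta>))"
  have y'L: "y' \<in> pts L2" unfolding y'_def by (intro L2_diff(1) L2_cmult(1) L2_add(1) L)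
  have y'0: "y' \<zeta> = 0" if "\<zeta> \<notin> window n" for \<zeta> using that by (simp add: y'_def I_def)
  have yy: "n2 y = n2 y'"
  proof (rule n2_cong, use g(2) in eventually_elim)
    case (elim \<zeta>)
    then show ?case by (simp add: y_def y'_def I_def l_def lin_symbol_eq algebra_simps diff_divide_distrib)
  qed
  show ?thesis unfolding yy
  proof (rule dual_norm_window_bound[OF y'L y'0])
    fix \<phi> c assume \<phi>: "\<phi> \<in> pts (X 3)" "AE \<zeta> in lborel. fourier \<phi> \<zeta> = of_real c * y' \<zeta>"
    then have \<phi>L: "\<phi> \<in> pts L2" by (auto simp: X_def graph_space_def H_iff)
    let ?cy = "\<lambda>\<zeta>. of_real c * y' \<zeta>"
    have cyL: "?cy \<in> pts L2" by (rule L2_cmult(1)[OF y'L])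
    note [measurable] = L2_measurable[OF cyL] fourier_measurable[OF \<phi>L]
    have e: "embed f \<phi> = ip (I (fourier f)) ?cy" if "f \<in> pts L2" for f
      unfolding I_def by (rule embed_window[OF that \<phi>L _ _ \<phi>(2)]) (auto simp: y'0)
    have "lin_op \<alpha> ut \<phi> = (LINT \<zeta>|lborel. I l \<zeta> * cnj (?cy \<zeta>))"
      unfolding lin_op_def
    proof (rule integral_cong_AE)
      show "AE \<zeta> in lborel. lin_symbol \<alpha> \<zeta> * fourier ut \<zeta> * cnj (fourier \<phi> \<zeta>) = I l \<zeta> * cnj (?cy \<zeta>)"
        using \<phi>(2)
      proof eventually_elim
        case (elim \<zeta>)
        then show ?case by (cases "\<zeta> \<in> window n") (simp_all add: I_def l_def y'0)
      qed
      show "(\<lambda>\<zeta>. I l \<zeta> * cnj (?cy \<zeta>)) \<in> borel_measurable lborel" using L2_measurable[OF Il] L2_measurable[OF y'L] by measurable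
    qed simp
    then have lin: "lin_op \<alpha> ut \<phi> = ip (I l) ?cy" by (simp add: ip_def)
    have "(embed ur \<phi> - embed ut \<phi>) / complex_of_real h - (lin_op \<alpha> ut \<phi> + embed ?g \<phi>) =
        of_real (1 / h) * (ip (I (fourier ur)) ?cy - ip (I (fourier ut)) ?cy) - (ip (I l) ?cy + ip (I (fourier ?g)) ?cy)"
      by (simp only: e[OF uL(1)] e[OF uL(2)] e[OF g(1)] lin) (simp add: field_simps)
    also have "\<dots> = ip y' ?cy"
      unfolding y'_def[of] ip_cmult_left[symmetric]
      by (simp only: ip_diff_left[OF L2_cmult(1)[OF L2_diff(1)[OF L(1,2)]] L2_add(1)[OF L(3,4)] cyL[unfolded y'_def]]
          ip_cmult_left ip_diff_left[OF L(1,2) cyL[unfolded y'_def]] ip_add_left[OF L(3,4) cyL[unfolded y'_def]])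
    also have "\<dots> = of_real (c * (n2 y')\<^sup>2)"
      by (simp only: ip_cmult_right ip_self(1)[OF y'L]) simp
    finally show "(embed ur \<phi> - embed ut \<phi>) / complex_of_real h - (lin_op \<alpha> ut \<phi> + embed ?g \<phi>) = of_real (c * (n2 y')\<^sup>2)" .
  qed
qed

lemma fsol_of_solution:
  assumes s: "s > 2" and \<alpha>: "-1 \<le> \<alpha>" "\<alpha> \<le> 1" and sol: "is_solution \<alpha> s T \<psi> u"
  shows "fsol \<alpha> s T (\<lambda>t. fourier (u t))"
  unfolding fsol_def
proof (intro ballI conjI allI)
  fix t assume t: "t \<in> {0..T}"
  have uH: "u r \<in> pts (H s)" if "r \<in> {0..T}" for r using sol that by (auto simp: is_solution_def cont_into_def)
  have uL: "u r \<in> pts L2" if "r \<in> {0..T}" for r using uH[OF that] by (simp add: H_iff)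
  have in_T: "eventually (\<lambda>r. r \<in> {0..T}) (at t within {0..T})" by (simp add: eventually_at_filter)
  show "fourier (u t) \<in> borel_measurable borel" by (rule fourier_measurable[OF uL[OF t]])
  show "wt (\<lambda>\<zeta>. jb \<zeta> powr s) (fourier (u t)) \<in> pts L2" using uH[OF t] by (simp add: H_iff)
  show "AE \<zeta> in lborel. fourier (u t) (- \<zeta>) = cnj (fourier (u t) \<zeta>)"
  proof -
    note [measurable] = L2_measurable[OF uL[OF t]]
    have "AE z in lborel. u t z \<in> \<real>" using sol t by (auto simp: is_solution_def real_valued_def)
    then have "AE z in lborel. cnj (u t z) = u t z" by eventually_elim (simp add: Reals_cnj_iff)
    then have eq: "fourier (\<lambda>z. cnj (u t z)) = fourier (u t)" by (rule fourier_cong[rotated 2]) measurable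
    from fourier_cnj[OF uL[OF t], unfolded eq] show ?thesis
    proof eventually_elim
      case (elim \<zeta>)
      show ?case by (simp only: elim complex_cnj_cnj)
    qed
  qed
  show "((\<lambda>r. n2 (wt (\<lambda>\<zeta>. jb \<zeta> powr s) (\<lambda>\<zeta>. fourier (u r) \<zeta> - fourier (u t) \<zeta>))) \<longlongrightarrow> 0) (at t within {0..T})"
  proof (rule Lim_transform_eventually)
    show "((\<lambda>r. nrm (H s) (\<lambda>z. u r z - u t z)) \<longlongrightarrow> 0) (at t within {0..T})"
      using sol t by (auto simp: is_solution_def cont_into_def)
    show "eventually (\<lambda>r. nrm (H s) (\<lambda>z. u r z - u t z) =
        n2 (wt (\<lambda>\<zeta>. jb \<zeta> powr s) (\<lambda>\<zeta>. fourier (u r) \<zeta> - fourier (u t) \<zeta>))) (at t within {0..T})"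
      using in_T
    proof eventually_elim
      case (elim r)
      show ?case unfolding nrm_H by (rule n2_cong[OF wt_cong_AE[OF fourier_diff[OF uL[OF elim] uL[OF t]]]])
    qed
  qed
  fix n
  let ?y = "\<lambda>r \<zeta>. indicator (window n) \<zeta> * ((fourier (u r) \<zeta> - fourier (u t) \<zeta>) / of_real (r - t) -
          (\<i> * of_real (psym \<alpha> \<zeta>) * fourier (u t) \<zeta> + nonlin (fourier (u t)) \<zeta>))"
  let ?d = "\<lambda>r. dual_norm (\<lambda>\<phi>. (embed (u r) \<phi> - embed (u t) \<phi>) / complex_of_real (r - t)
                          - (lin_op \<alpha> (u t) \<phi> + embed (\<lambda>z. u t z * fmult dx (u t) z) \<phi>))"
  have "(?d \<longlongrightarrow> 0) (at t within {0..T})" using sol t by (auto simp: is_solution_def solves_at_def)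
  then have "((\<lambda>r. ennreal (2 * real (n + 2) ^ 4) * ?d r) \<longlongrightarrow> ennreal (2 * real (n + 2) ^ 4) * 0) (at t within {0..T})"
    by (intro ennreal_tendsto_cmult) auto
  then have lim: "((\<lambda>r. ennreal (2 * real (n + 2) ^ 4) * ?d r) \<longlongrightarrow> 0) (at t within {0..T})" by simp
  have "((\<lambda>r. ennreal (n2 (?y r))) \<longlongrightarrow> 0) (at t within {0..T})"
  proof (rule tendsto_sandwich[OF _ _ tendsto_const lim])
    show "eventually (\<lambda>r. ennreal (n2 (?y r)) \<le> ennreal (2 * real (n + 2) ^ 4) * ?d r) (at t within {0..T})"
      using in_T by eventually_elim (rule solution_window_bound[OF s \<alpha> uH uH[OF t]])
  qed simp
  then have "((\<lambda>r. enn2real (ennreal (n2 (?y r)))) \<longlongrightarrow> enn2real 0) (at t within {0..T})"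
    by (intro tendsto_enn2real) auto
  then show "((\<lambda>r. n2 (?y r)) \<longlongrightarrow> 0) (at t within {0..T})"
    by (simp only: enn2real_ennreal[OF n2_nonneg] enn2real_0)
qed

subsection \<open>Energy identities\<close>

lemma gronwall:
  fixes f f' :: "real \<Rightarrow> real"
  assumes d: "\<And>t. t \<in> {0..T} \<Longrightarrow> (f has_real_derivative f' t) (at t within {0..T})"
    and le: "\<And>t. t \<in> {0..T} \<Longrightarrow> f' t \<le> a * f t + b"
    and ab: "0 \<le> a" "0 \<le> b" and t: "t \<in> {0..T}" and f0: "0 \<le> f 0"
  shows "f t \<le> exp (a * T) * (f 0 + T * b)"
proof -
  \<comment> \<open>With the integrating factor and \<open>b * r\<close> subtracted,
    \<open>g\<close> is nonincreasing, since exp (- a r) \<le> 1.\<close>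
  define g where "g r = exp (- a * r) * f r - b * r" for r
  have g': "(g has_real_derivative exp (- a * r) * (f' r - a * f r) - b) (at r within {0..T})" if "r \<in> {0..T}" for r
    unfolding g_def[abs_def] using that
    by (auto intro!: derivative_eq_intros d simp: algebra_simps)
  have neg: "exp (- a * r) * (f' r - a * f r) - b \<le> 0" if r: "r \<in> {0..T}" for r
  proof -
    have "exp (- a * r) * (f' r - a * f r) \<le> exp (- a * r) * b"
      using le[OF r] by (intro mult_left_mono) auto
    also have "\<dots> \<le> 1 * b" using ab r by (intro mult_right_mono) auto
    finally show ?thesis by simp
  qed
  have "g t \<le> g 0"
  proof -
    have "\<exists>x\<in>{0..t}. g t - g 0 = (\<lambda>h. (exp (- a * x) * (f' x - a * f x) - b) * h) (t - 0)"
    proof (rule mvt_very_simple)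
      show "0 \<le> t" using t by simp
      fix x assume "0 \<le> x" "x \<le> t"
      then have x: "x \<in> {0..T}" using t by auto
      have "(g has_real_derivative exp (- a * x) * (f' x - a * f x) - b) (at x within {0..t})"
        by (rule DERIV_subset[OF g'[OF x]]) (use t in auto)
      then show "(g has_derivative (\<lambda>h. (exp (- a * x) * (f' x - a * f x) - b) * h)) (at x within {0..t})"
        by (simp add: has_field_derivative_def)
    qed
    then obtain x where x: "x \<in> {0..t}" "g t - g 0 = (exp (- a * x) * (f' x - a * f x) - b) * t" by auto
    have "(exp (- a * x) * (f' x - a * f x) - b) * t \<le> 0"
      using neg[of x] x(1) t by (intro mult_nonpos_nonneg) auto
    with x(2) show ?thesis by simp
  qed
  then have "exp (- a * t) * f t \<le> f 0 + b * t" by (simp add: g_def)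
  also have "\<dots> \<le> f 0 + T * b" using t ab mult_left_mono[of t T b] by (simp add: mult.commute)
  finally have 1: "exp (- a * t) * f t \<le> f 0 + T * b" .
  have "f t = exp (a * t) * (exp (- a * t) * f t)" by (simp add: mult.assoc[symmetric] exp_add[symmetric])
  also have "\<dots> \<le> exp (a * t) * (f 0 + T * b)" using 1 by (intro mult_left_mono) auto
  also have "\<dots> \<le> exp (a * T) * (f 0 + T * b)"
    using t ab f0 by (intro mult_right_mono) (auto intro!: mult_left_mono add_nonneg_nonneg mult_nonneg_nonneg)
  finally show ?thesis .
qed

text \<open>Expanding the square of \<open>y t\<close> plus r - t times the difference quotient, the
  cross term gives the derivative and the remaining term is of order r - t.\<close>

lemma n2_sq_has_derivative:
  assumes y: "\<And>r. r \<in> S \<Longrightarrow> y r \<in> pts L2" and t: "t \<in> S" and d: "d \<in> pts L2"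
    and lim: "((\<lambda>r. n2 (\<lambda>\<zeta>. (y r \<zeta> - y t \<zeta>) / of_real (r - t) - d \<zeta>)) \<longlongrightarrow> 0) (at t within S)"
  shows "((\<lambda>r. (n2 (y r))\<^sup>2) has_real_derivative 2 * Re (ip d (y t))) (at t within S)"
  unfolding has_field_derivative_iff
proof -
  let ?q = "\<lambda>r \<zeta>. of_real (1 / (r - t)) * (y r \<zeta> - y t \<zeta>)"
  let ?e = "\<lambda>r. n2 (\<lambda>\<zeta>. ?q r \<zeta> - d \<zeta>)"
  have ev: "eventually (\<lambda>r. r \<in> S \<and> r \<noteq> t) (at t within S)" by (simp add: eventually_at_filter)
  have lim': "(?e \<longlongrightarrow> 0) (at t within S)" using lim by simp
  have qL: "?q r \<in> pts L2" if "r \<in> S" for r by (intro L2_cmult(1) L2_diff(1) y that t)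
  let ?D = "\<lambda>r. ((n2 (y r))\<^sup>2 - (n2 (y t))\<^sup>2) / (r - t) - 2 * Re (ip d (y t))"
  let ?b = "\<lambda>r. \<bar>r - t\<bar> * (n2 d + ?e r)\<^sup>2 + 2 * (?e r * n2 (y t))"
  have "(?b \<longlongrightarrow> \<bar>t - t\<bar> * (n2 d + 0)\<^sup>2 + 2 * (0 * n2 (y t))) (at t within S)"
    by (intro tendsto_intros lim')
  then have b: "(?b \<longlongrightarrow> 0) (at t within S)" by simp
  have "eventually (\<lambda>r. norm (?D r) \<le> ?b r) (at t within S)"
    using ev
  proof eventually_elim
    case (elim r)
    then have r: "r \<in> S" "r \<noteq> t" by auto
    note qr = qL[OF r(1)] and yt = y[OF t]
    have "(\<lambda>\<zeta>. of_real (r - t) * ?q r \<zeta> + y t \<zeta>) = y r"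
      using r(2) by (auto simp: field_simps simp flip: of_real_diff)
    then have "(n2 (y r))\<^sup>2 = (n2 (\<lambda>\<zeta>. of_real (r - t) * ?q r \<zeta>))\<^sup>2 + (n2 (y t))\<^sup>2 + 2 * Re (ip (\<lambda>\<zeta>. of_real (r - t) * ?q r \<zeta>) (y t))"
      using L2_add(3)[OF L2_cmult(1)[OF qr, of "of_real (r - t)"] yt] by simp
    also have "\<dots> = (r - t)\<^sup>2 * (n2 (?q r))\<^sup>2 + (n2 (y t))\<^sup>2 + 2 * ((r - t) * Re (ip (?q r) (y t)))"
      unfolding L2_cmult(2)[OF qr] norm_of_real ip_cmult_left power_mult_distrib power2_abs by simp
    finally have e: "((n2 (y r))\<^sup>2 - (n2 (y t))\<^sup>2) / (r - t) = (r - t) * (n2 (?q r))\<^sup>2 + 2 * Re (ip (?q r) (y t))"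
      using r(2) by (simp add: field_simps power2_eq_square)
    define P Q where "P = (r - t) * (n2 (?q r))\<^sup>2" and "Q = Re (ip (\<lambda>\<zeta>. ?q r \<zeta> - d \<zeta>) (y t))"
    have D: "?D r = P + 2 * Q"
      unfolding P_def Q_def e ip_diff_left[OF qr d yt] by simp
    have P: "\<bar>P\<bar> \<le> \<bar>r - t\<bar> * (n2 d + ?e r)\<^sup>2"
      unfolding P_def abs_mult abs_power2
      by (rule mult_left_mono[OF power_mono[OF n2_le_diff[OF qr d] n2_nonneg] abs_ge_zero])
    have Q: "\<bar>Q\<bar> \<le> ?e r * n2 (y t)"
      unfolding Q_def by (rule order_trans[OF abs_Re_le_cmod L2_integrable(6)[OF L2_diff(1)[OF qr d] yt]])
    show "norm (?D r) \<le> ?b r" unfolding D real_norm_def using P Q by linarith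
  qed
  from Lim_null_comparison[OF this b]
  show "((\<lambda>r. ((n2 (y r))\<^sup>2 - (n2 (y t))\<^sup>2) / (r - t)) \<longlongrightarrow> 2 * Re (ip d (y t))) (at t within S)"
    by (simp only: Lim_null[symmetric])
qed

abbreviation jw :: "real \<Rightarrow> plane \<Rightarrow> real" where "jw s \<equiv> (\<lambda>\<zeta>. jb \<zeta> powr s)"

lemma jw_measurable [measurable]: "jw s \<in> borel_measurable borel"
  by measurable

lemma fsolD:
  assumes "fsol \<alpha> s T U" "s > 2" "t \<in> {0..T}"
  shows "U t \<in> borel_measurable borel" "wt (jw s) (U t) \<in> pts L2" "U t \<in> pts L2" "integrable lborel (U t)"
    "AE \<zeta> in lborel. U t (- \<zeta>) = cnj (U t \<zeta>)"
    "((\<lambda>r. wdist (jw s) (U r) (U t)) \<longlongrightarrow> 0) (at t within {0..T})"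
    "conv (U t) (U t) \<in> pts L2"
proof -
  show m: "U t \<in> borel_measurable borel" and w: "wt (jw s) (U t) \<in> pts L2"
    and "AE \<zeta> in lborel. U t (- \<zeta>) = cnj (U t \<zeta>)"
    and "((\<lambda>r. wdist (jw s) (U r) (U t)) \<longlongrightarrow> 0) (at t within {0..T})"
    using assms(1,3) by (auto simp: fsol_def)
  show L: "U t \<in> pts L2" using jb_weight_L2(1)[OF _ m w] assms(2) by simp
  show i: "integrable lborel (U t)" by (rule L1_of_jb(1)[OF m weighted_L1(1)[OF assms(2) m w]])
  show "conv (U t) (U t) \<in> pts L2" by (rule young(1)[OF i L])
qed

text \<open>The symbol is purely imaginary, so only the nonlinearity contributes.\<close>

lemma fsol_energy:
  assumes U: "fsol \<alpha> s T U" and s: "s > 2" and \<alpha>: "-1 \<le> \<alpha>" "\<alpha> \<le> 1" and t: "t \<in> {0..T}"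
    and w [measurable]: "w \<in> borel_measurable borel" and c: "0 \<le> c" "\<And>\<zeta>. \<bar>w \<zeta>\<bar> \<le> c * indicator (window n) \<zeta>"
  shows "((\<lambda>r. (n2 (wt w (U r)))\<^sup>2) has_real_derivative
      2 * Re (ip (wt w (nonlin (U t))) (wt w (U t)))) (at t within {0..T})"
    "wt w (nonlin (U t)) \<in> pts L2"
proof -
  have wU: "wt w (U r) \<in> pts L2" if "r \<in> {0..T}" for r
  proof -
    note [measurable] = fsolD(1)[OF U s that]
    show ?thesis
    proof (rule L2_dom(1)[OF _ fsolD(3)[OF U s that] c(1)])
      show "AE \<zeta> in lborel. cmod (wt w (U r) \<zeta>) \<le> c * cmod (U r \<zeta>)"
      proof (rule AE_I2)
        fix \<zeta>
        have "\<bar>w \<zeta>\<bar> \<le> c" using c(2)[of \<zeta>] c(1) by (cases "\<zeta> \<in> window n") auto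
        then show "cmod (wt w (U r) \<zeta>) \<le> c * cmod (U r \<zeta>)" by (simp add: norm_mult mult_right_mono)
      qed
    qed measurable
  qed
  note [measurable] = fsolD(1)[OF U s t]
  note Ut = fsolD(3)[OF U s t]
  let ?p = "\<lambda>\<zeta>. w \<zeta> * psym \<alpha> \<zeta>"
  have pU: "wt ?p (U t) \<in> pts L2"
  proof (rule L2_dom(1)[where c="c * (2 * real (Suc n) ^ 3)", OF _ Ut])
    show "AE \<zeta> in lborel. cmod (wt ?p (U t) \<zeta>) \<le> c * (2 * real (Suc n) ^ 3) * cmod (U t \<zeta>)"
    proof (rule AE_I2)
      fix \<zeta>
      have "\<bar>w \<zeta>\<bar> * \<bar>psym \<alpha> \<zeta>\<bar> \<le> c * (2 * real (Suc n) ^ 3)"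
      proof (cases "\<zeta> \<in> window n")
        case True
        then show ?thesis using c(2)[of \<zeta>] by (intro mult_mono psym_window_bound \<alpha> c(1)) auto
      qed (use c(2)[of \<zeta>] c(1) in simp)
      from mult_right_mono[OF this norm_ge_zero[of "U t \<zeta>"]]
      show "cmod (wt ?p (U t) \<zeta>) \<le> c * (2 * real (Suc n) ^ 3) * cmod (U t \<zeta>)"
        by (simp add: norm_mult abs_mult)
    qed
  qed (use c(1) in simp_all)
  show nL: "wt w (nonlin (U t)) \<in> pts L2"
  proof (rule L2_dom(1)[where c="c * real (Suc n)", OF _ fsolD(7)[OF U s t]])
    show "AE \<zeta> in lborel. cmod (wt w (nonlin (U t)) \<zeta>) \<le> c * real (Suc n) * cmod (conv (U t) (U t) \<zeta>)"
    proof (rule AE_I2)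
      fix \<zeta> :: plane
      have "\<bar>w \<zeta>\<bar> * \<bar>fst \<zeta> / (4 * pi)\<bar> \<le> c * real (Suc n)"
      proof (cases "\<zeta> \<in> window n")
        case True
        have "\<bar>fst \<zeta> / (4 * pi)\<bar> \<le> \<bar>fst \<zeta>\<bar> / 1"
          unfolding abs_divide by (rule divide_left_mono) (use pi_gt3 in auto)
        also have "\<dots> \<le> real (Suc n)" using window_bounds(3)[OF True] by simp
        finally have "\<bar>fst \<zeta> / (4 * pi)\<bar> \<le> real (Suc n)" .
        then show ?thesis using c(2)[of \<zeta>] True by (intro mult_mono c(1)) auto
      qed (use c(2)[of \<zeta>] c(1) in simp)
      from mult_right_mono[OF this norm_ge_zero[of "conv (U t) (U t) \<zeta>"]]
      show "cmod (wt w (nonlin (U t)) \<zeta>) \<le> c * real (Suc n) * cmod (conv (U t) (U t) \<zeta>)"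
        unfolding nonlin_def norm_mult norm_of_real norm_ii by (simp only: ac_simps mult_1)
    qed
  qed (use c(1) in simp_all)
  \<comment> \<open>The time derivative of the weighted transform in L2. Its linear part is square
    integrable because \<open>w\<close> vanishes off the window.\<close>
  define d where "d = (\<lambda>\<zeta>. \<i> * wt ?p (U t) \<zeta> + wt w (nonlin (U t)) \<zeta>)"
  have dL: "d \<in> pts L2" unfolding d_def by (intro L2_add(1) L2_cmult(1) pU nL)
  have "((\<lambda>r. n2 (\<lambda>\<zeta>. (wt w (U r) \<zeta> - wt w (U t) \<zeta>) / of_real (r - t) - d \<zeta>)) \<longlongrightarrow> 0) (at t within {0..T})"
  proof (rule Lim_null_comparison)
    let ?y = "\<lambda>r \<zeta>. indicator (window n) \<zeta> * ((U r \<zeta> - U t \<zeta>) / of_real (r - t) -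
          (\<i> * of_real (psym \<alpha> \<zeta>) * U t \<zeta> + nonlin (U t) \<zeta>))"
    have "((\<lambda>r. n2 (?y r)) \<longlongrightarrow> 0) (at t within {0..T})" using U t by (auto simp: fsol_def)
    from tendsto_mult_right_zero[OF this] show "((\<lambda>r. c * n2 (?y r)) \<longlongrightarrow> 0) (at t within {0..T})" .
    have "eventually (\<lambda>r. r \<in> {0..T}) (at t within {0..T})" by (simp add: eventually_at_filter)
    then show "eventually (\<lambda>r. norm (n2 (\<lambda>\<zeta>. (wt w (U r) \<zeta> - wt w (U t) \<zeta>) / of_real (r - t) - d \<zeta>)) \<le> c * n2 (?y r)) (at t within {0..T})"
    proof eventually_elim
      case (elim r)
      note [measurable] = fsolD(1)[OF U s elim]
      have yL: "?y r \<in> pts L2"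
      proof -
        have I: "(\<lambda>\<zeta>. indicator (window n) \<zeta> * f \<zeta>) \<in> pts L2" if "f \<in> pts L2" for f :: func
          by (rule L2_dom(1)[where c=1, OF _ that]) (use L2_measurable[OF that] in \<open>auto simp: norm_mult indicator_def\<close>)
        have p1: "wt (\<lambda>\<zeta>. indicator (window n) \<zeta> * psym \<alpha> \<zeta>) (U t) \<in> pts L2"
        proof (rule L2_dom(1)[where c="2 * real (Suc n) ^ 3", OF _ Ut])
          show "AE \<zeta> in lborel. cmod (wt (\<lambda>\<zeta>. indicator (window n) \<zeta> * psym \<alpha> \<zeta>) (U t) \<zeta>) \<le> 2 * real (Suc n) ^ 3 * cmod (U t \<zeta>)"
            by (rule AE_I2) (use psym_window_bound[OF _ \<alpha>, of _ n] in \<open>auto simp: norm_mult indicator_def intro!: mult_right_mono\<close>)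
        qed simp_all
        have p2: "wt (\<lambda>\<zeta>. indicator (window n) \<zeta> * (fst \<zeta> / (4 * pi))) (conv (U t) (U t)) \<in> pts L2"
        proof (rule L2_dom(1)[where c="real (Suc n)", OF _ fsolD(7)[OF U s t]])
          show "AE \<zeta> in lborel. cmod (wt (\<lambda>\<zeta>. indicator (window n) \<zeta> * (fst \<zeta> / (4 * pi))) (conv (U t) (U t)) \<zeta>) \<le> real (Suc n) * cmod (conv (U t) (U t) \<zeta>)"
          proof (rule AE_I2)
            fix \<zeta> :: plane
            have "\<bar>indicator (window n) \<zeta> * (fst \<zeta> / (4 * pi))\<bar> \<le> real (Suc n)"
            proof (cases "\<zeta> \<in> window n")
              case True
              have "\<bar>fst \<zeta> / (4 * pi)\<bar> \<le> \<bar>fst \<zeta>\<bar> / 1"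
                unfolding abs_divide by (rule divide_left_mono) (use pi_gt3 in auto)
              also have "\<dots> \<le> real (Suc n)" using window_bounds(3)[OF True] by simp
              finally show ?thesis using True by simp
            qed simp
            from mult_right_mono[OF this norm_ge_zero[of "conv (U t) (U t) \<zeta>"]]
            show "cmod (wt (\<lambda>\<zeta>. indicator (window n) \<zeta> * (fst \<zeta> / (4 * pi))) (conv (U t) (U t)) \<zeta>) \<le> real (Suc n) * cmod (conv (U t) (U t) \<zeta>)"
              unfolding norm_mult norm_of_real .
          qed
        qed simp_all
        have "(\<lambda>\<zeta>. of_real (1 / (r - t)) * (indicator (window n) \<zeta> * (U r \<zeta> - U t \<zeta>)) -
            (\<i> * wt (\<lambda>\<zeta>. indicator (window n) \<zeta> * psym \<alpha> \<zeta>) (U t) \<zeta> +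
             \<i> * wt (\<lambda>\<zeta>. indicator (window n) \<zeta> * (fst \<zeta> / (4 * pi))) (conv (U t) (U t)) \<zeta>)) \<in> pts L2"
          by (intro L2_diff(1) L2_add(1) L2_cmult(1) I p1 p2 fsolD(3)[OF U s elim] Ut)
        also have "(\<lambda>\<zeta>. of_real (1 / (r - t)) * (indicator (window n) \<zeta> * (U r \<zeta> - U t \<zeta>)) -
            (\<i> * wt (\<lambda>\<zeta>. indicator (window n) \<zeta> * psym \<alpha> \<zeta>) (U t) \<zeta> +
             \<i> * wt (\<lambda>\<zeta>. indicator (window n) \<zeta> * (fst \<zeta> / (4 * pi))) (conv (U t) (U t)) \<zeta>)) = ?y r"
        proof
          fix \<zeta>
          show "of_real (1 / (r - t)) * (indicator (window n) \<zeta> * (U r \<zeta> - U t \<zeta>)) -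
            (\<i> * wt (\<lambda>\<zeta>. indicator (window n) \<zeta> * psym \<alpha> \<zeta>) (U t) \<zeta> +
             \<i> * wt (\<lambda>\<zeta>. indicator (window n) \<zeta> * (fst \<zeta> / (4 * pi))) (conv (U t) (U t)) \<zeta>) = ?y r \<zeta>"
            by (cases "\<zeta> \<in> window n") (simp_all add: nonlin_def)
        qed
        finally show ?thesis .
      qed
      have "AE \<zeta> in lborel. cmod ((wt w (U r) \<zeta> - wt w (U t) \<zeta>) / of_real (r - t) - d \<zeta>) \<le> c * cmod (?y r \<zeta>)"
      proof (rule AE_I2)
        fix \<zeta>
        show "cmod ((wt w (U r) \<zeta> - wt w (U t) \<zeta>) / of_real (r - t) - d \<zeta>) \<le> c * cmod (?y r \<zeta>)"
        proof (cases "\<zeta> \<in> window n")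
          case True
          have "(wt w (U r) \<zeta> - wt w (U t) \<zeta>) / of_real (r - t) - d \<zeta> = of_real (w \<zeta>) * ?y r \<zeta>"
            using True by (simp add: d_def algebra_simps diff_divide_distrib)
          then show ?thesis using c(2)[of \<zeta>] True by (simp add: norm_mult mult_right_mono)
        next
          case False
          then have "w \<zeta> = 0" using c(2)[of \<zeta>] by simp
          then show ?thesis using c(1) by (simp add: d_def)
        qed
      qed
      from L2_dom(2)[OF _ yL c(1) this] show ?case
        using L2_measurable[OF dL] by simp
    qed
  qed
  from n2_sq_has_derivative[OF wU t dL this]
  have "((\<lambda>r. (n2 (wt w (U r)))\<^sup>2) has_real_derivative 2 * Re (ip d (wt w (U t)))) (at t within {0..T})" .
  moreover have "Re (ip d (wt w (U t))) = Re (ip (wt w (nonlin (U t))) (wt w (U t)))"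
  proof -
    have "ip (wt ?p (U t)) (wt w (U t)) = of_real (LINT \<zeta>|lborel. ?p \<zeta> * w \<zeta> * (cmod (U t \<zeta>))\<^sup>2)"
      unfolding ip_def integral_complex_of_real[symmetric]
    proof (rule Bochner_Integration.integral_cong[OF refl])
      fix \<zeta>
      have "wt ?p (U t) \<zeta> * cnj (wt w (U t) \<zeta>) = of_real (?p \<zeta> * w \<zeta>) * (U t \<zeta> * cnj (U t \<zeta>))" by simp
      also have "U t \<zeta> * cnj (U t \<zeta>) = of_real ((cmod (U t \<zeta>))\<^sup>2)" by (rule complex_norm_square[symmetric])
      finally show "wt ?p (U t) \<zeta> * cnj (wt w (U t) \<zeta>) = of_real (?p \<zeta> * w \<zeta> * (cmod (U t \<zeta>))\<^sup>2)"
        by (simp only: of_real_mult)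
    qed
    then have "Re (\<i> * ip (wt ?p (U t)) (wt w (U t))) = 0" by simp
    then show ?thesis
      unfolding d_def ip_add_left[OF L2_cmult(1)[OF pU] nL wU[OF t]] ip_cmult_left by simp
  qed
  ultimately show "((\<lambda>r. (n2 (wt w (U r)))\<^sup>2) has_real_derivative
      2 * Re (ip (wt w (nonlin (U t))) (wt w (U t)))) (at t within {0..T})" by simp
qed

text \<open>A continuous curve in L2 over a compact interval has compact image, and contractions
  that tend to 0 on each element do so uniformly there. The argument is by contradiction along a
  convergent sequence of times.\<close>

lemma uniform_tail:
  fixes G :: "real \<Rightarrow> func" and ch :: "nat \<Rightarrow> plane \<Rightarrow> real"
  assumes G: "\<And>t. t \<in> {0..T} \<Longrightarrow> G t \<in> pts L2"
    and cont: "\<And>t. t \<in> {0..T} \<Longrightarrow> ((\<lambda>r. n2 (\<lambda>\<zeta>. G r \<zeta> - G t \<zeta>)) \<longlongrightarrow> 0) (at t within {0..T})"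
    and m [measurable]: "\<And>k. ch k \<in> borel_measurable borel" and bd: "\<And>k \<zeta>. \<bar>ch k \<zeta>\<bar> \<le> 1"
    and lim: "AE \<zeta> in lborel. (\<lambda>k. ch k \<zeta>) \<longlonglongrightarrow> 0" and e: "0 < e"
  shows "\<exists>k0. \<forall>k\<ge>k0. \<forall>t\<in>{0..T}. n2 (wt (ch k) (G t)) < e"
proof (rule ccontr)
  assume "\<not> ?thesis"
  then have "\<forall>j. \<exists>k t. k \<ge> j \<and> t \<in> {0..T} \<and> e \<le> n2 (wt (ch k) (G t))" by (meson not_le)
  then obtain k x where kx: "\<And>j. k j \<ge> j" "\<And>j. x j \<in> {0..T}" "\<And>j. e \<le> n2 (wt (ch (k j)) (G (x j)))"
    by metis
  obtain t r where tr: "t \<in> {0..T}" "strict_mono r" "(x \<circ> r) \<longlonglongrightarrow> t"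
    using compact_Icc[of 0 T] kx(2) unfolding compact_def by metis
  have wL: "wt (ch i) V \<in> pts L2 \<and> n2 (wt (ch i) V) \<le> n2 V" if "V \<in> pts L2" for i V
  proof -
    have "AE \<zeta> in lborel. cmod (wt (ch i) V \<zeta>) \<le> 1 * cmod (V \<zeta>)"
      by (rule AE_I2) (use bd in \<open>auto simp: norm_mult intro!: mult_left_le_one_le\<close>)
    from L2_dom[OF wt_measurable[OF m L2_measurable[OF that]] that _ this] show ?thesis by simp
  qed
  have A: "(\<lambda>j. n2 (\<lambda>\<zeta>. G (x (r j)) \<zeta> - G t \<zeta>)) \<longlonglongrightarrow> 0"
  proof -
    have c: "((\<lambda>s. n2 (\<lambda>\<zeta>. G s \<zeta> - G t \<zeta>)) \<longlongrightarrow> n2 (\<lambda>\<zeta>. G t \<zeta> - G t \<zeta>)) (at t within {0..T})"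
      using cont[OF tr(1)] by (simp add: L2_zero)
    have "continuous (at t within {0..T}) (\<lambda>s. n2 (\<lambda>\<zeta>. G s \<zeta> - G t \<zeta>))"
      unfolding continuous_within by (rule c)
    from this[unfolded continuous_within_sequentially, rule_format, of "x \<circ> r"] tr(3) kx(2)
    show ?thesis by (simp add: o_def L2_zero)
  qed
  have B: "(\<lambda>i. n2 (\<lambda>\<zeta>. wt (ch i) (G t) \<zeta> - 0)) \<longlonglongrightarrow> 0"
  proof (rule L2_dominated[where c=1, OF _ _ G[OF tr(1)]])
    show "wt (ch i) (G t) \<in> borel_measurable borel" for i
      by (rule wt_measurable[OF m L2_measurable[OF G[OF tr(1)]]])
    show "AE \<zeta> in lborel. cmod (wt (ch i) (G t) \<zeta>) \<le> 1 * cmod (G t \<zeta>)" for i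
      by (rule AE_I2) (use bd in \<open>auto simp: norm_mult intro!: mult_left_le_one_le\<close>)
    show "AE \<zeta> in lborel. (\<lambda>i. wt (ch i) (G t) \<zeta>) \<longlonglongrightarrow> 0"
      using lim
    proof eventually_elim
      case (elim \<zeta>)
      from tendsto_mult_left_zero[OF tendsto_of_real[OF elim, where 'a=complex, unfolded of_real_0]]
      show ?case .
    qed
  qed simp
  have sub: "filterlim (\<lambda>j. k (r j)) sequentially sequentially"
  proof (rule filterlim_at_top_mono[OF filterlim_ident always_eventually], rule allI)
    fix j show "j \<le> k (r j)" using kx(1)[of "r j"] seq_suble[OF tr(2), of j] by linarith
  qed
  have B': "(\<lambda>j. n2 (wt (ch (k (r j))) (G t))) \<longlonglongrightarrow> 0" using filterlim_compose[OF B sub] by simp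
  have "(\<lambda>j. n2 (\<lambda>\<zeta>. G (x (r j)) \<zeta> - G t \<zeta>) + n2 (wt (ch (k (r j))) (G t))) \<longlonglongrightarrow> 0"
    using tendsto_add[OF A B'] by simp
  from LIMSEQ_D[OF this e] obtain j where j: "n2 (\<lambda>\<zeta>. G (x (r j)) \<zeta> - G t \<zeta>) + n2 (wt (ch (k (r j))) (G t)) < e" by auto
  note Gx = G[OF kx(2)[of "r j"]] and Gt = G[OF tr(1)]
  have "n2 (wt (ch (k (r j))) (G (x (r j)))) \<le> n2 (wt (ch (k (r j))) (G t)) +
      n2 (\<lambda>\<zeta>. wt (ch (k (r j))) (G (x (r j))) \<zeta> - wt (ch (k (r j))) (G t) \<zeta>)"
    using wL[OF Gx] wL[OF Gt] by (intro n2_le_diff) blast+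
  also have "(\<lambda>\<zeta>. wt (ch (k (r j))) (G (x (r j))) \<zeta> - wt (ch (k (r j))) (G t) \<zeta>) =
      wt (ch (k (r j))) (\<lambda>\<zeta>. G (x (r j)) \<zeta> - G t \<zeta>)" by (simp add: right_diff_distrib)
  also have "n2 \<dots> \<le> n2 (\<lambda>\<zeta>. G (x (r j)) \<zeta> - G t \<zeta>)" using wL[OF L2_diff(1)[OF Gx Gt]] by blast
  finally show False using j kx(3)[of "r j"] by linarith
qed

subsection \<open>Propagation of weights\<close>

text \<open>The modulus as a complex function, so that \<open>conv\<close> and Young's inequality
  apply to it.\<close>

definition absf :: "func \<Rightarrow> func" where "absf U \<zeta> = complex_of_real (cmod (U \<zeta>))"

lemma absf_measurable [measurable]: "U \<in> borel_measurable borel \<Longrightarrow> absf U \<in> borel_measurable borel"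
  unfolding absf_def[abs_def] by measurable

lemma norm_absf [simp]: "cmod (absf U \<zeta>) = cmod (U \<zeta>)"
  by (simp add: absf_def)

lemma absf_L2:
  assumes "U \<in> pts L2" shows "absf U \<in> pts L2" "n2 (absf U) = n2 U"
proof -
  note [measurable] = L2_measurable[OF assms]
  show "absf U \<in> pts L2" using L2_norm_cong(1)[of "absf U" U] assms by simp
  show "n2 (absf U) = n2 U" by (rule L2_norm_cong(2)) simp_all
qed

lemma absf_integrable:
  assumes "integrable lborel U" shows "integrable lborel (absf U)"
  unfolding absf_def[abs_def] using integrable_norm[OF assms] by simp

lemma L2_bound2:
  assumes m: "F \<in> borel_measurable borel" and A: "A \<in> pts L2" and B: "B \<in> pts L2" and c: "0 \<le> c" "0 \<le> d"
    and le: "\<And>\<zeta>. cmod (F \<zeta>) \<le> c * cmod (A \<zeta>) + d * cmod (B \<zeta>)"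
  shows "F \<in> pts L2" "n2 F \<le> c * n2 A + d * n2 B"
proof -
  let ?G = "\<lambda>\<zeta>. of_real c * absf A \<zeta> + of_real d * absf B \<zeta>"
  note L = L2_cmult(1)[OF absf_L2(1)[OF A], of "of_real c"] L2_cmult(1)[OF absf_L2(1)[OF B], of "of_real d"]
  have G: "?G \<in> pts L2" by (rule L2_add(1)[OF L])
  have nG: "n2 ?G \<le> c * n2 A + d * n2 B"
    using L2_add(2)[OF L] c by (simp add: L2_cmult(2)[OF absf_L2(1)] A B absf_L2(2))
  have "cmod (F \<zeta>) \<le> 1 * cmod (?G \<zeta>)" for \<zeta>
  proof -
    have "?G \<zeta> = of_real (c * cmod (A \<zeta>) + d * cmod (B \<zeta>))" by (simp add: absf_def)
    then have "cmod (?G \<zeta>) = \<bar>c * cmod (A \<zeta>) + d * cmod (B \<zeta>)\<bar>" by (simp only: norm_of_real)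
    with le[of \<zeta>] show ?thesis by linarith
  qed
  from L2_dom[OF m G zero_le_one AE_I2[OF this]]
  show "F \<in> pts L2" "n2 F \<le> c * n2 A + d * n2 B" using nG by simp_all
qed

lemma wt_bound2:
  assumes m: "U \<in> borel_measurable borel" "\<rho> \<in> borel_measurable borel"
    and L: "wt \<rho>1 U \<in> pts L2" "wt \<rho>2 U \<in> pts L2" and ab: "0 \<le> a" "0 \<le> b"
    and le: "\<And>\<zeta>. \<bar>\<rho> \<zeta>\<bar> \<le> a * \<bar>\<rho>1 \<zeta>\<bar> + b * \<bar>\<rho>2 \<zeta>\<bar>"
  shows "wt \<rho> U \<in> pts L2" "n2 (wt \<rho> U) \<le> a * n2 (wt \<rho>1 U) + b * n2 (wt \<rho>2 U)"
proof -
  have w: "cmod (wt \<rho> U \<zeta>) \<le> a * cmod (wt \<rho>1 U \<zeta>) + b * cmod (wt \<rho>2 U \<zeta>)" for \<zeta>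
    using mult_right_mono[OF le norm_ge_zero[of "U \<zeta>"]] by (simp add: norm_mult algebra_simps)
  show "wt \<rho> U \<in> pts L2" "n2 (wt \<rho> U) \<le> a * n2 (wt \<rho>1 U) + b * n2 (wt \<rho>2 U)"
    by (rule L2_bound2[OF wt_measurable[OF m(2,1)] L ab w])+
qed

text \<open>The common form of the algebra and the commutator estimate: the weight at the output
  frequency is shared out between the left and the right factor of a convolution.\<close>

lemma kernel_bound:
  assumes L: "U1 \<in> pts L2" "V1 \<in> pts L2" "U2 \<in> pts L2" "V2 \<in> pts L2"
    and le: "\<And>\<zeta>'. cmod (k \<zeta>') \<le> cmod (U1 (\<zeta> - \<zeta>')) * cmod (V1 \<zeta>') + cmod (U2 (\<zeta> - \<zeta>')) * cmod (V2 \<zeta>')"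
  shows "cmod (LINT \<zeta>'|lborel. k \<zeta>') \<le> cmod (conv (absf U1) (absf V1) \<zeta>) + cmod (conv (absf U2) (absf V2) \<zeta>)"
proof -
  have c: "cmod (conv (absf U) (absf V) \<zeta>) = (LINT \<zeta>'|lborel. cmod (U (\<zeta> - \<zeta>')) * cmod (V \<zeta>'))" for U V
  proof -
    have "conv (absf U) (absf V) \<zeta> = (LINT \<zeta>'|lborel. complex_of_real (cmod (U (\<zeta> - \<zeta>')) * cmod (V \<zeta>')))"
      unfolding conv_def absf_def by simp
    also have "\<dots> = of_real (LINT \<zeta>'|lborel. cmod (U (\<zeta> - \<zeta>')) * cmod (V \<zeta>'))" by (rule integral_complex_of_real)
    finally have e: "conv (absf U) (absf V) \<zeta> = of_real (LINT \<zeta>'|lborel. cmod (U (\<zeta> - \<zeta>')) * cmod (V \<zeta>'))" .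
    have "0 \<le> (LINT \<zeta>'|lborel. cmod (U (\<zeta> - \<zeta>')) * cmod (V \<zeta>'))" by (rule integral_nonneg_AE) simp
    then show ?thesis unfolding e by simp
  qed
  note i1 = L2_integrable(3)[OF L2_reflect(1)[OF L(1), of \<zeta>] L(2)]
  note i2 = L2_integrable(3)[OF L2_reflect(1)[OF L(3), of \<zeta>] L(4)]
  have "cmod (LINT \<zeta>'|lborel. k \<zeta>') \<le> (LINT \<zeta>'|lborel. cmod (k \<zeta>'))" by (rule integral_norm_bound)
  also have "\<dots> \<le> (LINT \<zeta>'|lborel. cmod (U1 (\<zeta> - \<zeta>')) * cmod (V1 \<zeta>') + cmod (U2 (\<zeta> - \<zeta>')) * cmod (V2 \<zeta>'))"
    by (rule integral_mono') (use i1 i2 le in auto)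
  also have "\<dots> = cmod (conv (absf U1) (absf V1) \<zeta>) + cmod (conv (absf U2) (absf V2) \<zeta>)"
    unfolding c by (rule Bochner_Integration.integral_add[OF i1 i2])
  finally show ?thesis .
qed

lemma young_absf:
  assumes U: "integrable lborel U" and V: "V \<in> pts L2"
  shows "conv (absf U) (absf V) \<in> pts L2" "n2 (conv (absf U) (absf V)) \<le> (LINT z|lborel. cmod (U z)) * n2 V"
    "conv (absf V) (absf U) \<in> pts L2" "n2 (conv (absf V) (absf U)) \<le> (LINT z|lborel. cmod (U z)) * n2 V"
proof -
  note Y = young[OF absf_integrable[OF U] absf_L2(1)[OF V]]
  have [measurable]: "U \<in> borel_measurable borel" using borel_measurable_integrable[OF U] by simp
  note [measurable] = L2_measurable[OF V]
  have e: "conv (absf V) (absf U) = conv (absf U) (absf V)" by (rule conv_commute) measurable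
  show "conv (absf U) (absf V) \<in> pts L2" "conv (absf V) (absf U) \<in> pts L2" using Y(1) by (simp_all add: e)
  show "n2 (conv (absf U) (absf V)) \<le> (LINT z|lborel. cmod (U z)) * n2 V"
    "n2 (conv (absf V) (absf U)) \<le> (LINT z|lborel. cmod (U z)) * n2 V"
    using Y(2) by (simp_all add: e absf_L2(2)[OF V])
qed

text \<open>By the Lipschitz bound the larger of the two brackets on the right is at least half of
  \<open>jb \<zeta>\<close>.\<close>

lemma jw_subadd:
  assumes "0 \<le> s"
  shows "jb \<zeta> powr s \<le> 2 powr s * (jb (\<zeta> - \<zeta>') powr s + jb \<zeta>' powr s)"
proof -
  have "jb \<zeta> \<le> jb \<zeta>' + norm (\<zeta> - \<zeta>')" using jb_triangle[of \<zeta> \<zeta>'] by linarith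
  also have "\<dots> \<le> 2 * max (jb (\<zeta> - \<zeta>')) (jb \<zeta>')" using norm_le_jb[of "\<zeta> - \<zeta>'"] by linarith
  finally have "jb \<zeta> powr s \<le> (2 * max (jb (\<zeta> - \<zeta>')) (jb \<zeta>')) powr s"
    using assms by (intro powr_mono2) (auto simp: less_imp_le)
  also have "\<dots> = 2 powr s * (max (jb (\<zeta> - \<zeta>')) (jb \<zeta>')) powr s" by (rule powr_mult)
  also have "\<dots> \<le> 2 powr s * (jb (\<zeta> - \<zeta>') powr s + jb \<zeta>' powr s)"
    by (intro mult_left_mono) (auto simp: max_def)
  finally show ?thesis .
qed

definition alg_const :: "real \<Rightarrow> real" where "alg_const s = 2 powr s * 2 * emb_const s"

lemma emb_const_nonneg: "0 \<le> emb_const s"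
  by (simp add: emb_const_def)

lemma alg_const_nonneg: "0 \<le> alg_const s"
  by (simp add: alg_const_def emb_const_nonneg)

text \<open>The weight goes to one of the two factors, which stays in L2, and the other factor is
  estimated in L1 by \<open>weighted_L1\<close>. The two possibilities are the 2 in
  \<open>alg_const\<close>.\<close>

lemma conv_algebra:
  assumes s: "s > 2" and U: "U \<in> borel_measurable borel" "wt (jw s) U \<in> pts L2"
    and V: "V \<in> borel_measurable borel" "wt (jw s) V \<in> pts L2"
  shows "wt (jw s) (conv U V) \<in> pts L2"
    "n2 (wt (jw s) (conv U V)) \<le> alg_const s * n2 (wt (jw s) U) * n2 (wt (jw s) V)"
proof -
  note [measurable] = U(1) V(1)
  have s0: "0 \<le> s" using s by simp
  note UL = jb_weight_L2(1)[OF s0 U] and VL = jb_weight_L2(1)[OF s0 V]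
  note U1 = L1_of_jb[OF U(1) weighted_L1(1)[OF s U]] and V1 = L1_of_jb[OF V(1) weighted_L1(1)[OF s V]]
  note cU = order_trans[OF U1(2) weighted_L1(2)[OF s U]] and cV = order_trans[OF V1(2) weighted_L1(2)[OF s V]]
  let ?A = "conv (absf (wt (jw s) U)) (absf V)" and ?B = "conv (absf U) (absf (wt (jw s) V))"
  note YA = young_absf(3,4)[OF V1(1) U(2)] and YB = young_absf(1,2)[OF U1(1) V(2)]
  have le: "cmod (wt (jw s) (conv U V) \<zeta>) \<le> 2 powr s * cmod (?A \<zeta>) + 2 powr s * cmod (?B \<zeta>)" for \<zeta>
  proof -
    \<comment> \<open>The constant of \<open>jw_subadd\<close> is divided out to fit the unit
      coefficients of \<open>kernel_bound\<close> and restored afterwards.\<close>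
    let ?c = "complex_of_real (jb \<zeta> powr s / 2 powr s)"
    have kb: "cmod (LINT \<zeta>'|lborel. ?c * (U (\<zeta> - \<zeta>') * V \<zeta>')) \<le> cmod (?A \<zeta>) + cmod (?B \<zeta>)"
    proof (rule kernel_bound[OF U(2) VL UL V(2)])
      fix \<zeta>'
      have "jb \<zeta> powr s / 2 powr s \<le> jb (\<zeta> - \<zeta>') powr s + jb \<zeta>' powr s"
        using jw_subadd[OF s0, of \<zeta> \<zeta>'] by (simp add: divide_le_eq mult.commute)
      from mult_right_mono[OF this mult_nonneg_nonneg[OF norm_ge_zero[of "U (\<zeta> - \<zeta>')"] norm_ge_zero[of "V \<zeta>'"]]]
      show "cmod (?c * (U (\<zeta> - \<zeta>') * V \<zeta>')) \<le> cmod (wt (jw s) U (\<zeta> - \<zeta>')) * cmod (V \<zeta>') +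
          cmod (U (\<zeta> - \<zeta>')) * cmod (wt (jw s) V \<zeta>')"
        unfolding norm_mult norm_of_real by (simp add: algebra_simps)
    qed
    have "(LINT \<zeta>'|lborel. ?c * (U (\<zeta> - \<zeta>') * V \<zeta>')) = ?c * conv U V \<zeta>"
      unfolding conv_def by (rule integral_mult_right_zero)
    note kb[unfolded this]
    then have "2 powr s * cmod (?c * conv U V \<zeta>) \<le> 2 powr s * (cmod (?A \<zeta>) + cmod (?B \<zeta>))"
      by (intro mult_left_mono) auto
    moreover have "2 powr s * cmod (?c * conv U V \<zeta>) = cmod (wt (jw s) (conv U V) \<zeta>)"
      unfolding norm_mult norm_of_real by simp
    ultimately show ?thesis by (simp only: distrib_left)
  qed
  note B = L2_bound2[OF _ YA(1) YB(1) powr_ge_zero powr_ge_zero le]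
  show "wt (jw s) (conv U V) \<in> pts L2" by (rule B(1)) measurable
  have "n2 (wt (jw s) (conv U V)) \<le> 2 powr s * n2 ?A + 2 powr s * n2 ?B" by (rule B(2)) measurable
  also have "\<dots> \<le> 2 powr s * (emb_const s * n2 (wt (jw s) V) * n2 (wt (jw s) U)) +
      2 powr s * (emb_const s * n2 (wt (jw s) U) * n2 (wt (jw s) V))"
    by (intro add_mono mult_left_mono order_trans[OF YA(2)] order_trans[OF YB(2)] mult_right_mono cU cV) auto
  also have "\<dots> = alg_const s * n2 (wt (jw s) U) * n2 (wt (jw s) V)"
    by (simp add: alg_const_def algebra_simps)
  finally show "n2 (wt (jw s) (conv U V)) \<le> alg_const s * n2 (wt (jw s) U) * n2 (wt (jw s) V)" .
qed

lemma wt_diff: "wt \<mu> (\<lambda>\<zeta>. U \<zeta> - V \<zeta>) = (\<lambda>\<zeta>. wt \<mu> U \<zeta> - wt \<mu> V \<zeta>)"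
  by (simp add: right_diff_distrib)

lemma wt_diff_L2: "wt \<mu> U \<in> pts L2 \<Longrightarrow> wt \<mu> V \<in> pts L2 \<Longrightarrow> wt \<mu> (\<lambda>\<zeta>. U \<zeta> - V \<zeta>) \<in> pts L2"
  unfolding wt_diff by (rule L2_diff(1))

lemma conv_square_diff:
  assumes s: "s > 2" and U: "U \<in> borel_measurable borel" "wt (jw s) U \<in> pts L2"
    and V: "V \<in> borel_measurable borel" "wt (jw s) V \<in> pts L2"
  shows "n2 (wt (jw s) (\<lambda>\<zeta>. conv U U \<zeta> - conv V V \<zeta>)) \<le>
    alg_const s * wdist (jw s) U V * (n2 (wt (jw s) U) + n2 (wt (jw s) V))"
proof -
  have s0: "0 \<le> s" using s by simp
  note [measurable] = U(1) V(1)
  note L = jb_weight_L2(1)[OF s0 U] jb_weight_L2(1)[OF s0 V]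
  let ?D = "\<lambda>\<zeta>. U \<zeta> - V \<zeta>"
  have D: "?D \<in> borel_measurable borel" "wt (jw s) ?D \<in> pts L2" using wt_diff_L2[OF U(2) V(2)] by simp_all
  have e: "conv U U \<zeta> - conv V V \<zeta> = conv ?D U \<zeta> + conv V ?D \<zeta>" for \<zeta>
    by (simp add: conv_diff_left conv_diff_right L)
  note A1 = conv_algebra[OF s D U] and A2 = conv_algebra[OF s V D]
  have "n2 (wt (jw s) (\<lambda>\<zeta>. conv U U \<zeta> - conv V V \<zeta>)) \<le> n2 (wt (jw s) (conv ?D U)) + n2 (wt (jw s) (conv V ?D))"
    unfolding e using L2_add(2)[OF A1(1) A2(1)] by (simp add: distrib_left)
  also have "\<dots> \<le> alg_const s * n2 (wt (jw s) ?D) * n2 (wt (jw s) U) + alg_const s * n2 (wt (jw s) V) * n2 (wt (jw s) ?D)"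
    by (rule add_mono[OF A1(2) A2(2)])
  finally show ?thesis by (simp add: algebra_simps)
qed

section \<open>Bounds and time continuity of a solution and of its square\<close>

lemma fsol_bounded:
  assumes U: "fsol \<alpha> s T U" and s: "s > 2"
  shows "\<exists>M\<ge>0. \<forall>t\<in>{0..T}. n2 (wt (jw s) (U t)) \<le> M"
proof -
  have "continuous_on {0..T} (\<lambda>t. n2 (wt (jw s) (U t)))"
    unfolding continuous_on_def
  proof
    fix t assume t: "t \<in> {0..T}"
    have ev: "eventually (\<lambda>r. r \<in> {0..T}) (at t within {0..T})" by (simp add: eventually_at_filter)
    have "eventually (\<lambda>r. norm (n2 (wt (jw s) (U r)) - n2 (wt (jw s) (U t))) \<le> wdist (jw s) (U r) (U t)) (at t within {0..T})"
      using ev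
    proof eventually_elim
      case (elim r)
      show ?case unfolding wt_diff real_norm_def by (rule n2_abs_diff[OF fsolD(2)[OF U s elim] fsolD(2)[OF U s t]])
    qed
    from Lim_null_comparison[OF this fsolD(6)[OF U s t]]
    show "((\<lambda>t. n2 (wt (jw s) (U t))) \<longlongrightarrow> n2 (wt (jw s) (U t))) (at t within {0..T})"
      by (simp only: Lim_null[symmetric])
  qed
  from compact_imp_bounded[OF compact_continuous_image[OF this compact_Icc]]
  obtain M where "\<forall>t\<in>{0..T}. norm (n2 (wt (jw s) (U t))) \<le> M" by (auto simp: bounded_iff)
  then have "\<forall>t\<in>{0..T}. n2 (wt (jw s) (U t)) \<le> max M 0" by auto
  then show ?thesis by (intro exI[of _ "max M 0"]) simp
qed

lemma fsol_conv_continuous: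
  assumes U: "fsol \<alpha> s T U" and s: "s > 2" and t: "t \<in> {0..T}"
  shows "((\<lambda>r. n2 (\<lambda>\<zeta>. wt (jw s) (conv (U r) (U r)) \<zeta> - wt (jw s) (conv (U t) (U t)) \<zeta>)) \<longlongrightarrow> 0) (at t within {0..T})"
proof -
  obtain M where M: "M \<ge> 0" "\<And>r. r \<in> {0..T} \<Longrightarrow> n2 (wt (jw s) (U r)) \<le> M" using fsol_bounded[OF U s] by blast
  have ev: "eventually (\<lambda>r. r \<in> {0..T}) (at t within {0..T})" by (simp add: eventually_at_filter)
  have ev2: "eventually (\<lambda>r. norm (n2 (\<lambda>\<zeta>. wt (jw s) (conv (U r) (U r)) \<zeta> - wt (jw s) (conv (U t) (U t)) \<zeta>)) \<le>
      alg_const s * (2 * M) * wdist (jw s) (U r) (U t)) (at t within {0..T})"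
    using ev
  proof eventually_elim
    case (elim r)
    have "n2 (\<lambda>\<zeta>. wt (jw s) (conv (U r) (U r)) \<zeta> - wt (jw s) (conv (U t) (U t)) \<zeta>) \<le>
        alg_const s * wdist (jw s) (U r) (U t) * (n2 (wt (jw s) (U r)) + n2 (wt (jw s) (U t)))"
      unfolding wt_diff[symmetric, of "jw s" "conv (U r) (U r)"]
      by (rule conv_square_diff[OF s fsolD(1,2)[OF U s elim] fsolD(1,2)[OF U s t]])
    also have "\<dots> \<le> alg_const s * wdist (jw s) (U r) (U t) * (M + M)"
      using M(2)[OF elim] M(2)[OF t] by (intro mult_left_mono add_mono mult_nonneg_nonneg alg_const_nonneg n2_nonneg)
    finally show ?case by (simp add: mult_ac)
  qed
  show ?thesis
    by (rule Lim_null_comparison[OF ev2 tendsto_mult_right_zero[OF fsolD(6)[OF U s t]]])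
qed

text \<open>Closeness in the Sobolev norm is required at all times, as continuous dependence in
  \<open>H s\<close> will supply it; closeness in the weighted norm is required only
  initially.\<close>

abbreviation nearby :: "real \<Rightarrow> real \<Rightarrow> real \<Rightarrow> (plane \<Rightarrow> real) \<Rightarrow> (real \<Rightarrow> func) \<Rightarrow> real \<Rightarrow>
    ((real \<Rightarrow> func) \<Rightarrow> real \<Rightarrow> bool) \<Rightarrow> bool" where
  "nearby \<alpha> s T \<mu> U d P \<equiv> \<forall>U'. fsol \<alpha> s T U' \<longrightarrow> wt \<mu> (U' 0) \<in> pts L2 \<longrightarrow>
     (\<forall>t\<in>{0..T}. wdist (jw s) (U' t) (U t) < d) \<longrightarrow> wdist \<mu> (U' 0) (U 0) < d \<longrightarrow> (\<forall>t\<in>{0..T}. P U' t)"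

text \<open>The two conclusions of the theorem for the weighted norm \<open>\<parallel>\<mu> U\<parallel>\<close>, on the Fourier side. Both follow
  from tails \<open>\<parallel>\<tau> k U(t)\<parallel>\<close> that are small uniformly in \<open>t\<close> and in the nearby data.\<close>

definition propagates :: "real \<Rightarrow> real \<Rightarrow> real \<Rightarrow> (plane \<Rightarrow> real) \<Rightarrow> bool" where
  "propagates \<alpha> s T \<mu> \<longleftrightarrow> (\<forall>U. fsol \<alpha> s T U \<longrightarrow> wt \<mu> (U 0) \<in> pts L2 \<longrightarrow>
     (\<forall>t\<in>{0..T}. wt \<mu> (U t) \<in> pts L2 \<and> ((\<lambda>r. wdist \<mu> (U r) (U t)) \<longlongrightarrow> 0) (at t within {0..T})) \<and>
     (\<forall>e>0. \<exists>d>0. nearby \<alpha> s T \<mu> U d (\<lambda>U' t. wdist \<mu> (U' t) (U t) < e)))"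

text \<open>The order of quantifiers matters: one \<open>k\<close> and one \<open>d\<close> serve
  all times and all nearby solutions, \<open>U\<close> itself among them.\<close>

definition tail_control :: "real \<Rightarrow> real \<Rightarrow> real \<Rightarrow> (plane \<Rightarrow> real) \<Rightarrow> (nat \<Rightarrow> plane \<Rightarrow> real) \<Rightarrow> bool" where
  "tail_control \<alpha> s T \<mu> \<tau> \<longleftrightarrow> (\<forall>U. fsol \<alpha> s T U \<longrightarrow> wt \<mu> (U 0) \<in> pts L2 \<longrightarrow>
     (\<forall>e>0. \<exists>k. \<exists>d>0. nearby \<alpha> s T \<mu> U d (\<lambda>U' t. wt (\<tau> k) (U' t) \<in> pts L2 \<and> n2 (wt (\<tau> k) (U' t)) < e)))"

lemma propagates_jw:
  assumes "s > 2" shows "propagates \<alpha> s T (jw s)"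
  unfolding propagates_def
proof (intro allI impI conjI ballI)
  fix U t assume U: "fsol \<alpha> s T U" "t \<in> {0..T}"
  show "wt (jw s) (U t) \<in> pts L2" by (rule fsolD(2)[OF U(1) assms U(2)])
  show "((\<lambda>r. wdist (jw s) (U r) (U t)) \<longlongrightarrow> 0) (at t within {0..T})"
    by (rule fsolD(6)[OF U(1) assms U(2)])
next
  fix U and e :: real assume "0 < e"
  then show "\<exists>d>0. \<forall>U'. fsol \<alpha> s T U' \<longrightarrow> wt (jw s) (U' 0) \<in> pts L2 \<longrightarrow>
        (\<forall>t\<in>{0..T}. wdist (jw s) (U' t) (U t) < d) \<longrightarrow> wdist (jw s) (U' 0) (U 0) < d \<longrightarrow>
        (\<forall>t\<in>{0..T}. wdist (jw s) (U' t) (U t) < e)" by blast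
qed

text \<open>Up to the tail weight, \<open>\<mu>\<close> is dominated by \<open>\<nu>\<close>, whose
  propagation is known. So the difference of two solutions is measured with \<open>\<nu>\<close>,
  and of the tails only the sum of the two norms is used. \<open>\<nu>\<close> will be the Sobolev
  weight for the weights of size 1 / |\<xi>|, and |rho| for \<open>Y\<close>.\<close>

lemma propagates_of_tails:
  assumes s: "s > 2" and T: "0 \<le> T" and \<nu>: "propagates \<alpha> s T \<nu>" and tc: "tail_control \<alpha> s T \<mu> \<tau>"
    and [measurable]: "\<mu> \<in> borel_measurable borel" "\<nu> \<in> borel_measurable borel"
    and \<nu>le: "\<And>\<zeta>. \<bar>\<nu> \<zeta>\<bar> \<le> 1 * \<bar>jb \<zeta> powr s\<bar> + 1 * \<bar>\<mu> \<zeta>\<bar>"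
    and split: "\<And>k. \<exists>c\<ge>0. \<forall>\<zeta>. \<bar>\<mu> \<zeta>\<bar> \<le> c * \<bar>\<nu> \<zeta>\<bar> + 2 * \<bar>\<tau> k \<zeta>\<bar>"
  shows "propagates \<alpha> s T \<mu>"
  unfolding propagates_def
proof (intro allI impI)
  fix U assume U: "fsol \<alpha> s T U" and U0: "wt \<mu> (U 0) \<in> pts L2"
  have T0: "0 \<in> {0..T}" using T by simp
  have ar1: "x \<le> y + 2 * (a + b)" if "x \<le> y + 2 * z" "z \<le> a + b" for x y z a b :: real
    using that by simp
  \<comment> \<open>The budget: e / 2 for the part measured with \<open>\<nu>\<close> and less than
    2 (e / 8 + e / 8) for the two tails.\<close>
  have ar2: "x < e" if "x \<le> y + 2 * (a + b)" "y \<le> e / 2" "a < e / 8" "b < e / 8" "0 < e" for x y a b e :: real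
    using that by simp
  have \<nu>0: "wt \<nu> (V 0) \<in> pts L2" if V: "fsol \<alpha> s T V" "wt \<mu> (V 0) \<in> pts L2" for V
  proof -
    show ?thesis by (rule wt_bound2(1)[OF fsolD(1)[OF V(1) s T0] assms(6) fsolD(2)[OF V(1) s T0] V(2) zero_le_one zero_le_one \<nu>le])
  qed
  \<comment> \<open>\<open>U\<close> lies in each of its own neighbourhoods, so tail control applies
    to \<open>U\<close> as well.\<close>
  have self: "wdist \<rho> (U t) (U t) < d" if "d > 0" for \<rho> d t using that by (simp add: L2_zero)
  from tc U U0 have tcU: "\<exists>k. \<exists>d>0. nearby \<alpha> s T \<mu> U d (\<lambda>U' t. wt (\<tau> k) (U' t) \<in> pts L2 \<and> n2 (wt (\<tau> k) (U' t)) < e)" if "e > 0" for e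
    using that unfolding tail_control_def by simp
  have tcU1: "\<exists>k. \<forall>t\<in>{0..T}. wt (\<tau> k) (U t) \<in> pts L2 \<and> n2 (wt (\<tau> k) (U t)) < e" if e: "e > 0" for e
  proof -
    obtain k d where d: "d > 0" and *: "nearby \<alpha> s T \<mu> U d (\<lambda>U' t. wt (\<tau> k) (U' t) \<in> pts L2 \<and> n2 (wt (\<tau> k) (U' t)) < e)"
      using tcU[OF e] by (elim exE conjE)
    show ?thesis
      by (rule exI[of _ k], rule *[THEN spec, of U, THEN mp, OF U, THEN mp, OF U0, THEN mp, THEN mp]) (rule ballI, rule self[OF d], rule self[OF d])
  qed
  from \<nu> U \<nu>0[OF U U0] have \<nu>I: "\<And>t. t \<in> {0..T} \<Longrightarrow> wt \<nu> (U t) \<in> pts L2"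
      "\<And>t. t \<in> {0..T} \<Longrightarrow> ((\<lambda>r. wdist \<nu> (U r) (U t)) \<longlongrightarrow> 0) (at t within {0..T})"
    unfolding propagates_def by simp_all
  have \<nu>I': "wt \<nu> (V t) \<in> pts L2" if V: "fsol \<alpha> s T V" "wt \<mu> (V 0) \<in> pts L2" "t \<in> {0..T}" for V t
    using \<nu> V(1,3) \<nu>0[OF V(1,2)] unfolding propagates_def by simp
  from \<nu> U \<nu>0[OF U U0] have \<nu>II: "\<exists>d>0. nearby \<alpha> s T \<nu> U d (\<lambda>U' t. wdist \<nu> (U' t) (U t) < e)" if "e > 0" for e
    using that unfolding propagates_def by simp
  have mem: "wt \<mu> V \<in> pts L2" if "\<And>\<zeta>. \<bar>\<mu> \<zeta>\<bar> \<le> c * \<bar>\<nu> \<zeta>\<bar> + 2 * \<bar>\<tau> k \<zeta>\<bar>" "0 \<le> c" "V \<in> borel_measurable borel"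
    "wt \<nu> V \<in> pts L2" "wt (\<tau> k) V \<in> pts L2" for V c k
    by (rule wt_bound2(1)[OF that(3) assms(5) that(4,5,2) zero_le_numeral that(1)])
  have diff: "wdist \<mu> V V' \<le> c * wdist \<nu> V V' + 2 * (n2 (wt (\<tau> k) V) + n2 (wt (\<tau> k) V'))"
    if "\<And>\<zeta>. \<bar>\<mu> \<zeta>\<bar> \<le> c * \<bar>\<nu> \<zeta>\<bar> + 2 * \<bar>\<tau> k \<zeta>\<bar>" "0 \<le> c" "V \<in> borel_measurable borel" "V' \<in> borel_measurable borel"
    "wt \<nu> V \<in> pts L2" "wt (\<tau> k) V \<in> pts L2" "wt \<nu> V' \<in> pts L2" "wt (\<tau> k) V' \<in> pts L2" for V V' c k
  proof -
    note [measurable] = that(3,4)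
    have "wdist \<mu> V V' \<le> c * wdist \<nu> V V' + 2 * wdist (\<tau> k) V V'"
      by (rule wt_bound2(2)[OF _ assms(5) wt_diff_L2[OF that(5,7)] wt_diff_L2[OF that(6,8)] that(2) zero_le_numeral that(1)]) simp
    moreover have "wdist (\<tau> k) V V' \<le> n2 (wt (\<tau> k) V) + n2 (wt (\<tau> k) V')"
      unfolding wt_diff by (rule L2_diff(2)[OF that(6,8)])
    ultimately show ?thesis by (rule ar1)
  qed
  show "(\<forall>t\<in>{0..T}. wt \<mu> (U t) \<in> pts L2 \<and> ((\<lambda>r. wdist \<mu> (U r) (U t)) \<longlongrightarrow> 0) (at t within {0..T})) \<and>
     (\<forall>e>0. \<exists>d>0. nearby \<alpha> s T \<mu> U d (\<lambda>U' t. wdist \<mu> (U' t) (U t) < e))"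
  proof (intro conjI ballI allI impI)
    fix t assume t: "t \<in> {0..T}"
    obtain k where k: "\<And>t. t \<in> {0..T} \<Longrightarrow> wt (\<tau> k) (U t) \<in> pts L2"
      using tcU1[OF zero_less_one] by blast
    obtain c where "0 \<le> c" "\<And>\<zeta>. \<bar>\<mu> \<zeta>\<bar> \<le> c * \<bar>\<nu> \<zeta>\<bar> + 2 * \<bar>\<tau> k \<zeta>\<bar>" using split[of k] by blast
    then show "wt \<mu> (U t) \<in> pts L2" using mem fsolD(1)[OF U s t] \<nu>I(1)[OF t] k[OF t] by blast
    show "((\<lambda>r. wdist \<mu> (U r) (U t)) \<longlongrightarrow> 0) (at t within {0..T})"
    proof (rule tendstoI)
      fix e :: real assume e: "0 < e"
      then have "0 < e / 8" by simp
      from tcU1[OF this] obtain k where k: "\<And>t. t \<in> {0..T} \<Longrightarrow> wt (\<tau> k) (U t) \<in> pts L2 \<and> n2 (wt (\<tau> k) (U t)) < e / 8"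
        by blast
      obtain c where c: "0 \<le> c" "\<And>\<zeta>. \<bar>\<mu> \<zeta>\<bar> \<le> c * \<bar>\<nu> \<zeta>\<bar> + 2 * \<bar>\<tau> k \<zeta>\<bar>" using split[of k] by blast
      have "eventually (\<lambda>r. c * wdist \<nu> (U r) (U t) < e / 2) (at t within {0..T})"
        using order_tendstoD(2)[OF tendsto_mult_right_zero[OF \<nu>I(2)[OF t]], of "e / 2" c] e by simp
      moreover have "eventually (\<lambda>r. r \<in> {0..T}) (at t within {0..T})" by (simp add: eventually_at_filter)
      ultimately show "eventually (\<lambda>r. dist (wdist \<mu> (U r) (U t)) 0 < e) (at t within {0..T})"
      proof eventually_elim
        case (elim r)
        note D = diff[OF c(2,1) fsolD(1)[OF U s elim(2)] fsolD(1)[OF U s t] \<nu>I(1)[OF elim(2)] conjunct1[OF k[OF elim(2)]] \<nu>I(1)[OF t] conjunct1[OF k[OF t]]]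
        have "wdist \<mu> (U r) (U t) < e"
          by (rule ar2[OF D less_imp_le[OF elim(1)] conjunct2[OF k[OF elim(2)]] conjunct2[OF k[OF t]] e])
        then show ?case by (simp only: dist_real_def diff_0_right abs_of_nonneg[OF n2_nonneg])
      qed
    qed
  next
    fix e :: real assume e: "0 < e"
    then have "0 < e / 8" by simp
    from tcU[OF this] obtain k d1 where d1: "0 < d1" and k: "\<And>V t. fsol \<alpha> s T V \<Longrightarrow> wt \<mu> (V 0) \<in> pts L2 \<Longrightarrow>
        (\<forall>t\<in>{0..T}. wdist (jw s) (V t) (U t) < d1) \<Longrightarrow> wdist \<mu> (V 0) (U 0) < d1 \<Longrightarrow>
        t \<in> {0..T} \<Longrightarrow> wt (\<tau> k) (V t) \<in> pts L2 \<and> n2 (wt (\<tau> k) (V t)) < e / 8" by blast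
    obtain c where c: "0 \<le> c" "\<And>\<zeta>. \<bar>\<mu> \<zeta>\<bar> \<le> c * \<bar>\<nu> \<zeta>\<bar> + 2 * \<bar>\<tau> k \<zeta>\<bar>" using split[of k] by blast
    \<comment> \<open>Multiplied by \<open>c\<close> this is at most e / 2; the 1 guards against c =
      0.\<close>
    have e': "0 < e / (2 * (c + 1))" using e c(1) by simp
    obtain d2 where d2: "0 < d2" and \<nu>c: "\<And>V t. fsol \<alpha> s T V \<Longrightarrow> wt \<nu> (V 0) \<in> pts L2 \<Longrightarrow>
        (\<forall>t\<in>{0..T}. wdist (jw s) (V t) (U t) < d2) \<Longrightarrow> wdist \<nu> (V 0) (U 0) < d2 \<Longrightarrow>
        t \<in> {0..T} \<Longrightarrow> wdist \<nu> (V t) (U t) < e / (2 * (c + 1))"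
      using \<nu>II[OF e'] by blast
    show "\<exists>d>0. nearby \<alpha> s T \<mu> U d (\<lambda>U' t. wdist \<mu> (U' t) (U t) < e)"
    proof (intro exI[of _ "min d1 (d2 / 2)"] conjI allI impI ballI)
      \<comment> \<open>The initial \<open>\<nu>\<close> distance is at most the Sobolev distance
        plus the \<open>\<mu>\<close> distance, hence the half of \<open>d2\<close>.\<close>
      show "0 < min d1 (d2 / 2)" using d1 d2 by simp
      fix V t assume V: "fsol \<alpha> s T V" "wt \<mu> (V 0) \<in> pts L2"
        and cl: "\<forall>t\<in>{0..T}. wdist (jw s) (V t) (U t) < min d1 (d2 / 2)"
        and cl0: "wdist \<mu> (V 0) (U 0) < min d1 (d2 / 2)" and t: "t \<in> {0..T}"
      note [measurable] = fsolD(1)[OF V(1) s T0] fsolD(1)[OF U s T0]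
      have "wdist \<nu> (V 0) (U 0) \<le> 1 * wdist (jw s) (V 0) (U 0) + 1 * wdist \<mu> (V 0) (U 0)"
        by (rule wt_bound2(2)[OF _ assms(6) wt_diff_L2[OF fsolD(2)[OF V(1) s T0] fsolD(2)[OF U s T0]] wt_diff_L2[OF V(2) U0] zero_le_one zero_le_one \<nu>le]) simp
      then have n0: "wdist \<nu> (V 0) (U 0) < d2" using bspec[OF cl T0] cl0 by linarith
      have cl1: "\<forall>t\<in>{0..T}. wdist (jw s) (V t) (U t) < d1" using cl by simp
      have cl2: "\<forall>t\<in>{0..T}. wdist (jw s) (V t) (U t) < d2"
      proof
        fix t assume "t \<in> {0..T}"
        from bspec[OF cl this] show "wdist (jw s) (V t) (U t) < d2" using d2 by linarith
      qed
      have cl01: "wdist \<mu> (V 0) (U 0) < d1" using cl0 by simp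
      have kV: "wt (\<tau> k) (V t) \<in> pts L2 \<and> n2 (wt (\<tau> k) (V t)) < e / 8" by (rule k[OF V cl1 cl01 t])
      have kU: "wt (\<tau> k) (U t) \<in> pts L2 \<and> n2 (wt (\<tau> k) (U t)) < e / 8"
        by (rule k[OF U U0 _ _ t]) (rule ballI, rule self[OF d1], rule self[OF d1])
      have "wdist \<nu> (V t) (U t) < e / (2 * (c + 1))" by (rule \<nu>c[OF V(1) \<nu>0[OF V] cl2 n0 t])
      then have "c * wdist \<nu> (V t) (U t) \<le> c * (e / (2 * (c + 1)))" using c(1) by (intro mult_left_mono) auto
      also have "\<dots> \<le> e / 2" using c(1) e by (simp add: field_simps)
      finally have 1: "c * wdist \<nu> (V t) (U t) \<le> e / 2" .
      show "wdist \<mu> (V t) (U t) < e"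
        by (rule ar2[OF diff[OF c(2,1) fsolD(1)[OF V(1) s t] fsolD(1)[OF U s t] \<nu>I'[OF V t] conjunct1[OF kV] \<nu>I(1)[OF t] conjunct1[OF kU]]
          1 conjunct2[OF kV] conjunct2[OF kU] e])
    qed
  qed
qed

subsection \<open>Weights of size one over \<open>\<bar>\<xi>\<bar>\<close>\<close>

lemma AE_fst_nonzero: "AE \<zeta> in (lborel :: plane measure). fst \<zeta> \<noteq> 0"
proof -
  have "emeasure (lborel \<Otimes>\<^sub>M lborel) ({0 :: real} \<times> (UNIV :: real set)) = 0"
    by (subst lborel.emeasure_pair_measure_Times) auto
  then have "({0} \<times> UNIV :: plane set) \<in> null_sets lborel"
    by (intro null_setsI) (auto simp: lborel_prod intro!: borel_closed closed_Times)
  from AE_not_in[OF this] show ?thesis by eventually_elim (auto simp: mem_Times_iff)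
qed

lemma eventually_window:
  assumes "fst \<zeta> \<noteq> 0"
  shows "eventually (\<lambda>n. \<zeta> \<in> window n) sequentially"
proof -
  have "(\<lambda>n. 1 / real (Suc n)) \<longlonglongrightarrow> 0" by (rule LIMSEQ_Suc[OF lim_1_over_n])
  from order_tendstoD(2)[OF this, of "\<bar>fst \<zeta>\<bar>"] assms
  have 1: "eventually (\<lambda>n. 1 / real (Suc n) < \<bar>fst \<zeta>\<bar>) sequentially" by simp
  have "filterlim (\<lambda>n. real (Suc n)) at_top sequentially"
    using filterlim_compose[OF filterlim_real_sequentially filterlim_Suc] .
  then have "eventually (\<lambda>n. norm \<zeta> \<le> real (Suc n)) sequentially" by (simp only: filterlim_at_top)
  with 1 show ?thesis by eventually_elim (simp add: window_def)
qed

lemma window_complement_tendsto: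
  "AE \<zeta> in lborel. (\<lambda>k. indicator (- window k) \<zeta> :: real) \<longlonglongrightarrow> 0"
  using AE_fst_nonzero
proof eventually_elim
  case (elim \<zeta>)
  have "eventually (\<lambda>k. indicator (- window k) \<zeta> = (0 :: real)) sequentially"
    using eventually_window[OF elim] by eventually_elim simp
  then show ?case by (rule tendsto_eventually)
qed

lemma wt_window_limit:
  assumes m: "\<mu> \<in> borel_measurable borel" "V \<in> borel_measurable borel"
    and bd: "\<And>n. wt (\<lambda>\<zeta>. \<mu> \<zeta> * indicator (window n) \<zeta>) V \<in> pts L2"
      "\<And>n. n2 (wt (\<lambda>\<zeta>. \<mu> \<zeta> * indicator (window n) \<zeta>) V) \<le> c"
  shows "wt \<mu> V \<in> pts L2" "n2 (wt \<mu> V) \<le> c"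
proof -
  have "AE \<zeta> in lborel. (\<lambda>n. wt (\<lambda>\<zeta>. \<mu> \<zeta> * indicator (window n) \<zeta>) V \<zeta>) \<longlonglongrightarrow> wt \<mu> V \<zeta>"
    using AE_fst_nonzero
  proof eventually_elim
    case (elim \<zeta>)
    have "eventually (\<lambda>n. wt (\<lambda>\<zeta>. \<mu> \<zeta> * indicator (window n) \<zeta>) V \<zeta> = wt \<mu> V \<zeta>) sequentially"
      using eventually_window[OF elim] by eventually_elim simp
    then show ?case by (rule tendsto_eventually)
  qed
  from L2_Fatou[OF bd this wt_measurable[OF m]]
  show "wt \<mu> V \<in> pts L2" "n2 (wt \<mu> V) \<le> c" .
qed

lemma xweight_window_bound:
  assumes "\<zeta> \<in> window n" "0 \<le> \<mu> \<zeta>" "\<mu> \<zeta> * \<bar>fst \<zeta>\<bar> \<le> jb \<zeta> powr s" "0 \<le> s"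
  shows "\<mu> \<zeta> \<le> real (Suc n) * jb \<zeta> powr s" "\<mu> \<zeta> \<le> real (Suc n) * real (n + 2) powr s"
proof -
  note b = window_bounds[OF assms(1)]
  have "\<mu> \<zeta> = inverse \<bar>fst \<zeta>\<bar> * (\<mu> \<zeta> * \<bar>fst \<zeta>\<bar>)" using b(1) by simp
  also have "\<dots> \<le> real (Suc n) * jb \<zeta> powr s" using b(2) assms(2,3) by (intro mult_mono) auto
  finally show 1: "\<mu> \<zeta> \<le> real (Suc n) * jb \<zeta> powr s" .
  have "jb \<zeta> powr s \<le> real (n + 2) powr s"
    using b(5) assms(4) by (intro powr_mono2) (auto simp: less_imp_le)
  then have "real (Suc n) * jb \<zeta> powr s \<le> real (Suc n) * real (n + 2) powr s" by (rule mult_left_mono) simp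
  with 1 show "\<mu> \<zeta> \<le> real (Suc n) * real (n + 2) powr s" by (rule order_trans)
qed

lemma norm_nonlin_le: "cmod (nonlin U \<zeta>) \<le> \<bar>fst \<zeta>\<bar> * cmod (conv U U \<zeta>)"
proof -
  have "\<bar>fst \<zeta> / (4 * pi)\<bar> \<le> \<bar>fst \<zeta>\<bar> / 1"
    unfolding abs_divide by (rule divide_left_mono) (use pi_gt3 in auto)
  then have "\<bar>fst \<zeta> / (4 * pi)\<bar> * cmod (conv U U \<zeta>) \<le> \<bar>fst \<zeta>\<bar> / 1 * cmod (conv U U \<zeta>)"
    by (rule mult_right_mono) simp
  then show ?thesis unfolding nonlin_def norm_mult norm_of_real norm_ii by simp
qed

text \<open>Restriction to a set \<open>B\<close> of frequencies commutes with the linear evolution,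
  so the energy on \<open>B\<close> is driven only by the part of the nonlinearity in
  \<open>B\<close>. There the hypothesis on \<mu> |\<xi>| turns the weight into the Sobolev weight
  of the convolution. Through 2 x y \<le> x^2 + y^2 the Gronwall rate is 1, the same for all
  solutions.\<close>

lemma xweight_tail:
  assumes U: "fsol \<alpha> s T U" and s: "s > 2" and \<alpha>: "-1 \<le> \<alpha>" "\<alpha> \<le> 1"
    and \<mu> [measurable]: "\<mu> \<in> borel_measurable borel" and \<mu>0: "\<And>\<zeta>. 0 \<le> \<mu> \<zeta>" and \<mu>le: "\<And>\<zeta>. \<mu> \<zeta> * \<bar>fst \<zeta>\<bar> \<le> jb \<zeta> powr s"
    and B [measurable]: "B \<in> sets borel" and \<kappa>: "0 \<le> \<kappa>"
    and tail: "\<And>r. r \<in> {0..T} \<Longrightarrow> n2 (wt (indicator B) (wt (jw s) (conv (U r) (U r)))) \<le> \<kappa>"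
    and U0: "wt (\<lambda>\<zeta>. indicator B \<zeta> * \<mu> \<zeta>) (U 0) \<in> pts L2" and t: "t \<in> {0..T}"
  shows "wt (\<lambda>\<zeta>. indicator B \<zeta> * \<mu> \<zeta>) (U t) \<in> pts L2"
    "(n2 (wt (\<lambda>\<zeta>. indicator B \<zeta> * \<mu> \<zeta>) (U t)))\<^sup>2 \<le> exp T * ((n2 (wt (\<lambda>\<zeta>. indicator B \<zeta> * \<mu> \<zeta>) (U 0)))\<^sup>2 + T * \<kappa>\<^sup>2)"
proof -
  have T0: "0 \<in> {0..T}" using t by auto
  \<comment> \<open>The additional cut to a window makes the energy differentiable; the final bound
    does not depend on \<open>n\<close>, so Fatou removes the cut.\<close>
  let ?w = "\<lambda>n \<zeta>. indicator B \<zeta> * \<mu> \<zeta> * indicator (window n) \<zeta>"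
  have [measurable]: "?w n \<in> borel_measurable borel" for n by measurable
  let ?c = "\<lambda>n. real (Suc n) * real (n + 2) powr s"
  have wc: "\<bar>?w n \<zeta>\<bar> \<le> ?c n * indicator (window n) \<zeta>" for n \<zeta>
    using xweight_window_bound(2)[where \<mu>=\<mu> and \<zeta>=\<zeta> and n=n and s=s, OF _ \<mu>0 \<mu>le] \<mu>0[of \<zeta>] s by (cases "\<zeta> \<in> window n") (auto simp: indicator_def abs_mult)
  let ?E0 = "(n2 (wt (\<lambda>\<zeta>. indicator B \<zeta> * \<mu> \<zeta>) (U 0)))\<^sup>2"
  have En: "wt (?w n) (U t) \<in> pts L2 \<and> (n2 (wt (?w n) (U t)))\<^sup>2 \<le> exp T * (?E0 + T * \<kappa>\<^sup>2)" for n
  proof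
    have wL: "wt (?w n) (U r) \<in> pts L2" if r: "r \<in> {0..T}" for r
    proof (rule wt_L2_dom(1)[of "\<lambda>_. 1", OF _ _ fsolD(1)[OF U s r]])
      show "wt (\<lambda>_. 1) (U r) \<in> pts L2" using fsolD(3)[OF U s r] by simp
      show "0 \<le> ?c n" by simp
      show "\<bar>?w n \<zeta>\<bar> \<le> ?c n * \<bar>1\<bar>" for \<zeta>
        by (rule order_trans[OF wc]) (simp add: indicator_def)
    qed measurable
    then show "wt (?w n) (U t) \<in> pts L2" using t by blast
    have "(n2 (wt (?w n) (U t)))\<^sup>2 \<le> exp (1 * T) * ((n2 (wt (?w n) (U 0)))\<^sup>2 + T * \<kappa>\<^sup>2)"
    proof (rule gronwall[OF fsol_energy(1)[OF U s \<alpha>, of _ "?w n" "?c n" n] _ _ _ t])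
      fix r assume r: "r \<in> {0..T}"
      note [measurable] = fsolD(1)[OF U s r]
      have nL: "wt (?w n) (nonlin (U r)) \<in> pts L2"
        by (rule fsol_energy(2)[OF U s \<alpha> r _ _ wc]) simp_all
      have cL: "wt (indicator B) (wt (jw s) (conv (U r) (U r))) \<in> pts L2"
        by (rule L2_dom(1)[OF _ conv_algebra(1)[OF s fsolD(1,2)[OF U s r] fsolD(1,2)[OF U s r]] zero_le_one])
           (auto simp: norm_mult indicator_def)
      have "n2 (wt (?w n) (nonlin (U r))) \<le> 1 * n2 (wt (indicator B) (wt (jw s) (conv (U r) (U r))))"
      proof (rule L2_dom(2)[OF _ cL zero_le_one AE_I2])
        fix \<zeta>
        have "cmod (wt (?w n) (nonlin (U r)) \<zeta>) = indicator B \<zeta> * indicator (window n) \<zeta> * (\<mu> \<zeta> * cmod (nonlin (U r) \<zeta>))"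
          using \<mu>0[of \<zeta>] by (simp add: norm_mult abs_mult indicator_def)
        also have "\<dots> \<le> indicator B \<zeta> * 1 * (\<mu> \<zeta> * (\<bar>fst \<zeta>\<bar> * cmod (conv (U r) (U r) \<zeta>)))"
          using \<mu>0[of \<zeta>] by (intro mult_mono mult_left_mono norm_nonlin_le) (auto simp: indicator_def)
        also have "\<dots> = indicator B \<zeta> * (\<mu> \<zeta> * \<bar>fst \<zeta>\<bar> * cmod (conv (U r) (U r) \<zeta>))" by (simp add: mult.assoc)
        also have "\<dots> \<le> indicator B \<zeta> * (jb \<zeta> powr s * cmod (conv (U r) (U r) \<zeta>))"
          by (intro mult_left_mono mult_right_mono \<mu>le) auto
        also have "\<dots> = 1 * cmod (wt (indicator B) (wt (jw s) (conv (U r) (U r))) \<zeta>)"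
          by (simp add: norm_mult indicator_def)
        finally show "cmod (wt (?w n) (nonlin (U r)) \<zeta>) \<le> 1 * cmod (wt (indicator B) (wt (jw s) (conv (U r) (U r))) \<zeta>)" .
      qed measurable
      with tail[OF r] have N: "n2 (wt (?w n) (nonlin (U r))) \<le> \<kappa>" by simp
      define x y where "x = n2 (wt (?w n) (nonlin (U r)))" and "y = n2 (wt (?w n) (U r))"
      have "Re (ip (wt (?w n) (nonlin (U r))) (wt (?w n) (U r))) \<le> x * y"
        unfolding x_def y_def by (rule order_trans[OF complex_Re_le_cmod L2_integrable(6)[OF nL wL[OF r]]])
      then have "2 * Re (ip (wt (?w n) (nonlin (U r))) (wt (?w n) (U r))) \<le> 2 * x * y" by simp
      also have "\<dots> \<le> x\<^sup>2 + y\<^sup>2" by (rule sum_squares_bound)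
      also have "\<dots> \<le> 1 * y\<^sup>2 + \<kappa>\<^sup>2" using power_mono[OF N[folded x_def], of 2] by (simp add: x_def)
      finally show "2 * Re (ip (wt (?w n) (nonlin (U r))) (wt (?w n) (U r))) \<le> 1 * (n2 (wt (?w n) (U r)))\<^sup>2 + \<kappa>\<^sup>2"
        unfolding y_def .
    qed (use wc in auto)
    also have "\<dots> \<le> exp T * (?E0 + T * \<kappa>\<^sup>2)"
    proof -
      have "n2 (wt (?w n) (U 0)) \<le> 1 * n2 (wt (\<lambda>\<zeta>. indicator B \<zeta> * \<mu> \<zeta>) (U 0))"
        by (rule wt_L2_dom(2)[OF U0 _ fsolD(1)[OF U s T0] zero_le_one]) (auto simp: abs_mult indicator_def)
      then have "(n2 (wt (?w n) (U 0)))\<^sup>2 \<le> ?E0" by (intro power_mono) simp_all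
      then show ?thesis by simp
    qed
    finally show "(n2 (wt (?w n) (U t)))\<^sup>2 \<le> exp T * (?E0 + T * \<kappa>\<^sup>2)" .
  qed
  have "n2 (wt (?w n) (U t)) \<le> sqrt (exp T * (?E0 + T * \<kappa>\<^sup>2))" for n
    using En[of n] by (intro real_le_rsqrt) blast
  note F = wt_window_limit[of "\<lambda>\<zeta>. indicator B \<zeta> * \<mu> \<zeta>", OF _ fsolD(1)[OF U s t] conjunct1[OF En] this]
  show "wt (\<lambda>\<zeta>. indicator B \<zeta> * \<mu> \<zeta>) (U t) \<in> pts L2" by (rule F(1)) measurable
  have "n2 (wt (\<lambda>\<zeta>. indicator B \<zeta> * \<mu> \<zeta>) (U t)) \<le> sqrt (exp T * (?E0 + T * \<kappa>\<^sup>2))" by (rule F(2)) measurable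
  then have "(n2 (wt (\<lambda>\<zeta>. indicator B \<zeta> * \<mu> \<zeta>) (U t)))\<^sup>2 \<le> (sqrt (exp T * (?E0 + T * \<kappa>\<^sup>2)))\<^sup>2"
    by (rule power_mono) simp
  also have "\<dots> = exp T * (?E0 + T * \<kappa>\<^sup>2)" using t \<kappa> by simp
  finally show "(n2 (wt (\<lambda>\<zeta>. indicator B \<zeta> * \<mu> \<zeta>) (U t)))\<^sup>2 \<le> exp T * (?E0 + T * \<kappa>\<^sup>2)" .
qed

lemma fsol_conv_close:
  assumes U: "fsol \<alpha> s T U" and s: "s > 2" and h: "0 < h"
  shows "\<exists>d>0. \<forall>U'. fsol \<alpha> s T U' \<longrightarrow> (\<forall>t\<in>{0..T}. wdist (jw s) (U' t) (U t) < d) \<longrightarrow>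
    (\<forall>t\<in>{0..T}. n2 (wt (jw s) (\<lambda>\<zeta>. conv (U' t) (U' t) \<zeta> - conv (U t) (U t) \<zeta>)) < h)"
proof -
  obtain M where M: "M \<ge> 0" "\<And>r. r \<in> {0..T} \<Longrightarrow> n2 (wt (jw s) (U r)) \<le> M" using fsol_bounded[OF U s] by blast
  define A where "A = alg_const s * (2 * M + 1)"
  have A: "0 \<le> A" unfolding A_def using M(1) by (intro mult_nonneg_nonneg alg_const_nonneg) simp
  \<comment> \<open>The 1 in the minimum keeps a nearby solution below M + 1, so that the two norms
    add up to at most 2 M + 1.\<close>
  define d where "d = min 1 (h / (2 * (A + 1)))"
  have d: "0 < d" "d \<le> 1" using A h by (simp_all add: d_def)
  have Ad: "A * d < h"
  proof -
    have "A * d \<le> A * (h / (2 * (A + 1)))" using A by (intro mult_left_mono) (simp_all add: d_def)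
    also have "\<dots> < h" using A h mult_nonneg_nonneg[OF A less_imp_le[OF h]] by (simp add: field_simps add_nonneg_pos)
    finally show ?thesis .
  qed
  show ?thesis
  proof (intro exI[of _ d] conjI allI impI ballI)
    fix V t assume V: "fsol \<alpha> s T V" and cl: "\<forall>t\<in>{0..T}. wdist (jw s) (V t) (U t) < d" and t: "t \<in> {0..T}"
    define x where "x = wdist (jw s) (V t) (U t)"
    have x: "0 \<le> x" "x < d" using bspec[OF cl t] by (simp_all add: x_def)
    have "n2 (wt (jw s) (V t)) \<le> n2 (wt (jw s) (U t)) + x"
      unfolding x_def wt_diff by (rule n2_le_diff[OF fsolD(2)[OF V s t] fsolD(2)[OF U s t]])
    with M(2)[OF t] x d have sm: "n2 (wt (jw s) (V t)) + n2 (wt (jw s) (U t)) \<le> 2 * M + 1" by linarith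
    have "n2 (wt (jw s) (\<lambda>\<zeta>. conv (V t) (V t) \<zeta> - conv (U t) (U t) \<zeta>)) \<le>
        alg_const s * x * (n2 (wt (jw s) (V t)) + n2 (wt (jw s) (U t)))"
      unfolding x_def by (rule conv_square_diff[OF s fsolD(1,2)[OF V s t] fsolD(1,2)[OF U s t]])
    also have "\<dots> \<le> alg_const s * x * (2 * M + 1)"
      using x by (intro mult_left_mono sm mult_nonneg_nonneg alg_const_nonneg)
    also have "\<dots> = A * x" by (simp add: A_def)
    also have "\<dots> \<le> A * d" using x A by (intro mult_left_mono) auto
    also have "\<dots> < h" by (rule Ad)
    finally show "n2 (wt (jw s) (\<lambda>\<zeta>. conv (V t) (V t) \<zeta> - conv (U t) (U t) \<zeta>)) < h" .
  qed (rule d)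
qed

lemma wt_indicator_le:
  assumes "V \<in> pts L2" and [measurable]: "B \<in> sets borel"
  shows "wt (indicator B) V \<in> pts L2" "n2 (wt (indicator B) V) \<le> n2 V"
proof -
  note [measurable] = L2_measurable[OF assms(1)]
  have m: "wt (indicator B) V \<in> borel_measurable borel" by measurable
  have "AE \<zeta> in lborel. cmod (wt (indicator B) V \<zeta>) \<le> 1 * cmod (V \<zeta>)"
    by (rule AE_I2) (simp add: norm_mult indicator_def)
  from L2_dom[OF m assms(1) zero_le_one this]
  show "wt (indicator B) V \<in> pts L2" "n2 (wt (indicator B) V) \<le> n2 V" by simp_all
qed

lemma exists_small:
  fixes e c :: real assumes "0 < e" "0 \<le> c"
  shows "\<exists>h>0. c * h\<^sup>2 < e\<^sup>2"
proof (intro exI conjI)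
  let ?h = "e / (c + 1)"
  show "0 < ?h" using assms by simp
  have "c * ?h\<^sup>2 = e\<^sup>2 * (c / (c + 1)\<^sup>2)" by (simp add: power_divide)
  also have "\<dots> < e\<^sup>2 * 1"
  proof (rule mult_strict_left_mono)
    have "c < (c + 1)\<^sup>2" using assms by (simp add: power2_sum add_strict_increasing2)
    then show "c / (c + 1)\<^sup>2 < 1" using assms by simp
  qed (use assms in simp)
  finally show "c * ?h\<^sup>2 < e\<^sup>2" by simp
qed

text \<open>\<open>k\<close> is chosen from the tails of \<open>U\<close> alone, namely those of the
  weighted self-convolution and of the initial value. For a nearby solution they differ by at most
  \<open>h\<close>, since cutting is a contraction, and so \<open>k\<close> serves all of
  them.\<close>

lemma xweight_tail_control:
  assumes s: "s > 2" and T: "0 \<le> T" and \<alpha>: "-1 \<le> \<alpha>" "\<alpha> \<le> 1"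
    and \<mu> [measurable]: "\<mu> \<in> borel_measurable borel" and \<mu>0: "\<And>\<zeta>. 0 \<le> \<mu> \<zeta>" and \<mu>le: "\<And>\<zeta>. \<mu> \<zeta> * \<bar>fst \<zeta>\<bar> \<le> jb \<zeta> powr s"
  shows "tail_control \<alpha> s T \<mu> (\<lambda>k \<zeta>. indicator (- window k) \<zeta> * \<mu> \<zeta>)"
  unfolding tail_control_def
proof (intro allI impI)
  fix U and e :: real assume U: "fsol \<alpha> s T U" and U0: "wt \<mu> (U 0) \<in> pts L2" and e: "0 < e"
  have T0: "0 \<in> {0..T}" using T by simp
  \<comment> \<open>The 4 is that of (h + h)^2: each tail is at most \<open>h\<close> for
    \<open>U\<close> plus \<open>h\<close> for the perturbation.\<close>
  obtain h where h: "0 < h" "4 * (exp T * (1 + T)) * h\<^sup>2 < e\<^sup>2"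
    using exists_small[OF e, of "4 * (exp T * (1 + T))"] T by auto
  let ?G = "\<lambda>t. wt (jw s) (conv (U t) (U t))"
  have GL: "?G t \<in> pts L2" if "t \<in> {0..T}" for t by (intro conv_algebra(1) s fsolD(1,2)[OF U s that])
  have ind: "\<bar>indicator (- window k) \<zeta> :: real\<bar> \<le> 1" for k \<zeta> by (simp add: indicator_def)
  have mi: "(indicator (- window k) :: plane \<Rightarrow> real) \<in> borel_measurable borel" for k by measurable
  obtain k1 where k1: "\<And>k t. k \<ge> k1 \<Longrightarrow> t \<in> {0..T} \<Longrightarrow> n2 (wt (indicator (- window k)) (?G t)) < h"
    using uniform_tail[where G="?G" and ch="\<lambda>k. indicator (- window k)", OF GL fsol_conv_continuous[OF U s] mi ind window_complement_tendsto h(1)]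
    by blast
  obtain k2 where k2: "\<And>k t. k \<ge> k2 \<Longrightarrow> t \<in> {0..T} \<Longrightarrow> n2 (wt (indicator (- window k)) (wt \<mu> (U 0))) < h"
    using uniform_tail[where T=T and G="\<lambda>_. wt \<mu> (U 0)" and ch="\<lambda>k. indicator (- window k)", OF U0 _ mi ind window_complement_tendsto h(1)]
    by (auto simp: L2_zero)
  define k where "k = max k1 k2"
  obtain d where d: "0 < d" and cl: "\<And>V t. fsol \<alpha> s T V \<Longrightarrow> (\<forall>t\<in>{0..T}. wdist (jw s) (V t) (U t) < d) \<Longrightarrow>
    t \<in> {0..T} \<Longrightarrow> n2 (wt (jw s) (\<lambda>\<zeta>. conv (V t) (V t) \<zeta> - conv (U t) (U t) \<zeta>)) < h"
    using fsol_conv_close[OF U s h(1)] by blast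
  let ?B = "- window k"
  have Bm [measurable]: "?B \<in> sets borel" by measurable
  show "\<exists>k. \<exists>d>0. nearby \<alpha> s T \<mu> U d (\<lambda>U' t. wt (\<lambda>\<zeta>. indicator (- window k) \<zeta> * \<mu> \<zeta>) (U' t) \<in> pts L2 \<and> n2 (wt (\<lambda>\<zeta>. indicator (- window k) \<zeta> * \<mu> \<zeta>) (U' t)) < e)"
  proof (rule exI[of _ k], rule exI[of _ "min d h"], intro conjI allI impI ballI)
    show "0 < min d h" using d h by simp
    fix V t assume V: "fsol \<alpha> s T V" "wt \<mu> (V 0) \<in> pts L2"
      and c: "\<forall>t\<in>{0..T}. wdist (jw s) (V t) (U t) < min d h"
      and c0: "wdist \<mu> (V 0) (U 0) < min d h" and t: "t \<in> {0..T}"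
    have Vc: "wt (jw s) (conv (V r) (V r)) \<in> pts L2" if "r \<in> {0..T}" for r
      by (intro conv_algebra(1) s fsolD(1,2)[OF V(1) s that])
    have split: "n2 (wt (indicator ?B) F) \<le> x + y"
      if "F \<in> pts L2" "F' \<in> pts L2" "n2 (wt (indicator ?B) F') \<le> x" "n2 (\<lambda>\<zeta>. F \<zeta> - F' \<zeta>) \<le> y" for F F' x y
    proof -
      have "n2 (wt (indicator ?B) F) \<le> n2 (wt (indicator ?B) F') + n2 (\<lambda>\<zeta>. wt (indicator ?B) F \<zeta> - wt (indicator ?B) F' \<zeta>)"
        by (intro n2_le_diff wt_indicator_le(1) that(1,2) Bm)
      also have "(\<lambda>\<zeta>. wt (indicator ?B) F \<zeta> - wt (indicator ?B) F' \<zeta>) = wt (indicator ?B) (\<lambda>\<zeta>. F \<zeta> - F' \<zeta>)"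
        by (simp add: right_diff_distrib)
      also have "n2 \<dots> \<le> n2 (\<lambda>\<zeta>. F \<zeta> - F' \<zeta>)" by (rule wt_indicator_le(2)[OF L2_diff(1)[OF that(1,2)] Bm])
      finally show ?thesis using that(3,4) by linarith
    qed
    have tail: "n2 (wt (indicator ?B) (wt (jw s) (conv (V r) (V r)))) \<le> h + h" if r: "r \<in> {0..T}" for r
    proof (rule split[OF Vc[OF r] GL[OF r]])
      show "n2 (wt (indicator ?B) (?G r)) \<le> h" using k1[of k r] r by (simp add: k_def)
      have "\<forall>t\<in>{0..T}. wdist (jw s) (V t) (U t) < d" using c by simp
      from cl[OF V(1) this r] show "n2 (\<lambda>\<zeta>. wt (jw s) (conv (V r) (V r)) \<zeta> - ?G r \<zeta>) \<le> h"
        by (simp add: right_diff_distrib)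
    qed
    have e1: "wt (indicator ?B) (wt \<mu> (V 0)) = wt (\<lambda>\<zeta>. indicator ?B \<zeta> * \<mu> \<zeta>) (V 0)" by (simp add: mult.assoc)
    have V0: "wt (\<lambda>\<zeta>. indicator ?B \<zeta> * \<mu> \<zeta>) (V 0) \<in> pts L2"
      using wt_indicator_le(1)[OF V(2) Bm] by (simp add: mult.assoc)
    have "n2 (wt (indicator ?B) (wt \<mu> (V 0))) \<le> h + h"
    proof (rule split[OF V(2) U0])
      show "n2 (wt (indicator ?B) (wt \<mu> (U 0))) \<le> h" using k2[OF _ T0, of k] by (simp add: k_def)
      show "n2 (\<lambda>\<zeta>. wt \<mu> (V 0) \<zeta> - wt \<mu> (U 0) \<zeta>) \<le> h" using c0 by (simp add: right_diff_distrib)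
    qed
    then have i0: "n2 (wt (\<lambda>\<zeta>. indicator ?B \<zeta> * \<mu> \<zeta>) (V 0)) \<le> h + h" by (simp only: e1)
    note ET = xweight_tail[OF V(1) s \<alpha> \<mu> \<mu>0 \<mu>le Bm _ tail V0 t]
    show "wt (\<lambda>\<zeta>. indicator ?B \<zeta> * \<mu> \<zeta>) (V t) \<in> pts L2" by (rule ET(1)) (use h in auto)
    have "(n2 (wt (\<lambda>\<zeta>. indicator ?B \<zeta> * \<mu> \<zeta>) (V t)))\<^sup>2 \<le>
        exp T * ((n2 (wt (\<lambda>\<zeta>. indicator ?B \<zeta> * \<mu> \<zeta>) (V 0)))\<^sup>2 + T * (h + h)\<^sup>2)" by (rule ET(2)) (use h in auto)
    also have "\<dots> \<le> exp T * ((h + h)\<^sup>2 + T * (h + h)\<^sup>2)"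
      by (intro mult_left_mono add_right_mono power_mono i0) auto
    also have "\<dots> = 4 * (exp T * (1 + T)) * h\<^sup>2" by (simp add: power2_eq_square algebra_simps)
    also have "\<dots> < e\<^sup>2" by (rule h(2))
    finally show "n2 (wt (\<lambda>\<zeta>. indicator ?B \<zeta> * \<mu> \<zeta>) (V t)) < e"
      by (rule power2_less_imp_less) (use e in simp)
  qed
qed

lemma xweight_propagates:
  assumes s: "s > 2" and T: "0 \<le> T" and \<alpha>: "-1 \<le> \<alpha>" "\<alpha> \<le> 1"
    and \<mu>: "\<mu> \<in> borel_measurable borel" and \<mu>0: "\<And>\<zeta>. 0 \<le> \<mu> \<zeta>" and \<mu>le: "\<And>\<zeta>. \<mu> \<zeta> * \<bar>fst \<zeta>\<bar> \<le> jb \<zeta> powr s"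
  shows "propagates \<alpha> s T \<mu>"
proof (rule propagates_of_tails[OF s T propagates_jw[OF s] xweight_tail_control[OF s T \<alpha> \<mu> \<mu>0 \<mu>le] \<mu>])
  fix k
  show "\<exists>c\<ge>0. \<forall>\<zeta>. \<bar>\<mu> \<zeta>\<bar> \<le> c * \<bar>jb \<zeta> powr s\<bar> + 2 * \<bar>indicator (- window k) \<zeta> * \<mu> \<zeta>\<bar>"
  proof (intro exI[of _ "real (Suc k)"] conjI allI)
    fix \<zeta>
    show "\<bar>\<mu> \<zeta>\<bar> \<le> real (Suc k) * \<bar>jb \<zeta> powr s\<bar> + 2 * \<bar>indicator (- window k) \<zeta> * \<mu> \<zeta>\<bar>"
      using xweight_window_bound(1)[where \<mu>=\<mu> and \<zeta>=\<zeta> and n=k and s=s, OF _ \<mu>0 \<mu>le] \<mu>0[of \<zeta>] s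
      by (cases "\<zeta> \<in> window k") (auto intro: add_nonneg_nonneg)
  qed simp
qed simp_all

subsection \<open>Commutators with radial weights\<close>

text \<open>\<open>hK\<close> is \<open>hH\<close> divided by its argument and measures the size of
  the derivative of \<open>hH\<close>.\<close>

definition hK :: "real \<Rightarrow> real \<Rightarrow> real \<Rightarrow> real" where "hK s N x = x powr s / (x + N)"
definition hH :: "real \<Rightarrow> real \<Rightarrow> real \<Rightarrow> real" where "hH s N x = x powr s * (x / (x + N))"
text \<open>The weights are \<open>hH s N (gE \<epsilon> \<langle>\<zeta>\<rangle>)\<close>. The parameter \<open>N\<close> suppresses the frequencies below \<open>N\<close> while keeping
  \<open>x hH' \<le> (s + 1) hH\<close>, so that the constants do not depend on it; \<open>\<epsilon>\<close> makes the weight bounded. Since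
  \<open>gE \<epsilon> x - gE \<epsilon> y = (x - y) / ((1 + \<epsilon> x) (1 + \<epsilon> y))\<close>, the second factor turns the derivative \<open>y\<close> that falls on
  the unknown back into \<open>gE \<epsilon> y\<close>, and the commutator estimate is uniform in \<open>\<epsilon>\<close> too.\<close>

definition gE :: "real \<Rightarrow> real \<Rightarrow> real" where "gE \<epsilon> x = x / (1 + \<epsilon> * x)"

lemma hH_hK: "hH s N x = x * hK s N x"
  by (simp add: hH_def hK_def)

text \<open>With one power split off, \<open>x powr (s - 1)\<close> and \<open>x / (x + N)\<close>
  are both nondecreasing, the first because s \<ge> 1.\<close>

lemma hK_mono:
  assumes "1 \<le> s" "0 < N" "0 < x" "x \<le> y"
  shows "hK s N x \<le> hK s N y"
proof -
  have e: "hK s N z = z powr (s - 1) * (z / (z + N))" if "0 < z" for z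
    using that powr_mult_base[of z "s - 1"] by (simp add: hK_def mult.commute)
  have "x powr (s - 1) * (x / (x + N)) \<le> y powr (s - 1) * (y / (y + N))"
    using assms by (intro mult_mono powr_mono2) (auto simp: field_simps)
  then show ?thesis using e[of x] e[of y] assms by simp
qed

lemma hK_nonneg: "0 < N \<Longrightarrow> 0 \<le> x \<Longrightarrow> 0 \<le> hK s N x"
  by (simp add: hK_def)

lemma hK_double:
  assumes "0 < N" "0 < x"
  shows "hK s N (2 * x) \<le> 2 powr s * hK s N x"
proof -
  have "hK s N (2 * x) = 2 powr s * (x powr s / (2 * x + N))" by (simp add: hK_def powr_mult)
  also have "\<dots> \<le> 2 powr s * (x powr s / (x + N))"
    using assms by (intro mult_left_mono divide_left_mono) auto
  finally show ?thesis by (simp add: hK_def)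
qed

lemma hK_add:
  assumes "1 \<le> s" "0 < N" "0 < a" "0 < b" "0 < c" "a \<le> b + c"
  shows "hK s N a \<le> 2 powr s * (hK s N b + hK s N c)"
proof -
  have "hK s N a \<le> hK s N (2 * max b c)" using assms by (intro hK_mono) auto
  also have "\<dots> \<le> 2 powr s * hK s N (max b c)" using assms by (intro hK_double) auto
  also have "\<dots> \<le> 2 powr s * (hK s N b + hK s N c)"
    using assms hK_nonneg[of N b s] hK_nonneg[of N c s] by (intro mult_left_mono) (auto simp: max_def)
  finally show ?thesis .
qed

lemma hH_lipschitz_le:
  assumes "1 \<le> s" "0 < N" "0 < a" "a \<le> b"
  shows "0 \<le> hH s N b - hH s N a" "hH s N b - hH s N a \<le> (s + 1) * (b - a) * hK s N b"
proof -
  \<comment> \<open>In this form the derivative of \<open>hH\<close> visibly lies between s and s +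
    1 times \<open>hK\<close>, whatever \<open>N\<close> is.\<close>
  let ?D = "\<lambda>x. hK s N x * ((s + 1) - x / (x + N))"
  have D: "(hH s N has_real_derivative ?D x) (at x)" if x: "0 < x" for x
  proof -
    have "x + N \<noteq> 0" using x assms(2) by simp
    from DERIV_mult[OF has_real_derivative_powr[OF x, of s]
        DERIV_divide[OF DERIV_ident DERIV_add[OF DERIV_ident DERIV_const[of N]] this]]
    have "((\<lambda>x. x powr s * (x / (x + N))) has_real_derivative
        s * x powr (s - 1) * (x / (x + N)) + x powr s * ((1 * (x + N) - x * 1) / ((x + N) * (x + N)))) (at x)"
      by (simp add: mult.commute)
    moreover have "s * x powr (s - 1) * (x / (x + N)) + x powr s * ((1 * (x + N) - x * 1) / ((x + N) * (x + N))) = ?D x"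
    proof -
      have p: "x powr (s - 1) * x = x powr s" using x powr_mult_base[of x "s - 1"] by (simp add: mult.commute)
      have "s * x powr (s - 1) * (x / (x + N)) = s * (x powr (s - 1) * x) / (x + N)" by simp
      also have "\<dots> = s * hK s N x" unfolding p by (simp add: hK_def)
      finally have 1: "s * x powr (s - 1) * (x / (x + N)) = s * hK s N x" .
      have "(1 * (x + N) - x * 1) / ((x + N) * (x + N)) = (1 - x / (x + N)) / (x + N)"
        using x assms(2) by (simp add: field_simps)
      then have "x powr s * ((1 * (x + N) - x * 1) / ((x + N) * (x + N))) = hK s N x * (1 - x / (x + N))"
        by (simp add: hK_def)
      with 1 show ?thesis by (simp add: algebra_simps)
    qed
    ultimately show ?thesis unfolding hH_def[abs_def] by simp
  qed
  have D0: "0 \<le> ?D x" "?D x \<le> (s + 1) * hK s N b" if "a \<le> x" "x \<le> b" for x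
  proof -
    have x: "0 < x" using that assms by simp
    have q: "0 \<le> x / (x + N)" "x / (x + N) \<le> 1" using x assms by simp_all
    have q2: "0 \<le> (s + 1) - x / (x + N)" "(s + 1) - x / (x + N) \<le> s + 1" using q assms(1) by linarith+
    note K0 = hK_nonneg[OF assms(2) less_imp_le[OF x], of s]
    show "0 \<le> ?D x" by (rule mult_nonneg_nonneg[OF K0 q2(1)])
    have "?D x \<le> hK s N x * (s + 1)" by (rule mult_left_mono[OF q2(2) K0])
    also have "\<dots> \<le> hK s N b * (s + 1)" using assms that x by (intro mult_right_mono hK_mono) auto
    finally show "?D x \<le> (s + 1) * hK s N b" by (simp add: mult.commute)
  qed
  have "\<exists>x. a \<le> x \<and> x \<le> b \<and> hH s N b - hH s N a = (b - a) * ?D x"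
  proof (cases "a = b")
    case True then show ?thesis by auto
  next
    case False
    then have "a < b" using assms by simp
    have "\<exists>z>a. z < b \<and> hH s N b - hH s N a = (b - a) * ?D z"
      by (rule MVT2[OF \<open>a < b\<close>], rule D) (use assms(3) in linarith)
    then show ?thesis using less_imp_le by blast
  qed
  then obtain x where x: "a \<le> x" "x \<le> b" "hH s N b - hH s N a = (b - a) * ?D x" by blast
  show "0 \<le> hH s N b - hH s N a" unfolding x(3) using D0[OF x(1,2)] assms by simp
  have "(b - a) * ?D x \<le> (b - a) * ((s + 1) * hK s N b)" using D0[OF x(1,2)] assms by (intro mult_left_mono) auto
  then show "hH s N b - hH s N a \<le> (s + 1) * (b - a) * hK s N b" unfolding x(3) by (simp add: ac_simps)
qed

lemma hH_lipschitz:
  assumes "1 \<le> s" "0 < N" "0 < a" "0 < b"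
  shows "\<bar>hH s N a - hH s N b\<bar> \<le> (s + 1) * \<bar>a - b\<bar> * (hK s N a + hK s N b)"
proof -
  have K: "0 \<le> hK s N a" "0 \<le> hK s N b" using hK_nonneg assms by auto
  show ?thesis
  proof (cases "a \<le> b")
    case True
    have "\<bar>hH s N a - hH s N b\<bar> \<le> (s + 1) * (b - a) * hK s N b" using hH_lipschitz_le[OF assms(1-3) True] by linarith
    also have "\<dots> \<le> (s + 1) * (b - a) * (hK s N a + hK s N b)"
      using assms True K by (intro mult_left_mono) auto
    finally show ?thesis using True by simp
  next
    case False
    then have le: "b \<le> a" by simp
    have "\<bar>hH s N a - hH s N b\<bar> \<le> (s + 1) * (a - b) * hK s N a" using hH_lipschitz_le[OF assms(1,2,4) le] by linarith
    also have "\<dots> \<le> (s + 1) * (a - b) * (hK s N a + hK s N b)"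
      using assms le K by (intro mult_left_mono) auto
    finally show ?thesis using le by simp
  qed
qed

lemma hH_mono: "1 \<le> s \<Longrightarrow> 0 < N \<Longrightarrow> 0 < a \<Longrightarrow> a \<le> b \<Longrightarrow> hH s N a \<le> hH s N b"
  using hH_lipschitz_le(1)[of s N a b] by simp

lemma hH_le: "0 < N \<Longrightarrow> 0 < x \<Longrightarrow> hH s N x \<le> x powr s"
  unfolding hH_def by (intro mult_right_le_one_le) auto

lemma hH_nonneg: "0 < N \<Longrightarrow> 0 \<le> x \<Longrightarrow> 0 \<le> hH s N x"
  unfolding hH_def by simp

definition yW :: "real \<Rightarrow> real \<Rightarrow> real \<Rightarrow> plane \<Rightarrow> real" where
  "yW s N \<epsilon> \<zeta> = hH s N (gE \<epsilon> (jb \<zeta>))"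

text \<open>s + 1 is the Lipschitz factor of \<open>hH\<close>; 1 + 2 powr s arises when
  \<open>hK\<close> at the output frequency is replaced, by \<open>hK_add\<close>, with its values
  at the two input frequencies.\<close>

definition comm_const :: "real \<Rightarrow> real" where "comm_const s = (s + 1) * (1 + 2 powr s)"

lemma hH_measurable [measurable]: "hH s N \<in> borel_measurable borel"
  unfolding hH_def[abs_def] by measurable

lemma gE_measurable [measurable]: "gE \<epsilon> \<in> borel_measurable borel"
  unfolding gE_def[abs_def] by measurable

lemma yW_measurable [measurable]: "yW s N \<epsilon> \<in> borel_measurable borel"
  unfolding yW_def[abs_def] by measurable

lemma gE_bounds:
  assumes "0 < \<epsilon>" "0 < x"
  shows "0 < gE \<epsilon> x" "gE \<epsilon> x \<le> x" "gE \<epsilon> x \<le> 1 / \<epsilon>"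
proof -
  have p: "0 < 1 + \<epsilon> * x" using assms by (simp add: add_pos_pos)
  show "0 < gE \<epsilon> x" using assms p by (simp add: gE_def)
  show "gE \<epsilon> x \<le> x" using assms p by (simp add: gE_def divide_le_eq algebra_simps)
  show "gE \<epsilon> x \<le> 1 / \<epsilon>" using assms p by (simp add: gE_def field_simps)
qed

lemma yW_bounds:
  assumes "1 \<le> s" "0 < N" "0 < \<epsilon>"
  shows "0 \<le> yW s N \<epsilon> \<zeta>" "yW s N \<epsilon> \<zeta> \<le> hH s N (jb \<zeta>)" "yW s N \<epsilon> \<zeta> \<le> (1 / \<epsilon>) powr s"
proof -
  note g = gE_bounds[OF assms(3) jb_pos[of \<zeta>]]
  show "0 \<le> yW s N \<epsilon> \<zeta>" unfolding yW_def using g by (intro hH_nonneg assms) auto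
  show "yW s N \<epsilon> \<zeta> \<le> hH s N (jb \<zeta>)" unfolding yW_def by (intro hH_mono assms g)
  have "yW s N \<epsilon> \<zeta> \<le> gE \<epsilon> (jb \<zeta>) powr s" unfolding yW_def by (intro hH_le assms g)
  also have "\<dots> \<le> (1 / \<epsilon>) powr s" using g assms by (intro powr_mono2) auto
  finally show "yW s N \<epsilon> \<zeta> \<le> (1 / \<epsilon>) powr s" .
qed

text \<open>\<open>k\<close> stands for |\<xi>'|, the derivative on the unknown. The difference of
  the weights is paid either by one derivative of \<open>u\<close> with the full weight on the
  unknown, or by the full weight on \<open>u\<close> while the derivative stays on the unknown. The
  second case is harmless because \<xi> V = \<eta> U.\<close>

lemma yW_commutator:
  assumes s: "1 \<le> s" and N: "0 < N" and \<epsilon>: "0 < \<epsilon>" and k: "k \<le> jb \<zeta>'" "0 \<le> k"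
  shows "\<bar>yW s N \<epsilon> \<zeta> - yW s N \<epsilon> \<zeta>'\<bar> * k \<le>
    comm_const s * (norm (\<zeta> - \<zeta>') * yW s N \<epsilon> \<zeta>' + hH s N (jb (\<zeta> - \<zeta>')) * k)"
proof -
  define x y d c where "x = jb \<zeta>" and "y = jb \<zeta>'" and "d = norm (\<zeta> - \<zeta>')" and "c = jb (\<zeta> - \<zeta>')"
  define a b where "a = gE \<epsilon> x" and "b = gE \<epsilon> y"
  have pos: "0 < x" "0 < y" "0 < c" "0 \<le> d" by (simp_all add: x_def y_def c_def d_def)
  have xy: "\<bar>x - y\<bar> \<le> d" unfolding x_def y_def d_def by (rule jb_triangle)
  have dc: "d \<le> c" unfolding d_def c_def by (rule norm_le_jb)
  have ab: "0 < a" "0 < b" unfolding a_def b_def using gE_bounds[OF \<epsilon>] pos by auto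
  have p: "1 \<le> 1 + \<epsilon> * x" "1 \<le> 1 + \<epsilon> * y" using \<epsilon> pos by auto
  have "a - b = (x - y) / ((1 + \<epsilon> * x) * (1 + \<epsilon> * y))"
  proof -
    have nz: "1 + \<epsilon> * x \<noteq> 0" "1 + \<epsilon> * y \<noteq> 0" using p by linarith+
    show ?thesis unfolding a_def b_def gE_def
      by (simp add: diff_frac_eq[OF nz]) (simp add: algebra_simps)
  qed
  then have "\<bar>a - b\<bar> = \<bar>x - y\<bar> / ((1 + \<epsilon> * x) * (1 + \<epsilon> * y))" using p by (simp add: abs_mult)
  also have "\<dots> \<le> d / (1 * (1 + \<epsilon> * y))"
    using p xy pos by (intro frac_le mult_right_mono) auto
  finally have abd: "\<bar>a - b\<bar> \<le> d / (1 + \<epsilon> * y)" by simp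
  also have "\<dots> \<le> d / 1" using p pos by (intro divide_left_mono) auto
  finally have abd2: "\<bar>a - b\<bar> \<le> d" by simp
  have abc: "a \<le> b + c" using abd2 dc by linarith
  have K0: "0 \<le> hK s N b" "0 \<le> hK s N c" using hK_nonneg[OF N] ab pos by auto
  have Ka: "hK s N a \<le> 2 powr s * (hK s N b + hK s N c)" by (rule hK_add[OF s N ab pos(3) abc])
  have "\<bar>hH s N a - hH s N b\<bar> \<le> (s + 1) * \<bar>a - b\<bar> * (hK s N a + hK s N b)"
    by (rule hH_lipschitz[OF s N ab])
  also have "\<dots> \<le> (s + 1) * \<bar>a - b\<bar> * ((1 + 2 powr s) * (hK s N b + hK s N c))"
    using Ka K0 s by (intro mult_left_mono) (auto simp: algebra_simps)
  also have "\<dots> = comm_const s * (\<bar>a - b\<bar> * (hK s N b + hK s N c))" by (simp add: comm_const_def)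
  finally have "\<bar>hH s N a - hH s N b\<bar> * k \<le> comm_const s * (\<bar>a - b\<bar> * (hK s N b + hK s N c)) * k"
    by (rule mult_right_mono[OF _ k(2)])
  also have "\<dots> = comm_const s * ((\<bar>a - b\<bar> * k) * hK s N b + \<bar>a - b\<bar> * (hK s N c * k))" by (simp add: algebra_simps)
  also have "\<dots> \<le> comm_const s * (d * hH s N b + hH s N c * k)"
  proof (intro mult_left_mono add_mono)
    have "\<bar>a - b\<bar> * k \<le> d / (1 + \<epsilon> * y) * y" using abd k pos p unfolding y_def[symmetric] by (intro mult_mono) auto
    also have "\<dots> = d * b" by (simp add: b_def gE_def)
    finally have "\<bar>a - b\<bar> * k * hK s N b \<le> d * b * hK s N b" by (rule mult_right_mono[OF _ K0(1)])
    then show "\<bar>a - b\<bar> * k * hK s N b \<le> d * hH s N b" by (simp add: hH_hK mult.assoc)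
    have "\<bar>a - b\<bar> * (hK s N c * k) \<le> c * (hK s N c * k)" using abd2 dc K0 k by (intro mult_right_mono) auto
    then show "\<bar>a - b\<bar> * (hK s N c * k) \<le> hH s N c * k" by (simp add: hH_hK mult.assoc)
  qed (use s in \<open>simp add: comm_const_def\<close>)
  finally show ?thesis unfolding yW_def a_def b_def x_def y_def c_def d_def .
qed

text \<open>Multiplication by the real function \<open>u\<close> is symmetric. On the Fourier side
  its reality is the hermitian symmetry of \<open>U\<close>, and Fubini exchanges the two
  frequencies.\<close>

lemma conv_adjoint:
  assumes U: "U \<in> pts L2" "integrable lborel U" and herm: "AE \<zeta> in lborel. U (- \<zeta>) = cnj (U \<zeta>)"
    and f: "f \<in> pts L2" and g: "g \<in> pts L2"
  shows "ip (conv U f) g = ip f (conv U g)"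
proof -
  note [measurable] = L2_measurable[OF U(1)] L2_measurable[OF f] L2_measurable[OF g]
  let ?F = "\<lambda>\<zeta> \<zeta>'. U (\<zeta> - \<zeta>') * f \<zeta>' * cnj (g \<zeta>)"
  have "ip (conv U f) g = (LINT \<zeta>|lborel. LINT \<zeta>'|lborel. ?F \<zeta> \<zeta>')"
    unfolding ip_def conv_def by (simp only: integral_mult_left_zero)
  also have "\<dots> = (LINT \<zeta>'|lborel. LINT \<zeta>|lborel. ?F \<zeta> \<zeta>')"
  proof (rule Fubini_swap)
    note Y = young_absf(1)[OF U(2) f]
    have "(\<integral>\<^sup>+ \<zeta>. \<integral>\<^sup>+ \<zeta>'. ennreal (cmod (?F \<zeta> \<zeta>')) \<partial>lborel \<partial>lborel) \<le>
        (\<integral>\<^sup>+ \<zeta>. ennreal (cmod (conv (absf U) (absf f) \<zeta>) * cmod (g \<zeta>)) \<partial>lborel)"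
    proof (rule nn_integral_mono)
      fix \<zeta>
      note i = L2_integrable(3)[OF L2_reflect(1)[OF U(1), of \<zeta>] f]
      have "conv (absf U) (absf f) \<zeta> = (LINT \<zeta>'|lborel. complex_of_real (cmod (U (\<zeta> - \<zeta>')) * cmod (f \<zeta>')))"
        unfolding conv_def absf_def by simp
      also have "\<dots> = of_real (LINT \<zeta>'|lborel. cmod (U (\<zeta> - \<zeta>')) * cmod (f \<zeta>'))" by (rule integral_complex_of_real)
      finally have e: "conv (absf U) (absf f) \<zeta> = of_real (LINT \<zeta>'|lborel. cmod (U (\<zeta> - \<zeta>')) * cmod (f \<zeta>'))" .
      have nn: "0 \<le> (LINT \<zeta>'|lborel. cmod (U (\<zeta> - \<zeta>')) * cmod (f \<zeta>'))" by (rule integral_nonneg_AE) simp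
      have "(\<integral>\<^sup>+ \<zeta>'. ennreal (cmod (?F \<zeta> \<zeta>')) \<partial>lborel) =
          (\<integral>\<^sup>+ \<zeta>'. ennreal (cmod (U (\<zeta> - \<zeta>')) * cmod (f \<zeta>')) * ennreal (cmod (g \<zeta>)) \<partial>lborel)"
        by (simp add: norm_mult ennreal_mult')
      also have "\<dots> = (\<integral>\<^sup>+ \<zeta>'. ennreal (cmod (U (\<zeta> - \<zeta>')) * cmod (f \<zeta>')) \<partial>lborel) * ennreal (cmod (g \<zeta>))"
        by (rule nn_integral_multc) measurable
      also have "(\<integral>\<^sup>+ \<zeta>'. ennreal (cmod (U (\<zeta> - \<zeta>')) * cmod (f \<zeta>')) \<partial>lborel) = ennreal (cmod (conv (absf U) (absf f) \<zeta>))"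
        using nn_integral_eq_integral[OF i] nn by (simp add: e)
      finally show "(\<integral>\<^sup>+ \<zeta>'. ennreal (cmod (?F \<zeta> \<zeta>')) \<partial>lborel) \<le> ennreal (cmod (conv (absf U) (absf f) \<zeta>) * cmod (g \<zeta>))"
        by (simp add: ennreal_mult')
    qed
    also have "\<dots> \<le> ennreal (n2 (conv (absf U) (absf f)) * n2 g)" by (rule L2_CS_nn[OF Y g])
    finally show "(\<integral>\<^sup>+ \<zeta>. \<integral>\<^sup>+ \<zeta>'. ennreal (cmod (?F \<zeta> \<zeta>')) \<partial>lborel \<partial>lborel) < \<infinity>"
      by (rule le_less_trans) simp
  qed measurable
  also have "\<dots> = ip f (conv U g)"
    unfolding ip_def
  proof (rule Bochner_Integration.integral_cong[OF refl])
    fix \<zeta>'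
    have "(LINT \<zeta>|lborel. ?F \<zeta> \<zeta>') = f \<zeta>' * (LINT \<zeta>|lborel. U (\<zeta> - \<zeta>') * cnj (g \<zeta>))"
      by (subst integral_mult_right_zero[symmetric]) (simp only: ac_simps)
    also have "(LINT \<zeta>|lborel. U (\<zeta> - \<zeta>') * cnj (g \<zeta>)) = (LINT \<zeta>|lborel. cnj (U (\<zeta>' - \<zeta>) * g \<zeta>))"
    proof (rule integral_cong_AE)
      show "AE \<zeta> in lborel. U (\<zeta> - \<zeta>') * cnj (g \<zeta>) = cnj (U (\<zeta>' - \<zeta>) * g \<zeta>)"
        using AE_reflect[OF herm, of \<zeta>'] by eventually_elim simp
    qed simp_all
    also have "\<dots> = cnj (conv U g \<zeta>')" unfolding conv_def by (rule Bochner_Integration.integral_cnj)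
    finally show "(LINT \<zeta>|lborel. ?F \<zeta> \<zeta>') = f \<zeta>' * cnj (conv U g \<zeta>')" .
  qed
  finally show ?thesis .
qed

text \<open>The integration by parts that turns the integral of u v_x v into minus half that of u_x
  v^2. Symmetry and the product rule identify \<open>?z\<close> minus its conjugate with the pairing
  of \<open>g\<close> and \<open>conv (wt fst U) g\<close>, so the imaginary part of
  \<open>?z\<close>, the only one that enters, carries no derivative of \<open>g\<close>.\<close>

lemma transport_skew:
  assumes U: "U \<in> pts L2" "integrable lborel U" and herm: "AE \<zeta> in lborel. U (- \<zeta>) = cnj (U \<zeta>)"
    and fU: "wt fst U \<in> pts L2" "integrable lborel (wt fst U)"
    and g: "g \<in> pts L2" and fg: "wt fst g \<in> pts L2"
  shows "\<bar>Re (\<i> * ip (conv U (wt fst g)) g)\<bar> \<le> (LINT \<zeta>|lborel. cmod (wt fst U \<zeta>)) * (n2 g)\<^sup>2"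
proof -
  let ?z = "ip (conv U (wt fst g)) g"
  note Y1 = young[OF fU(2) g] and Y2 = young[OF U(2) fg]
  have lb: "wt fst (conv U g) \<zeta> = conv (wt fst U) g \<zeta> + conv U (wt fst g) \<zeta>" for \<zeta>
    by (rule conv_leibniz[OF U(1) g fU(1) fg]) simp
  have "?z = ip (wt fst g) (conv U g)" by (rule conv_adjoint[OF U herm fg g])
  also have "\<dots> = ip g (wt fst (conv U g))" unfolding ip_def by (simp add: mult_ac)
  also have "\<dots> = ip g (conv (wt fst U) g) + ip g (conv U (wt fst g))"
    unfolding lb by (rule ip_add_right[OF Y1(1) Y2(1) g])
  finally have z1: "?z = ip g (conv (wt fst U) g) + ip g (conv U (wt fst g))" .
  have z2: "ip g (conv U (wt fst g)) = cnj ?z" by (rule ip_commute)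
  have "?z - cnj ?z = ip g (conv (wt fst U) g)" unfolding z2[symmetric] by (subst z1) (rule add_diff_cancel_right')
  then have "cmod (?z - cnj ?z) \<le> n2 g * n2 (conv (wt fst U) g)"
    using L2_integrable(6)[OF g Y1(1)] by simp
  also have "\<dots> \<le> n2 g * ((LINT \<zeta>|lborel. cmod (wt fst U \<zeta>)) * n2 g)" by (intro mult_left_mono Y1(2)) simp
  finally have 1: "cmod (?z - cnj ?z) \<le> (LINT \<zeta>|lborel. cmod (wt fst U \<zeta>)) * (n2 g)\<^sup>2"
    by (simp add: power2_eq_square mult_ac)
  have "?z - cnj ?z = of_real (2 * Im ?z) * \<i>" by (simp add: complex_diff_cnj)
  then have "cmod (?z - cnj ?z) = 2 * \<bar>Im ?z\<bar>" by (simp add: norm_mult)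
  with 1 show ?thesis by simp
qed

subsection \<open>The weight \<open>\<langle>\<zeta>\<rangle>\<^sup>s \<bar>\<eta> / \<xi>\<bar>\<close>\<close>

text \<open>With \<open>V = rho U\<close>, the transform of \<open>v = \<partial>\<^sub>x\<inverse> u\<^sub>y\<close>, one has \<open>\<xi> V = \<eta> U\<close> almost everywhere: the nonlinearity
  of the equation for \<open>v\<close> is the transport term \<open>u v\<^sub>x\<close>, and the \<open>L\<^sup>1\<close> norm of \<open>\<xi> V\<close> is controlled by \<open>U\<close> alone.\<close>

definition rho :: "plane \<Rightarrow> real" where "rho \<zeta> = snd \<zeta> / fst \<zeta>"

lemma rho_measurable [measurable]: "rho \<in> borel_measurable borel"
  unfolding rho_def[abs_def] by measurable

lemma norm_measurable_plane [measurable]: "(norm :: plane \<Rightarrow> real) \<in> borel_measurable borel"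
  by measurable

text \<open>\<open>L\<close> bounds the norm of \<open>U\<close> that sets the growth rate; the
  weights 1, \<xi>, \<eta> and |\<zeta>| are all covered, being at most \<open>jb\<close>.\<close>

lemma weighted_L1_le:
  assumes s: "s > 2" and U: "U \<in> borel_measurable borel" "wt (jw s) U \<in> pts L2"
    and L: "(LINT \<zeta>|lborel. jb \<zeta> * cmod (U \<zeta>)) \<le> L"
    and \<mu>: "\<mu> \<in> borel_measurable borel" "\<And>\<zeta>. \<bar>\<mu> \<zeta>\<bar> \<le> jb \<zeta>"
  shows "wt \<mu> U \<in> pts L2" "n2 (wt \<mu> U) \<le> n2 (wt (jw s) U)" "integrable lborel (wt \<mu> U)"
    "(LINT \<zeta>|lborel. cmod (wt \<mu> U \<zeta>)) \<le> L"
proof -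
  have le: "\<bar>\<mu> \<zeta>\<bar> \<le> 1 * \<bar>jb \<zeta> powr s\<bar>" for \<zeta>
    using \<mu>(2)[of \<zeta>] jb_le_powr[of s \<zeta>] s by simp
  show "wt \<mu> U \<in> pts L2" "n2 (wt \<mu> U) \<le> n2 (wt (jw s) U)"
    using wt_L2_dom[OF U(2) \<mu>(1) U(1) zero_le_one le] by simp_all
  note i = weighted_L1(1)[OF s U]
  note [measurable] = \<mu>(1) U(1)
  have pw: "cmod (wt \<mu> U \<zeta>) \<le> jb \<zeta> * cmod (U \<zeta>)" for \<zeta>
    unfolding norm_mult norm_of_real by (rule mult_right_mono[OF \<mu>(2) norm_ge_zero])
  show i2: "integrable lborel (wt \<mu> U)"
    by (rule Bochner_Integration.integrable_bound[OF i]) (use pw in \<open>auto simp: norm_mult\<close>)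
  have "integrable lborel (\<lambda>\<zeta>. jb \<zeta> * cmod (U \<zeta>))" using integrable_norm[OF i] by (simp add: norm_mult)
  then have "(LINT \<zeta>|lborel. cmod (wt \<mu> U \<zeta>)) \<le> (LINT \<zeta>|lborel. jb \<zeta> * cmod (U \<zeta>))"
    using integrable_norm[OF i2] pw by (intro integral_mono)
  with L show "(LINT \<zeta>|lborel. cmod (wt \<mu> U \<zeta>)) \<le> L" by linarith
qed

text \<open>For the weighted unknown \<open>g\<close> the nonlinearity splits into the transport of
  \<open>g\<close> itself, skew up to L times the squared norm, and the commutator \<open>R\<close>.
  That the weight is bounded for fixed \<epsilon> gives membership and the crude bound on the
  nonlinearity. In the last estimate \<epsilon> and \<open>N\<close> enter only through
  \<open>g\<close> and through \<tau>, the damped Sobolev norm of \<open>U\<close>.\<close>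

lemma yweight_energy_bound:
  assumes s: "s > 2" and N: "0 < N" and \<epsilon>: "0 < \<epsilon>"
    and U: "U \<in> borel_measurable borel" "wt (jw s) U \<in> pts L2" and herm: "AE \<zeta> in lborel. U (- \<zeta>) = cnj (U \<zeta>)"
    and V: "wt rho U \<in> pts L2" and L: "(LINT \<zeta>|lborel. jb \<zeta> * cmod (U \<zeta>)) \<le> L"
  defines "w \<equiv> \<lambda>\<zeta>. yW s N \<epsilon> \<zeta> * rho \<zeta>" and "cW \<equiv> (1 / \<epsilon>) powr s"
    and "\<tau> \<equiv> n2 (wt (\<lambda>\<zeta>. hH s N (jb \<zeta>)) U)"
  shows "wt w U \<in> pts L2" "wt w (nonlin U) \<in> pts L2" "n2 (wt w (nonlin U)) \<le> cW * (L * n2 (wt (jw s) U))"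
    "Re (ip (wt w (nonlin U)) (wt w U)) \<le> (2 * comm_const s + 1) * L * ((n2 (wt w U))\<^sup>2 + \<tau>\<^sup>2)"
proof -
  have s1: "1 \<le> s" and s0: "0 \<le> s" using s by simp_all
  note W = yW_bounds[OF s1 N \<epsilon>]
  note WL = weighted_L1_le[OF s U L]
  note [measurable] = U(1)
  have cW: "0 \<le> cW" by (simp add: cW_def)
  have j1: "\<bar>1\<bar> \<le> jb \<zeta>" for \<zeta> using jb_ge_1[of \<zeta>] by simp
  have jf: "\<bar>fst \<zeta>\<bar> \<le> jb \<zeta>" "\<bar>snd \<zeta>\<bar> \<le> jb \<zeta>" "\<bar>norm \<zeta>\<bar> \<le> jb \<zeta>" for \<zeta> :: plane
    using fst_snd_le_norm[of \<zeta>] norm_le_jb[of \<zeta>] by simp_all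
  have U1: "U \<in> pts L2" "integrable lborel U" "(LINT \<zeta>|lborel. cmod (U \<zeta>)) \<le> L"
    using WL(1,3,4)[of "\<lambda>_. 1", OF _ j1] by simp_all
  have fstm: "(fst :: plane \<Rightarrow> real) \<in> borel_measurable borel" and sndm: "(snd :: plane \<Rightarrow> real) \<in> borel_measurable borel"
    by measurable
  note fU = WL[OF fstm jf(1)] and sU = WL[OF sndm jf(2)] and nU = WL[OF norm_measurable_plane jf(3)]
  have L0: "0 \<le> L" by (rule order_trans[OF _ U1(3)]) simp
  define g where "g = wt w U"
  define Q where "Q = conv U (wt snd U)"
  define fV where "fV = wt fst (wt rho U)"
  have g_eq: "g = wt (yW s N \<epsilon>) (wt rho U)" by (simp add: g_def w_def mult.assoc)
  have gm [measurable]: "g \<in> borel_measurable borel" unfolding g_eq by measurable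
  have gL: "g \<in> pts L2"
  proof (rule L2_dom(1)[OF gm V cW])
    show "AE \<zeta> in lborel. cmod (g \<zeta>) \<le> cW * cmod (wt rho U \<zeta>)"
      by (rule AE_I2) (use W(1,3) in \<open>auto simp: g_eq norm_mult cW_def intro!: mult_right_mono\<close>)
  qed
  show "wt w U \<in> pts L2" using gL by (simp only: g_def)
  have Qm [measurable]: "Q \<in> borel_measurable borel" unfolding Q_def by measurable
  have QL: "Q \<in> pts L2" unfolding Q_def by (rule young(1)[OF U1(2) sU(1)])
  have nQ: "n2 Q \<le> L * n2 (wt (jw s) U)"
    unfolding Q_def by (rule order_trans[OF young(2)[OF U1(2) sU(1)]]) (intro mult_mono U1(3) sU(2) L0 n2_nonneg)
  have wm [measurable]: "w \<in> borel_measurable borel" unfolding w_def by measurable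
  define P where "P = wt w (nonlin U)"
  have Pm: "P \<in> borel_measurable borel" unfolding P_def by measurable
  \<comment> \<open>\<open>rho\<close> replaces the factor \<xi> of \<open>nonlin\<close> by \<eta>;
    the Leibniz rule then gives \<open>2 * Q\<close>, and 1 / (4 pi) becomes 1 / (2 pi).\<close>
  define P' where "P' = (\<lambda>\<zeta>. \<i> * of_real (1 / (2 * pi)) * wt (yW s N \<epsilon>) Q \<zeta>)"
  have P'm: "P' \<in> borel_measurable borel" unfolding P'_def by measurable
  have PP: "AE \<zeta> in lborel. P \<zeta> = P' \<zeta>"
    using AE_fst_nonzero
  proof eventually_elim
    case (elim \<zeta>)
    have l: "of_real (snd \<zeta>) * conv U U \<zeta> = 2 * Q \<zeta>"
      unfolding Q_def by (rule conv_self_leibniz[OF U1(1) sU(1)]) simp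
    have "of_real (rho \<zeta>) * nonlin U \<zeta> = \<i> * of_real (1 / (4 * pi)) * (of_real (snd \<zeta>) * conv U U \<zeta>)"
      using elim by (simp add: rho_def nonlin_def)
    then have "of_real (rho \<zeta>) * nonlin U \<zeta> = \<i> * of_real (1 / (4 * pi)) * (2 * Q \<zeta>)" by (simp only: l)
    then have "P \<zeta> = of_real (yW s N \<epsilon> \<zeta>) * (\<i> * of_real (1 / (4 * pi)) * (2 * Q \<zeta>))"
      by (simp add: P_def w_def mult.assoc)
    then show ?case by (simp add: P'_def)
  qed
  have WQL: "wt (yW s N \<epsilon>) Q \<in> pts L2" "n2 (wt (yW s N \<epsilon>) Q) \<le> cW * n2 Q"
  proof -
    have m: "wt (yW s N \<epsilon>) Q \<in> borel_measurable borel" by measurable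
    have "AE \<zeta> in lborel. cmod (wt (yW s N \<epsilon>) Q \<zeta>) \<le> cW * cmod (Q \<zeta>)"
      by (rule AE_I2) (use W(1,3) in \<open>auto simp: norm_mult cW_def intro!: mult_right_mono\<close>)
    from L2_dom[OF m QL cW this]
    show "wt (yW s N \<epsilon>) Q \<in> pts L2" "n2 (wt (yW s N \<epsilon>) Q) \<le> cW * n2 Q" .
  qed
  have P'L: "P' \<in> pts L2" unfolding P'_def by (rule L2_cmult(1)[OF WQL(1)])
  have pi1: "1 / (2 * pi) \<le> 1" using pi_gt3 by simp
  have nP': "n2 P' = 1 / (2 * pi) * n2 (wt (yW s N \<epsilon>) Q)"
    unfolding P'_def L2_cmult(2)[OF WQL(1)] by (simp add: norm_mult norm_divide)
  have PL: "P \<in> pts L2" using L2_cong_AE[OF PP Pm P'm] P'L by simp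
  show "wt w (nonlin U) \<in> pts L2" using PL by (simp only: P_def)
  have "n2 P = n2 P'" by (rule n2_cong[OF PP])
  also have "\<dots> \<le> 1 * n2 (wt (yW s N \<epsilon>) Q)" unfolding nP' by (rule mult_right_mono[OF pi1 n2_nonneg])
  also have "\<dots> \<le> cW * n2 Q" using WQL(2) by simp
  also have "\<dots> \<le> cW * (L * n2 (wt (jw s) U))" by (rule mult_left_mono[OF nQ cW])
  finally show "n2 (wt w (nonlin U)) \<le> cW * (L * n2 (wt (jw s) U))" by (simp only: P_def)
  have fVm [measurable]: "fV \<in> borel_measurable borel" unfolding fV_def by measurable
  have sUm: "wt snd U \<in> borel_measurable borel" by measurable
  have fVs: "AE \<zeta> in lborel. fV \<zeta> = wt snd U \<zeta>"
    using AE_fst_nonzero by eventually_elim (simp add: fV_def rho_def)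
  have fVL: "fV \<in> pts L2" using L2_cong_AE[OF fVs fVm sUm] sU(1) by simp
  have fVi: "integrable lborel fV" using integrable_cong_AE[of fV lborel "wt snd U"] fVs sU(3) by simp
  have fVn: "(LINT \<zeta>|lborel. cmod (fV \<zeta>)) \<le> L"
  proof -
    have "(LINT \<zeta>|lborel. cmod (fV \<zeta>)) = (LINT \<zeta>|lborel. cmod (wt snd U \<zeta>))"
      by (rule integral_cong_AE) (use fVs in auto)
    with sU(4) show ?thesis by simp
  qed
  \<comment> \<open>As \<xi> V = \<eta> U almost everywhere, the same convolution is the transport
    of \<open>v\<close> by \<open>u\<close>, the form that has a skew part.\<close>
  have Q_fV: "Q = conv U fV"
    unfolding Q_def by (rule conv_cong_right[OF U(1) sUm fVm]) (use fVs in eventually_elim, simp)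
  have fg_pw: "complex_of_real (fst \<zeta>) * g \<zeta> = of_real (yW s N \<epsilon> \<zeta>) * fV \<zeta>" for \<zeta>
    by (simp add: g_eq fV_def mult_ac)
  have fgL: "wt fst g \<in> pts L2"
  proof -
    have m: "wt fst g \<in> borel_measurable borel" unfolding fg_pw by measurable
    have "AE \<zeta> in lborel. cmod (wt fst g \<zeta>) \<le> cW * cmod (fV \<zeta>)"
      unfolding fg_pw by (rule AE_I2) (use W(1,3) in \<open>auto simp: norm_mult cW_def intro!: mult_right_mono\<close>)
    from L2_dom(1)[OF m fVL cW this] show ?thesis .
  qed
  \<comment> \<open>The commutator of the weight with the transport by \<open>u\<close>, the only
    place where the weight is compared at two frequencies.\<close>
  define R where "R = (\<lambda>\<zeta>. wt (yW s N \<epsilon>) Q \<zeta> - conv U (wt fst g) \<zeta>)"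
  note cfg = young(1)[OF U1(2) fgL]
  have RL: "R \<in> pts L2" unfolding R_def by (rule L2_diff(1)[OF WQL(1) cfg])
  let ?C = "comm_const s"
  have C: "0 < ?C" using s by (simp add: comm_const_def add_pos_pos)
  let ?hU = "wt (\<lambda>\<zeta>. hH s N (jb \<zeta>)) U"
  have hUL: "?hU \<in> pts L2"
  proof (rule wt_L2_dom(1)[OF U(2) _ U(1) zero_le_one])
    show "\<bar>hH s N (jb \<zeta>)\<bar> \<le> 1 * \<bar>jb \<zeta> powr s\<bar>" for \<zeta>
      using hH_le[OF N jb_pos[of \<zeta>], of s] hH_nonneg[OF N less_imp_le[OF jb_pos[of \<zeta>]], of s] by simp
  qed measurable
  note YA = young_absf(1,2)[OF nU(3) gL] and YB = young_absf(3,4)[OF fVi hUL]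
  have Rpw: "cmod (R \<zeta>) \<le> ?C * cmod (conv (absf (wt norm U)) (absf g) \<zeta>) + ?C * cmod (conv (absf ?hU) (absf fV) \<zeta>)" for \<zeta>
  proof -
    let ?k = "\<lambda>\<zeta>'. of_real (1 / ?C) * (of_real (yW s N \<epsilon> \<zeta> - yW s N \<epsilon> \<zeta>') * (U (\<zeta> - \<zeta>') * fV \<zeta>'))"
    have kb: "cmod (LINT \<zeta>'|lborel. ?k \<zeta>') \<le> cmod (conv (absf (wt norm U)) (absf g) \<zeta>) + cmod (conv (absf ?hU) (absf fV) \<zeta>)"
    proof (rule kernel_bound[OF nU(1) gL hUL fVL])
      fix \<zeta>'
      define a b k where "a = cmod (U (\<zeta> - \<zeta>'))" and "b = cmod (wt rho U \<zeta>')" and "k = \<bar>fst \<zeta>'\<bar>"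
      have ab: "0 \<le> a" "0 \<le> b" by (simp_all add: a_def b_def)
      have "\<bar>yW s N \<epsilon> \<zeta> - yW s N \<epsilon> \<zeta>'\<bar> * k \<le> ?C * (norm (\<zeta> - \<zeta>') * yW s N \<epsilon> \<zeta>' + hH s N (jb (\<zeta> - \<zeta>')) * k)"
        unfolding k_def by (rule yW_commutator[OF s1 N \<epsilon> jf(1)]) simp
      then have "1 / ?C * (\<bar>yW s N \<epsilon> \<zeta> - yW s N \<epsilon> \<zeta>'\<bar> * k) \<le> norm (\<zeta> - \<zeta>') * yW s N \<epsilon> \<zeta>' + hH s N (jb (\<zeta> - \<zeta>')) * k"
        using C by (simp add: divide_le_eq mult.commute)
      from mult_right_mono[OF this mult_nonneg_nonneg[OF ab]]
      have "1 / ?C * (\<bar>yW s N \<epsilon> \<zeta> - yW s N \<epsilon> \<zeta>'\<bar> * (a * (k * b))) \<le>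
          norm (\<zeta> - \<zeta>') * a * (yW s N \<epsilon> \<zeta>' * b) + hH s N (jb (\<zeta> - \<zeta>')) * a * (k * b)"
        by (simp add: algebra_simps)
      moreover have "cmod (?k \<zeta>') = 1 / ?C * (\<bar>yW s N \<epsilon> \<zeta> - yW s N \<epsilon> \<zeta>'\<bar> * (a * (k * b)))"
        unfolding norm_mult norm_of_real fV_def a_def b_def k_def using C by simp
      moreover have "cmod (wt norm U (\<zeta> - \<zeta>')) = norm (\<zeta> - \<zeta>') * a" unfolding norm_mult norm_of_real a_def by simp
      moreover have "cmod (g \<zeta>') = yW s N \<epsilon> \<zeta>' * b" unfolding g_eq norm_mult norm_of_real b_def using W(1)[of \<zeta>'] by simp
      moreover have "cmod (?hU (\<zeta> - \<zeta>')) = hH s N (jb (\<zeta> - \<zeta>')) * a"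
        unfolding norm_mult norm_of_real a_def using hH_nonneg[OF N less_imp_le[OF jb_pos[of "\<zeta> - \<zeta>'"]], of s] by simp
      moreover have "cmod (fV \<zeta>') = k * b" unfolding fV_def norm_mult norm_of_real b_def k_def by simp
      ultimately show "cmod (?k \<zeta>') \<le> cmod (wt norm U (\<zeta> - \<zeta>')) * cmod (g \<zeta>') + cmod (?hU (\<zeta> - \<zeta>')) * cmod (fV \<zeta>')"
        by (simp only:)
    qed
    have "(LINT \<zeta>'|lborel. ?k \<zeta>') = of_real (1 / ?C) * (LINT \<zeta>'|lborel. of_real (yW s N \<epsilon> \<zeta>) * (U (\<zeta> - \<zeta>') * fV \<zeta>') - U (\<zeta> - \<zeta>') * wt fst g \<zeta>')"
      unfolding fg_pw by (subst integral_mult_right_zero[symmetric]) (simp add: algebra_simps)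
    also have "(LINT \<zeta>'|lborel. of_real (yW s N \<epsilon> \<zeta>) * (U (\<zeta> - \<zeta>') * fV \<zeta>') - U (\<zeta> - \<zeta>') * wt fst g \<zeta>') = R \<zeta>"
    proof -
      have "(LINT \<zeta>'|lborel. of_real (yW s N \<epsilon> \<zeta>) * (U (\<zeta> - \<zeta>') * fV \<zeta>') - U (\<zeta> - \<zeta>') * wt fst g \<zeta>') =
          (LINT \<zeta>'|lborel. of_real (yW s N \<epsilon> \<zeta>) * (U (\<zeta> - \<zeta>') * fV \<zeta>')) - (LINT \<zeta>'|lborel. U (\<zeta> - \<zeta>') * wt fst g \<zeta>')"
        by (intro Bochner_Integration.integral_diff integrable_mult_right conv_integrable U1(1) fVL fgL)
      also have "(LINT \<zeta>'|lborel. of_real (yW s N \<epsilon> \<zeta>) * (U (\<zeta> - \<zeta>') * fV \<zeta>')) = of_real (yW s N \<epsilon> \<zeta>) * (LINT \<zeta>'|lborel. U (\<zeta> - \<zeta>') * fV \<zeta>')"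
        by (rule integral_mult_right_zero)
      finally show ?thesis unfolding R_def Q_fV by (simp only: conv_def)
    qed
    finally have kR: "(LINT \<zeta>'|lborel. ?k \<zeta>') = of_real (1 / ?C) * R \<zeta>" .
    have "1 / ?C * cmod (R \<zeta>) \<le> cmod (conv (absf (wt norm U)) (absf g) \<zeta>) + cmod (conv (absf ?hU) (absf fV) \<zeta>)"
      using kb[unfolded kR norm_mult norm_of_real] C by simp
    then show ?thesis using C by (simp add: divide_le_eq algebra_simps)
  qed
  have nR: "n2 R \<le> ?C * (L * n2 g) + ?C * (L * \<tau>)"
  proof -
    have "n2 R \<le> ?C * n2 (conv (absf (wt norm U)) (absf g)) + ?C * n2 (conv (absf ?hU) (absf fV))"
      by (rule L2_bound2(2)[OF L2_measurable[OF RL] YA(1) YB(1) less_imp_le[OF C] less_imp_le[OF C] Rpw])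
    moreover have "?C * n2 (conv (absf (wt norm U)) (absf g)) \<le> ?C * (L * n2 g)"
      by (intro mult_left_mono order_trans[OF YA(2)] mult_right_mono nU(4) n2_nonneg less_imp_le[OF C])
    moreover have "?C * n2 (conv (absf ?hU) (absf fV)) \<le> ?C * (L * \<tau>)"
      unfolding \<tau>_def by (intro mult_left_mono order_trans[OF YB(2)] mult_right_mono fVn n2_nonneg less_imp_le[OF C])
    ultimately show ?thesis by linarith
  qed
  define z1 z2 E where "z1 = ip R g" and "z2 = ip (conv U (wt fst g)) g" and "E = n2 g"
  have "ip P g = ip P' g" by (rule ip_cong[OF PP _ Pm P'm gm gm]) simp
  also have "\<dots> = \<i> * of_real (1 / (2 * pi)) * ip (wt (yW s N \<epsilon>) Q) g" unfolding P'_def by (rule ip_cmult_left)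
  also have "ip (wt (yW s N \<epsilon>) Q) g = z1 + z2"
    unfolding z1_def z2_def R_def ip_diff_left[OF WQL(1) cfg gL] by simp
  finally have ipP: "ip P g = of_real (1 / (2 * pi)) * (\<i> * (z1 + z2))" by (simp add: mult_ac)
  have z1: "cmod z1 \<le> (?C * (L * E) + ?C * (L * \<tau>)) * E"
    unfolding z1_def E_def by (rule order_trans[OF L2_integrable(6)[OF RL gL] mult_right_mono[OF nR n2_nonneg]])
  have z2: "\<bar>Re (\<i> * z2)\<bar> \<le> L * E\<^sup>2"
    unfolding z2_def E_def
    by (rule order_trans[OF transport_skew[OF U1(1,2) herm fU(1,3) gL fgL] mult_right_mono[OF fU(4)]]) simp
  have E0: "0 \<le> E" "0 \<le> \<tau>" by (simp_all add: E_def \<tau>_def)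
  have sq: "E * \<tau> \<le> E\<^sup>2 + \<tau>\<^sup>2" using sum_squares_bound[of E \<tau>] E0 mult_nonneg_nonneg[OF E0] by linarith
  have "Re (ip P g) = 1 / (2 * pi) * (Re (\<i> * z1) + Re (\<i> * z2))" unfolding ipP
    by (simp add: diff_divide_distrib)
  also have "\<dots> \<le> 1 / (2 * pi) * (cmod z1 + L * E\<^sup>2)"
    using complex_Re_le_cmod[of "\<i> * z1"] z2 by (intro mult_left_mono) (auto simp: norm_mult)
  also have "\<dots> \<le> 1 * (cmod z1 + L * E\<^sup>2)"
    using L0 by (intro mult_right_mono pi1) simp
  also have "\<dots> \<le> (?C * (L * E) + ?C * (L * \<tau>)) * E + L * E\<^sup>2" using z1 by simp
  also have "\<dots> = ?C * L * (E\<^sup>2 + E * \<tau>) + L * E\<^sup>2" by (simp add: power2_eq_square algebra_simps)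
  also have "\<dots> \<le> ?C * L * (2 * (E\<^sup>2 + \<tau>\<^sup>2)) + L * (E\<^sup>2 + \<tau>\<^sup>2)"
    using order_trans[OF sq, of "E\<^sup>2 + 2 * \<tau>\<^sup>2"] C L0 by (intro add_mono mult_left_mono) auto
  also have "\<dots> = (2 * ?C + 1) * L * (E\<^sup>2 + \<tau>\<^sup>2)" by (simp add: algebra_simps)
  finally show "Re (ip (wt w (nonlin U)) (wt w U)) \<le> (2 * comm_const s + 1) * L * ((n2 (wt w U))\<^sup>2 + \<tau>\<^sup>2)"
    by (simp only: P_def g_def E_def)
qed

text \<open>For letting the tail error \<open>h\<close> tend to 0 while \<epsilon> and
  \<open>N\<close> stay fixed.\<close>

lemma le_of_quadratic_error:
  fixes x y p q :: real
  assumes "\<And>h. 0 < h \<Longrightarrow> x \<le> y + p * h\<^sup>2 + q * h"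
  shows "x \<le> y"
proof -
  have a: "(\<lambda>n. 1 / real (Suc n)) \<longlonglongrightarrow> 0" by (rule LIMSEQ_Suc[OF lim_1_over_n])
  have "(\<lambda>n. y + p * (1 / real (Suc n))\<^sup>2 + q * (1 / real (Suc n))) \<longlonglongrightarrow> y + p * 0\<^sup>2 + q * 0"
    by (intro tendsto_intros a)
  then have lim: "(\<lambda>n. y + p * (1 / real (Suc n))\<^sup>2 + q * (1 / real (Suc n))) \<longlonglongrightarrow> y" by simp
  have "x \<le> y + p * (1 / real (Suc n))\<^sup>2 + q * (1 / real (Suc n))" for n by (rule assms) simp
  then show ?thesis by (intro LIMSEQ_le_const[OF lim]) blast
qed

lemma rho_xweight:
  assumes "1 \<le> s"
  shows "\<bar>rho \<zeta>\<bar> * \<bar>fst \<zeta>\<bar> \<le> jb \<zeta> powr s"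
proof -
  have "\<bar>rho \<zeta>\<bar> * \<bar>fst \<zeta>\<bar> \<le> \<bar>snd \<zeta>\<bar>" by (simp add: rho_def)
  also have "\<dots> \<le> jb \<zeta> powr s"
    using fst_snd_le_norm(2)[of \<zeta>] norm_le_jb[of \<zeta>] jb_le_powr[OF assms, of \<zeta>] by linarith
  finally show ?thesis .
qed

lemma rho_window: "\<zeta> \<in> window n \<Longrightarrow> \<bar>rho \<zeta>\<bar> \<le> real (Suc n) * real (Suc n)"
proof -
  assume w: "\<zeta> \<in> window n"
  have "\<bar>rho \<zeta>\<bar> = \<bar>snd \<zeta>\<bar> * inverse \<bar>fst \<zeta>\<bar>" by (simp add: rho_def divide_inverse abs_mult)
  also have "\<dots> \<le> real (Suc n) * real (Suc n)"
    using window_bounds[OF w] by (intro mult_mono) auto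
  finally show ?thesis .
qed

lemma wt_abs_iff:
  assumes [measurable]: "\<mu> \<in> borel_measurable borel" "\<mu>' \<in> borel_measurable borel" "U \<in> borel_measurable borel"
    and e: "\<And>\<zeta>. \<bar>\<mu> \<zeta>\<bar> = \<bar>\<mu>' \<zeta>\<bar>"
  shows "wt \<mu> U \<in> pts L2 \<longleftrightarrow> wt \<mu>' U \<in> pts L2" "n2 (wt \<mu> U) = n2 (wt \<mu>' U)"
  by (rule L2_norm_cong; simp add: norm_mult e)+

text \<open>As |rho| |\<xi>| \<le> |\<eta>|, the weight |rho| is one of those of size 1 / |\<xi>|.
  Tail control for it, applied to \<open>U\<close> within its own neighbourhood, is uniform in
  time.\<close>

lemma rho_tails:
  assumes U: "fsol \<alpha> s T U" and s: "s > 2" and T: "0 \<le> T" and \<alpha>: "-1 \<le> \<alpha>" "\<alpha> \<le> 1"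
    and U0: "wt rho (U 0) \<in> pts L2"
  shows "t \<in> {0..T} \<Longrightarrow> wt rho (U t) \<in> pts L2"
    "0 < h \<Longrightarrow> \<exists>n. \<forall>t\<in>{0..T}. n2 (wt (indicator (- window n)) (wt rho (U t))) < h"
proof -
  let ?\<mu> = "\<lambda>\<zeta>. \<bar>rho \<zeta>\<bar>"
  have T0: "0 \<in> {0..T}" using T by simp
  have m: "?\<mu> \<in> borel_measurable borel" by measurable
  have s1: "1 \<le> s" using s by simp
  have e: "wt ?\<mu> V \<in> pts L2 \<longleftrightarrow> wt rho V \<in> pts L2" if "V \<in> borel_measurable borel" for V
    by (rule wt_abs_iff(1)[OF m rho_measurable that]) simp
  have U0': "wt ?\<mu> (U 0) \<in> pts L2" using U0 e[OF fsolD(1)[OF U s T0]] by simp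
  have pw: "propagates \<alpha> s T ?\<mu>" by (rule xweight_propagates[OF s T \<alpha> m _ rho_xweight[OF s1]]) simp
  have tc: "tail_control \<alpha> s T ?\<mu> (\<lambda>k \<zeta>. indicator (- window k) \<zeta> * ?\<mu> \<zeta>)"
    by (rule xweight_tail_control[OF s T \<alpha> m _ rho_xweight[OF s1]]) simp
  show "wt rho (U t) \<in> pts L2" if t: "t \<in> {0..T}"
    using pw U U0' t e[OF fsolD(1)[OF U s t]] unfolding propagates_def by blast
  assume h: "0 < h"
  obtain k d where d: "0 < d" and *: "nearby \<alpha> s T ?\<mu> U d (\<lambda>U' t. wt (\<lambda>\<zeta>. indicator (- window k) \<zeta> * ?\<mu> \<zeta>) (U' t) \<in> pts L2 \<and> n2 (wt (\<lambda>\<zeta>. indicator (- window k) \<zeta> * ?\<mu> \<zeta>) (U' t)) < h)"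
    using tc[unfolded tail_control_def, THEN spec, THEN mp, OF U, THEN mp, OF U0', THEN spec, THEN mp, OF h]
    by (elim exE conjE)
  have self: "wdist \<mu> (U t) (U t) < d" for \<mu> t using d by (simp add: L2_zero)
  have **: "\<forall>t\<in>{0..T}. wt (\<lambda>\<zeta>. indicator (- window k) \<zeta> * ?\<mu> \<zeta>) (U t) \<in> pts L2 \<and>
           n2 (wt (\<lambda>\<zeta>. indicator (- window k) \<zeta> * ?\<mu> \<zeta>) (U t)) < h"
    by (rule *[THEN spec, of U, THEN mp, OF U, THEN mp, OF U0', THEN mp, THEN mp]) (rule ballI, rule self, rule self)
  show "\<exists>n. \<forall>t\<in>{0..T}. n2 (wt (indicator (- window n)) (wt rho (U t))) < h"
  proof (intro exI[of _ k] ballI)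
    fix t assume t: "t \<in> {0..T}"
    note [measurable] = fsolD(1)[OF U s t]
    have "n2 (wt (\<lambda>\<zeta>. indicator (- window k) \<zeta> * rho \<zeta>) (U t)) = n2 (wt (\<lambda>\<zeta>. indicator (- window k) \<zeta> * ?\<mu> \<zeta>) (U t))"
      by (rule wt_abs_iff(2)) (simp_all add: abs_mult)
    with bspec[OF ** t] show "n2 (wt (indicator (- window k)) (wt rho (U t))) < h" by (simp add: mult.assoc)
  qed
qed

text \<open>The energy is differentiated on a window, where everything is bounded; the commutator estimate needs
  the full weight, and the difference is small because the tails of \<open>rho U\<close> outside the windows are.\<close>

lemma yweight_tail_regularised:
  assumes U: "fsol \<alpha> s T U" and s: "s > 2" and T: "0 \<le> T" and \<alpha>: "-1 \<le> \<alpha>" "\<alpha> \<le> 1"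
    and N: "0 < N" and \<epsilon>: "0 < \<epsilon>"
    and U0: "wt rho (U 0) \<in> pts L2" "wt (\<lambda>\<zeta>. hH s N (jb \<zeta>) * rho \<zeta>) (U 0) \<in> pts L2"
    and L: "\<And>t. t \<in> {0..T} \<Longrightarrow> (LINT \<zeta>|lborel. jb \<zeta> * cmod (U t \<zeta>)) \<le> L"
    and \<tau>: "\<And>t. t \<in> {0..T} \<Longrightarrow> n2 (wt (\<lambda>\<zeta>. hH s N (jb \<zeta>)) (U t)) \<le> \<tau>"
    and t: "t \<in> {0..T}"
  defines "a \<equiv> 2 * ((2 * comm_const s + 1) * L)"
  shows "wt (\<lambda>\<zeta>. yW s N \<epsilon> \<zeta> * rho \<zeta>) (U t) \<in> pts L2"
    "(n2 (wt (\<lambda>\<zeta>. yW s N \<epsilon> \<zeta> * rho \<zeta>) (U t)))\<^sup>2 \<le>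
      exp (a * T) * ((n2 (wt (\<lambda>\<zeta>. hH s N (jb \<zeta>) * rho \<zeta>) (U 0)))\<^sup>2 + T * (a * \<tau>\<^sup>2))"
proof -
  have s1: "1 \<le> s" using s by simp
  have T0: "0 \<in> {0..T}" using T by simp
  obtain M where M: "M \<ge> 0" "\<And>r. r \<in> {0..T} \<Longrightarrow> n2 (wt (jw s) (U r)) \<le> M" using fsol_bounded[OF U s] by blast
  define cW where "cW = (1 / \<epsilon>) powr s"
  have cW: "0 \<le> cW" by (simp add: cW_def)
  note W = yW_bounds[OF s1 N \<epsilon>]
  have L0: "0 \<le> L" by (rule order_trans[OF _ L[OF T0]]) (simp add: less_imp_le)
  have \<tau>0: "0 \<le> \<tau>" by (rule order_trans[OF n2_nonneg \<tau>[OF T0]])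
  have C0: "0 \<le> comm_const s" using s by (simp add: comm_const_def)
  have a0: "0 \<le> a" unfolding a_def using C0 L0 by (intro mult_nonneg_nonneg) auto
  let ?w = "\<lambda>\<zeta>. yW s N \<epsilon> \<zeta> * rho \<zeta>"
  have wm [measurable]: "?w \<in> borel_measurable borel" by measurable
  note r1 = rho_tails(1)[OF U s T \<alpha> U0(1)]
  have Y: "wt ?w (U r) \<in> pts L2" "wt ?w (nonlin (U r)) \<in> pts L2" "n2 (wt ?w (nonlin (U r))) \<le> cW * (L * M)"
    "Re (ip (wt ?w (nonlin (U r))) (wt ?w (U r))) \<le> (2 * comm_const s + 1) * L * ((n2 (wt ?w (U r)))\<^sup>2 + \<tau>\<^sup>2)"
    if r: "r \<in> {0..T}" for r
  proof -
    note B = yweight_energy_bound[OF s N \<epsilon> fsolD(1,2)[OF U s r] fsolD(5)[OF U s r] r1[OF r] L[OF r]]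
    show "wt ?w (U r) \<in> pts L2" "wt ?w (nonlin (U r)) \<in> pts L2" by (rule B)+
    have "n2 (wt ?w (nonlin (U r))) \<le> cW * (L * n2 (wt (jw s) (U r)))" unfolding cW_def by (rule B)
    also have "\<dots> \<le> cW * (L * M)" by (intro mult_left_mono M(2) r L0 cW)
    finally show "n2 (wt ?w (nonlin (U r))) \<le> cW * (L * M)" .
    have "Re (ip (wt ?w (nonlin (U r))) (wt ?w (U r))) \<le> (2 * comm_const s + 1) * L * ((n2 (wt ?w (U r)))\<^sup>2 + (n2 (wt (\<lambda>\<zeta>. hH s N (jb \<zeta>)) (U r)))\<^sup>2)"
      by (rule B)
    also have "\<dots> \<le> (2 * comm_const s + 1) * L * ((n2 (wt ?w (U r)))\<^sup>2 + \<tau>\<^sup>2)"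
      using C0 L0 by (intro mult_left_mono add_left_mono power_mono \<tau> r n2_nonneg) auto
    finally show "Re (ip (wt ?w (nonlin (U r))) (wt ?w (U r))) \<le> (2 * comm_const s + 1) * L * ((n2 (wt ?w (U r)))\<^sup>2 + \<tau>\<^sup>2)" .
  qed
  show "wt ?w (U t) \<in> pts L2" by (rule Y(1)[OF t])
  let ?E0 = "(n2 (wt (\<lambda>\<zeta>. hH s N (jb \<zeta>) * rho \<zeta>) (U 0)))\<^sup>2"
  \<comment> \<open>Per unit of \<open>h\<close>, the change in the derivative of the energy caused
    by the cut to a window: the nonlinearity is at most \<open>cW * (L * M)\<close> and the part of
    the weighted unknown off the window at most \<open>cW * h\<close>.\<close>
  let ?q = "2 * cW * (cW * (L * M))"
  show "(n2 (wt ?w (U t)))\<^sup>2 \<le> exp (a * T) * (?E0 + T * (a * \<tau>\<^sup>2))"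
  proof (rule le_of_quadratic_error)
    fix h :: real assume h: "0 < h"
    obtain n where n: "\<And>r. r \<in> {0..T} \<Longrightarrow> n2 (wt (indicator (- window n)) (wt rho (U r))) < h"
      using rho_tails(2)[OF U s T \<alpha> U0(1) h] by blast
    let ?A = "window n" and ?B = "- window n"
    have Bm [measurable]: "?B \<in> sets borel" by measurable
    let ?wn = "\<lambda>\<zeta>. ?w \<zeta> * indicator ?A \<zeta>"
    have wnm: "?wn \<in> borel_measurable borel" by measurable
    let ?c = "cW * (real (Suc n) * real (Suc n))"
    have c0: "0 \<le> ?c" using cW by simp
    have wc: "\<bar>?wn \<zeta>\<bar> \<le> ?c * indicator ?A \<zeta>" for \<zeta>
    proof (cases "\<zeta> \<in> ?A")
      case True
      have "\<bar>yW s N \<epsilon> \<zeta>\<bar> * \<bar>rho \<zeta>\<bar> \<le> ?c"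
        using W(1,3)[of \<zeta>] by (intro mult_mono rho_window True cW) (auto simp: cW_def)
      then show ?thesis using True by (simp add: abs_mult)
    qed simp
    have gA: "wt ?wn (U r) = wt (indicator ?A) (wt ?w (U r))" for r by (simp add: mult_ac)
    \<comment> \<open>The parts on and off the window are orthogonal, so the full energy in the
      commutator estimate exceeds the differentiable one by at most
      \<open>(cW * h)\<^sup>2\<close>.\<close>
    have split: "(n2 (wt ?w (U r)))\<^sup>2 = (n2 (wt ?wn (U r)))\<^sup>2 + (n2 (wt (indicator ?B) (wt ?w (U r))))\<^sup>2"
      and gB: "n2 (wt (indicator ?B) (wt ?w (U r))) \<le> cW * h"
      and cross: "ip (wt ?wn (nonlin (U r))) (wt ?wn (U r)) =
        ip (wt ?w (nonlin (U r))) (wt ?w (U r)) - ip (wt ?w (nonlin (U r))) (wt (indicator ?B) (wt ?w (U r)))"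
      if r: "r \<in> {0..T}" for r
    proof -
      define g where "g = wt ?w (U r)"
      define P where "P = wt ?w (nonlin (U r))"
      have gL: "g \<in> pts L2" and PL: "P \<in> pts L2" using Y(1,2)[OF r] by (simp_all only: g_def P_def)
      note LA = wt_indicator_le(1)[OF gL window_measurable[of n]] and LB = wt_indicator_le(1)[OF gL Bm]
      have sum: "g \<zeta> = wt (indicator ?A) g \<zeta> + wt (indicator ?B) g \<zeta>" for \<zeta> by (cases "\<zeta> \<in> ?A") simp_all
      have "ip (wt (indicator ?A) g) (wt (indicator ?B) g) = (LINT \<zeta>|(lborel :: plane measure). 0)"
        unfolding ip_def by (intro Bochner_Integration.integral_cong refl) (simp add: indicator_def)
      then have orth: "ip (wt (indicator ?A) g) (wt (indicator ?B) g) = 0" by simp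
      have "(n2 g)\<^sup>2 = (n2 (wt (indicator ?A) g))\<^sup>2 + (n2 (wt (indicator ?B) g))\<^sup>2"
        using L2_add(3)[OF LA LB] orth unfolding sum[symmetric] by simp
      then show "(n2 (wt ?w (U r)))\<^sup>2 = (n2 (wt ?wn (U r)))\<^sup>2 + (n2 (wt (indicator ?B) (wt ?w (U r))))\<^sup>2"
        unfolding gA by (simp only: g_def)
      have "ip (wt ?wn (nonlin (U r))) (wt ?wn (U r)) = ip P (wt (indicator ?A) g)"
        unfolding ip_def
      proof (intro Bochner_Integration.integral_cong refl)
        fix \<zeta>
        show "wt ?wn (nonlin (U r)) \<zeta> * cnj (wt ?wn (U r) \<zeta>) = P \<zeta> * cnj (wt (indicator ?A) g \<zeta>)"
          unfolding P_def g_def by (cases "\<zeta> \<in> ?A") simp_all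
      qed
      moreover have "ip P g = ip P (wt (indicator ?A) g) + ip P (wt (indicator ?B) g)"
        using ip_add_right[OF LA LB PL] unfolding sum[symmetric] .
      ultimately show "ip (wt ?wn (nonlin (U r))) (wt ?wn (U r)) =
        ip (wt ?w (nonlin (U r))) (wt ?w (U r)) - ip (wt ?w (nonlin (U r))) (wt (indicator ?B) (wt ?w (U r)))"
        unfolding P_def g_def by simp
      have rL: "wt (indicator ?B) (wt rho (U r)) \<in> pts L2" by (rule wt_indicator_le(1)[OF r1[OF r] Bm])
      have pw: "AE \<zeta> in lborel. cmod (wt (indicator ?B) g \<zeta>) \<le> cW * cmod (wt (indicator ?B) (wt rho (U r)) \<zeta>)"
      proof (rule AE_I2)
        fix \<zeta>
        have "yW s N \<epsilon> \<zeta> * (cmod (of_real (indicator ?B \<zeta>)) * cmod (wt rho (U r) \<zeta>)) \<le> cW * (cmod (of_real (indicator ?B \<zeta>)) * cmod (wt rho (U r) \<zeta>))"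
          using W(3)[of \<zeta>] by (intro mult_right_mono) (auto simp: cW_def)
        then show "cmod (wt (indicator ?B) g \<zeta>) \<le> cW * cmod (wt (indicator ?B) (wt rho (U r)) \<zeta>)"
          using W(1)[of \<zeta>] by (simp add: g_def norm_mult abs_mult mult_ac)
      qed
      have "n2 (wt (indicator ?B) g) \<le> cW * n2 (wt (indicator ?B) (wt rho (U r)))"
        by (rule L2_dom(2)[OF L2_measurable[OF LB] rL cW pw])
      also have "\<dots> \<le> cW * h" using n[OF r] by (intro mult_left_mono cW) simp
      finally show "n2 (wt (indicator ?B) (wt ?w (U r))) \<le> cW * h" by (simp only: g_def)
    qed
    let ?b = "a * \<tau>\<^sup>2 + (a * (cW * h)\<^sup>2 + ?q * h)"
    have b0: "0 \<le> ?b" using a0 cW L0 M(1) h by (intro add_nonneg_nonneg mult_nonneg_nonneg) auto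
    have "(n2 (wt ?wn (U t)))\<^sup>2 \<le> exp (a * T) * ((n2 (wt ?wn (U 0)))\<^sup>2 + T * ?b)"
    proof (rule gronwall[OF fsol_energy(1)[OF U s \<alpha> _ wnm c0 wc] _ a0 b0 t])
      fix r assume r: "r \<in> {0..T}"
      define G x y z where "G = Re (ip (wt ?w (nonlin (U r))) (wt ?w (U r)))" and "x = (n2 (wt ?wn (U r)))\<^sup>2"
        and "y = n2 (wt (indicator ?B) (wt ?w (U r)))"
        and "z = ip (wt ?w (nonlin (U r))) (wt (indicator ?B) (wt ?w (U r)))"
      have y: "0 \<le> y" "y \<le> cW * h" using gB[OF r] by (simp_all add: y_def)
      have "cmod z \<le> n2 (wt ?w (nonlin (U r))) * y"
        unfolding z_def y_def by (rule L2_integrable(6)[OF Y(2)[OF r] wt_indicator_le(1)[OF Y(1)[OF r] Bm]])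
      also have "\<dots> \<le> (cW * (L * M)) * (cW * h)"
        using Y(3)[OF r] y cW L0 M(1) by (intro mult_mono) auto
      finally have z: "- Re z \<le> (cW * (L * M)) * (cW * h)" using abs_Re_le_cmod[of z] by linarith
      have "G \<le> (2 * comm_const s + 1) * L * ((x + y\<^sup>2) + \<tau>\<^sup>2)"
        using Y(4)[OF r] unfolding split[OF r] G_def x_def y_def .
      also have "\<dots> \<le> (2 * comm_const s + 1) * L * ((x + (cW * h)\<^sup>2) + \<tau>\<^sup>2)"
        using C0 L0 y \<tau>0 by (intro mult_left_mono add_mono power_mono) auto
      finally have G: "2 * G \<le> a * x + (a * \<tau>\<^sup>2 + a * (cW * h)\<^sup>2)" by (simp add: a_def algebra_simps)
      have "2 * Re (ip (wt ?wn (nonlin (U r))) (wt ?wn (U r))) = 2 * G - 2 * Re z"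
        unfolding cross[OF r] G_def z_def by simp
      also have "\<dots> \<le> a * x + (a * \<tau>\<^sup>2 + a * (cW * h)\<^sup>2) + ?q * h" using G z by (simp add: algebra_simps)
      finally show "2 * Re (ip (wt ?wn (nonlin (U r))) (wt ?wn (U r))) \<le> a * (n2 (wt ?wn (U r)))\<^sup>2 + ?b"
        unfolding x_def by (simp add: algebra_simps)
    qed simp_all
    also have "\<dots> \<le> exp (a * T) * (?E0 + T * ?b)"
    proof -
      have "n2 (wt ?wn (U 0)) \<le> 1 * n2 (wt (\<lambda>\<zeta>. hH s N (jb \<zeta>) * rho \<zeta>) (U 0))"
      proof (rule wt_L2_dom(2)[OF U0(2) wnm fsolD(1)[OF U s T0] zero_le_one])
        fix \<zeta>
        have "\<bar>?wn \<zeta>\<bar> \<le> yW s N \<epsilon> \<zeta> * \<bar>rho \<zeta>\<bar>" using W(1)[of \<zeta>] by (simp add: abs_mult indicator_def)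
        also have "\<dots> \<le> hH s N (jb \<zeta>) * \<bar>rho \<zeta>\<bar>" by (intro mult_right_mono W(2)) simp
        also have "\<dots> \<le> 1 * \<bar>hH s N (jb \<zeta>) * rho \<zeta>\<bar>" by (simp add: abs_mult mult_right_mono)
        finally show "\<bar>?wn \<zeta>\<bar> \<le> 1 * \<bar>hH s N (jb \<zeta>) * rho \<zeta>\<bar>" .
      qed
      then have "(n2 (wt ?wn (U 0)))\<^sup>2 \<le> ?E0" by (intro power_mono) simp_all
      then show ?thesis by simp
    qed
    finally have 1: "(n2 (wt ?wn (U t)))\<^sup>2 \<le> exp (a * T) * (?E0 + T * ?b)" .
    have "(n2 (wt (indicator ?B) (wt ?w (U t))))\<^sup>2 \<le> (cW * h)\<^sup>2" by (intro power_mono gB[OF t] n2_nonneg)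
    with 1 split[OF t] have "(n2 (wt ?w (U t)))\<^sup>2 \<le> exp (a * T) * (?E0 + T * ?b) + (cW * h)\<^sup>2" by linarith
    also have "\<dots> = exp (a * T) * (?E0 + T * (a * \<tau>\<^sup>2)) + (exp (a * T) * T * a * cW\<^sup>2 + cW\<^sup>2) * h\<^sup>2 + (exp (a * T) * T * ?q) * h"
      by (simp add: algebra_simps power_mult_distrib)
    finally show "(n2 (wt ?w (U t)))\<^sup>2 \<le> exp (a * T) * (?E0 + T * (a * \<tau>\<^sup>2)) +
        (exp (a * T) * T * a * cW\<^sup>2 + cW\<^sup>2) * h\<^sup>2 + (exp (a * T) * T * ?q) * h" .
  qed
qed

lemma yW_tendsto:
  assumes "0 < N"
  shows "(\<lambda>n. yW s N (1 / real (Suc n)) \<zeta>) \<longlonglongrightarrow> hH s N (jb \<zeta>)"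
proof -
  have a: "(\<lambda>n. 1 / real (Suc n)) \<longlonglongrightarrow> 0" by (rule LIMSEQ_Suc[OF lim_1_over_n])
  have "(\<lambda>n. jb \<zeta> / (1 + 1 / real (Suc n) * jb \<zeta>)) \<longlonglongrightarrow> jb \<zeta> / (1 + 0 * jb \<zeta>)"
    by (intro tendsto_intros a) simp
  then have g: "(\<lambda>n. gE (1 / real (Suc n)) (jb \<zeta>)) \<longlonglongrightarrow> jb \<zeta>" by (simp add: gE_def)
  have "jb \<zeta> + N \<noteq> 0" using jb_pos[of \<zeta>] assms by linarith
  then show ?thesis unfolding yW_def hH_def using less_imp_neq[OF jb_pos[of \<zeta>]] by (intro tendsto_intros g) auto
qed

text \<open>The regularised bound is free of \<epsilon>, so Fatou along \<epsilon> = 1 / (n + 1)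
  removes the regularisation and yields membership at the same time.\<close>

lemma yweight_tail:
  assumes U: "fsol \<alpha> s T U" and s: "s > 2" and T: "0 \<le> T" and \<alpha>: "-1 \<le> \<alpha>" "\<alpha> \<le> 1" and N: "0 < N"
    and U0: "wt rho (U 0) \<in> pts L2" "wt (\<lambda>\<zeta>. hH s N (jb \<zeta>) * rho \<zeta>) (U 0) \<in> pts L2"
    and L: "\<And>t. t \<in> {0..T} \<Longrightarrow> (LINT \<zeta>|lborel. jb \<zeta> * cmod (U t \<zeta>)) \<le> L"
    and \<tau>: "\<And>t. t \<in> {0..T} \<Longrightarrow> n2 (wt (\<lambda>\<zeta>. hH s N (jb \<zeta>)) (U t)) \<le> \<tau>"
    and t: "t \<in> {0..T}"
  defines "a \<equiv> 2 * ((2 * comm_const s + 1) * L)"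
  shows "wt (\<lambda>\<zeta>. hH s N (jb \<zeta>) * rho \<zeta>) (U t) \<in> pts L2"
    "n2 (wt (\<lambda>\<zeta>. hH s N (jb \<zeta>) * rho \<zeta>) (U t)) \<le>
      sqrt (exp (a * T) * ((n2 (wt (\<lambda>\<zeta>. hH s N (jb \<zeta>) * rho \<zeta>) (U 0)))\<^sup>2 + T * (a * \<tau>\<^sup>2)))"
proof -
  note [measurable] = fsolD(1)[OF U s t]
  note R = yweight_tail_regularised[OF U s T \<alpha> N _ U0 L \<tau> t, folded a_def]
  let ?e = "\<lambda>n. 1 / real (Suc n)"
  have e: "0 < ?e n" for n by simp
  have bd: "n2 (wt (\<lambda>\<zeta>. yW s N (?e n) \<zeta> * rho \<zeta>) (U t)) \<le>
      sqrt (exp (a * T) * ((n2 (wt (\<lambda>\<zeta>. hH s N (jb \<zeta>) * rho \<zeta>) (U 0)))\<^sup>2 + T * (a * \<tau>\<^sup>2)))" for n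
    by (rule real_le_rsqrt[OF R(2)[OF e]])
  have lim: "AE \<zeta> in lborel. (\<lambda>n. wt (\<lambda>\<zeta>. yW s N (?e n) \<zeta> * rho \<zeta>) (U t) \<zeta>) \<longlonglongrightarrow> wt (\<lambda>\<zeta>. hH s N (jb \<zeta>) * rho \<zeta>) (U t) \<zeta>"
    by (intro AE_I2 tendsto_intros yW_tendsto N)
  have m: "wt (\<lambda>\<zeta>. hH s N (jb \<zeta>) * rho \<zeta>) (U t) \<in> borel_measurable borel" by measurable
  show "wt (\<lambda>\<zeta>. hH s N (jb \<zeta>) * rho \<zeta>) (U t) \<in> pts L2"
    "n2 (wt (\<lambda>\<zeta>. hH s N (jb \<zeta>) * rho \<zeta>) (U t)) \<le>
      sqrt (exp (a * T) * ((n2 (wt (\<lambda>\<zeta>. hH s N (jb \<zeta>) * rho \<zeta>) (U 0)))\<^sup>2 + T * (a * \<tau>\<^sup>2)))"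
    by (rule L2_Fatou[OF R(1)[OF e] bd lim m]; assumption)+
qed

subsection \<open>Persistence and continuous dependence\<close>

lemma wt_contraction:
  assumes ch: "ch \<in> borel_measurable borel" "\<And>\<zeta>. \<bar>ch \<zeta>\<bar> \<le> 1" and F: "F \<in> pts L2"
  shows "wt ch F \<in> pts L2" "n2 (wt ch F) \<le> n2 F"
proof -
  have "AE \<zeta> in lborel. cmod (wt ch F \<zeta>) \<le> 1 * cmod (F \<zeta>)"
    by (rule AE_I2) (use ch(2) in \<open>auto simp: norm_mult intro!: mult_left_le_one_le\<close>)
  from L2_dom[OF wt_measurable[OF ch(1) L2_measurable[OF F]] F zero_le_one this]
  show "wt ch F \<in> pts L2" "n2 (wt ch F) \<le> n2 F" by simp_all
qed

lemma wt_contraction_split: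
  assumes ch: "ch \<in> borel_measurable borel" "\<And>\<zeta>. \<bar>ch \<zeta>\<bar> \<le> 1" and F: "F \<in> pts L2" "F' \<in> pts L2"
    and le: "n2 (wt ch F') \<le> x" "n2 (\<lambda>\<zeta>. F \<zeta> - F' \<zeta>) \<le> y"
  shows "n2 (wt ch F) \<le> x + y"
proof -
  have "n2 (wt ch F) \<le> n2 (wt ch F') + n2 (\<lambda>\<zeta>. wt ch F \<zeta> - wt ch F' \<zeta>)"
    by (intro n2_le_diff wt_contraction(1) ch F)
  also have "(\<lambda>\<zeta>. wt ch F \<zeta> - wt ch F' \<zeta>) = wt ch (\<lambda>\<zeta>. F \<zeta> - F' \<zeta>)" by (simp add: right_diff_distrib)
  also have "n2 \<dots> \<le> n2 (\<lambda>\<zeta>. F \<zeta> - F' \<zeta>)" by (rule wt_contraction(2)[OF ch L2_diff(1)[OF F]])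
  finally show ?thesis using le by linarith
qed

text \<open>The factor by which \<open>hH\<close> with N = k + 1 differs from the pure power. It is
  a contraction that tends to 0 at each frequency, so \<open>uniform_tail\<close> applies to
  it.\<close>

definition damp :: "nat \<Rightarrow> plane \<Rightarrow> real" where "damp k \<zeta> = jb \<zeta> / (jb \<zeta> + real (Suc k))"

lemma damp_measurable [measurable]: "damp k \<in> borel_measurable borel"
  unfolding damp_def[abs_def] by measurable

lemma damp_bounds: "0 \<le> damp k \<zeta>" "\<bar>damp k \<zeta>\<bar> \<le> 1"
proof -
  have "0 < jb \<zeta> + real (Suc k)" by (intro add_pos_pos) simp_all
  then show "0 \<le> damp k \<zeta>" "\<bar>damp k \<zeta>\<bar> \<le> 1" 
    using less_imp_le[OF jb_pos[of \<zeta>]] by (simp_all add: damp_def)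
qed

lemma damp_tendsto: "(\<lambda>k. damp k \<zeta>) \<longlonglongrightarrow> 0"
proof (rule Lim_null_comparison[OF always_eventually])
  show "\<forall>k. norm (damp k \<zeta>) \<le> jb \<zeta> * (1 / real (Suc k))"
  proof
    fix k
    have "jb \<zeta> / (jb \<zeta> + real (Suc k)) \<le> jb \<zeta> / real (Suc k)"
      by (intro divide_left_mono mult_pos_pos add_pos_pos) (simp_all add: less_imp_le)
    moreover have "norm (damp k \<zeta>) = damp k \<zeta>" using damp_bounds(1)[of k \<zeta>] by simp
    ultimately show "norm (damp k \<zeta>) \<le> jb \<zeta> * (1 / real (Suc k))"
      by (simp only: damp_def times_divide_eq_right mult_1_right)
  qed
  show "(\<lambda>k. jb \<zeta> * (1 / real (Suc k))) \<longlonglongrightarrow> 0"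
    by (rule tendsto_mult_right_zero[OF LIMSEQ_Suc[OF lim_1_over_n]])
qed

lemma hH_damp: "hH s (real (Suc k)) (jb \<zeta>) = damp k \<zeta> * jb \<zeta> powr s"
  by (simp add: hH_def damp_def)

text \<open>Smooth damping takes the place of the sharp cut, since the commutator estimate needs a
  slowly varying weight. The forcing \<tau> and the initial weighted norm are both damped quantities
  of \<open>U\<close> up to a small perturbation, hence small for large \<open>k\<close>.\<close>

lemma yweight_tail_control:
  assumes s: "s > 2" and T: "0 \<le> T" and \<alpha>: "-1 \<le> \<alpha>" "\<alpha> \<le> 1"
  shows "tail_control \<alpha> s T (\<lambda>\<zeta>. jb \<zeta> powr s * \<bar>rho \<zeta>\<bar>) (\<lambda>k \<zeta>. hH s (real (Suc k)) (jb \<zeta>) * rho \<zeta>)"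
  unfolding tail_control_def
proof (intro allI impI)
  let ?\<mu> = "\<lambda>\<zeta>. jb \<zeta> powr s * \<bar>rho \<zeta>\<bar>"
  fix U and e :: real assume U: "fsol \<alpha> s T U" and U0: "wt ?\<mu> (U 0) \<in> pts L2" and e: "0 < e"
  have s0: "0 \<le> s" using s by simp
  have T0: "0 \<in> {0..T}" using T by simp
  obtain M where M: "M \<ge> 0" "\<And>r. r \<in> {0..T} \<Longrightarrow> n2 (wt (jw s) (U r)) \<le> M" using fsol_bounded[OF U s] by blast
  \<comment> \<open>M + 1 covers all solutions within distance 1 of \<open>U\<close>, so the growth
    rate \<open>a\<close> is fixed before \<open>h\<close> and \<open>k\<close> are chosen.\<close>
  define L where "L = emb_const s * (M + 1)"
  have L0: "0 \<le> L" unfolding L_def using M(1) emb_const_nonneg by (intro mult_nonneg_nonneg) auto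
  define a where "a = 2 * ((2 * comm_const s + 1) * L)"
  have a0: "0 \<le> a" unfolding a_def using s L0 by (intro mult_nonneg_nonneg) (auto simp: comm_const_def)
  obtain h where h: "0 < h" "4 * (exp (a * T) * (1 + T * a)) * h\<^sup>2 < e\<^sup>2"
    using exists_small[OF e, of "4 * (exp (a * T) * (1 + T * a))"] T a0 by auto
  obtain k1 where k1: "\<And>k t. k \<ge> k1 \<Longrightarrow> t \<in> {0..T} \<Longrightarrow> n2 (wt (damp k) (wt (jw s) (U t))) < h"
    using uniform_tail[where G="\<lambda>t. wt (jw s) (U t)" and ch=damp and T=T, OF fsolD(2)[OF U s] fsolD(6)[OF U s, unfolded wt_diff] damp_measurable damp_bounds(2) AE_I2[OF damp_tendsto] h(1)]
    by blast
  obtain k2 where k2: "\<And>k t. k \<ge> k2 \<Longrightarrow> t \<in> {0..T} \<Longrightarrow> n2 (wt (damp k) (wt ?\<mu> (U 0))) < h"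
    using uniform_tail[where T=T and G="\<lambda>_. wt ?\<mu> (U 0)" and ch=damp, OF U0 _ damp_measurable damp_bounds(2) AE_I2[OF damp_tendsto] h(1)]
    by (auto simp: L2_zero)
  define k where "k = max k1 k2"
  let ?N = "real (Suc k)"
  have N: "0 < ?N" by simp
  show "\<exists>k. \<exists>d>0. nearby \<alpha> s T ?\<mu> U d (\<lambda>U' t. wt (\<lambda>\<zeta>. hH s (real (Suc k)) (jb \<zeta>) * rho \<zeta>) (U' t) \<in> pts L2 \<and> n2 (wt (\<lambda>\<zeta>. hH s (real (Suc k)) (jb \<zeta>) * rho \<zeta>) (U' t)) < e)"
  proof (rule exI[of _ k], rule exI[of _ "min 1 h"], intro conjI allI impI ballI)
    show "0 < min 1 h" using h by simp
    fix V t assume V: "fsol \<alpha> s T V" "wt ?\<mu> (V 0) \<in> pts L2"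
      and c: "\<forall>t\<in>{0..T}. wdist (jw s) (V t) (U t) < min 1 h"
      and c0: "wdist ?\<mu> (V 0) (U 0) < min 1 h" and t: "t \<in> {0..T}"
    have Lb: "(LINT \<zeta>|lborel. jb \<zeta> * cmod (V r \<zeta>)) \<le> L" if r: "r \<in> {0..T}" for r
    proof -
      have "n2 (wt (jw s) (V r)) \<le> n2 (wt (jw s) (U r)) + wdist (jw s) (V r) (U r)"
        unfolding wt_diff by (rule n2_le_diff[OF fsolD(2)[OF V(1) s r] fsolD(2)[OF U s r]])
      then have "n2 (wt (jw s) (V r)) \<le> M + 1" using M(2)[OF r] bspec[OF c r] by linarith
      then have "emb_const s * n2 (wt (jw s) (V r)) \<le> L" unfolding L_def by (rule mult_left_mono[OF _ emb_const_nonneg])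
      with weighted_L1(2)[OF s fsolD(1,2)[OF V(1) s r]] show ?thesis by linarith
    qed
    have \<tau>: "n2 (wt (\<lambda>\<zeta>. hH s ?N (jb \<zeta>)) (V r)) \<le> h + h" if r: "r \<in> {0..T}" for r
    proof -
      have "n2 (wt (damp k) (wt (jw s) (V r))) \<le> h + h"
      proof (rule wt_contraction_split[OF damp_measurable damp_bounds(2) fsolD(2)[OF V(1) s r] fsolD(2)[OF U s r]])
        show "n2 (wt (damp k) (wt (jw s) (U r))) \<le> h" using k1[of k r] r by (simp add: k_def)
        show "n2 (\<lambda>\<zeta>. wt (jw s) (V r) \<zeta> - wt (jw s) (U r) \<zeta>) \<le> h"
          using bspec[OF c r] unfolding wt_diff by simp
      qed
      then show ?thesis unfolding hH_damp of_real_mult mult.assoc .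
    qed
    note Vm [measurable] = fsolD(1)[OF V(1) s T0]
    have cm: "(\<lambda>\<zeta>. hH s ?N (jb \<zeta>) * rho \<zeta>) \<in> borel_measurable borel" "(\<lambda>\<zeta>. damp k \<zeta> * ?\<mu> \<zeta>) \<in> borel_measurable borel"
      by measurable
    have ab: "\<bar>hH s ?N (jb \<zeta>) * rho \<zeta>\<bar> = \<bar>damp k \<zeta> * ?\<mu> \<zeta>\<bar>" for \<zeta>
      unfolding hH_damp by (simp add: abs_mult)
    note eq = wt_abs_iff[OF cm Vm ab]
    have V0r: "wt rho (V 0) \<in> pts L2"
    proof (rule wt_L2_dom(1)[OF V(2) rho_measurable Vm zero_le_one])
      fix \<zeta>
      have "1 * \<bar>rho \<zeta>\<bar> \<le> jb \<zeta> powr s * \<bar>rho \<zeta>\<bar>" by (intro mult_right_mono jb_powr_ge_1 s0) simp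
      then show "\<bar>rho \<zeta>\<bar> \<le> 1 * \<bar>jb \<zeta> powr s * \<bar>rho \<zeta>\<bar>\<bar>" by simp
    qed
    have V0h: "wt (\<lambda>\<zeta>. hH s ?N (jb \<zeta>) * rho \<zeta>) (V 0) \<in> pts L2"
      using eq(1) wt_contraction(1)[OF damp_measurable damp_bounds(2) V(2), of k] by (simp add: mult.assoc)
    have i0: "n2 (wt (\<lambda>\<zeta>. hH s ?N (jb \<zeta>) * rho \<zeta>) (V 0)) \<le> h + h"
    proof -
      have "n2 (wt (damp k) (wt ?\<mu> (V 0))) \<le> h + h"
      proof (rule wt_contraction_split[OF damp_measurable damp_bounds(2) V(2) U0])
        show "n2 (wt (damp k) (wt ?\<mu> (U 0))) \<le> h" using k2[OF _ T0, of k] by (simp add: k_def)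
        show "n2 (\<lambda>\<zeta>. wt ?\<mu> (V 0) \<zeta> - wt ?\<mu> (U 0) \<zeta>) \<le> h" using c0 unfolding wt_diff by simp
      qed
      then show ?thesis unfolding eq(2) by (simp add: mult.assoc)
    qed
    note YT = yweight_tail[OF V(1) s T \<alpha> N V0r V0h Lb \<tau> t, folded a_def]
    show "wt (\<lambda>\<zeta>. hH s ?N (jb \<zeta>) * rho \<zeta>) (V t) \<in> pts L2" by (rule YT(1); assumption)
    have "n2 (wt (\<lambda>\<zeta>. hH s ?N (jb \<zeta>) * rho \<zeta>) (V t)) \<le>
        sqrt (exp (a * T) * ((n2 (wt (\<lambda>\<zeta>. hH s ?N (jb \<zeta>) * rho \<zeta>) (V 0)))\<^sup>2 + T * (a * (h + h)\<^sup>2)))"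
      by (rule YT(2); assumption)
    also have "\<dots> \<le> sqrt (exp (a * T) * ((h + h)\<^sup>2 + T * (a * (h + h)\<^sup>2)))"
      by (intro real_sqrt_le_mono mult_left_mono add_right_mono power_mono i0) auto
    also have "\<dots> < e"
    proof (rule real_less_lsqrt)
      have "exp (a * T) * ((h + h)\<^sup>2 + T * (a * (h + h)\<^sup>2)) = 4 * (exp (a * T) * (1 + T * a)) * h\<^sup>2"
        by (simp add: power2_eq_square algebra_simps)
      with h(2) show "exp (a * T) * ((h + h)\<^sup>2 + T * (a * (h + h)\<^sup>2)) < e\<^sup>2" by linarith
    qed (use e in simp)
    finally show "n2 (wt (\<lambda>\<zeta>. hH s ?N (jb \<zeta>) * rho \<zeta>) (V t)) < e" .
  qed
qed

lemma yweight_propagates: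
  assumes s: "s > 2" and T: "0 \<le> T" and \<alpha>: "-1 \<le> \<alpha>" "\<alpha> \<le> 1"
  shows "propagates \<alpha> s T (\<lambda>\<zeta>. jb \<zeta> powr s * \<bar>rho \<zeta>\<bar>)"
proof -
  have s1: "1 \<le> s" and s0: "0 \<le> s" using s by simp_all
  have m: "(\<lambda>\<zeta>. \<bar>rho \<zeta>\<bar>) \<in> borel_measurable borel" "(\<lambda>\<zeta>. jb \<zeta> powr s * \<bar>rho \<zeta>\<bar>) \<in> borel_measurable borel"
    by measurable
  have pw: "propagates \<alpha> s T (\<lambda>\<zeta>. \<bar>rho \<zeta>\<bar>)" by (rule xweight_propagates[OF s T \<alpha> m(1) _ rho_xweight[OF s1]]) simp
  show ?thesis
  proof (rule propagates_of_tails[OF s T pw yweight_tail_control[OF s T \<alpha>] m(2,1)])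
    fix \<zeta>
    have "1 * \<bar>rho \<zeta>\<bar> \<le> jb \<zeta> powr s * \<bar>rho \<zeta>\<bar>" by (intro mult_right_mono jb_powr_ge_1 s0) simp
    then show "\<bar>\<bar>rho \<zeta>\<bar>\<bar> \<le> 1 * \<bar>jb \<zeta> powr s\<bar> + 1 * \<bar>jb \<zeta> powr s * \<bar>rho \<zeta>\<bar>\<bar>" by (simp add: add_increasing)
  next
    fix k
    show "\<exists>c\<ge>0. \<forall>\<zeta>. \<bar>jb \<zeta> powr s * \<bar>rho \<zeta>\<bar>\<bar> \<le> c * \<bar>\<bar>rho \<zeta>\<bar>\<bar> + 2 * \<bar>hH s (real (Suc k)) (jb \<zeta>) * rho \<zeta>\<bar>"
    proof (intro exI[of _ "real (Suc k) powr s"] conjI allI)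
      fix \<zeta>
      let ?N = "real (Suc k)"
      \<comment> \<open>Below \<open>?N\<close> the power is at most \<open>?N powr s\<close>; above
        it the damping factor is at least 1 / 2, which is the origin of the 2 in
        \<open>propagates_of_tails\<close>.\<close>
      have "jb \<zeta> powr s \<le> ?N powr s + 2 * hH s ?N (jb \<zeta>)"
      proof (cases "jb \<zeta> \<le> ?N")
        case True
        then have "jb \<zeta> powr s \<le> ?N powr s" using s0 by (intro powr_mono2) (auto simp: less_imp_le)
        moreover have "0 \<le> hH s ?N (jb \<zeta>)" by (rule hH_nonneg) (simp_all add: less_imp_le)
        ultimately show ?thesis by linarith
      next
        case False
        have "1 \<le> 2 * damp k \<zeta>" using False jb_pos[of \<zeta>] unfolding damp_def by (simp add: le_divide_eq)
        from mult_right_mono[OF this powr_ge_zero[of "jb \<zeta>" s]]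
        have "jb \<zeta> powr s \<le> 2 * hH s ?N (jb \<zeta>)" by (simp only: hH_damp mult_1 mult.assoc)
        then show ?thesis by (rule order_trans) simp
      qed
      from mult_right_mono[OF this abs_ge_zero[of "rho \<zeta>"]]
      have "jb \<zeta> powr s * \<bar>rho \<zeta>\<bar> \<le> ?N powr s * \<bar>rho \<zeta>\<bar> + 2 * (hH s ?N (jb \<zeta>) * \<bar>rho \<zeta>\<bar>)"
        by (simp only: distrib_right mult.assoc)
      moreover have "0 \<le> hH s ?N (jb \<zeta>)" by (rule hH_nonneg) (simp_all add: less_imp_le)
      ultimately show "\<bar>jb \<zeta> powr s * \<bar>rho \<zeta>\<bar>\<bar> \<le> ?N powr s * \<bar>\<bar>rho \<zeta>\<bar>\<bar> + 2 * \<bar>hH s ?N (jb \<zeta>) * rho \<zeta>\<bar>"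
        by (simp only: abs_mult abs_abs abs_of_nonneg powr_ge_zero)
    qed simp
  qed
qed

text \<open>The five spaces enter only through a single weight. The norm formula is demanded on
  \<open>pts Z\<close>, since outside the domain of the multiplier \<open>fmult\<close> is an
  arbitrary choice.\<close>

definition weight_space :: "real \<Rightarrow> fspace \<Rightarrow> (plane \<Rightarrow> real) \<Rightarrow> bool" where
  "weight_space s Z \<mu> \<longleftrightarrow> \<mu> \<in> borel_measurable borel \<and>
     (\<forall>f. f \<in> pts Z \<longleftrightarrow> f \<in> pts (H s) \<and> wt \<mu> (fourier f) \<in> pts L2) \<and>
     (\<forall>f\<in>pts Z. nrm Z f = sqrt ((nrm (H s) f)\<^sup>2 + (n2 (wt \<mu> (fourier f)))\<^sup>2))"

lemma weight_space_graph_L2: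
  "m \<in> borel_measurable borel \<Longrightarrow> weight_space s (graph_space (H s) m L2) (\<lambda>\<zeta>. cmod (m \<zeta>))"
  unfolding weight_space_def using graph_L2[of m] by auto

lemma weight_space_graph_H:
  "m \<in> borel_measurable borel \<Longrightarrow> 0 \<le> s \<Longrightarrow>
    weight_space s (graph_space (H s) m (H s)) (\<lambda>\<zeta>. jb \<zeta> powr s * cmod (m \<zeta>))"
  unfolding weight_space_def using graph_H[of m s] by auto

lemma norm_dx_inv: "cmod (dx_inv \<zeta>) = inverse \<bar>fst \<zeta>\<bar>"
  by (simp add: dx_inv_def case_prod_beta norm_inverse norm_mult)

lemma norm_dx_inv_dy: "cmod (dx_inv \<zeta> * dy \<zeta>) = \<bar>rho \<zeta>\<bar>"
  by (simp add: norm_mult norm_dx_inv dy_def case_prod_beta rho_def abs_divide divide_inverse abs_mult)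

lemma norm_Dx: "cmod (Dx a \<zeta>) = \<bar>fst \<zeta>\<bar> powr a"
  by (simp add: Dx_def case_prod_beta)

lemma weight_of_space:
  assumes s: "s > 2" and \<alpha>: "-1 \<le> \<alpha>" "\<alpha> \<le> 1" and Z: "Z \<in> {X s, X_hat s, X_hat_alpha \<alpha> s, Y s, Y_hat s}"
  shows "\<exists>\<mu>. weight_space s Z \<mu> \<and> (\<forall>T\<ge>0. propagates \<alpha> s T \<mu>)"
proof -
  have s0: "0 \<le> s" and s1: "1 \<le> s" using s by simp_all
  have J: "jb \<zeta> \<le> jb \<zeta> powr s" "1 \<le> jb \<zeta> powr s" for \<zeta> using jb_le_powr[OF s1] jb_powr_ge_1[OF s0] by auto
  have mY: "(\<lambda>\<zeta>. dx_inv \<zeta> * dy \<zeta>) \<in> borel_measurable borel" by measurable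
  \<comment> \<open>With the convention inverse 0 = 0 the bound also holds on the null set \<xi> =
    0.\<close>
  have inv1: "inverse \<bar>x\<bar> * \<bar>x\<bar> \<le> 1" for x :: real by (cases "x = 0") simp_all
  consider "Z = X s" | "Z = X_hat s" | "Z = X_hat_alpha \<alpha> s" | "Z = Y s" | "Z = Y_hat s" using Z by auto
  then show ?thesis
  proof cases
    case 1
    have "propagates \<alpha> s T (\<lambda>\<zeta>. jb \<zeta> powr s * cmod (dx_inv \<zeta>))" if T: "0 \<le> T" for T
    proof (rule xweight_propagates[OF s T \<alpha>])
      show "jb \<zeta> powr s * cmod (dx_inv \<zeta>) * \<bar>fst \<zeta>\<bar> \<le> jb \<zeta> powr s" for \<zeta>
        using mult_left_mono[OF inv1[of "fst \<zeta>"] powr_ge_zero[of "jb \<zeta>" s]] by (simp add: norm_dx_inv mult.assoc)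
    qed simp_all
    then show ?thesis unfolding 1 X_def using weight_space_graph_H[of dx_inv s] s0 by auto
  next
    case 2
    have "propagates \<alpha> s T (\<lambda>\<zeta>. cmod (dx_inv \<zeta>))" if T: "0 \<le> T" for T
    proof (rule xweight_propagates[OF s T \<alpha>])
      show "cmod (dx_inv \<zeta>) * \<bar>fst \<zeta>\<bar> \<le> jb \<zeta> powr s" for \<zeta>
        unfolding norm_dx_inv by (rule order_trans[OF inv1 J(2)])
    qed simp_all
    then show ?thesis unfolding 2 X_hat_def using weight_space_graph_L2[of dx_inv s] by auto
  next
    case 3
    have "propagates \<alpha> s T (\<lambda>\<zeta>. cmod (Dx ((\<alpha> - 1) / 2) \<zeta>))" if T: "0 \<le> T" for T
    proof (rule xweight_propagates[OF s T \<alpha>])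
      fix \<zeta> :: plane
      let ?x = "\<bar>fst \<zeta>\<bar>"
      have x: "?x \<le> jb \<zeta>" using fst_snd_le_norm(1)[of \<zeta>] norm_le_jb[of \<zeta>] by linarith
      \<comment> \<open>The exponent plus 1 equals (\<alpha> + 1) / 2, which the range of \<alpha>
        places in [0, 1]; so one power of the bracket dominates.\<close>
      have e0: "0 \<le> (\<alpha> - 1) / 2 + 1" "(\<alpha> - 1) / 2 + 1 \<le> 1" using \<alpha> by (simp_all add: field_simps)
      have "?x powr ((\<alpha> - 1) / 2) * ?x \<le> jb \<zeta>"
      proof (cases "?x = 0")
        case False
        then have "?x powr ((\<alpha> - 1) / 2) * ?x = ?x powr ((\<alpha> - 1) / 2 + 1)" by (simp add: powr_add)
        also have "\<dots> \<le> jb \<zeta> powr ((\<alpha> - 1) / 2 + 1)" using x by (intro powr_mono2 e0) auto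
        also have "\<dots> \<le> jb \<zeta> powr 1" by (intro powr_mono jb_ge_1 e0)
        finally show ?thesis by (simp add: less_imp_le)
      qed (simp add: less_imp_le)
      then show "cmod (Dx ((\<alpha> - 1) / 2) \<zeta>) * ?x \<le> jb \<zeta> powr s" unfolding norm_Dx by (rule order_trans[OF _ J(1)])
    qed simp_all
    then show ?thesis unfolding 3 X_hat_alpha_def using weight_space_graph_L2[of "Dx ((\<alpha> - 1) / 2)" s] by auto
  next
    case 4
    have "weight_space s (Y s) (\<lambda>\<zeta>. jb \<zeta> powr s * \<bar>rho \<zeta>\<bar>)"
      using weight_space_graph_H[OF mY s0] unfolding Y_def norm_dx_inv_dy .
    then show ?thesis unfolding 4 using yweight_propagates[OF s _ \<alpha>] by blast
  next
    case 5
    have "weight_space s (Y_hat s) (\<lambda>\<zeta>. \<bar>rho \<zeta>\<bar>)"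
      using weight_space_graph_L2[OF mY] unfolding Y_hat_def norm_dx_inv_dy .
    moreover have "propagates \<alpha> s T (\<lambda>\<zeta>. \<bar>rho \<zeta>\<bar>)" if T: "0 \<le> T" for T
      by (rule xweight_propagates[OF s T \<alpha> _ _ rho_xweight[OF s1]]) simp_all
    ultimately show ?thesis unfolding 5 by blast
  qed
qed

text \<open>Up to null sets the transform of a difference is the difference of the transforms, so
  distances in \<open>Z\<close> are made of the weighted distances that \<open>propagates\<close>
  controls.\<close>

lemma weight_space_diff:
  assumes Z: "weight_space s Z \<mu>" and f: "f \<in> pts Z" and g: "g \<in> pts Z"
  shows "nrm (H s) (\<lambda>z. f z - g z) = wdist (jw s) (fourier f) (fourier g)"
    "nrm Z (\<lambda>z. f z - g z) = sqrt ((wdist (jw s) (fourier f) (fourier g))\<^sup>2 +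
       (wdist \<mu> (fourier f) (fourier g))\<^sup>2)"
proof -
  have fg: "f \<in> pts (H s)" "wt \<mu> (fourier f) \<in> pts L2" "g \<in> pts (H s)" "wt \<mu> (fourier g) \<in> pts L2"
    and [measurable]: "\<mu> \<in> borel_measurable borel"
    using Z f g by (auto simp: weight_space_def)
  then have L: "f \<in> pts L2" "g \<in> pts L2" and J: "wt (jw s) (fourier f) \<in> pts L2" "wt (jw s) (fourier g) \<in> pts L2"
    by (auto simp: H_iff)
  note D = L2_diff(1)[OF L]
  note [measurable] = fourier_measurable[OF L(1)] fourier_measurable[OF L(2)] fourier_measurable[OF D]
  have ae: "AE \<zeta> in lborel. wt \<rho> (fourier (\<lambda>z. f z - g z)) \<zeta> = wt \<rho> (\<lambda>\<zeta>. fourier f \<zeta> - fourier g \<zeta>) \<zeta>" for \<rho>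
    by (rule wt_cong_AE[OF fourier_diff[OF L]])
  have "wt (jw s) (fourier (\<lambda>z. f z - g z)) \<in> pts L2"
    by (subst L2_cong_AE[OF ae]) (simp_all only: wt_diff_L2[OF J], measurable)
  moreover have "wt \<mu> (fourier (\<lambda>z. f z - g z)) \<in> pts L2"
    by (subst L2_cong_AE[OF ae]) (simp_all only: wt_diff_L2[OF fg(2,4)], measurable)
  ultimately have "(\<lambda>z. f z - g z) \<in> pts Z" using Z D by (auto simp: weight_space_def H_iff)
  moreover show h: "nrm (H s) (\<lambda>z. f z - g z) = wdist (jw s) (fourier f) (fourier g)"
    unfolding nrm_H by (rule n2_cong[OF ae])
  ultimately show "nrm Z (\<lambda>z. f z - g z) = sqrt ((wdist (jw s) (fourier f) (fourier g))\<^sup>2 +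
       (wdist \<mu> (fourier f) (fourier g))\<^sup>2)"
    using Z n2_cong[OF ae[of \<mu>]] by (simp add: weight_space_def)
qed

text \<open>\<open>fourier_cong\<close> turns the initial condition, which holds almost everywhere,
  into an equality of transforms, so that weighted hypotheses on \<psi> carry over to time
  0.\<close>

lemma solution_initial:
  assumes sol: "is_solution \<alpha> s T \<psi> u" and T: "0 \<le> T" and \<psi>: "\<psi> \<in> pts (H s)"
  shows "fourier (u 0) = fourier \<psi>"
proof (rule fourier_cong)
  show "u 0 \<in> borel_measurable borel" using sol T by (auto simp: is_solution_def cont_into_def H_iff intro: L2_measurable)
  show "\<psi> \<in> borel_measurable borel" using \<psi> by (auto simp: H_iff intro: L2_measurable)
  show "AE z in lborel. u 0 z = \<psi> z" using sol by (simp add: is_solution_def)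
qed

lemma persistence:
  assumes s: "s > 2" and \<alpha>: "-1 \<le> \<alpha>" "\<alpha> \<le> 1" and T: "0 \<le> T"
    and Z: "weight_space s Z \<mu>" and pw: "propagates \<alpha> s T \<mu>"
    and \<psi>: "\<psi> \<in> pts Z" and sol: "is_solution \<alpha> s T \<psi> u"
  shows "cont_into T Z u"
proof -
  let ?U = "\<lambda>t. fourier (u t)"
  have U: "fsol \<alpha> s T ?U" by (rule fsol_of_solution[OF s \<alpha> sol])
  have uH: "u t \<in> pts (H s)" if "t \<in> {0..T}" for t using sol that by (auto simp: is_solution_def cont_into_def)
  have "\<psi> \<in> pts (H s)" "wt \<mu> (fourier \<psi>) \<in> pts L2" using Z \<psi> by (auto simp: weight_space_def)
  then have U0: "wt \<mu> (?U 0) \<in> pts L2" by (simp add: solution_initial[OF sol T])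
  have I: "wt \<mu> (?U t) \<in> pts L2" "((\<lambda>r. wdist \<mu> (?U r) (?U t)) \<longlongrightarrow> 0) (at t within {0..T})"
    if t: "t \<in> {0..T}" for t
  proof -
    note P = pw[unfolded propagates_def, THEN spec, THEN mp, OF U, THEN mp, OF U0, THEN conjunct1, THEN bspec, OF t]
    show "wt \<mu> (?U t) \<in> pts L2" "((\<lambda>r. wdist \<mu> (?U r) (?U t)) \<longlongrightarrow> 0) (at t within {0..T})"
      by (rule P[THEN conjunct1], rule P[THEN conjunct2])
  qed
  have uZ: "u t \<in> pts Z" if "t \<in> {0..T}" for t using Z uH[OF that] I(1)[OF that] by (simp add: weight_space_def)
  show ?thesis unfolding cont_into_def
  proof (intro ballI conjI)
    fix t assume t: "t \<in> {0..T}"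
    show "u t \<in> pts Z" by (rule uZ[OF t])
    have "((\<lambda>r. sqrt ((wdist (jw s) (?U r) (?U t))\<^sup>2 + (wdist \<mu> (?U r) (?U t))\<^sup>2)) \<longlongrightarrow> sqrt (0\<^sup>2 + 0\<^sup>2)) (at t within {0..T})"
      by (intro tendsto_intros I(2)[OF t] fsolD(6)[OF U s t])
    then have lim: "((\<lambda>r. sqrt ((wdist (jw s) (?U r) (?U t))\<^sup>2 + (wdist \<mu> (?U r) (?U t))\<^sup>2)) \<longlongrightarrow> 0) (at t within {0..T})"
      by simp
    show "((\<lambda>r. nrm Z (\<lambda>z. u r z - u t z)) \<longlongrightarrow> 0) (at t within {0..T})"
    proof (rule Lim_transform_eventually[OF lim])
      have "eventually (\<lambda>r. r \<in> {0..T}) (at t within {0..T})" by (simp add: eventually_at_filter)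
      then show "eventually (\<lambda>r. sqrt ((wdist (jw s) (?U r) (?U t))\<^sup>2 + (wdist \<mu> (?U r) (?U t))\<^sup>2) =
          nrm Z (\<lambda>z. u r z - u t z)) (at t within {0..T})"
      proof eventually_elim
        case (elim r)
        show ?case by (rule weight_space_diff(2)[OF Z uZ[OF elim] uZ[OF t], symmetric])
      qed
    qed
  qed
qed

text \<open>Continuous dependence in \<open>H s\<close> gives the closeness at all times that
  \<open>nearby\<close> asks for; the initial weighted distance is part of the norm of
  \<open>Z\<close>.\<close>

lemma continuous_dependence:
  assumes s: "s > 2" and \<alpha>: "-1 \<le> \<alpha>" "\<alpha> \<le> 1" and lwp: "locally_well_posed \<alpha> s T" and R: "0 \<le> R"
    and Z: "weight_space s Z \<mu>" and pw: "propagates \<alpha> s (T R) \<mu>"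
  shows "flow_continuous \<alpha> s (T R) Z (pts Z \<inter> data s R)"
  unfolding flow_continuous_def
proof (intro ballI allI impI)
  fix \<psi> and \<epsilon> :: real assume \<psi>: "\<psi> \<in> pts Z \<inter> data s R" and \<epsilon>: "0 < \<epsilon>"
  let ?T = "T R"
  have T: "0 \<le> ?T" and ex: "\<exists>u. is_solution \<alpha> s ?T \<psi> u"
    and uniq: "\<And>u v. is_solution \<alpha> s ?T \<psi> u \<Longrightarrow> is_solution \<alpha> s ?T \<psi> v \<Longrightarrow> (\<forall>t\<in>{0..?T}. AE z in lborel. u t z = v t z)"
    and fc: "flow_continuous \<alpha> s ?T (H s) (data s R)"
    using lwp R \<psi> unfolding locally_well_posed_def by (auto simp: less_imp_le)
  have T0: "0 \<in> {0..?T}" using T by simp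
  have zH: "f \<in> pts (H s)" "wt \<mu> (fourier f) \<in> pts L2" if "f \<in> pts Z" for f using Z that by (auto simp: weight_space_def)
  \<comment> \<open>\<delta> has to be found before the solution \<open>u\<close> is given, so one
    solution \<open>u0\<close> is fixed first; uniqueness identifies its transform with that of
    \<open>u\<close> in the end.\<close>
  obtain u0 where u0: "is_solution \<alpha> s ?T \<psi> u0" using ex by blast
  let ?U = "\<lambda>t. fourier (u0 t)"
  have U: "fsol \<alpha> s ?T ?U" by (rule fsol_of_solution[OF s \<alpha> u0])
  have U0: "?U 0 = fourier \<psi>" by (rule solution_initial[OF u0 T zH(1)]) (use \<psi> in simp)
  have U0L: "wt \<mu> (?U 0) \<in> pts L2" unfolding U0 using zH(2) \<psi> by simp
  have \<epsilon>2: "0 < \<epsilon> / 2" using \<epsilon> by simp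
  obtain d where d: "0 < d" and close: "\<And>V t. fsol \<alpha> s ?T V \<Longrightarrow> wt \<mu> (V 0) \<in> pts L2 \<Longrightarrow>
        (\<forall>t\<in>{0..?T}. wdist (jw s) (V t) (?U t) < d) \<Longrightarrow> wdist \<mu> (V 0) (?U 0) < d \<Longrightarrow>
        t \<in> {0..?T} \<Longrightarrow> wdist \<mu> (V t) (?U t) < \<epsilon> / 2"
    using pw[unfolded propagates_def, THEN spec, THEN mp, OF U, THEN mp, OF U0L, THEN conjunct2, THEN spec, THEN mp, OF \<epsilon>2] by blast
  \<comment> \<open>\<open>d\<close> triggers the weighted estimate, and \<epsilon> / 2 is the
    Sobolev share of the distance in \<open>Z\<close>.\<close>
  have pos: "0 < min d (\<epsilon> / 2)" using d \<epsilon> by simp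
  have \<psi>d: "\<psi> \<in> data s R" using \<psi> by simp
  obtain \<delta> where \<delta>: "0 < \<delta>" and dep: "\<And>\<psi>' u u' t. \<psi>' \<in> data s R \<Longrightarrow> nrm (H s) (\<lambda>z. \<psi>' z - \<psi> z) < \<delta> \<Longrightarrow>
      is_solution \<alpha> s ?T \<psi> u \<Longrightarrow> is_solution \<alpha> s ?T \<psi>' u' \<Longrightarrow> t \<in> {0..?T} \<Longrightarrow>
      nrm (H s) (\<lambda>z. u' t z - u t z) < min d (\<epsilon> / 2)"
    using fc[unfolded flow_continuous_def, THEN bspec, OF \<psi>d, THEN spec, THEN mp, OF pos] by blast
  show "\<exists>\<delta>>0. \<forall>\<psi>'\<in>pts Z \<inter> data s R. nrm Z (\<lambda>z. \<psi>' z - \<psi> z) < \<delta> \<longrightarrow>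
        (\<forall>u u'. is_solution \<alpha> s ?T \<psi> u \<longrightarrow> is_solution \<alpha> s ?T \<psi>' u' \<longrightarrow>
           (\<forall>t\<in>{0..?T}. nrm Z (\<lambda>z. u' t z - u t z) < \<epsilon>))"
  proof (intro exI[of _ "min d \<delta>"] conjI ballI allI impI)
    show "0 < min d \<delta>" using d \<delta> by simp
    fix \<psi>' u u' t assume \<psi>': "\<psi>' \<in> pts Z \<inter> data s R" and cl: "nrm Z (\<lambda>z. \<psi>' z - \<psi> z) < min d \<delta>"
      and u: "is_solution \<alpha> s ?T \<psi> u" and u': "is_solution \<alpha> s ?T \<psi>' u'" and t: "t \<in> {0..?T}"
    let ?V = "\<lambda>t. fourier (u' t)"
    have V: "fsol \<alpha> s ?T ?V" by (rule fsol_of_solution[OF s \<alpha> u'])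
    have V0: "?V 0 = fourier \<psi>'" by (rule solution_initial[OF u' T zH(1)]) (use \<psi>' in simp)
    have V0L: "wt \<mu> (?V 0) \<in> pts L2" unfolding V0 using zH(2) \<psi>' by simp
    have uZ: "u r \<in> pts Z" and u'Z: "u' r \<in> pts Z" and u0Z: "u0 r \<in> pts Z" if "r \<in> {0..?T}" for r
      using persistence[OF s \<alpha> T Z pw _ u] persistence[OF s \<alpha> T Z pw _ u'] persistence[OF s \<alpha> T Z pw _ u0] \<psi> \<psi>' that
      by (auto simp: cont_into_def)
    have nZ: "nrm (H s) (\<lambda>z. \<psi>' z - \<psi> z) \<le> nrm Z (\<lambda>z. \<psi>' z - \<psi> z)"
      "wdist \<mu> (fourier \<psi>') (fourier \<psi>) \<le> nrm Z (\<lambda>z. \<psi>' z - \<psi> z)"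
      using weight_space_diff[OF Z, of \<psi>' \<psi>] \<psi> \<psi>' by (auto simp: real_sqrt_sum_squares_ge1 real_sqrt_sum_squares_ge2)
    have dH: "nrm (H s) (\<lambda>z. \<psi>' z - \<psi> z) < \<delta>" using nZ(1) cl by simp
    have \<psi>'d: "\<psi>' \<in> data s R" using \<psi>' by simp
    have H0: "wdist (jw s) (?V r) (?U r) < min d (\<epsilon> / 2)" if r: "r \<in> {0..?T}" for r
      using dep[OF \<psi>'d dH u0 u' r] weight_space_diff(1)[OF Z u'Z[OF r] u0Z[OF r]] by simp
    have cl1: "\<forall>r\<in>{0..?T}. wdist (jw s) (?V r) (?U r) < d" using H0 by simp
    have cl2: "wdist \<mu> (?V 0) (?U 0) < d" unfolding U0 V0 using nZ(2) cl by simp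
    have M0: "wdist \<mu> (?V t) (?U t) < \<epsilon> / 2" by (rule close[OF V V0L cl1 cl2 t])
    have "fourier (u t) = ?U t"
    proof (rule fourier_cong)
      show "u t \<in> borel_measurable borel" "u0 t \<in> borel_measurable borel"
        using zH(1)[OF uZ[OF t]] zH(1)[OF u0Z[OF t]] by (auto simp: H_iff intro: L2_measurable)
      show "AE z in lborel. u t z = u0 t z" using uniq[OF u u0] t by blast
    qed
    then have "nrm Z (\<lambda>z. u' t z - u t z) = sqrt ((wdist (jw s) (?V t) (?U t))\<^sup>2 + (wdist \<mu> (?V t) (?U t))\<^sup>2)"
      using weight_space_diff(2)[OF Z u'Z[OF t] uZ[OF t]] by simp
    also have "\<dots> \<le> wdist (jw s) (?V t) (?U t) + wdist \<mu> (?V t) (?U t)"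
      by (rule sqrt_sum_squares_le_sum) simp_all
    also have "\<dots> < \<epsilon>" using H0[OF t] M0 by simp
    finally show "nrm Z (\<lambda>z. u' t z - u t z) < \<epsilon>" .
  qed
qed

theorem theorem2p7:
  fixes s \<alpha> :: real and T :: "real \<Rightarrow> real" and Z :: fspace
  assumes "s > 2" and "-1 \<le> \<alpha>" and "\<alpha> \<le> 1"
    and "locally_well_posed \<alpha> s T"
    and "Z \<in> {X s, X_hat s, X_hat_alpha \<alpha> s, Y s, Y_hat s}"
  shows "\<forall>R\<ge>0. (\<forall>\<psi>\<in>pts Z \<inter> data s R. \<forall>u. is_solution \<alpha> s (T R) \<psi> u \<longrightarrow> cont_into (T R) Z u) \<and>
                flow_continuous \<alpha> s (T R) Z (pts Z \<inter> data s R)"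
proof (intro allI impI)
  fix R :: real assume R: "0 \<le> R"
  obtain \<mu> where Z: "weight_space s Z \<mu>" and pw: "\<And>T. 0 \<le> T \<Longrightarrow> propagates \<alpha> s T \<mu>"
    using weight_of_space[OF assms(1,2,3,5)] by blast
  have T: "0 \<le> T R" using assms(4) R by (auto simp: locally_well_posed_def less_imp_le)
  show "(\<forall>\<psi>\<in>pts Z \<inter> data s R. \<forall>u. is_solution \<alpha> s (T R) \<psi> u \<longrightarrow> cont_into (T R) Z u) \<and>
                flow_continuous \<alpha> s (T R) Z (pts Z \<inter> data s R)"
    using persistence[OF assms(1-3) T Z pw[OF T]] continuous_dependence[OF assms(1-4) R Z pw[OF T]] by blast
qed

end
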